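(* Let $\varphi(t)$ be a smooth one-parameter family of $G_2$-structures on a smooth 7-manifold $M$ evolving by the general flow $$\frac{\partial}{\partial t}\varphi_{ijk} = h^l_i\varphi_{ljk} + h^l_j\varphi_{ilk} + h^l_k\varphi_{ijl} + X^l\psi_{lijk},$$ where $h=h(t)$ is a symmetric 2-tensor, $X=X(t)$ is a vector field, and $h^l_i = g^{lm}h_{im}$. Then the torsion forms $\tau_0$ and $\tau_3$ evolve by $$\frac{\partial}{\partial t}\tau_0 = -\tfrac17\mathrm{Tr}_g(h)\,\tau_0 + \tfrac47\langle h,\tau_3\rangle - \tfrac47\langle X,\tau_1\rangle + \tfrac47 g^{pq}\nabla_pX_q$$ and $$\begin{aligned}\frac{\partial}{\partial t}(\tau_3)_{ij} ={}& \Big(-\tfrac1{28}\mathrm{Tr}_g(h)\tau_0 + \tfrac17\langle h,\tau_3\rangle - \tfrac17\langle X,\tau_1\rangle + \tfrac17 g^{pq}\nabla_pX_q\Big)g_{ij}\\ &+ \tfrac14\tau_0h_{ij} + \tfrac12\{h,\tau_3\}_{ij} + \tfrac12[h,\tau_1]_{ij} - \tfrac14[h,\tau_2]_{ij}\\ &- \tfrac12[X,\tau_3]_{ij} - \tfrac12\{X,\tau_1\}_{ij} + \tfrac14\{X,\tau_2\}_{ij}\\ &- \tfrac12(\nabla_kh_{li})g^{ka}g^{lb}\varphi_{abj} - \tfrac12(\nabla_kh_{lj})g^{ka}g^{lb}\varphi_{abi} - \tfrac12(\nabla_iX_j+\nabla_jX_i).\end{aligned}$$ Here, inside $\langle\cdot,\cdot\rangle$,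 $[\cdot,\cdot]$, $\{\cdot,\cdot\}$, $X$ and $\tau_1$ denote the skew-symmetric 2-tensors $X_{ab}$ and $(\tau_1)_{ab}$ defined in the context, while $X_q=g_{qk}X^k$.
   Context: Index notation in local coordinates $x^1,\dots,x^7$, with the summation convention; forms are written $\alpha=\frac{1}{k!}\alpha_{i_1\cdots i_k}dx^{i_1}\wedge\cdots\wedge dx^{i_k}$. A $G_2$-structure on a smooth 7-manifold $M$ is a smooth 3-form $\varphi$ which at each point is equivalent, under a linear isomorphism $T_xM\cong\mathbb{R}^7$, to $e^{123}+e^{145}+e^{167}+e^{246}-e^{257}-e^{347}-e^{356}$. It determines a unique Riemannian metric $g$ and orientation (volume form $\mathsf{vol}$) by the convention $(u\lrcorner\varphi)\wedge(v\lrcorner\varphi)\wedge\varphi=-6\,g(u,v)\,\mathsf{vol}$. Let $\psi=*\varphi$ (Hodge star) and $\nabla$ the Levi-Civita connection of $g$. In the flow, all of these are determined by $\varphi(t)$ at time $t$. Decomposition of forms: $\Omega^2_{14}=\{\beta\in\Omega^2:\beta_{ij}g^{ia}g^{jb}\varphi_{abk}=0\}$ and $\Omega^3_{27}=\{\frac12 h_{im}g^{ml}\varphi_{ljk}\,dx^i\wedge dx^j\wedge dx^k: h_{ij}=h_{ji},\ g^{ij}h_{ij}=0\}$. Torsion forms: the function $\tau_0$, 1-form $\tau_1$, $\tau_2\in\Omega^2_{14}$, $\tau_3\in\Omega^3_{27}$ are uniquely defined by $d\varphi=\tau_0\psi+3\tau_1\wedge\varphi+*\tau_3$ and $d\psi=4\tau_1\wedge\psi+*\tau_2$.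 In components: $\tau_1=(\tau_1)_l\,dx^l$, also regarded as the skew 2-tensor $(\tau_1)_{ab}=(\tau_1)_lg^{lk}\varphi_{kab}$; $\tau_2=\frac12(\tau_2)_{ab}dx^a\wedge dx^b$; $\tau_3=\frac12(\tau_3)_{im}g^{ml}\varphi_{ljk}dx^i\wedge dx^j\wedge dx^k$ with $(\tau_3)_{im}$ symmetric and traceless. A vector field $X^k$ is also regarded as the skew 2-tensor $X_{ab}=X^l\varphi_{lab}$. For 2-tensors: $\mathrm{Tr}_g(A)=g^{ij}A_{ij}$, $\langle A,B\rangle=A_{ij}B_{kl}g^{ik}g^{jl}$, $[A,B]_{pq}=A_{pl}g^{lm}B_{mq}-B_{pl}g^{lm}A_{mq}$, $\{A,B\}_{pq}=A_{pl}g^{lm}B_{mq}+B_{pl}g^{lm}A_{mq}$. *)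

theory Defs
  imports "HOL-Analysis.Analysis" "HOL-Combinatorics.Permutations"
begin

section \<open>Smooth functions\<close>

primrec Ck_on :: "nat \<Rightarrow> 'a::real_normed_vector set \<Rightarrow> ('a \<Rightarrow> 'b::real_normed_vector) \<Rightarrow> bool" where
  "Ck_on 0 S f \<longleftrightarrow> continuous_on S f"
| "Ck_on (Suc n) S f \<longleftrightarrow> (\<forall>x\<in>S. f differentiable (at x)) \<and>
     (\<forall>v. Ck_on n S (\<lambda>x. frechet_derivative f (at x) v))"

text \<open>On an arbitrary set, smoothness means local existence of smooth extensions. The general
  case is needed for products of a possibly half-open time interval with an open set.\<close>

definition smooth_on :: "'a::real_normed_vector set \<Rightarrow> ('a \<Rightarrow> 'b::real_normed_vector) \<Rightarrow> bool" where
  "smooth_on S f \<longleftrightarrow> (\<forall>p\<in>S. \<exists>U F. open U \<and> p \<in> U \<and> (\<forall>n. Ck_on n U F) \<and> (\<forall>x\<in>S \<inter> U. f x = F x))"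

definition pd :: "7 \<Rightarrow> (real^7 \<Rightarrow> real) \<Rightarrow> real^7 \<Rightarrow> real" where
  "pd i f x = frechet_derivative f (at x) (axis i 1)"


section \<open>Smooth 7-manifolds\<close>

text \<open>A chart is an open set together with a coordinate map, whose values outside the set are
  irrelevant. An atlas need not be maximal.\<close>

type_synonym 'a chart = "'a set \<times> ('a \<Rightarrow> real^7)"

abbreviation chart_dom :: "'a chart \<Rightarrow> 'a set" where "chart_dom c \<equiv> fst c"
abbreviation coord :: "'a chart \<Rightarrow> 'a \<Rightarrow> real^7" where "coord c \<equiv> snd c"
abbreviation chart_ran :: "'a chart \<Rightarrow> (real^7) set" where "chart_ran c \<equiv> coord c ` chart_dom c"

definition chart_pt :: "'a chart \<Rightarrow> real^7 \<Rightarrow> 'a" where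
  "chart_pt c = inv_into (chart_dom c) (coord c)"

definition transition :: "'a chart \<Rightarrow> 'a chart \<Rightarrow> real^7 \<Rightarrow> real^7" where
  "transition c c' x = coord c' (chart_pt c x)"

definition smooth_manifold7 :: "'a topology \<Rightarrow> 'a chart set \<Rightarrow> bool" where
  "smooth_manifold7 M A \<longleftrightarrow>
     Hausdorff_space M \<and> second_countable M \<and>
     (\<forall>c\<in>A. openin M (chart_dom c) \<and> open (chart_ran c) \<and>
        homeomorphic_map (subtopology M (chart_dom c)) (top_of_set (chart_ran c)) (coord c)) \<and>
     (\<Union>c\<in>A. chart_dom c) = topspace M \<and>
     (\<forall>c\<in>A. \<forall>c'\<in>A. smooth_on (coord c ` (chart_dom c \<inter> chart_dom c')) (transition c c'))"


section \<open>Tensors and tensor fields in components\<close>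

text \<open>A covariant tensor of rank \<open>k\<close> on \<open>\<real>\<^sup>7\<close> is given by its components, indexed by lists of
  length \<open>k\<close>; values at lists of other lengths are irrelevant. The seven indices are the
  elements \<open>1, \<dots>, 7\<close> of the type \<open>7\<close>, in which \<open>7 = 0\<close>. A tensor field assigns to each
  chart its component functions of the coordinates.\<close>

type_synonym tensor = "7 list \<Rightarrow> real"
type_synonym 'a tensor_field = "'a chart \<Rightarrow> real^7 \<Rightarrow> tensor"
type_synonym 'a vector_field = "'a chart \<Rightarrow> real^7 \<Rightarrow> real^7"

definition pullback :: "nat \<Rightarrow> real^7^7 \<Rightarrow> tensor \<Rightarrow> tensor" where
  "pullback k P T I = (\<Sum>K | length K = k. (\<Prod>r<k. P $ (K ! r) $ (I ! r)) * T K)"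

definition jacobian :: "'a chart \<Rightarrow> 'a chart \<Rightarrow> real^7 \<Rightarrow> real^7^7" where
  "jacobian c c' x = matrix (frechet_derivative (transition c c') (at x))"

definition smooth_function :: "'a chart set \<Rightarrow> ('a \<Rightarrow> real) \<Rightarrow> bool" where
  "smooth_function A f \<longleftrightarrow> (\<forall>c\<in>A. smooth_on (chart_ran c) (\<lambda>x. f (chart_pt c x)))"

definition smooth_tensor_field :: "'a chart set \<Rightarrow> nat \<Rightarrow> 'a tensor_field \<Rightarrow> bool" where
  "smooth_tensor_field A k T \<longleftrightarrow>
     (\<forall>c\<in>A. \<forall>I. length I = k \<longrightarrow> smooth_on (chart_ran c) (\<lambda>x. T c x I)) \<and>
     (\<forall>c\<in>A. \<forall>c'\<in>A. \<forall>x\<in>coord c ` (chart_dom c \<inter> chart_dom c'). \<forall>I. length I = k \<longrightarrow>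
        T c x I = pullback k (jacobian c c' x) (T c' (transition c c' x)) I)"

definition smooth_vector_field :: "'a chart set \<Rightarrow> 'a vector_field \<Rightarrow> bool" where
  "smooth_vector_field A X \<longleftrightarrow>
     (\<forall>c\<in>A. smooth_on (chart_ran c) (X c)) \<and>
     (\<forall>c\<in>A. \<forall>c'\<in>A. \<forall>x\<in>coord c ` (chart_dom c \<inter> chart_dom c').
        X c' (transition c c' x) = jacobian c c' x *v X c x)"

definition alternating :: "nat \<Rightarrow> tensor \<Rightarrow> bool" where
  "alternating k \<alpha> \<longleftrightarrow> (\<forall>I \<sigma>. length I = k \<and> \<sigma> permutes {..<k} \<longrightarrow>
     \<alpha> (permute_list \<sigma> I) = of_int (sign \<sigma>) * \<alpha> I)"

definition smooth_form :: "'a chart set \<Rightarrow> nat \<Rightarrow> 'a tensor_field \<Rightarrow> bool" where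
  "smooth_form A k \<alpha> \<longleftrightarrow> smooth_tensor_field A k \<alpha> \<and>
     (\<forall>c\<in>A. \<forall>x\<in>chart_ran c. alternating k (\<alpha> c x))"

definition smooth_sym2 :: "'a chart set \<Rightarrow> 'a tensor_field \<Rightarrow> bool" where
  "smooth_sym2 A s \<longleftrightarrow> smooth_tensor_field A 2 s \<and>
     (\<forall>c\<in>A. \<forall>x\<in>chart_ran c. \<forall>i j. s c x [i, j] = s c x [j, i])"


section \<open>Exterior algebra\<close>

definition wedge :: "nat \<Rightarrow> nat \<Rightarrow> tensor \<Rightarrow> tensor \<Rightarrow> tensor" where
  "wedge k l \<alpha> \<beta> I = 1 / (fact k * fact l) *
     (\<Sum>\<sigma> | \<sigma> permutes {..<k + l}. of_int (sign \<sigma>) *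
        \<alpha> (take k (permute_list \<sigma> I)) * \<beta> (drop k (permute_list \<sigma> I)))"

text \<open>The basis forms \<open>e\<^sup>i = dx\<^sup>i\<close> and \<open>e\<^sup>i \<and> e\<^sup>j \<and> e\<^sup>k\<close>.\<close>

definition e1 :: "7 \<Rightarrow> tensor" where
  "e1 i I = (if I = [i] then 1 else 0)"

definition e3 :: "7 \<Rightarrow> 7 \<Rightarrow> 7 \<Rightarrow> tensor" where
  "e3 i j k = wedge 1 2 (e1 i) (wedge 1 1 (e1 j) (e1 k))"

definition interior_prod :: "real^7 \<Rightarrow> tensor \<Rightarrow> tensor" where
  "interior_prod u \<alpha> I = (\<Sum>l\<in>UNIV. u $ l * \<alpha> (l # I))"

definition ext_deriv :: "(real^7 \<Rightarrow> tensor) \<Rightarrow> real^7 \<Rightarrow> tensor" where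
  "ext_deriv \<alpha> x I =
     (\<Sum>r<length I. (-1) ^ r * pd (I ! r) (\<lambda>y. \<alpha> y (take r I @ drop (Suc r) I)) x)"


section \<open>Riemannian metrics\<close>

definition gmat :: "tensor \<Rightarrow> real^7^7" where
  "gmat g = (\<chi> i j. g [i, j])"

definition ginv :: "tensor \<Rightarrow> 7 \<Rightarrow> 7 \<Rightarrow> real" where
  "ginv g i j = matrix_inv (gmat g) $ i $ j"

definition riemannian_metric :: "'a chart set \<Rightarrow> 'a tensor_field \<Rightarrow> bool" where
  "riemannian_metric A g \<longleftrightarrow> smooth_sym2 A g \<and>
     (\<forall>c\<in>A. \<forall>x\<in>chart_ran c. \<forall>u::real^7. u \<noteq> 0 \<longrightarrow> u \<bullet> (gmat (g c x) *v u) > 0)"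

text \<open>A 7-form whose component \<open>vol\<^bsub>1\<dots>7\<^esub>\<close> is \<open>sqrt (det g)\<close> in positively oriented charts and
  \<open>- sqrt (det g)\<close> in negatively oriented ones; the form itself encodes the orientation.\<close>

definition volume_form :: "'a chart set \<Rightarrow> 'a tensor_field \<Rightarrow> 'a tensor_field \<Rightarrow> bool" where
  "volume_form A g vol \<longleftrightarrow> smooth_form A 7 vol \<and>
     (\<forall>c\<in>A. \<forall>x\<in>chart_ran c. (vol c x [1, 2, 3, 4, 5, 6, 7])\<^sup>2 = det (gmat (g c x)))"

text \<open>\<open>(*\<alpha>)\<^sub>J = (1/k!) \<alpha>\<^sub>K g\<^bsup>KI\<^esup> vol\<^bsub>IJ\<^esub>\<close>, that is \<open>\<beta> \<and> *\<alpha> = \<langle>\<beta>, \<alpha>\<rangle> vol\<close>.\<close>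

definition hodge_star :: "tensor \<Rightarrow> tensor \<Rightarrow> nat \<Rightarrow> tensor \<Rightarrow> tensor" where
  "hodge_star g vol k \<alpha> J = 1 / fact k *
     (\<Sum>I | length I = k. \<Sum>K | length K = k.
        (\<Prod>r<k. ginv g (I ! r) (K ! r)) * \<alpha> K * vol (I @ J))"

text \<open>Christoffel symbols \<open>\<Gamma>\<^sup>m\<^sub>i\<^sub>j\<close> of the Levi-Civita connection, and the component
  \<open>\<nabla>\<^sub>k T\<^sub>I\<close> of the covariant derivative.\<close>

definition christoffel :: "(real^7 \<Rightarrow> tensor) \<Rightarrow> real^7 \<Rightarrow> 7 \<Rightarrow> 7 \<Rightarrow> 7 \<Rightarrow> real" where
  "christoffel g x m i j = 1 / 2 * (\<Sum>l\<in>UNIV. ginv (g x) m l *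
     (pd i (\<lambda>y. g y [j, l]) x + pd j (\<lambda>y. g y [i, l]) x - pd l (\<lambda>y. g y [i, j]) x))"

definition cov_deriv :: "(real^7 \<Rightarrow> tensor) \<Rightarrow> (real^7 \<Rightarrow> tensor) \<Rightarrow> real^7 \<Rightarrow> 7 \<Rightarrow> tensor" where
  "cov_deriv g T x k I = pd k (\<lambda>y. T y I) x -
     (\<Sum>r<length I. \<Sum>m\<in>UNIV. christoffel g x m k (I ! r) * T x (I[r := m]))"

definition flat :: "tensor \<Rightarrow> real^7 \<Rightarrow> tensor" where
  "flat g X I = (\<Sum>k\<in>UNIV. g [hd I, k] * X $ k)"

definition sharp :: "tensor \<Rightarrow> tensor \<Rightarrow> real^7" where
  "sharp g \<alpha> = (\<chi> k. \<Sum>l\<in>UNIV. \<alpha> [l] * ginv g l k)"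

definition trace_g :: "tensor \<Rightarrow> tensor \<Rightarrow> real" where
  "trace_g g S = (\<Sum>i\<in>UNIV. \<Sum>j\<in>UNIV. ginv g i j * S [i, j])"

definition inner_g :: "tensor \<Rightarrow> tensor \<Rightarrow> tensor \<Rightarrow> real" where
  "inner_g g S T = (\<Sum>i\<in>UNIV. \<Sum>j\<in>UNIV. \<Sum>k\<in>UNIV. \<Sum>l\<in>UNIV.
     S [i, j] * T [k, l] * ginv g i k * ginv g j l)"

definition commutator_g :: "tensor \<Rightarrow> tensor \<Rightarrow> tensor \<Rightarrow> 7 \<Rightarrow> 7 \<Rightarrow> real" where
  "commutator_g g S T p q = (\<Sum>l\<in>UNIV. \<Sum>m\<in>UNIV.
     S [p, l] * ginv g l m * T [m, q] - T [p, l] * ginv g l m * S [m, q])"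

definition anticommutator_g :: "tensor \<Rightarrow> tensor \<Rightarrow> tensor \<Rightarrow> 7 \<Rightarrow> 7 \<Rightarrow> real" where
  "anticommutator_g g S T p q = (\<Sum>l\<in>UNIV. \<Sum>m\<in>UNIV.
     S [p, l] * ginv g l m * T [m, q] + T [p, l] * ginv g l m * S [m, q])"


section \<open>$G_2$-structures\<close>

definition phi0 :: tensor where
  "phi0 I = e3 1 2 3 I + e3 1 4 5 I + e3 1 6 7 I + e3 2 4 6 I - e3 2 5 7 I - e3 3 4 7 I - e3 3 5 6 I"

definition G2_structure :: "'a chart set \<Rightarrow> 'a tensor_field \<Rightarrow> bool" where
  "G2_structure A \<phi> \<longleftrightarrow> smooth_form A 3 \<phi> \<and>
     (\<forall>c\<in>A. \<forall>x\<in>chart_ran c. \<exists>P. invertible P \<and>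
        (\<forall>I. length I = 3 \<longrightarrow> \<phi> c x I = pullback 3 P phi0 I))"

text \<open>The metric and the volume form determined by a $G_2$-structure. With this sign convention
  \<open>phi0\<close> induces the orientation opposite to \<open>e\<^sup>1 \<and> \<dots> \<and> e\<^sup>7\<close>.\<close>

definition G2_metric :: "'a chart set \<Rightarrow> 'a tensor_field \<Rightarrow> 'a tensor_field \<Rightarrow> 'a tensor_field \<Rightarrow> bool" where
  "G2_metric A \<phi> g vol \<longleftrightarrow> riemannian_metric A g \<and> volume_form A g vol \<and>
     (\<forall>c\<in>A. \<forall>x\<in>chart_ran c. \<forall>u v I. length I = 7 \<longrightarrow>
        wedge 4 3 (wedge 2 2 (interior_prod u (\<phi> c x)) (interior_prod v (\<phi> c x))) (\<phi> c x) I
          = - 6 * (u \<bullet> (gmat (g c x) *v v)) * vol c x I)"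

definition dual4 :: "'a tensor_field \<Rightarrow> 'a tensor_field \<Rightarrow> 'a tensor_field \<Rightarrow> 'a tensor_field" where
  "dual4 \<phi> g vol c x = hodge_star (g c x) (vol c x) 3 (\<phi> c x)"

definition in_Omega2_14 :: "tensor \<Rightarrow> tensor \<Rightarrow> tensor \<Rightarrow> bool" where
  "in_Omega2_14 \<phi> g \<beta> \<longleftrightarrow> alternating 2 \<beta> \<and>
     (\<forall>k. (\<Sum>i\<in>UNIV. \<Sum>j\<in>UNIV. \<Sum>a\<in>UNIV. \<Sum>b\<in>UNIV.
        \<beta> [i, j] * ginv g i a * ginv g j b * \<phi> [a, b, k]) = 0)"

text \<open>The 3-form \<open>(1/2) s\<^sub>i\<^sub>m g\<^sup>m\<^sup>l \<phi>\<^sub>l\<^sub>j\<^sub>k dx\<^sup>i \<and> dx\<^sup>j \<and> dx\<^sup>k\<close> of a symmetric 2-tensor \<open>s\<close>; the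
  space \<open>\<Omega>\<^sup>3\<^sub>2\<^sub>7\<close> consists of these forms for traceless \<open>s\<close>.\<close>

definition form3_of_sym2 :: "tensor \<Rightarrow> tensor \<Rightarrow> tensor \<Rightarrow> tensor" where
  "form3_of_sym2 \<phi> g s I = 1 / 2 * (\<Sum>i\<in>UNIV. \<Sum>j\<in>UNIV. \<Sum>k\<in>UNIV. \<Sum>m\<in>UNIV. \<Sum>l\<in>UNIV.
     s [i, m] * ginv g m l * \<phi> [l, j, k] * e3 i j k I)"

text \<open>\<open>\<tau>\<^sub>0, \<tau>\<^sub>1, \<tau>\<^sub>2, \<tau>\<^sub>3\<close> are the torsion forms of \<open>\<phi>\<close>; here \<open>\<tau>\<^sub>3\<close> is the traceless symmetric
  2-tensor \<open>(\<tau>\<^sub>3)\<^sub>i\<^sub>m\<close>.\<close>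

definition torsion_forms :: "'a chart set \<Rightarrow> 'a tensor_field \<Rightarrow> 'a tensor_field \<Rightarrow> 'a tensor_field \<Rightarrow>
    ('a \<Rightarrow> real) \<Rightarrow> 'a tensor_field \<Rightarrow> 'a tensor_field \<Rightarrow> 'a tensor_field \<Rightarrow> bool" where
  "torsion_forms A \<phi> g vol \<tau>0 \<tau>1 \<tau>2 \<tau>3 \<longleftrightarrow>
     smooth_function A \<tau>0 \<and> smooth_form A 1 \<tau>1 \<and> smooth_form A 2 \<tau>2 \<and> smooth_sym2 A \<tau>3 \<and>
     (\<forall>c\<in>A. \<forall>x\<in>chart_ran c.
        in_Omega2_14 (\<phi> c x) (g c x) (\<tau>2 c x) \<and>
        trace_g (g c x) (\<tau>3 c x) = 0 \<and>
        (\<forall>I. length I = 4 \<longrightarrow>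
           ext_deriv (\<phi> c) x I = \<tau>0 (chart_pt c x) * dual4 \<phi> g vol c x I
             + 3 * wedge 1 3 (\<tau>1 c x) (\<phi> c x) I
             + hodge_star (g c x) (vol c x) 3 (form3_of_sym2 (\<phi> c x) (g c x) (\<tau>3 c x)) I) \<and>
        (\<forall>I. length I = 5 \<longrightarrow>
           ext_deriv (dual4 \<phi> g vol c) x I = 4 * wedge 1 4 (\<tau>1 c x) (dual4 \<phi> g vol c x) I
             + hodge_star (g c x) (vol c x) 2 (\<tau>2 c x) I))"

definition smooth_G2_family :: "'a chart set \<Rightarrow> real set \<Rightarrow> (real \<Rightarrow> 'a tensor_field) \<Rightarrow> bool" where
  "smooth_G2_family A J \<phi> \<longleftrightarrow> (\<forall>t\<in>J. G2_structure A (\<phi> t)) \<and>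
     (\<forall>c\<in>A. \<forall>I. length I = 3 \<longrightarrow> smooth_on (J \<times> chart_ran c) (\<lambda>(t, x). \<phi> t c x I))"

definition raise_sym2 :: "tensor \<Rightarrow> tensor \<Rightarrow> 7 \<Rightarrow> 7 \<Rightarrow> real" where
  "raise_sym2 g h l i = (\<Sum>m\<in>UNIV. ginv g l m * h [i, m])"

definition general_flow :: "'a chart set \<Rightarrow> real set \<Rightarrow> (real \<Rightarrow> 'a tensor_field) \<Rightarrow> (real \<Rightarrow> 'a tensor_field) \<Rightarrow>
    (real \<Rightarrow> 'a tensor_field) \<Rightarrow> (real \<Rightarrow> 'a tensor_field) \<Rightarrow> (real \<Rightarrow> 'a vector_field) \<Rightarrow> bool" where
  "general_flow A J \<phi> g vol h X \<longleftrightarrow>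
     (\<forall>t\<in>J. \<forall>c\<in>A. \<forall>x\<in>chart_ran c. \<forall>i j k.
        ((\<lambda>s. \<phi> s c x [i, j, k]) has_real_derivative
           (\<Sum>l\<in>UNIV. raise_sym2 (g t c x) (h t c x) l i * \<phi> t c x [l, j, k]
                    + raise_sym2 (g t c x) (h t c x) l j * \<phi> t c x [i, l, k]
                    + raise_sym2 (g t c x) (h t c x) l k * \<phi> t c x [i, j, l]
                    + X t c x $ l * dual4 (\<phi> t) (g t) (vol t) c x [l, i, j, k]))
          (at t within J))"

end

theory Submission
  imports Defs
begin

text \<open>Everything is computed at one point in an adapted frame, in which the 3-form is \<open>phi0\<close> and the metric
  is the identity. Along a curve through the point the frame is moved so that the metric becomes
  stationary to first order. Then the identity \<open>\<phi>\<^sub>i\<^sub>a\<^sub>b \<phi>\<^sub>j\<^sub>a\<^sub>b = 6 g\<^sub>i\<^sub>j\<close> forces the derivative of \<open>\<phi>\<close> to be the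
  contraction of \<open>\<psi>\<close> with a vector \<open>Y\<close>, and the derivative of \<open>\<psi>\<close> is linear in \<open>Y\<close> and \<open>\<phi>\<close>. For coordinate
  lines, with the frame moved by the Christoffel symbols, this produces the torsion tensor \<open>T\<close> with
  \<open>\<nabla>\<^sub>p \<phi>\<^sub>i\<^sub>j\<^sub>k = T\<^sub>p\<^sub>q \<psi>\<^sub>q\<^sub>i\<^sub>j\<^sub>k\<close>; for the time direction, with the frame moved by \<open>-h\<close>, the vector is \<open>X\<close>.
  The contraction of \<open>d\<phi>\<close> with \<open>\<psi>\<close> has trace \<open>168 \<tau>\<^sub>0\<close> and symmetric part \<open>24 \<tau>\<^sub>0 g - 12 \<tau>\<^sub>3\<close>, so \<open>\<tau>\<^sub>0\<close> and \<open>\<tau>\<^sub>3\<close>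
  evolve by the exterior derivative of the velocity of \<open>\<phi>\<close>, in which
  \<open>T = \<tau>\<^sub>0/4 g - \<tau>\<^sub>3 + \<tau>\<^sub>1 - \<tau>\<^sub>2/2\<close> is substituted.\<close>

section \<open>Pullbacks and contractions\<close>

text \<open>A G2-structure supplies an adapted frame at each point, but nothing makes these frames
  depend differentiably on the point or on time. So no frame field is ever differentiated. The
  metric and the dual 4-form are tied to the 3-form by identities that mention no frame, and these
  are differentiated along a curve, in a frame moved by hand away from one fixed adapted frame. Nor
  is the metric, \<tau>0 or \<tau>3 assumed differentiable in time: the metric is a ninth-root
  expression in the 3-form, and \<tau>0 and \<tau>3 are recovered algebraically. The recovery
  contracts d\<phi> with \<psi> because 4-forms split under G2 into pieces of dimension 1, 7 and 27.
  The symmetric part of the contraction sees the pieces of \<tau>0 and \<tau>3; the 7-dimensional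
  piece, carried by \<tau>1, lands in the skew part. Thus the evolution of \<tau>0 and \<tau>3
  closes up without that of \<tau>1 and \<tau>2, which enter through T only. The skew part of T is
  obtained from d\<psi>, using that contraction with \<psi> acts on 2-forms with eigenvalues -4 and
  2.\<close>

lemma UNIV_7: "(UNIV :: 7 set) = {1, 2, 3, 4, 5, 6, 7}"
  by (rule sym, rule card_subset_eq) simp_all

lemma all_7: "(\<forall>i::7. P i) \<longleftrightarrow> P 1 \<and> P 2 \<and> P 3 \<and> P 4 \<and> P 5 \<and> P 6 \<and> P 7"
proof -
  have "(\<forall>i::7. P i) \<longleftrightarrow> (\<forall>i\<in>UNIV. P i)" by simp
  then show ?thesis unfolding UNIV_7 by simp
qed

lemma finite_lists_length [simp]: "finite {K :: 'b::finite list. length K = k}"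
  using finite_lists_length_eq[of "UNIV :: 'b set" k] by simp

lemma sum_lists_0 [simp]: "(\<Sum>K | length K = 0. F K) = F []"
proof -
  have "{K::'a list. length K = 0} = {[]}" by auto
  then show ?thesis by simp
qed

lemma sum_lists_Suc:
  "(\<Sum>K | length K = Suc k. F K) = (\<Sum>i\<in>(UNIV::'a::finite set). \<Sum>K | length K = k. F (i # K))"
proof -
  have "(\<Sum>i\<in>(UNIV::'a set). \<Sum>K | length K = k. F (i # K))
      = (\<Sum>z\<in>UNIV \<times> {K. length K = k}. F (fst z # snd z))"
    by (simp add: sum.cartesian_product case_prod_beta)
  also have "\<dots> = (\<Sum>K | length K = Suc k. F K)"
    by (rule sum.reindex_bij_witness[of _ "\<lambda>K. (hd K, tl K)" "\<lambda>z. fst z # snd z"])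
       (auto simp: length_Suc_conv)
  finally show ?thesis by simp
qed

lemma sum_lists_append:
  "(\<Sum>K | length K = m + n. F K) = (\<Sum>I | length I = m. \<Sum>J | length J = n. F (I @ J :: 'a::finite list))"
proof (induction m arbitrary: F)
  case (Suc m)
  then show ?case by (simp add: sum_lists_Suc)
qed (simp add: sum_lists_0[simplified])

lemma prod_nth_Cons:
  "(\<Prod>r<Suc k. h ((a # K) ! r) ((i # I) ! r)) = h a i * (\<Prod>r<k. h (K ! r) (I ! r))"
  by (subst prod.lessThan_Suc_shift) simp

lemma pullback_0 [simp]: "pullback 0 P T I = T []"
  by (simp add: pullback_def sum_lists_0[simplified])

text \<open>Splitting off the first index replaces the sum over all multi-indices by a recursion on
  the rank. Many facts about \<open>pullback\<close> below are inductions along it.\<close>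

lemma pullback_Suc:
  "pullback (Suc k) P T (i # I) = (\<Sum>a\<in>UNIV. P $ a $ i * pullback k P (\<lambda>K. T (a # K)) I)"
  unfolding pullback_def sum_lists_Suc prod_nth_Cons[where h = "\<lambda>x y. P $ x $ y"]
  by (simp only: sum_distrib_left mult.assoc)

lemma pullback_sum: "pullback k P (\<lambda>K. \<Sum>a\<in>S. c a * T a K) I = (\<Sum>a\<in>S. c a * pullback k P (T a) I)"
  unfolding pullback_def sum_distrib_left
  by (subst sum.swap) (simp add: mult.left_commute)

lemma pullback_scale: "pullback k P (\<lambda>K. c * T K) I = c * pullback k P T I"
  unfolding pullback_def by (simp add: sum_distrib_left mult.left_commute)

lemma pullback_add: "pullback k P (\<lambda>K. S K + T K) I = pullback k P S I + pullback k P T I"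
  unfolding pullback_def by (simp add: sum.distrib distrib_left)

lemma pullback_diff: "pullback k P (\<lambda>K. S K - T K) I = pullback k P S I - pullback k P T I"
  unfolding pullback_def by (simp add: sum_subtractf right_diff_distrib)

lemma pullback_cong: "(\<And>K. length K = k \<Longrightarrow> S K = T K) \<Longrightarrow> pullback k P S I = pullback k P T I"
  unfolding pullback_def by (rule sum.cong) auto

lemma pullback_append:
  "length I = k \<Longrightarrow>
   pullback (k + l) P T (I @ J) = pullback k P (\<lambda>I'. pullback l P (\<lambda>J'. T (I' @ J')) J) I"
proof (induction k arbitrary: I T)
  case (Suc k)
  then obtain i I' where "I = i # I'" "length I' = k" by (cases I) auto
  then show ?case using Suc.IH[of I'] by (simp add: pullback_Suc)
qed simp

text \<open>Pulling back is contravariant: \<open>P $ a $ i\<close> carries the new index second, so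
  \<open>N\<close> followed by \<open>Q\<close> amounts to the product
  \<open>N ** Q\<close>.\<close>

lemma pullback_pullback:
  "length I = k \<Longrightarrow> pullback k Q (pullback k N T) I = pullback k (N ** Q) T I"
proof (induction k arbitrary: I T)
  case (Suc k)
  then obtain i I' where I: "I = i # I'" "length I' = k" by (cases I) auto
  have "pullback (Suc k) Q (pullback (Suc k) N T) I
      = (\<Sum>b\<in>UNIV. Q $ b $ i * pullback k Q (\<lambda>K. \<Sum>a\<in>UNIV. N $ a $ b * pullback k N (\<lambda>L. T (a # L)) K) I')"
    by (simp add: I pullback_Suc)
  also have "\<dots> = (\<Sum>b\<in>UNIV. \<Sum>a\<in>UNIV. Q $ b $ i * N $ a $ b * pullback k (N ** Q) (\<lambda>L. T (a # L)) I')"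
    by (simp add: pullback_sum Suc.IH I sum_distrib_left mult.assoc)
  also have "\<dots> = (\<Sum>a\<in>UNIV. (N ** Q) $ a $ i * pullback k (N ** Q) (\<lambda>L. T (a # L)) I')"
    by (subst sum.swap) (simp add: matrix_matrix_mult_def sum_distrib_right mult.commute)
  finally show ?case by (simp add: I pullback_Suc)
qed simp

lemma pullback_one: "length I = k \<Longrightarrow> pullback k (mat 1) T I = T I"
proof (induction k arbitrary: I T)
  case (Suc k)
  then obtain i I' where I: "I = i # I'" "length I' = k" by (cases I) auto
  show ?case
    unfolding I pullback_Suc Suc.IH[OF I(2)]
    by (simp add: mat_def if_distrib[of "\<lambda>x. x * _"] cong: if_cong)
qed simp

text \<open>Pairs the slots of \<open>u\<close> and \<open>w\<close> one by one. There is no factor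
  \<open>1 / fact k\<close>, so on k-forms with \<open>\<gamma> = ginv g\<close> this is
  \<open>fact k\<close> times the usual inner product.\<close>

definition contr :: "nat \<Rightarrow> (7 \<Rightarrow> 7 \<Rightarrow> real) \<Rightarrow> tensor \<Rightarrow> tensor \<Rightarrow> real" where
  "contr k \<gamma> u w = (\<Sum>I | length I = k. \<Sum>K | length K = k. (\<Prod>r<k. \<gamma> (I ! r) (K ! r)) * u I * w K)"

abbreviation kdelta :: "7 \<Rightarrow> 7 \<Rightarrow> real" where "kdelta i j \<equiv> of_bool (i = j)"

lemma contr_0 [simp]: "contr 0 \<gamma> u w = u [] * w []"
  by (simp add: contr_def sum_lists_0[simplified])

lemma contr_Suc:
  "contr (Suc k) \<gamma> u w = (\<Sum>i\<in>UNIV. \<Sum>j\<in>UNIV. \<gamma> i j * contr k \<gamma> (\<lambda>I. u (i # I)) (\<lambda>K. w (j # K)))"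
  unfolding contr_def sum_lists_Suc prod_nth_Cons
  by (simp add: sum_distrib_left mult.assoc) (subst (2) sum.swap, simp)

lemma contr_sum_left: "contr k \<gamma> (\<lambda>K. \<Sum>a\<in>S. c a * T a K) w = (\<Sum>a\<in>S. c a * contr k \<gamma> (T a) w)"
proof (induction k arbitrary: T w)
  case (Suc k)
  show ?case unfolding contr_Suc Suc.IH sum_distrib_left
    by (subst sum.swap[of _ _ S], rule sum.cong[OF refl], subst sum.swap[of _ _ S]) (simp add: mult.left_commute)
qed (simp add: sum_distrib_right mult.assoc)

lemma contr_sum_right: "contr k \<gamma> u (\<lambda>K. \<Sum>a\<in>S. c a * T a K) = (\<Sum>a\<in>S. c a * contr k \<gamma> u (T a))"
proof (induction k arbitrary: T u)
  case (Suc k)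
  show ?case unfolding contr_Suc Suc.IH sum_distrib_left
    by (subst sum.swap[of _ _ S], rule sum.cong[OF refl], subst sum.swap[of _ _ S]) (simp add: mult.left_commute)
qed (simp add: sum_distrib_left mult.left_commute)

text \<open>The matrix is moved from the tensors onto the bilinear form. When
  \<open>\<gamma>\<close> is the inverse metric and the rows of \<open>N\<close> form an orthonormal
  coframe, \<open>\<gamma>'\<close> is \<open>kdelta\<close>, and metric contractions become plain
  sums of frame components.\<close>

lemma contr_pullback:
  assumes "\<And>a b. \<gamma>' a b = (\<Sum>i\<in>UNIV. \<Sum>j\<in>UNIV. N $ a $ i * N $ b $ j * \<gamma> i j)"
  shows "contr k \<gamma> (pullback k N u) (pullback k N w) = contr k \<gamma>' u w"
proof (induction k arbitrary: u w)
  case (Suc k)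
  have "contr (Suc k) \<gamma> (pullback (Suc k) N u) (pullback (Suc k) N w)
     = (\<Sum>i\<in>UNIV. \<Sum>j\<in>UNIV. \<gamma> i j * (\<Sum>a\<in>UNIV. N $ a $ i * (\<Sum>b\<in>UNIV. N $ b $ j *
          contr k \<gamma>' (\<lambda>I. u (a # I)) (\<lambda>I. w (b # I)))))"
    by (simp add: contr_Suc pullback_Suc contr_sum_left contr_sum_right Suc.IH)
  also have "\<dots> = (\<Sum>i\<in>UNIV. \<Sum>j\<in>UNIV. \<Sum>a\<in>UNIV. \<Sum>b\<in>UNIV. N $ a $ i * N $ b $ j * \<gamma> i j *
          contr k \<gamma>' (\<lambda>I. u (a # I)) (\<lambda>I. w (b # I)))"
    by (simp add: sum_distrib_left mult_ac)
  also have "\<dots> = (\<Sum>a\<in>UNIV. \<Sum>b\<in>UNIV. \<Sum>i\<in>UNIV. \<Sum>j\<in>UNIV. N $ a $ i * N $ b $ j * \<gamma> i j *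
          contr k \<gamma>' (\<lambda>I. u (a # I)) (\<lambda>I. w (b # I)))"
    apply (subst (2) sum.swap)
    apply (subst (3) sum.swap)
    apply (subst (1) sum.swap)
    apply (subst (2) sum.swap)
    by (rule refl)
  also have "\<dots> = contr (Suc k) \<gamma>' u w"
    by (simp add: contr_Suc assms sum_distrib_right)
  finally show ?case .
qed simp

lemma contr_kdelta_Suc:
  "contr (Suc k) kdelta u w = (\<Sum>i\<in>UNIV. contr k kdelta (\<lambda>I. u (i # I)) (\<lambda>K. w (i # K)))"
  unfolding contr_Suc by (simp add: if_distrib[of "\<lambda>x. x * _"] of_bool_def cong: if_cong)

lemma contr_kdelta: "contr k kdelta u w = (\<Sum>I | length I = k. u I * w I)"
proof (induction k arbitrary: u w)
  case (Suc k) then show ?case by (simp add: contr_kdelta_Suc sum_lists_Suc)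
qed (simp add: sum_lists_0[simplified])

lemma hodge_star_contr:
  "hodge_star g vol k \<alpha> J = 1 / fact k * contr k (ginv g) (\<lambda>I. vol (I @ J)) \<alpha>"
  unfolding hodge_star_def contr_def by (simp add: mult_ac)

lemma pullback_contr_left:
  "pullback l N (\<lambda>J. contr k \<gamma> (\<lambda>I. T I J) \<alpha>) J = contr k \<gamma> (\<lambda>I. pullback l N (T I) J) \<alpha>"
proof (induction k arbitrary: T \<alpha>)
  case 0
  show ?case using pullback_scale[of l N "\<alpha> []" "T []" J] by (simp add: mult.commute)
next
  case (Suc k)
  have "pullback l N (\<lambda>J. contr (Suc k) \<gamma> (\<lambda>I. T I J) \<alpha>) J
     = (\<Sum>i\<in>UNIV. pullback l N (\<lambda>J. \<Sum>j\<in>UNIV. \<gamma> i j * contr k \<gamma> (\<lambda>I. T (i # I) J) (\<lambda>K. \<alpha> (j # K))) J)"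
    using pullback_sum[where c = "\<lambda>_. 1" and k = l and P = N and S = UNIV] by (simp add: contr_Suc)
  then show ?case by (simp add: contr_Suc pullback_sum Suc.IH)
qed

section \<open>Alternating tensors and the wedge product\<close>

lemma tl_permute_list_transpose:
  assumes "length Y = Suc l" "1 \<le> a" "a \<le> l" "1 \<le> b" "b \<le> l"
  shows "tl (permute_list (Transposition.transpose a b) Y) = permute_list (Transposition.transpose (a - 1) (b - 1)) (tl Y)"
  using assms
  by (intro nth_equalityI) (auto simp: permute_list_def nth_tl Transposition.transpose_def simp del: upt_Suc)

lemma alternating_swap:
  assumes "alternating k T" "length I = k" "a < k" "b < k" "a \<noteq> b"
  shows "T (permute_list (Transposition.transpose a b) I) = - T I"
  using assms permutes_swap_id[of a "{..<k}" b]
  by (simp add: alternating_def sign_swap_id)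

text \<open>A permutation fixing position \<open>0\<close> is a product of transpositions of the
  later positions, and each of these, shifted by one, transposes positions of the tail. This
  evaluates a whole coset of permutations in \<open>wedge_1\<close>.\<close>

lemma alternating_tl:
  assumes T: "alternating l T" and q: "q permutes {1..<Suc l}" and Y: "length Y = Suc l"
  shows "T (tl (permute_list q Y)) = of_int (sign q) * T (tl Y)"
proof -
  have fin: "finite {1..<Suc l}" by simp
  show ?thesis using q fin Y
  proof (induction arbitrary: Y rule: permutes_induct)
    case id then show ?case by simp
  next
    case (swap a b p)
    have p: "permutation p" using \<open>p permutes {1..<Suc l}\<close> by (meson finite_atLeastLessThan permutation_permutes)
    have p': "p permutes {..<length Y}" using swap by (intro permutes_subset[OF \<open>p permutes {1..<Suc l}\<close>]) auto
    have "T (tl (permute_list (Transposition.transpose a b \<circ> p) Y)) = T (tl (permute_list p (permute_list (Transposition.transpose a b) Y)))"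
      using p' by (simp add: permute_list_compose)
    also have "\<dots> = of_int (sign p) * T (tl (permute_list (Transposition.transpose a b) Y))"
      using swap by simp
    also have "\<dots> = of_int (sign p) * - T (tl Y)"
    proof -
      have "T (permute_list (Transposition.transpose (a - 1) (b - 1)) (tl Y)) = - T (tl Y)"
        using swap(1,2,3) swap.prems by (intro alternating_swap[OF T]) auto
      then show ?thesis
        using swap(1,2) swap.prems by (simp only: tl_permute_list_transpose[of Y l a b] atLeastLessThan_iff less_Suc_eq_le)
    qed
    finally show ?case
      unfolding sign_compose[OF permutation_swap_id p] using swap(3) by (simp add: sign_swap_id comp_def)
  qed
qed

text \<open>Every permutation of the \<open>l + 1\<close> positions is uniquely a transposition of
  \<open>0\<close> and \<open>b\<close> composed with a permutation fixing \<open>0\<close>. The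
  \<open>fact l\<close> members of a class give equal terms and cancel the normalisation. As the
  representatives are transpositions rather than cyclic shifts, every sign with b \<noteq> 0 is -1
  and slot \<open>b\<close> receives the former head.\<close>

lemma wedge_1:
  assumes \<beta>: "alternating l \<beta>" and I: "length I = Suc l"
  shows "wedge 1 l \<alpha> \<beta> I = (\<Sum>b<Suc l. (if b = 0 then 1 else - 1) * \<alpha> [I ! b]
            * \<beta> (tl (permute_list (Transposition.transpose 0 b) I)))"
proof -
  have ins: "{..<1 + l} = insert 0 {1..<Suc l}" by auto
  let ?f = "\<lambda>\<sigma>. of_int (sign \<sigma>) * \<alpha> (take 1 (permute_list \<sigma> I)) * \<beta> (drop 1 (permute_list \<sigma> I))"
  have key: "?f (Transposition.transpose 0 b \<circ> q) = (if b = 0 then 1 else - 1) * \<alpha> [I ! b] * \<beta> (tl (permute_list (Transposition.transpose 0 b) I))"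
    if b: "b \<le> l" and q: "q permutes {1..<Suc l}" for b q
  proof -
    have qp: "permutation q" using q by (auto simp: permutation_permutes)
    have q': "q permutes {..<length I}" using I by (intro permutes_subset[OF q]) auto
    define Y where "Y = permute_list (Transposition.transpose 0 b) I"
    have Y: "length Y = Suc l" by (simp add: Y_def I)
    have "permute_list (Transposition.transpose 0 b \<circ> q) I = permute_list q Y"
      using q' by (simp add: permute_list_compose Y_def)
    moreover have "take 1 (permute_list q Y) = [I ! b]"
    proof -
      have "q 0 = 0" using q by (simp add: permutes_def)
      then have "permute_list q Y ! 0 = Y ! 0" using Y by (simp add: permute_list_def del: upt_Suc)
      also have "\<dots> = I ! b" using I by (simp add: Y_def permute_list_def del: upt_Suc)
      finally show ?thesis using Y by (cases "permute_list q Y") (auto dest: arg_cong[of _ _ length])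
    qed
    moreover have "\<beta> (drop 1 (permute_list q Y)) = of_int (sign q) * \<beta> (tl Y)"
      using alternating_tl[OF \<beta> q Y] by (simp add: drop_Suc)
    moreover have "of_int (sign q) * of_int (sign q) = (1::real)"
      by (metis of_int_1 of_int_mult sign_idempotent)
    ultimately show ?thesis
      using qp by (simp add: sign_compose permutation_swap_id sign_swap_id Y_def mult.assoc mult.left_commute)
  qed
  have "(\<Sum>\<sigma> | \<sigma> permutes {..<1 + l}. ?f \<sigma>)
      = (\<Sum>b\<in>insert 0 {1..<Suc l}. \<Sum>q | q permutes {1..<Suc l}.
           (if b = 0 then 1 else - 1) * \<alpha> [I ! b] * \<beta> (tl (permute_list (Transposition.transpose 0 b) I)))"
    unfolding ins
    by (subst sum_over_permutations_insert, simp, simp, intro sum.cong refl) (rule key; auto)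
  also have "\<dots> = fact l * (\<Sum>b<Suc l. (if b = 0 then 1 else - 1) * \<alpha> [I ! b]
            * \<beta> (tl (permute_list (Transposition.transpose 0 b) I)))"
    using ins by (simp add: card_permutations[of _ l] sum_distrib_left mult.assoc del: sum.insert sum.lessThan_Suc)
  finally show ?thesis unfolding wedge_def by (simp del: sum.lessThan_Suc)
qed

lemma alternating_1: "alternating 1 \<alpha>"
proof -
  have "\<sigma> = id" if "\<sigma> permutes {..<1::nat}" for \<sigma>
    using that by (simp add: lessThan_Suc)
  then show ?thesis unfolding alternating_def by (metis mult_1 of_int_1 permute_list_id sign_id)
qed

lemma wedge_1_1: "wedge 1 1 \<alpha> \<beta> [i, j] = \<alpha> [i] * \<beta> [j] - \<alpha> [j] * \<beta> [i]"
  by (subst wedge_1[OF alternating_1]) (simp_all add: permute_list_def upt_conv_Cons Transposition.transpose_def)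

lemma wedge_1_2:
  assumes "alternating 2 \<beta>"
  shows "wedge 1 2 \<alpha> \<beta> [i, j, k] = \<alpha> [i] * \<beta> [j, k] - \<alpha> [j] * \<beta> [i, k] - \<alpha> [k] * \<beta> [j, i]"
  by (subst wedge_1[OF assms]) (simp_all add: permute_list_def upt_conv_Cons Transposition.transpose_def numeral_2_eq_2)

lemma wedge_1_3:
  assumes "alternating 3 \<beta>"
  shows "wedge 1 3 \<alpha> \<beta> [i, j, k, l] = \<alpha> [i] * \<beta> [j, k, l] - \<alpha> [j] * \<beta> [i, k, l]
     - \<alpha> [k] * \<beta> [j, i, l] - \<alpha> [l] * \<beta> [j, k, i]"
  by (subst wedge_1[OF assms]) (simp_all add: permute_list_def upt_conv_Cons Transposition.transpose_def numeral_3_eq_3)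

lemma wedge_1_4:
  assumes "alternating 4 \<beta>"
  shows "wedge 1 4 \<alpha> \<beta> [i, j, k, l, m] = \<alpha> [i] * \<beta> [j, k, l, m] - \<alpha> [j] * \<beta> [i, k, l, m]
     - \<alpha> [k] * \<beta> [j, i, l, m] - \<alpha> [l] * \<beta> [j, k, i, m] - \<alpha> [m] * \<beta> [j, k, l, i]"
  by (subst wedge_1[OF assms]) (simp_all add: permute_list_def upt_conv_Cons Transposition.transpose_def numeral_eq_Suc)

lemma permute_list_inv:
  assumes "\<sigma> permutes {..<length K}"
  shows "permute_list \<sigma> (permute_list (inv \<sigma>) K) = K" "permute_list (inv \<sigma>) (permute_list \<sigma> K) = K"
  using permute_list_compose[OF assms, of "inv \<sigma>"] permute_list_compose[OF permutes_inv[OF assms], of "\<sigma>"]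
    permutes_inv_o[OF assms] by simp_all

lemma sum_lists_permute:
  assumes "\<sigma> permutes {..<k}"
  shows "(\<Sum>K | length K = k. F (permute_list \<sigma> K)) = (\<Sum>K | length K = k. F (K :: 'a list))"
  by (rule sum.reindex_bij_witness[of _ "permute_list (inv \<sigma>)" "permute_list \<sigma>"])
     (use assms permute_list_inv in auto)

text \<open>Permuting the summation multi-index together with the factors of the product leaves the
  sum unchanged, so a permutation of slots passes through the pullback.\<close>

lemma pullback_permute:
  assumes \<sigma>: "\<sigma> permutes {..<k}" and I: "length I = k"
  shows "pullback k N (\<lambda>K. T (permute_list \<sigma> K)) I = pullback k N T (permute_list \<sigma> I)"
proof -
  have "pullback k N T (permute_list \<sigma> I)
      = (\<Sum>K | length K = k. (\<Prod>r<k. N $ (permute_list \<sigma> K ! r) $ (permute_list \<sigma> I ! r)) * T (permute_list \<sigma> K))"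
    unfolding pullback_def
    by (rule sum_lists_permute[OF \<sigma>, where F = "\<lambda>K. (\<Prod>r<k. N $ (K ! r) $ (permute_list \<sigma> I ! r)) * T K", symmetric])
  also have "\<dots> = (\<Sum>K | length K = k. (\<Prod>r<k. N $ (K ! \<sigma> r) $ (I ! \<sigma> r)) * T (permute_list \<sigma> K))"
    using \<sigma> I by (intro sum.cong refl arg_cong2[of _ _ _ _ "(*)"] prod.cong) (auto simp: permute_list_nth)
  also have "\<dots> = (\<Sum>K | length K = k. (\<Prod>r<k. N $ (K ! r) $ (I ! r)) * T (permute_list \<sigma> K))"
    by (intro sum.cong refl arg_cong2[of _ _ _ _ "(*)"] prod.permute[OF \<sigma>, symmetric, unfolded o_def])
  finally show ?thesis by (simp add: pullback_def)
qed

lemma alternating_pullback: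
  assumes "alternating k T"
  shows "alternating k (pullback k N T)"
  unfolding alternating_def
proof (intro allI impI, elim conjE)
  fix I :: "7 list" and \<sigma> assume I: "length I = k" and \<sigma>: "\<sigma> permutes {..<k}"
  have "pullback k N T (permute_list \<sigma> I) = pullback k N (\<lambda>K. T (permute_list \<sigma> K)) I"
    by (simp add: pullback_permute I \<sigma>)
  also have "\<dots> = pullback k N (\<lambda>K. of_int (sign \<sigma>) * T K) I"
    using assms \<sigma> by (intro pullback_cong) (auto simp: alternating_def)
  finally show "pullback k N T (permute_list \<sigma> I) = of_int (sign \<sigma>) * pullback k N T I"
    by (simp add: pullback_scale)
qed

lemma pullback_tensor:
  assumes "length I = k + l"
  shows "pullback (k + l) N (\<lambda>K. \<alpha> (take k K) * \<beta> (drop k K)) I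
    = pullback k N \<alpha> (take k I) * pullback l N \<beta> (drop k I)"
proof -
  have "pullback (k + l) N (\<lambda>K. \<alpha> (take k K) * \<beta> (drop k K)) (take k I @ drop k I)
     = pullback k N (\<lambda>I'. pullback l N (\<lambda>J'. \<alpha> (take k (I' @ J')) * \<beta> (drop k (I' @ J'))) (drop k I)) (take k I)"
    using assms by (subst pullback_append) auto
  also have "\<dots> = pullback k N (\<lambda>I'. pullback l N \<beta> (drop k I) * \<alpha> I') (take k I)"
    by (rule pullback_cong) (simp add: pullback_scale mult.commute)
  also have "\<dots> = pullback l N \<beta> (drop k I) * pullback k N \<alpha> (take k I)"
    by (rule pullback_scale)
  finally show ?thesis by (simp only: append_take_drop_id mult.commute)
qed

lemma pullback_wedge:
  assumes "length I = k + l"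
  shows "pullback (k + l) N (wedge k l \<alpha> \<beta>) I = wedge k l (pullback k N \<alpha>) (pullback l N \<beta>) I"
proof -
  have "pullback (k + l) N (wedge k l \<alpha> \<beta>) I = 1 / (fact k * fact l) *
     (\<Sum>\<sigma> | \<sigma> permutes {..<k + l}. of_int (sign \<sigma>) * pullback (k + l) N
        (\<lambda>K. \<alpha> (take k (permute_list \<sigma> K)) * \<beta> (drop k (permute_list \<sigma> K))) I)"
    unfolding wedge_def[abs_def] pullback_scale pullback_sum mult.assoc ..
  also have "\<dots> = wedge k l (pullback k N \<alpha>) (pullback l N \<beta>) I"
  proof -
    have "pullback (k + l) N (\<lambda>K. \<alpha> (take k (permute_list \<sigma> K)) * \<beta> (drop k (permute_list \<sigma> K))) I
        = pullback k N \<alpha> (take k (permute_list \<sigma> I)) * pullback l N \<beta> (drop k (permute_list \<sigma> I))"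
      if "\<sigma> permutes {..<k + l}" for \<sigma>
      using pullback_permute[OF that assms, of N "\<lambda>K. \<alpha> (take k K) * \<beta> (drop k K)"] assms
      by (simp add: pullback_tensor)
    then show ?thesis unfolding wedge_def by (simp add: mult.assoc)
  qed
  finally show ?thesis .
qed

lemma alternating_not_distinct:
  assumes "alternating k T" "length I = k" "\<not> distinct I"
  shows "T I = 0"
proof -
  obtain a b where ab: "a < k" "b < k" "a \<noteq> b" "I ! a = I ! b"
    using assms by (auto simp: distinct_conv_nth)
  have "permute_list (Transposition.transpose a b) I = I"
    using ab assms(2) by (intro nth_equalityI) (auto simp: permute_list_def Transposition.transpose_def)
  moreover have "T (permute_list (Transposition.transpose a b) I) = - T I"
    using assms ab permutes_swap_id[of a "{..<k}" b] by (simp add: alternating_def sign_swap_id)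
  ultimately show ?thesis by simp
qed

text \<open>Against an alternating tensor all \<open>fact (k + l)\<close> terms of the
  antisymmetrisation contribute equally, so the wedge may be replaced by the tensor product. This
  spares every explicit expansion of wedges of higher degree.\<close>

lemma sum_alternating_wedge:
  assumes "alternating (k + l) T"
  shows "(\<Sum>L | length L = k + l. T L * wedge k l \<alpha> \<beta> L)
    = fact (k + l) / (fact k * fact l) * (\<Sum>I | length I = k. \<Sum>J | length J = l. T (I @ J) * \<alpha> I * \<beta> J)"
proof -
  let ?G = "\<lambda>L. \<alpha> (take k L) * \<beta> (drop k L)"
  have "(\<Sum>L | length L = k + l. T L * (of_int (sign \<sigma>) * ?G (permute_list \<sigma> L))) = (\<Sum>L | length L = k + l. T L * ?G L)"
    if \<sigma>: "\<sigma> permutes {..<k + l}" for \<sigma>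
  proof -
    have "(\<Sum>L | length L = k + l. T L * (of_int (sign \<sigma>) * ?G (permute_list \<sigma> L)))
      = (\<Sum>L | length L = k + l. T (permute_list \<sigma> L) * ?G (permute_list \<sigma> L))"
      using assms \<sigma> by (intro sum.cong) (auto simp: alternating_def)
    then show ?thesis using sum_lists_permute[OF \<sigma>, of "\<lambda>L. T L * ?G L"] by simp
  qed
  then have *: "(\<Sum>\<sigma> | \<sigma> permutes {..<k + l}. \<Sum>L | length L = k + l. T L * (of_int (sign \<sigma>) * ?G (permute_list \<sigma> L)))
     = fact (k + l) * (\<Sum>L | length L = k + l. T L * ?G L)"
    by (simp add: card_permutations[of _ "k + l"])
  have "(\<Sum>L | length L = k + l. T L * wedge k l \<alpha> \<beta> L) = 1 / (fact k * fact l) *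
     (\<Sum>\<sigma> | \<sigma> permutes {..<k + l}. \<Sum>L | length L = k + l. T L * (of_int (sign \<sigma>) * ?G (permute_list \<sigma> L)))"
    unfolding wedge_def sum_distrib_left
    by (subst sum.swap) (simp add: mult_ac)
  also have "\<dots> = fact (k + l) / (fact k * fact l) * (\<Sum>L | length L = k + l. T L * ?G L)"
    unfolding * by simp
  also have "(\<Sum>L | length L = k + l. T L * ?G L) = (\<Sum>I | length I = k. \<Sum>J | length J = l. T (I @ J) * \<alpha> I * \<beta> J)"
    unfolding sum_lists_append by (intro sum.cong) (auto simp: mult.assoc)
  finally show ?thesis .
qed

section \<open>Forms of top degree and the determinant\<close>

abbreviation indices :: "7 list" where "indices \<equiv> [1, 2, 3, 4, 5, 6, 7]"

lemma set_indices: "set indices = UNIV"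
  by (simp add: UNIV_7[symmetric])

text \<open>A list of length 7 without repetition uses every index exactly once, hence is a unique
  rearrangement of \<open>indices\<close>.\<close>

lemma sum_lists_distinct_7:
  assumes "\<And>L. length L = 7 \<Longrightarrow> \<not> distinct L \<Longrightarrow> H L = 0"
  shows "(\<Sum>L | length L = 7. H L) = (\<Sum>\<sigma> | \<sigma> permutes {..<7}. H (permute_list \<sigma> indices))"
proof -
  have "(\<Sum>L | length L = 7. H L) = (\<Sum>L | length L = 7 \<and> distinct L. H L)"
    using assms by (intro sum.mono_neutral_right) auto
  also have "{L :: 7 list. length L = 7 \<and> distinct L} = (\<lambda>\<sigma>. permute_list \<sigma> indices) ` {\<sigma>. \<sigma> permutes {..<7}}"
  proof (intro subset_antisym subsetI)
    fix L :: "7 list" assume "L \<in> {L. length L = 7 \<and> distinct L}"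
    then have L: "length L = 7" "distinct L" by auto
    have "set L = UNIV" using L by (intro card_subset_eq) (auto simp: distinct_card)
    then have "mset L = mset indices"
      using L set_indices by (intro set_eq_iff_mset_eq_distinct[THEN iffD1]) auto
    then obtain p where "p permutes {..<length indices}" "permute_list p indices = L"
      by (rule mset_eq_permutation)
    then show "L \<in> (\<lambda>\<sigma>. permute_list \<sigma> indices) ` {\<sigma>. \<sigma> permutes {..<7}}"
      by (intro image_eqI[of _ _ p]) (simp_all add: numeral_eq_Suc)
  next
    fix L assume "L \<in> (\<lambda>\<sigma>. permute_list \<sigma> indices) ` {\<sigma>. \<sigma> permutes {..<7}}"
    then obtain \<sigma> where "\<sigma> permutes {..<length indices}" "L = permute_list \<sigma> indices"
      by (auto simp: numeral_eq_Suc)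
    then show "L \<in> {L. length L = 7 \<and> distinct L}"
      using distinct_permute_list[of \<sigma> indices] by simp
  qed
  also have "(\<Sum>L\<in>\<dots>. H L) = (\<Sum>\<sigma> | \<sigma> permutes {..<7}. H (permute_list \<sigma> indices))"
  proof (subst sum.reindex)
    have "\<sigma> = \<tau>" if "\<sigma> permutes {..<7}" "\<tau> permutes {..<7}" "permute_list \<sigma> indices = permute_list \<tau> indices" for \<sigma> \<tau>
    proof
      fix x show "\<sigma> x = \<tau> x"
      proof (cases "x < 7")
        case True
        then have "indices ! \<sigma> x = indices ! \<tau> x"
          using arg_cong[OF that(3), of "\<lambda>L. L ! x"] that(1,2)
              permute_list_nth[of \<sigma> indices x] permute_list_nth[of \<tau> indices x]
            by (simp add: numeral_eq_Suc)
        moreover have "\<sigma> x < 7" "\<tau> x < 7" using that True by (metis lessThan_iff permutes_in_image)+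
        ultimately show ?thesis using nth_eq_iff_index_eq[of indices "\<sigma> x" "\<tau> x"] by simp
      qed (use that in \<open>auto simp: permutes_def\<close>)
    qed
    then show "inj_on (\<lambda>\<sigma>. permute_list \<sigma> indices) {\<sigma>. \<sigma> permutes {..<7}}" by (auto simp: inj_on_def)
  qed simp
  finally show ?thesis .
qed

lemma alternating_7_sum_squares:
  assumes "alternating 7 vol"
  shows "(\<Sum>L | length L = 7. vol L * vol L) = 5040 * (vol indices)\<^sup>2"
proof -
  have "(\<Sum>L | length L = 7. vol L * vol L) = (\<Sum>\<sigma> | \<sigma> permutes {..<7}. vol (permute_list \<sigma> indices) * vol (permute_list \<sigma> indices))"
    using alternating_not_distinct[OF assms] by (intro sum_lists_distinct_7) simp
  also have "\<dots> = (\<Sum>\<sigma> | \<sigma> permutes {..<7::nat}. (vol indices)\<^sup>2)"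
  proof (intro sum.cong refl)
    fix \<sigma> :: "nat \<Rightarrow> nat" assume "\<sigma> \<in> {\<sigma>. \<sigma> permutes {..<7}}"
    then have "vol (permute_list \<sigma> indices) = of_int (sign \<sigma>) * vol indices"
      using assms unfolding alternating_def by simp
    moreover have "of_int (sign \<sigma>) * of_int (sign \<sigma>) = (1::real)"
      by (metis of_int_1 of_int_mult sign_idempotent)
    ultimately show "vol (permute_list \<sigma> indices) * vol (permute_list \<sigma> indices) = (vol indices)\<^sup>2"
      by (simp add: power2_eq_square algebra_simps)
  qed
  also have "\<dots> = 5040 * (vol indices)\<^sup>2"
    by (simp add: card_permutations[of _ 7] fact_numeral)
  finally show ?thesis .
qed

lemma nth_indices_bij: "bij_betw ((!) indices) {..<7} UNIV"
  using bij_betw_nth[of indices "{..<7}" UNIV] set_indices by simp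

text \<open>On lists without repetition the pullback sum is Leibniz' formula for the
  determinant.\<close>

lemma pullback_7_det:
  assumes vol: "alternating 7 vol"
  shows "pullback 7 P vol indices = det P * vol indices"
proof -
  let ?ix = "(!) indices"
  have inj: "inj_on ?ix {..<7}" using nth_indices_bij by (simp add: bij_betw_def)
  have "pullback 7 P vol indices
     = (\<Sum>\<sigma> | \<sigma> permutes {..<7}. (\<Prod>r<7. P $ (permute_list \<sigma> indices ! r) $ (?ix r)) * vol (permute_list \<sigma> indices))"
    unfolding pullback_def using alternating_not_distinct[OF vol]
    by (intro sum_lists_distinct_7) simp
  also have "\<dots> = (\<Sum>\<sigma> | \<sigma> permutes {..<7}. of_int (sign \<sigma>) * (\<Prod>r<7. P $ (?ix (\<sigma> r)) $ (?ix r)) * vol indices)"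
  proof (intro sum.cong refl)
    fix \<sigma> :: "nat \<Rightarrow> nat" assume \<sigma>: "\<sigma> \<in> {\<sigma>. \<sigma> permutes {..<7}}"
    then have "vol (permute_list \<sigma> indices) = of_int (sign \<sigma>) * vol indices"
      using vol unfolding alternating_def by simp
    moreover have "permute_list \<sigma> indices ! r = ?ix (\<sigma> r)" if "r < 7" for r
      using permute_list_nth[of \<sigma> indices r] \<sigma> that by (simp add: numeral_eq_Suc)
    ultimately show "(\<Prod>r<7. P $ (permute_list \<sigma> indices ! r) $ (?ix r)) * vol (permute_list \<sigma> indices)
       = of_int (sign \<sigma>) * (\<Prod>r<7. P $ (?ix (\<sigma> r)) $ (?ix r)) * vol indices"
      by (simp del: nth_Cons_numeral)
  qed
  \<comment> \<open>\<open>det\<close> sums over permutations of the index type, the left side over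
    permutations of list positions. \<open>map_permutation\<close> along the bijection
    \<open>(!) indices\<close> translates between them and preserves signs.\<close>
  also have "\<dots> = (\<Sum>p | p permutes UNIV. of_int (sign p) * (\<Prod>i\<in>UNIV. P $ (p i) $ i) * vol indices)"
  proof (rule sum.reindex_bij_witness[of _ "map_permutation UNIV (inv_into {..<7} ?ix)" "map_permutation {..<7} ?ix"])
    fix \<sigma> :: "nat \<Rightarrow> nat" assume "\<sigma> \<in> {\<sigma>. \<sigma> permutes {..<7}}"
    then have \<sigma>: "\<sigma> permutes {..<7}" by simp
    show "map_permutation UNIV (inv_into {..<7} ?ix) (map_permutation {..<7} ?ix \<sigma>) = \<sigma>"
      using nth_indices_bij \<sigma> by (intro map_permutation_compose_inv) (auto simp: bij_betw_def)
    show "map_permutation {..<7} ?ix \<sigma> \<in> {p. p permutes UNIV}"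
      using map_permutation_permutes[OF nth_indices_bij \<sigma>] by simp
    have "(\<Prod>i\<in>UNIV. P $ (map_permutation {..<7} ?ix \<sigma> i) $ i) = (\<Prod>r<7. P $ (map_permutation {..<7} ?ix \<sigma> (?ix r)) $ (?ix r))"
      by (rule prod.reindex_bij_betw[OF nth_indices_bij, symmetric])
    also have "\<dots> = (\<Prod>r<7. P $ (?ix (\<sigma> r)) $ (?ix r))"
      using inj by (intro prod.cong refl) (simp add: map_permutation_apply del: nth_Cons_numeral)
    finally show "of_int (sign (map_permutation {..<7} ?ix \<sigma>)) * (\<Prod>i\<in>UNIV. P $ (map_permutation {..<7} ?ix \<sigma> i) $ i) * vol indices
       = of_int (sign \<sigma>) * (\<Prod>r<7. P $ (?ix (\<sigma> r)) $ (?ix r)) * vol indices"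
      using sign_map_permutation[OF inj \<sigma>] by simp
  next
    fix p :: "7 \<Rightarrow> 7" assume "p \<in> {p. p permutes UNIV}"
    then have p: "p permutes UNIV" by simp
    have bij: "bij_betw (inv_into {..<7} ?ix) UNIV {..<7}" by (rule bij_betw_inv_into[OF nth_indices_bij])
    show "map_permutation UNIV (inv_into {..<7} ?ix) p \<in> {\<sigma>. \<sigma> permutes {..<7}}"
      using map_permutation_permutes[OF bij p] by simp
    show "map_permutation {..<7} ?ix (map_permutation UNIV (inv_into {..<7} ?ix) p) = p"
      using bij p nth_indices_bij
      by (intro map_permutation_compose_inv) (auto simp: bij_betw_def f_inv_into_f)
  qed
  \<comment> \<open>The permutation sits on the row index, so Leibniz' formula first yields the
    determinant of the transpose.\<close>
  also have "\<dots> = det (Finite_Cartesian_Product.transpose P) * vol indices"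
    unfolding det_def by (simp add: sum_distrib_right Finite_Cartesian_Product.transpose_def)
  finally show ?thesis by simp
qed

text \<open>Reindexing the antisymmetrisation by left composition with \<tau> brings out the factor
  \<open>sign \<tau>\<close>.\<close>

lemma alternating_wedge: "alternating (k + l) (wedge k l \<alpha> \<beta>)"
  unfolding alternating_def
proof (intro allI impI, elim conjE)
  fix I :: "7 list" and \<tau> assume I: "length I = k + l" and \<tau>: "\<tau> permutes {..<k + l}"
  let ?G = "\<lambda>L. \<alpha> (take k L) * \<beta> (drop k L)"
  have "(\<Sum>\<sigma> | \<sigma> permutes {..<k + l}. of_int (sign \<sigma>) * ?G (permute_list \<sigma> I))
      = (\<Sum>\<sigma> | \<sigma> permutes {..<k + l}. of_int (sign (\<tau> \<circ> \<sigma>)) * ?G (permute_list (\<tau> \<circ> \<sigma>) I))"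
    by (rule sum.reindex_bij_betw[symmetric], rule bij_betwI[of _ _ _ "\<lambda>\<sigma>. inv \<tau> \<circ> \<sigma>"])
       (use \<tau> permutes_inv_o[OF \<tau>] in \<open>auto intro: permutes_compose permutes_inv simp: comp_assoc[symmetric]\<close>)
  also have "\<dots> = (\<Sum>\<sigma> | \<sigma> permutes {..<k + l}. of_int (sign \<tau>) * (of_int (sign \<sigma>) * ?G (permute_list \<sigma> (permute_list \<tau> I))))"
  proof (intro sum.cong refl)
    fix \<sigma> assume "\<sigma> \<in> {\<sigma>. \<sigma> permutes {..<k + l}}"
    then have \<sigma>: "\<sigma> permutes {..<k + l}" by simp
    then have "permutation \<sigma>" "permutation \<tau>" using \<tau> by (auto simp: permutation_permutes)
    then show "of_int (sign (\<tau> \<circ> \<sigma>)) * ?G (permute_list (\<tau> \<circ> \<sigma>) I)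
        = of_int (sign \<tau>) * (of_int (sign \<sigma>) * ?G (permute_list \<sigma> (permute_list \<tau> I)))"
      using permute_list_compose[of \<sigma> I \<tau>] \<sigma> I by (simp add: sign_compose)
  qed
  finally have "(\<Sum>\<sigma> | \<sigma> permutes {..<k + l}. of_int (sign \<sigma>) * ?G (permute_list \<sigma> I))
      = of_int (sign \<tau>) * (\<Sum>\<sigma> | \<sigma> permutes {..<k + l}. of_int (sign \<sigma>) * ?G (permute_list \<sigma> (permute_list \<tau> I)))"
    by (simp add: sum_distrib_left)
  then have "wedge k l \<alpha> \<beta> I = of_int (sign \<tau>) * wedge k l \<alpha> \<beta> (permute_list \<tau> I)"
    unfolding wedge_def by (simp add: mult.assoc)
  moreover have "of_int (sign \<tau>) * of_int (sign \<tau>) = (1::real)"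
    by (metis of_int_1 of_int_mult sign_idempotent)
  ultimately show "wedge k l \<alpha> \<beta> (permute_list \<tau> I) = of_int (sign \<tau>) * wedge k l \<alpha> \<beta> I"
    by (simp add: mult.assoc[symmetric])
qed

lemma alternating_Cons:
  assumes T: "alternating (Suc l) T"
  shows "alternating l (\<lambda>J. T (i # J))"
  unfolding alternating_def
proof (intro allI impI, elim conjE)
  fix J :: "7 list" and \<sigma> assume J: "length J = l" and \<sigma>: "\<sigma> permutes {..<l}"
  have fin: "finite {..<l}" by simp
  show "T (i # permute_list \<sigma> J) = of_int (sign \<sigma>) * T (i # J)" using \<sigma> fin J
  proof (induction arbitrary: J rule: permutes_induct)
    case id then show ?case by simp
  next
    case (swap a b p)
    have p: "permutation p" using \<open>p permutes {..<l}\<close> by (auto simp: permutation_permutes)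
    have "T (i # permute_list (Transposition.transpose a b \<circ> p) J) = T (i # permute_list p (permute_list (Transposition.transpose a b) J))"
      using swap.prems \<open>p permutes {..<l}\<close> by (simp add: permute_list_compose)
    also have "\<dots> = of_int (sign p) * T (i # permute_list (Transposition.transpose a b) J)"
      using swap by simp
    also have "i # permute_list (Transposition.transpose a b) J = permute_list (Transposition.transpose (Suc a) (Suc b)) (i # J)"
      using swap(1,2) swap.prems
      by (intro nth_equalityI) (auto simp: permute_list_def nth_Cons' Transposition.transpose_def simp del: upt_Suc)
    also have "T \<dots> = - T (i # J)"
      using swap(1-3) swap.prems by (intro alternating_swap[OF T]) auto
    finally show ?case
      unfolding sign_compose[OF permutation_swap_id p] using swap(3) by (simp add: sign_swap_id comp_def)
  qed
qed

lemma alternating_append: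
  "alternating (k + l) T \<Longrightarrow> length I = k \<Longrightarrow> alternating l (\<lambda>J. T (I @ J))"
proof (induction k arbitrary: I T)
  case (Suc k)
  then obtain i I' where "I = i # I'" "length I' = k" by (cases I) auto
  then show ?case using Suc.IH[of "\<lambda>J. T (i # J)" I'] alternating_Cons[of "k + l" T] Suc.prems by simp
qed simp

lemma alternating_add: "alternating k S \<Longrightarrow> alternating k T \<Longrightarrow> alternating k (\<lambda>I. S I + T I)"
  by (simp add: alternating_def distrib_left)

lemma alternating_diff: "alternating k S \<Longrightarrow> alternating k T \<Longrightarrow> alternating k (\<lambda>I. S I - T I)"
  by (simp add: alternating_def right_diff_distrib)

lemma alternating_scale: "alternating k T \<Longrightarrow> alternating k (\<lambda>I. c * T I)"
  by (simp add: alternating_def mult.left_commute)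

lemma alternating_sum: "(\<And>a. a \<in> S \<Longrightarrow> alternating k (T a)) \<Longrightarrow> alternating k (\<lambda>I. \<Sum>a\<in>S. T a I)"
  by (simp add: alternating_def sum_distrib_left)

section \<open>Exchanging neighbouring slots\<close>

lemma swap_2: "alternating 2 T \<Longrightarrow> T [j, i] = - T [i, j]"
  using alternating_swap[of 2 T "[i, j]" 0 1] by (simp add: permute_list_def upt_conv_Cons)

lemma swap_3:
  assumes "alternating 3 T"
  shows "T [j, i, k] = - T [i, j, k]" "T [i, k, j] = - T [i, j, k]"
  using alternating_swap[OF assms, of "[i, j, k]" 0 1] alternating_swap[OF assms, of "[i, j, k]" 1 2]
  by (simp_all add: permute_list_def upt_conv_Cons Transposition.transpose_def)

lemma swap_4:
  assumes "alternating 4 T"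
  shows "T [j, i, k, l] = - T [i, j, k, l]" "T [i, k, j, l] = - T [i, j, k, l]" "T [i, j, l, k] = - T [i, j, k, l]"
  using alternating_swap[OF assms, of "[i, j, k, l]" 0 1] alternating_swap[OF assms, of "[i, j, k, l]" 1 2]
    alternating_swap[OF assms, of "[i, j, k, l]" 2 3]
  by (simp_all add: permute_list_def upt_conv_Cons Transposition.transpose_def)

lemma swap_7:
  assumes "alternating 7 T"
  shows "T [j, i, k, l, m, n, p] = - T [i, j, k, l, m, n, p]" "T [i, k, j, l, m, n, p] = - T [i, j, k, l, m, n, p]"
    "T [i, j, l, k, m, n, p] = - T [i, j, k, l, m, n, p]" "T [i, j, k, m, l, n, p] = - T [i, j, k, l, m, n, p]"
    "T [i, j, k, l, n, m, p] = - T [i, j, k, l, m, n, p]" "T [i, j, k, l, m, p, n] = - T [i, j, k, l, m, n, p]"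
  using alternating_swap[OF assms, of "[i, j, k, l, m, n, p]" 0 1] alternating_swap[OF assms, of "[i, j, k, l, m, n, p]" 1 2]
    alternating_swap[OF assms, of "[i, j, k, l, m, n, p]" 2 3] alternating_swap[OF assms, of "[i, j, k, l, m, n, p]" 3 4]
    alternating_swap[OF assms, of "[i, j, k, l, m, n, p]" 4 5] alternating_swap[OF assms, of "[i, j, k, l, m, n, p]" 5 6]
  by (simp_all add: permute_list_def upt_conv_Cons Transposition.transpose_def)

text \<open>Moving a block of three past a block of four takes twelve transpositions, an even
  number. This reconciles the volume form with its 3-form slots first, as in the Hodge star, and
  with its 4-form slots first, as in \<open>B0\<close>.\<close>

lemma swap_7_block:
  assumes "alternating 7 T"
  shows "T [a, b, c, d, i, j, k] = T [i, j, k, a, b, c, d]"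
proof -
  note s = swap_7[OF assms]
  have mv: "T [x, a, b, c, d, y, z] = T [a, b, c, d, x, y, z]" for x y z a b c d
    using s(1)[of x a b c d y z] s(2)[of a x b c d y z] s(3)[of a b x c d y z] s(4)[of a b c x d y z] by simp
  have mv2: "T [x, y, a, b, c, d, z] = T [x, a, b, c, d, y, z]" for x y z a b c d
    using s(2)[of x a y b c d z] s(3)[of x a b y c d z] s(4)[of x a b c y d z] s(5)[of x a b c d y z] by simp
  have mv3: "T [x, y, z, a, b, c, d] = T [x, y, a, b, c, d, z]" for x y z a b c d
    using s(3)[of x y a z b c d] s(4)[of x y a b z c d] s(5)[of x y a b c z d] s(6)[of x y a b c d z] by simp
  show ?thesis by (simp add: mv3 mv2 mv)
qed

section \<open>The standard $G_2$-form and its dual\<close>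

lemma e3_eq: "e3 a b c [i, j, k] = kdelta i a * (kdelta j b * kdelta k c - kdelta k b * kdelta j c)
   - kdelta j a * (kdelta i b * kdelta k c - kdelta k b * kdelta i c)
   - kdelta k a * (kdelta j b * kdelta i c - kdelta i b * kdelta j c)"
proof -
  have *: "alternating 2 (wedge 1 1 (e1 b) (e1 c))"
    using alternating_wedge[of 1 1] by (simp add: numeral_2_eq_2)
  show ?thesis unfolding e3_def wedge_1_2[OF *] wedge_1_1 by (simp add: e1_def)
qed

lemma alternating_phi0: "alternating 3 phi0"
proof -
  have "alternating 3 (e3 a b c)" for a b c
    unfolding e3_def using alternating_wedge[of 1 2] by (simp add: numeral_3_eq_3)
  then show ?thesis unfolding phi0_def[abs_def] by (intro alternating_add alternating_diff) simp_all
qed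

definition phi :: "7 \<Rightarrow> 7 \<Rightarrow> 7 \<Rightarrow> real" where "phi i j k = phi0 [i, j, k]"

lemma phi_swap: "phi j i k = - phi i j k" "phi i k j = - phi i j k"
  unfolding phi_def by (rule swap_3[OF alternating_phi0])+

section \<open>Octonion multiplication table and contraction identities\<close>

primrec list_pos :: "7 list \<Rightarrow> 7 \<Rightarrow> nat" where "list_pos [] i = 0" | "list_pos (x # xs) i = (if x = i then 0 else Suc (list_pos xs i))"
text \<open>The form \<open>phi0\<close> is given by the multiplication of the imaginary octonions: \<open>phi i j k\<close> is \<open>oct_sign i j\<close> if
  \<open>k = oct_index i j\<close> and \<open>0\<close> otherwise. This turns the contraction identities into finite integer checks.\<close>

definition oct_sign :: "7 \<Rightarrow> 7 \<Rightarrow> int" where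
 "oct_sign i j = [[0, 1, -1, 1, -1, 1, -1], [-1, 0, 1, 1, -1, -1, 1], [1, -1, 0, -1, -1, 1, 1], [-1, -1, 1, 0, 1, 1, -1], [1, 1, 1, -1, 0, -1, -1], [-1, 1, -1, -1, 1, 0, 1], [1, -1, -1, 1, 1, -1, 0]] ! list_pos [1,2,3,4,5,6,7] i ! list_pos [1,2,3,4,5,6,7] j"
text \<open>The diagonal entries are a default value; they are harmless because
  \<open>oct_sign i i = 0\<close>.\<close>

definition oct_index :: "7 \<Rightarrow> 7 \<Rightarrow> 7" where
 "oct_index i j = [[1, 3, 2, 5, 4, 7, 6], [3, 1, 1, 6, 7, 4, 5], [2, 1, 1, 7, 6, 5, 4], [5, 6, 7, 1, 1, 2, 3], [4, 7, 6, 1, 1, 3, 2], [7, 4, 5, 2, 3, 1, 1], [6, 5, 4, 3, 2, 1, 1]] ! list_pos [1,2,3,4,5,6,7] i ! list_pos [1,2,3,4,5,6,7] j"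
text \<open>Tabulated entry by entry so that the finite checks below rewrite directly instead of
  searching the lists each time.\<close>

lemma oct_sign_table: "oct_sign 1 1 = 0" "oct_sign 1 2 = 1" "oct_sign 1 3 = -1" "oct_sign 1 4 = 1" "oct_sign 1 5 = -1" "oct_sign 1 6 = 1" "oct_sign 1 7 = -1" "oct_sign 2 1 = -1" "oct_sign 2 2 = 0" "oct_sign 2 3 = 1" "oct_sign 2 4 = 1" "oct_sign 2 5 = -1" "oct_sign 2 6 = -1" "oct_sign 2 7 = 1" "oct_sign 3 1 = 1" "oct_sign 3 2 = -1" "oct_sign 3 3 = 0" "oct_sign 3 4 = -1" "oct_sign 3 5 = -1" "oct_sign 3 6 = 1" "oct_sign 3 7 = 1" "oct_sign 4 1 = -1" "oct_sign 4 2 = -1" "oct_sign 4 3 = 1" "oct_sign 4 4 = 0" "oct_sign 4 5 = 1" "oct_sign 4 6 = 1" "oct_sign 4 7 = -1" "oct_sign 5 1 = 1" "oct_sign 5 2 = 1" "oct_sign 5 3 = 1" "oct_sign 5 4 = -1" "oct_sign 5 5 = 0" "oct_sign 5 6 = -1" "oct_sign 5 7 = -1" "oct_sign 6 1 = -1" "oct_sign 6 2 = 1" "oct_sign 6 3 = -1" "oct_sign 6 4 = -1" "oct_sign 6 5 = 1" "oct_sign 6 6 = 0" "oct_sign 6 7 = 1" "oct_sign 7 1 = 1" "oct_sign 7 2 = -1" "oct_sign 7 3 = -1" "oct_sign 7 4 = 1" "oct_sign 7 5 = 1" "oct_sign 7 6 = -1" "oct_sign 7 7 = 0" by (simp_all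 add: oct_sign_def)
lemma oct_index_table: "oct_index 1 1 = 1" "oct_index 1 2 = 3" "oct_index 1 3 = 2" "oct_index 1 4 = 5" "oct_index 1 5 = 4" "oct_index 1 6 = 7" "oct_index 1 7 = 6" "oct_index 2 1 = 3" "oct_index 2 2 = 1" "oct_index 2 3 = 1" "oct_index 2 4 = 6" "oct_index 2 5 = 7" "oct_index 2 6 = 4" "oct_index 2 7 = 5" "oct_index 3 1 = 2" "oct_index 3 2 = 1" "oct_index 3 3 = 1" "oct_index 3 4 = 7" "oct_index 3 5 = 6" "oct_index 3 6 = 5" "oct_index 3 7 = 4" "oct_index 4 1 = 5" "oct_index 4 2 = 6" "oct_index 4 3 = 7" "oct_index 4 4 = 1" "oct_index 4 5 = 1" "oct_index 4 6 = 2" "oct_index 4 7 = 3" "oct_index 5 1 = 4" "oct_index 5 2 = 7" "oct_index 5 3 = 6" "oct_index 5 4 = 1" "oct_index 5 5 = 1" "oct_index 5 6 = 3" "oct_index 5 7 = 2" "oct_index 6 1 = 7" "oct_index 6 2 = 4" "oct_index 6 3 = 5" "oct_index 6 4 = 2" "oct_index 6 5 = 3" "oct_index 6 6 = 1" "oct_index 6 7 = 1" "oct_index 7 1 = 6" "oct_index 7 2 = 5" "oct_index 7 3 = 4" "oct_index 7 4 = 3" "oct_index 7 5 = 2" "oct_index 7 6 = 1" "oct_index 7 7 = 1" by (simp_all add: oct_index_def)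
definition delta_int :: "7 \<Rightarrow> 7 \<Rightarrow> int" where "delta_int i j = (if i = j then 1 else 0)"
text \<open>Integer counterpart of \<open>psi\<close>. Since \<open>phi i j\<close> is supported on
  a single index, the sum over the contracted index shrinks to one product guarded by
  \<open>delta_int\<close>.\<close>

definition psi_int :: "7 \<Rightarrow> 7 \<Rightarrow> 7 \<Rightarrow> 7 \<Rightarrow> int" where
  "psi_int i j k l = delta_int i k * delta_int j l - delta_int i l * delta_int j k - oct_sign i j * oct_sign k l * delta_int (oct_index i j) (oct_index k l)"
text \<open>The identity \<open>phi_psi\<close> in integers for one fixed pair of indices, so that
  the check over five indices can be cut into manageable portions.\<close>

definition Q7 where "Q7 i j \<longleftrightarrow> (\<forall>a b c. oct_sign i j * psi_int a b c (oct_index i j) = delta_int i a * (oct_sign j b * delta_int (oct_index j b) c) + delta_int i b * (oct_sign a j * delta_int (oct_index a j) c)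
   + delta_int i c * (oct_sign a b * delta_int (oct_index a b) j) - delta_int j a * (oct_sign i b * delta_int (oct_index i b) c) - delta_int j b * (oct_sign a i * delta_int (oct_index a i) c)
   - delta_int j c * (oct_sign a b * delta_int (oct_index a b) i))"
lemma oct_sign_m7_sym: "\<forall>i j. oct_sign j i = - oct_sign i j \<and> oct_index j i = oct_index i j \<and> oct_sign i i = 0"
  by (simp add: all_7 oct_sign_table oct_index_table)

text \<open>Skewness in the two indices leaves 21 pairs; for each of them 343 integer equations are
  evaluated.\<close>

lemma Q7_table: "Q7 1 2" "Q7 1 3" "Q7 1 4" "Q7 1 5" "Q7 1 6" "Q7 1 7" "Q7 2 3" "Q7 2 4" "Q7 2 5" "Q7 2 6" "Q7 2 7" "Q7 3 4" "Q7 3 5" "Q7 3 6" "Q7 3 7" "Q7 4 5" "Q7 4 6" "Q7 4 7" "Q7 5 6" "Q7 5 7" "Q7 6 7"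
  by (simp_all only: Q7_def) (simp_all add: all_7 psi_int_def oct_sign_table oct_index_table delta_int_def)

lemma Q7_all: "Q7 i j"
proof -
  have "i = j \<or> Q7 i j \<or> Q7 j i"
  proof -
    have "\<forall>i j. i = j \<or> Q7 i j \<or> Q7 j i" unfolding all_7 by (simp add: Q7_table)
    then show ?thesis by blast
  qed
  moreover have "Q7 i j" if "Q7 j i"
    unfolding Q7_def
  proof (intro allI)
    fix a b c
    have "oct_sign i j = - oct_sign j i" "oct_index i j = oct_index j i" using oct_sign_m7_sym by blast+
    then show "oct_sign i j * psi_int a b c (oct_index i j) = delta_int i a * (oct_sign j b * delta_int (oct_index j b) c) + delta_int i b * (oct_sign a j * delta_int (oct_index a j) c)
       + delta_int i c * (oct_sign a b * delta_int (oct_index a b) j) - delta_int j a * (oct_sign i b * delta_int (oct_index i b) c) - delta_int j b * (oct_sign a i * delta_int (oct_index a i) c)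
       - delta_int j c * (oct_sign a b * delta_int (oct_index a b) i)"
      using that[unfolded Q7_def, rule_format, of a b c] by simp
  qed
  moreover have "Q7 i i"
  proof -
    have "oct_sign i i = 0" using oct_sign_m7_sym by blast
    then show ?thesis unfolding Q7_def by simp
  qed
  ultimately show ?thesis by blast
qed

text \<open>Exchanges of neighbours sort any triple up to sign, and a repeated index forces the
  value zero. Identities between alternating arrays thereby need checking on increasing triples
  only.\<close>

lemma antisym3_eq_0:
  fixes S :: "'b \<Rightarrow> 'b \<Rightarrow> 'b \<Rightarrow> real" and r :: "'b \<Rightarrow> nat"
  assumes r: "inj r"
    and S: "\<And>i j k. S j i k = - S i j k" "\<And>i j k. S i k j = - S i j k"
    and 0: "\<And>i j k. r i < r j \<Longrightarrow> r j < r k \<Longrightarrow> S i j k = 0"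
  shows "S i j k = 0"
proof -
  have cmp: "i = j \<or> r i < r j \<or> r j < r i" for i j
    using injD[OF r, of i j] by linarith
  have z: "S i i k = 0" "S i j j = 0" for i j k using S(1)[of i i k] S(2)[of i j j] by simp_all
  have 1: "S i j k = 0" if "r i < r j" for i j k
    using cmp[of i k] cmp[of j k] 0[of i j k] 0[of i k j] 0[of k i j] S(2)[of i k j] S(1)[of i k j]
      z(1)[of i j] z(1)[of i k] z(2)[of i j] z(2)[of i k] z(2)[of k i] that by force
  show ?thesis using cmp[of i j] 1[of i j k] 1[of j i k] S(1)[of i j k] z by auto
qed

text \<open>The last index is first inserted into an increasing triple; with it held fixed, the case
  of three indices finishes.\<close>

lemma antisym4_eq_0:
  fixes S :: "'b \<Rightarrow> 'b \<Rightarrow> 'b \<Rightarrow> 'b \<Rightarrow> real" and r :: "'b \<Rightarrow> nat"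
  assumes r: "inj r"
    and S: "\<And>i j k l. S j i k l = - S i j k l" "\<And>i j k l. S i k j l = - S i j k l" "\<And>i j k l. S i j l k = - S i j k l"
    and 0: "\<And>i j k l. r i < r j \<Longrightarrow> r j < r k \<Longrightarrow> r k < r l \<Longrightarrow> S i j k l = 0"
  shows "S i j k l = 0"
proof -
  have cmp: "i = j \<or> r i < r j \<or> r j < r i" for i j
    using injD[OF r, of i j] by linarith
  have z: "S i i k l = 0" "S i j j l = 0" "S i j k k = 0" for i j k l
    using S(1)[of i i k l] S(2)[of i j j l] S(3)[of i j k k] by simp_all
  have m: "S i j k l = - S i j l k" "S i j k l = S i l j k" "S i j k l = - S l i j k" for i j k l
    using S(3)[of i j l k] S(2)[of i l j k] S(1)[of l i j k] S(2)[of i j l k] S(3)[of i j k l] by linarith+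
  have 1: "S i j k l = 0" if "r i < r j" "r j < r k" for i j k l
  proof -
    have "l = i \<or> l = j \<or> l = k \<or> r l < r i \<or> r i < r l \<and> r l < r j \<or> r j < r l \<and> r l < r k \<or> r k < r l"
      using cmp[of l i] cmp[of l j] cmp[of l k] by blast
    moreover have "S i j k l = 0" if "l = i \<or> l = j \<or> l = k" using that m[of i j k l] z by auto
    moreover have "S i j k l = 0" if "r l < r i" using m(3)[of i j k l] 0[of l i j k] that \<open>r i < r j\<close> \<open>r j < r k\<close> by simp
    moreover have "S i j k l = 0" if "r i < r l \<and> r l < r j" using m(2)[of i j k l] 0[of i l j k] that \<open>r i < r j\<close> \<open>r j < r k\<close> by simp
    moreover have "S i j k l = 0" if "r j < r l \<and> r l < r k" using m(1)[of i j k l] 0[of i j l k] that \<open>r i < r j\<close> \<open>r j < r k\<close> by simp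
    moreover have "S i j k l = 0" if "r k < r l" using 0[of i j k l] that \<open>r i < r j\<close> \<open>r j < r k\<close> by simp
    ultimately show ?thesis by blast
  qed
  have "S i j k l = 0" for i j k
    by (rule antisym3_eq_0[OF r, of "\<lambda>i j k. S i j k l"]) (use S 1 in blast)+
  then show ?thesis .
qed

text \<open>Orders the indices as 1, ..., 7, with 7 last although \<open>7 = 0\<close> in the index
  type.\<close>

definition rank7 :: "7 \<Rightarrow> nat" where "rank7 i = list_pos indices i"

lemma rank7_simps: "rank7 1 = 0" "rank7 2 = 1" "rank7 3 = 2" "rank7 4 = 3" "rank7 5 = 4" "rank7 6 = 5" "rank7 7 = 6"
  by (simp_all add: rank7_def)

lemma inj_rank7: "inj rank7"
proof -
  have "\<forall>i j. rank7 i = rank7 j \<longrightarrow> i = j" unfolding all_7 by (simp add: rank7_simps)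
  then show ?thesis by (simp add: inj_def)
qed

text \<open>Both sides are alternating, so the expansion of \<open>phi0\<close> into monomials is
  evaluated on increasing triples only.\<close>

lemma phi_table: "phi i j k = of_int (oct_sign i j * delta_int (oct_index i j) k)"
proof -
  let ?t = "\<lambda>i j k. oct_sign i j * delta_int (oct_index i j) k"
  have t1: "\<forall>i j k. ?t j i k = - ?t i j k" by (simp add: all_7 oct_sign_table oct_index_table delta_int_def)
  have t2: "\<forall>i j k. ?t i k j = - ?t i j k" by (simp add: all_7 oct_sign_table oct_index_table delta_int_def)
  have 0: "\<forall>i j k. rank7 i < rank7 j \<and> rank7 j < rank7 k \<longrightarrow> phi i j k - of_int (?t i j k) = 0"
    by (simp add: all_7 rank7_simps phi_def phi0_def e3_eq oct_sign_table oct_index_table delta_int_def)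
  have S: "phi j i k - of_int (?t j i k) = - (phi i j k - of_int (?t i j k))"
    "phi i k j - of_int (?t i k j) = - (phi i j k - of_int (?t i j k))" for i j k
    using t1[rule_format, of j i k] t2[rule_format, of i k j] phi_swap(1)[of j i k] phi_swap(2)[of i k j]
    by (simp_all only: of_int_minus)
  have "phi i j k - of_int (?t i j k) = 0"
    by (rule antisym3_eq_0[OF inj_rank7, of "\<lambda>i j k. phi i j k - of_int (?t i j k)"])
       (rule S, rule S, rule 0[rule_format], rule conjI)
  then show ?thesis by simp
qed

text \<open>The dual 4-form is defined by the contraction identity of two copies of \<open>phi\<close>; \<open>star_phi0\<close> identifies it with \<open>*phi0\<close>.\<close>

definition psi :: "7 \<Rightarrow> 7 \<Rightarrow> 7 \<Rightarrow> 7 \<Rightarrow> real" where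
  "psi i j k l = kdelta i k * kdelta j l - kdelta i l * kdelta j k - (\<Sum>m\<in>UNIV. phi i j m * phi k l m)"

text \<open>At most one index \<open>m\<close> has \<open>phi i j m\<close> nonzero.\<close>

lemma sum_phi: "(\<Sum>m\<in>UNIV. phi i j m * u m) = of_int (oct_sign i j) * u (oct_index i j)"
  by (simp add: phi_table delta_int_def if_distrib[of "\<lambda>x. x * _"] if_distrib[of of_int] if_distrib[of "\<lambda>x. _ * x"] cong: if_cong)

lemma psi_p7: "psi i j k l = of_int (psi_int i j k l)"
  unfolding psi_def sum_phi by (simp add: phi_table psi_int_def delta_int_def)

lemma phi_phi: "(\<Sum>m\<in>UNIV. phi i j m * phi k l m) = kdelta i k * kdelta j l - kdelta i l * kdelta j k - psi i j k l"
  by (simp add: psi_def)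

text \<open>With \<open>phi_phi\<close> this is the source of the later contraction identities; only
  the integer tables stand behind the two.\<close>

lemma phi_psi:
  "(\<Sum>k\<in>UNIV. phi i j k * psi a b c k) = kdelta i a * phi j b c + kdelta i b * phi a j c + kdelta i c * phi a b j
     - kdelta j a * phi i b c - kdelta j b * phi a i c - kdelta j c * phi a b i"
proof -
  have d: "kdelta x y = of_int (delta_int x y)" for x y by (simp add: delta_int_def)
  have "oct_sign i j * psi_int a b c (oct_index i j) = delta_int i a * (oct_sign j b * delta_int (oct_index j b) c) + delta_int i b * (oct_sign a j * delta_int (oct_index a j) c)
       + delta_int i c * (oct_sign a b * delta_int (oct_index a b) j) - delta_int j a * (oct_sign i b * delta_int (oct_index i b) c) - delta_int j b * (oct_sign a i * delta_int (oct_index a i) c)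
       - delta_int j c * (oct_sign a b * delta_int (oct_index a b) i)"
    using Q7_all[of i j] by (simp add: Q7_def)
  then show ?thesis
    unfolding sum_phi psi_p7 unfolding phi_table d of_int_mult[symmetric] of_int_add[symmetric] of_int_diff[symmetric] of_int_eq_iff
    by (simp only: mult.assoc)
qed

text \<open>The defining formula shows skewness of \<open>psi\<close> inside each pair of indices,
  but not across the two pairs. The middle exchange is therefore checked on the integer
  table.\<close>

definition R7 where "R7 i j \<longleftrightarrow> (\<forall>k l. psi_int i k j l = - psi_int i j k l)"

lemma R7_table: "R7 1 1" "R7 1 2" "R7 1 3" "R7 1 4" "R7 1 5" "R7 1 6" "R7 1 7" "R7 2 1" "R7 2 2" "R7 2 3" "R7 2 4" "R7 2 5" "R7 2 6" "R7 2 7" "R7 3 1" "R7 3 2" "R7 3 3" "R7 3 4" "R7 3 5" "R7 3 6" "R7 3 7" "R7 4 1" "R7 4 2" "R7 4 3" "R7 4 4" "R7 4 5" "R7 4 6" "R7 4 7" "R7 5 1" "R7 5 2" "R7 5 3" "R7 5 4" "R7 5 5" "R7 5 6" "R7 5 7" "R7 6 1" "R7 6 2" "R7 6 3" "R7 6 4" "R7 6 5" "R7 6 6" "R7 6 7" "R7 7 1" "R7 7 2" "R7 7 3" "R7 7 4" "R7 7 5" "R7 7 6" "R7 7 7"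
  by (simp_all only: R7_def) (simp_all add: all_7 psi_int_def oct_sign_table oct_index_table delta_int_def)

lemma psi_swap: "psi j i k l = - psi i j k l" "psi i k j l = - psi i j k l" "psi i j l k = - psi i j k l"
proof -
  show "psi j i k l = - psi i j k l"
    unfolding psi_def phi_swap(1)[of j i] by (simp add: sum_negf)
  show "psi i j l k = - psi i j k l"
    unfolding psi_def phi_swap(1)[of l k] by (simp add: sum_negf)
  have "\<forall>i j. R7 i j" unfolding all_7 by (simp add: R7_table)
  then have "psi_int i k j l = - psi_int i j k l" unfolding R7_def by blast
  then show "psi i k j l = - psi i j k l" by (simp add: psi_p7)
qed

lemma psi_eq_0: "psi i i k l = 0" "psi i j j l = 0" "psi i j k k = 0"
  using psi_swap(1)[of i i k l] psi_swap(2)[of i j j l] psi_swap(3)[of i j k k] by simp_all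

lemma sum_lists_2: "(\<Sum>K | length K = 2. F K) = (\<Sum>i\<in>UNIV. \<Sum>j\<in>UNIV. F [i, j :: 'a::finite])"
  by (simp add: numeral_2_eq_2 sum_lists_Suc sum_lists_0[simplified])

lemma sum_lists_3: "(\<Sum>K | length K = 3. F K) = (\<Sum>i\<in>UNIV. \<Sum>j\<in>UNIV. \<Sum>k\<in>UNIV. F [i, j, k :: 'a::finite])"
  by (simp add: numeral_3_eq_3 sum_lists_Suc sum_lists_0[simplified])

lemma sum_kdelta3:
  "(\<Sum>i\<in>UNIV. \<Sum>j\<in>UNIV. \<Sum>k\<in>UNIV. F i j k * (kdelta i a * (kdelta j b * kdelta k c))) = F a b c"
proof -
  have "(\<Sum>i\<in>UNIV. \<Sum>j\<in>UNIV. \<Sum>k\<in>UNIV. F i j k * (kdelta i a * (kdelta j b * kdelta k c)))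
     = (\<Sum>i\<in>UNIV. kdelta i a * (\<Sum>j\<in>UNIV. kdelta j b * (\<Sum>k\<in>UNIV. F i j k * kdelta k c)))"
    by (simp only: sum_distrib_left mult_ac)
  then show ?thesis by simp
qed

lemma e3_eq':
  "e3 a b c [i, j, k] = kdelta i a * (kdelta j b * kdelta k c) - kdelta i a * (kdelta j c * kdelta k b)
   - kdelta i b * (kdelta j a * kdelta k c) + kdelta i c * (kdelta j a * kdelta k b)
   - (kdelta i c * (kdelta j b * kdelta k a) - kdelta i b * (kdelta j c * kdelta k a))"
  unfolding e3_eq by (simp only: right_diff_distrib mult_ac)

text \<open>The value \<open>-1\<close> reflects that \<open>phi0\<close> induces the opposite orientation.\<close>
lemma star_phi0:
  assumes vol: "alternating 7 vol" "vol indices = -1"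
  shows "1 / 6 * contr 3 kdelta (\<lambda>I. vol (I @ [i, j, k, l])) phi0 = psi i j k l"
proof -
  note s = swap_7[OF vol(1)]
  have z: "vol L = 0" if "length L = 7" "\<not> distinct L" for L
    using alternating_not_distinct[OF vol(1) that] .
  have v: "vol indices = -1" by (fact vol)
  \<comment> \<open>Contraction with \<open>phi0\<close> fills the first three slots of
    \<open>vol\<close> with the seven signed monomials of \<open>phi0\<close>. Both
    \<open>A vol\<close> and \<open>psi\<close> are alternating, so 35 increasing quadruples
    decide.\<close>
  define A :: "tensor \<Rightarrow> 7 \<Rightarrow> 7 \<Rightarrow> 7 \<Rightarrow> 7 \<Rightarrow> real" where "A T i j k l = (T [1,2,3,i,j,k,l] + T [1,4,5,i,j,k,l] + T [1,6,7,i,j,k,l] + T [2,4,6,i,j,k,l]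
     - T [2,5,7,i,j,k,l] - T [3,4,7,i,j,k,l] - T [3,5,6,i,j,k,l]  )" for T i j k l
  define S where "S i j k l = A vol i j k l - psi i j k l" for i j k l
  have S: "S j i k l = - S i j k l" "S i k j l = - S i j k l" "S i j l k = - S i j k l" for i j k l
    unfolding S_def A_def psi_swap(1)[of j i] psi_swap(2)[of i k j] psi_swap(3)[of i j l k]
      s(4)[of _ _ _ j i] s(5)[of _ _ _ _ k j] s(6)[of _ _ _ _ _ l k] by simp_all
  define Z where "Z i j \<longleftrightarrow> (\<forall>k l. rank7 i < rank7 j \<and> rank7 j < rank7 k \<and> rank7 k < rank7 l \<longrightarrow> S i j k l = 0)" for i j
  \<comment> \<open>Guarded by descending neighbours, the exchanges form a terminating rewrite
    system that sorts the slots of \<open>vol\<close>.\<close>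
  have sw: "rank7 a > rank7 b \<Longrightarrow> vol [a, b, c, d, e, g, h] = - vol [b, a, c, d, e, g, h]"
    "rank7 b > rank7 c \<Longrightarrow> vol [a, b, c, d, e, g, h] = - vol [a, c, b, d, e, g, h]"
    "rank7 c > rank7 d \<Longrightarrow> vol [a, b, c, d, e, g, h] = - vol [a, b, d, c, e, g, h]"
    "rank7 d > rank7 e \<Longrightarrow> vol [a, b, c, d, e, g, h] = - vol [a, b, c, e, d, g, h]"
    "rank7 e > rank7 g \<Longrightarrow> vol [a, b, c, d, e, g, h] = - vol [a, b, c, d, g, e, h]"
    "rank7 g > rank7 h \<Longrightarrow> vol [a, b, c, d, e, g, h] = - vol [a, b, c, d, e, h, g]" for a b c d e g h
    by (rule s)+
  have st: "S 1 2 3 4 = 0" "S 1 2 3 5 = 0" "S 1 2 3 6 = 0" "S 1 2 3 7 = 0" "S 1 2 4 5 = 0" "S 1 2 4 6 = 0" "S 1 2 4 7 = 0" "S 1 2 5 6 = 0" "S 1 2 5 7 = 0" "S 1 2 6 7 = 0" "S 1 3 4 5 = 0" "S 1 3 4 6 = 0" "S 1 3 4 7 = 0" "S 1 3 5 6 = 0" "S 1 3 5 7 = 0" "S 1 3 6 7 = 0" "S 1 4 5 6 = 0" "S 1 4 5 7 = 0" "S 1 4 6 7 = 0" "S 1 5 6 7 = 0" "S 2 3 4 5 = 0" "S 2 3 4 6 = 0" "S 2 3 4 7 = 0" "S 2 3 5 6 = 0" "S 2 3 5 7 = 0" "S 2 3 6 7 = 0" "S 2 4 5 6 = 0" "S 2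 4 5 7 = 0" "S 2 4 6 7 = 0" "S 2 5 6 7 = 0" "S 3 4 5 6 = 0" "S 3 4 5 7 = 0" "S 3 4 6 7 = 0" "S 3 5 6 7 = 0" "S 4 5 6 7 = 0"
    by (simp_all add: S_def A_def psi_p7 psi_int_def oct_sign_table oct_index_table delta_int_def z sw rank7_simps v)
  have zt: "Z 1 2" "Z 1 3" "Z 1 4" "Z 1 5" "Z 1 6" "Z 1 7" "Z 2 3" "Z 2 4" "Z 2 5" "Z 2 6" "Z 2 7" "Z 3 4" "Z 3 5" "Z 3 6" "Z 3 7" "Z 4 5" "Z 4 6" "Z 4 7" "Z 5 6" "Z 5 7" "Z 6 7"
    unfolding Z_def all_7 rank7_simps by (simp_all add: st)
  have "\<forall>i j. rank7 i < rank7 j \<longrightarrow> Z i j" unfolding all_7 by (simp add: rank7_simps zt)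
  then have Z: "S i j k l = 0" if "rank7 i < rank7 j" "rank7 j < rank7 k" "rank7 k < rank7 l" for i j k l
    using that unfolding Z_def by blast
  have S0: "S i j k l = 0"
    by (rule antisym4_eq_0[OF inj_rank7, of S]) (rule S, rule S, rule S, rule Z)
  \<comment> \<open>The six orderings of one monomial contribute equally, which cancels the factor
    1/6 of the Hodge star.\<close>
  have e: "contr 3 kdelta (\<lambda>I. vol (I @ [i, j, k, l])) (e3 a b c) = 6 * vol [a, b, c, i, j, k, l]" for a b c
  proof -
    have "contr 3 kdelta (\<lambda>I. vol (I @ [i, j, k, l])) (e3 a b c)
      = vol [a, b, c, i, j, k, l] - vol [a, c, b, i, j, k, l] - vol [b, a, c, i, j, k, l] + vol [c, a, b, i, j, k, l]
        - (vol [c, b, a, i, j, k, l] - vol [b, c, a, i, j, k, l])"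
      unfolding contr_kdelta sum_lists_3 e3_eq' append.simps
      by (simp only: right_diff_distrib distrib_left sum_subtractf sum.distrib sum_kdelta3)
    also have "\<dots> = 6 * vol [a, b, c, i, j, k, l]"
      using s(2)[of a c b i j k l] s(1)[of b a c i j k l] s(1)[of c a b i j k l] s(2)[of a c b i j k l]
        s(1)[of c b a i j k l] s(2)[of b c a i j k l] s(2)[of c b a i j k l] s(1)[of b c a i j k l]  by linarith
    finally show ?thesis .
  qed
  have "contr 3 kdelta (\<lambda>I. vol (I @ [i, j, k, l])) phi0 = 6 * A vol i j k l"
    unfolding A_def distrib_left right_diff_distrib e[symmetric] contr_kdelta
    by (simp add: phi0_def sum.distrib sum_subtractf distrib_left right_diff_distrib)
  then show ?thesis using S0 by (simp add: S_def)
qed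

section \<open>Double contractions of the standard forms\<close>

lemma phi_repeat: "phi i i k = 0" "phi i k k = 0" "phi i k i = 0"
  using phi_swap(1)[of i i k] phi_swap(2)[of i k k] phi_swap(1)[of i k i] phi_swap(2)[of k i i] by simp_all

lemma psi_repeat: "psi i i k l = 0" "psi i k k l = 0" "psi i k l l = 0" "psi i k i l = 0" "psi i k l k = 0" "psi i k l i = 0"
  using psi_eq_0(1)[of i k l] psi_eq_0(2)[of i k l] psi_eq_0(3)[of i k l] psi_swap(1)[of i k i l] psi_eq_0(2)[of k i l]
    psi_swap(3)[of i k k l] psi_swap(1)[of k i i l] psi_swap(2)[of k i l i] psi_swap(3)[of k l i i]
    psi_swap(1)[of i k l i] psi_eq_0(3)[of k l i] by simp_all

lemma phi_phi_2: "(\<Sum>j\<in>UNIV. \<Sum>k\<in>UNIV. phi i j k * phi a j k) = 6 * kdelta i a"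
  by (simp add: phi_phi sum_subtractf psi_repeat sum_distrib_left[symmetric] sum_distrib_right[symmetric])

lemma phi_psi_2: "(\<Sum>j\<in>UNIV. \<Sum>k\<in>UNIV. phi i j k * psi a b j k) = - 4 * phi i a b"
  using phi_swap(1)[of i b a] phi_swap(2)[of i a b] phi_swap(1)[of a i b] phi_swap(2)[of a b i]
  by (simp add: phi_psi sum_subtractf sum.distrib phi_repeat sum_distrib_left[symmetric] sum_distrib_right[symmetric])

text \<open>\<open>psi\<close> is only known to change sign under exchanges of neighbours. Written
  as a contraction of a volume form it becomes a tensor on lists that is alternating under all
  permutations.\<close>

lemma alternating_psi: 
  assumes vol: "alternating 7 vol" "vol indices = -1"
  defines "\<Psi> \<equiv> \<lambda>J. 1 / 6 * contr 3 kdelta (\<lambda>I. vol (I @ J)) phi0"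
  shows "alternating 4 \<Psi>" "\<Psi> [i, j, k, l] = psi i j k l"
proof -
  show "alternating 4 \<Psi>" unfolding \<Psi>_def contr_kdelta
    by (rule alternating_scale, rule alternating_sum, subst mult.commute, rule alternating_scale,
        rule alternating_append[of 3 4]) (use vol in simp_all)
  show "\<Psi> [i, j, k, l] = psi i j k l" unfolding \<Psi>_def by (rule star_phi0[OF vol])
qed

text \<open>Forms of top degree are a one-dimensional space. The product form avoids dividing by a
  component that may vanish.\<close>

lemma alternating_7_proportional:
  assumes S: "alternating 7 S" and T: "alternating 7 T" and L: "length L = 7"
  shows "S L * T indices = T L * S indices"
proof (cases "distinct L")
  case True
  have "set L = UNIV" using L True by (intro card_subset_eq) (auto simp: distinct_card)
  then have "mset L = mset indices"
    using True set_indices by (intro set_eq_iff_mset_eq_distinct[THEN iffD1]) auto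
  then obtain p where p: "p permutes {..<length indices}" "permute_list p indices = L"
    by (rule mset_eq_permutation)
  then have "p permutes {..<7}" by (simp add: numeral_eq_Suc)
  then show ?thesis using S T p(2) unfolding alternating_def by (force simp: p(2)[symmetric])
next
  case False
  then show ?thesis using alternating_not_distinct[OF S L] alternating_not_distinct[OF T L] by simp
qed

lemma sum_swap22:
  "(\<Sum>i\<in>A. \<Sum>j\<in>B. \<Sum>k\<in>C. \<Sum>l\<in>D. F i j k l) = (\<Sum>k\<in>C. \<Sum>l\<in>D. \<Sum>i\<in>A. \<Sum>j\<in>B. F i j k l :: 'a::comm_monoid_add)"
proof -
  have "(\<Sum>i\<in>A. \<Sum>j\<in>B. \<Sum>k\<in>C. \<Sum>l\<in>D. F i j k l) = (\<Sum>i\<in>A. \<Sum>k\<in>C. \<Sum>j\<in>B. \<Sum>l\<in>D. F i j k l)"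
    by (intro sum.cong refl sum.swap)
  also have "\<dots> = (\<Sum>k\<in>C. \<Sum>i\<in>A. \<Sum>l\<in>D. \<Sum>j\<in>B. F i j k l)"
    by (subst sum.swap, intro sum.cong refl sum.swap)
  also have "\<dots> = (\<Sum>k\<in>C. \<Sum>l\<in>D. \<Sum>i\<in>A. \<Sum>j\<in>B. F i j k l)"
    by (intro sum.cong refl sum.swap)
  finally show ?thesis .
qed

section \<open>The metric determined by a $G_2$-structure\<close>

text \<open>The bilinear form with values in 7-forms that equals -6 times the metric times the
  volume form, and from which both are recovered.\<close>

definition B0 :: "tensor \<Rightarrow> real^7 \<Rightarrow> real^7 \<Rightarrow> tensor" where
  "B0 \<phi> u w = wedge 4 3 (wedge 2 2 (interior_prod u \<phi>) (interior_prod w \<phi>)) \<phi>"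

text \<open>One factor contracted with \<open>psi\<close> gives -4 by \<open>phi_psi_2\<close>, the
  remaining product 6 by \<open>phi_phi_2\<close>.\<close>

lemma sum_phi_phi_psi:
  "(\<Sum>i\<in>UNIV. \<Sum>j\<in>UNIV. \<Sum>k\<in>UNIV. \<Sum>l\<in>UNIV. psi i j k l * (\<Sum>a\<in>UNIV. u $ a * phi a i j) * (\<Sum>b\<in>UNIV. w $ b * phi b k l))
   = - 24 * (u \<bullet> (w :: real^7))"
proof -
  have 1: "(\<Sum>k\<in>UNIV. \<Sum>l\<in>UNIV. psi i j k l * (\<Sum>b\<in>UNIV. w $ b * phi b k l)) = - 4 * (\<Sum>b\<in>UNIV. w $ b * phi b i j)" for i j
  proof -
    have "(\<Sum>k\<in>UNIV. \<Sum>l\<in>UNIV. psi i j k l * (\<Sum>b\<in>UNIV. w $ b * phi b k l))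
      = (\<Sum>k\<in>UNIV. \<Sum>l\<in>UNIV. \<Sum>b\<in>UNIV. w $ b * (phi b k l * psi i j k l))"
      by (simp add: sum_distrib_left mult_ac)
    also have "\<dots> = (\<Sum>k\<in>UNIV. \<Sum>b\<in>UNIV. \<Sum>l\<in>UNIV. w $ b * (phi b k l * psi i j k l))"
      by (subst sum.swap) (rule refl)
    also have "\<dots> = (\<Sum>b\<in>UNIV. w $ b * (\<Sum>k\<in>UNIV. \<Sum>l\<in>UNIV. phi b k l * psi i j k l))"
      by (subst sum.swap) (simp add: sum_distrib_left)
    finally show ?thesis by (simp add: phi_psi_2 sum_distrib_left mult_ac)
  qed
  define U where "U i j = (\<Sum>a\<in>UNIV. u $ a * phi a i j)" for i j
  define V where "V i j = (\<Sum>a\<in>UNIV. w $ a * phi a i j)" for i j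
  have "(\<Sum>i\<in>UNIV. \<Sum>j\<in>UNIV. \<Sum>k\<in>UNIV. \<Sum>l\<in>UNIV. psi i j k l * U i j * V k l)
     = (\<Sum>i\<in>UNIV. \<Sum>j\<in>UNIV. U i j * (\<Sum>k\<in>UNIV. \<Sum>l\<in>UNIV. psi i j k l * V k l))"
    by (simp add: sum_distrib_left mult_ac)
  also have "\<dots> = - 4 * (\<Sum>i\<in>UNIV. \<Sum>j\<in>UNIV. \<Sum>a\<in>UNIV. \<Sum>b\<in>UNIV. u $ a * w $ b * (phi a i j * phi b i j))"
  proof -
    have "U i j * V i j = (\<Sum>a\<in>UNIV. \<Sum>b\<in>UNIV. u $ a * w $ b * (phi a i j * phi b i j))" for i j
      unfolding U_def V_def sum_product by (simp add: mult_ac)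
    then have "U i j * (- 4 * V i j) = - 4 * (\<Sum>a\<in>UNIV. \<Sum>b\<in>UNIV. u $ a * w $ b * (phi a i j * phi b i j))" for i j
      by (simp add: mult.left_commute[of "U i j" 4])
    then show ?thesis unfolding 1[folded V_def] by (simp only: sum_distrib_left)
  qed
  also have "(\<Sum>i\<in>UNIV. \<Sum>j\<in>UNIV. \<Sum>a\<in>UNIV. \<Sum>b\<in>UNIV. u $ a * w $ b * (phi a i j * phi b i j))
     = (\<Sum>a\<in>UNIV. \<Sum>b\<in>UNIV. u $ a * w $ b * (\<Sum>i\<in>UNIV. \<Sum>j\<in>UNIV. phi a i j * phi b i j))"
    by (subst sum_swap22) (simp only: sum_distrib_left)
  also have "\<dots> = 6 * (u \<bullet> w)"
  proof -
    have "u $ a * w $ b * (\<Sum>i\<in>UNIV. \<Sum>j\<in>UNIV. phi a i j * phi b i j) = (6 * (u $ a * w $ b)) * kdelta a b" for a b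
      by (simp add: phi_phi_2)
    then show ?thesis by (simp add: inner_vec_def sum_distrib_left)
  qed
  finally show ?thesis by (simp add: U_def V_def)
qed

text \<open>The coefficient is found by pairing with \<open>vol\<close>, which turns both wedges
  into tensor products with factors 35 and 6 and the outer 3-form into 6 times \<open>psi\<close>.
  Hence \<open>-5040 * B0 = 35 * 6 * 6 * (-24) * (u \<bullet> w)\<close> on \<open>indices\<close>.
  The value +6 instead of -6 reflects \<open>vol indices = -1\<close>.\<close>

lemma B0_phi0:
  assumes vol: "alternating 7 vol" "vol indices = -1"
  shows "B0 phi0 u w indices = 6 * (u \<bullet> w)"
proof -
  define \<Psi> where "\<Psi> J = 1 / 6 * contr 3 kdelta (\<lambda>I. vol (I @ J)) phi0" for J
  note \<Psi> = alternating_psi[OF vol, folded \<Psi>_def]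
  define W where "W = wedge 2 2 (interior_prod u phi0) (interior_prod w phi0)"
  have B: "alternating 7 (B0 phi0 u w)" unfolding B0_def using alternating_wedge[of 4 3] by simp
  have "(\<Sum>L | length L = 7. vol L * B0 phi0 u w L) = (\<Sum>L | length L = 7. - B0 phi0 u w indices * (vol L * vol L))"
  proof (intro sum.cong refl)
    fix L :: "7 list" assume "L \<in> {L. length L = 7}"
    then have "B0 phi0 u w L = - vol L * B0 phi0 u w indices"
      using alternating_7_proportional[OF B vol(1), of L] vol(2) by simp
    then show "vol L * B0 phi0 u w L = - B0 phi0 u w indices * (vol L * vol L)" by simp
  qed
  then have 1: "(\<Sum>L | length L = 7. vol L * B0 phi0 u w L) = - 5040 * B0 phi0 u w indices"
    using alternating_7_sum_squares[OF vol(1)] vol(2) by (simp add: sum_negf sum_distrib_left[symmetric])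
  have "(\<Sum>L | length L = 4 + 3. vol L * wedge 4 3 W phi0 L)
      = fact (4 + 3) / (fact 4 * fact 3) * (\<Sum>I | length I = 4. \<Sum>J | length J = 3. vol (I @ J) * W I * phi0 J)"
    by (rule sum_alternating_wedge) (use vol in simp)
  also have "(\<Sum>I | length I = 4. \<Sum>J | length J = 3. vol (I @ J) * W I * phi0 J) = (\<Sum>I | length I = 4. 6 * (\<Psi> I * W I))"
  proof (intro sum.cong refl)
    fix I :: "7 list" assume "I \<in> {I. length I = 4}"
    then obtain a b c d where I: "I = [a, b, c, d]"
      by (auto simp: numeral_eq_Suc length_Suc_conv)
    show "(\<Sum>J | length J = 3. vol (I @ J) * W I * phi0 J) = 6 * (\<Psi> I * W I)"
      by (simp add: I \<Psi>_def contr_kdelta sum_lists_3 swap_7_block[OF vol(1)] sum_distrib_left sum_distrib_right mult_ac)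
  qed
  also have "\<dots> = 6 * (\<Sum>I | length I = 2 + 2. \<Psi> I * wedge 2 2 (interior_prod u phi0) (interior_prod w phi0) I)"
    by (simp add: sum_distrib_left W_def)
  also have "(\<Sum>I | length I = 2 + 2. \<Psi> I * wedge 2 2 (interior_prod u phi0) (interior_prod w phi0) I)
     = fact (2 + 2) / (fact 2 * fact 2) * (\<Sum>I | length I = 2. \<Sum>J | length J = 2. \<Psi> (I @ J) * interior_prod u phi0 I * interior_prod w phi0 J)"
    by (rule sum_alternating_wedge) (use \<Psi>(1) in simp)
  also have "(\<Sum>I | length I = 2. \<Sum>J | length J = 2. \<Psi> (I @ J) * interior_prod u phi0 I * interior_prod w phi0 J) = - 24 * (u \<bullet> w)"
    unfolding sum_phi_phi_psi[symmetric] sum_lists_2 by (simp add: \<Psi>(2) interior_prod_def phi_def)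
  finally have "(\<Sum>L | length L = 7. vol L * B0 phi0 u w L) = - 30240 * (u \<bullet> w)"
    by (simp add: fact_numeral B0_def W_def)
  then show ?thesis using 1 by simp
qed

lemma wedge_cong:
  assumes "\<And>K. length K = k \<Longrightarrow> \<alpha> K = \<alpha>' K" "\<And>K. length K = l \<Longrightarrow> \<beta> K = \<beta>' K" "length I = k + l"
  shows "wedge k l \<alpha> \<beta> I = wedge k l \<alpha>' \<beta>' I"
  unfolding wedge_def using assms by simp

text \<open>Covariant slots are pulled back while the inserted vector is pushed forward, hence
  \<open>P *v u\<close>.\<close>

lemma interior_prod_pullback:
  "interior_prod u (pullback (Suc k) P T) I = pullback k P (interior_prod (P *v u) T) I"
proof -
  have "interior_prod u (pullback (Suc k) P T) I
     = (\<Sum>a\<in>UNIV. (P *v u) $ a * pullback k P (\<lambda>K. T (a # K)) I)"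
    unfolding interior_prod_def pullback_Suc sum_distrib_left
    by (subst sum.swap) (simp add: matrix_vector_mult_def sum_distrib_left mult_ac)
  also have "\<dots> = pullback k P (interior_prod (P *v u) T) I"
    unfolding interior_prod_def[abs_def] pullback_sum ..
  finally show ?thesis .
qed

lemma B0_pullback:
  assumes \<phi>: "\<And>I. length I = 3 \<Longrightarrow> \<phi> I = pullback 3 P phi0 I" and I: "length I = 7"
  shows "B0 \<phi> u w I = pullback 7 P (B0 phi0 (P *v u) (P *v w)) I"
proof -
  have i: "interior_prod u \<phi> K = pullback 2 P (interior_prod (P *v u) phi0) K" if "length K = 2" for u K
    using interior_prod_pullback[of u 2 P phi0 K] that by (simp add: interior_prod_def \<phi> numeral_3_eq_3 numeral_2_eq_2)
  have "wedge 2 2 (interior_prod u \<phi>) (interior_prod w \<phi>) K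
      = pullback 4 P (wedge 2 2 (interior_prod (P *v u) phi0) (interior_prod (P *v w) phi0)) K" if "length K = 4" for K
  proof -
    have "wedge 2 2 (interior_prod u \<phi>) (interior_prod w \<phi>) K
      = wedge 2 2 (pullback 2 P (interior_prod (P *v u) phi0)) (pullback 2 P (interior_prod (P *v w) phi0)) K"
      using that by (intro wedge_cong i) simp_all
    then show ?thesis using that pullback_wedge[of K 2 2 P] by simp
  qed
  then have "B0 \<phi> u w I = wedge 4 3 (pullback 4 P (wedge 2 2 (interior_prod (P *v u) phi0) (interior_prod (P *v w) phi0))) (pullback 3 P phi0) I"
    unfolding B0_def using \<phi> I by (intro wedge_cong) auto
  then show ?thesis unfolding B0_def using pullback_wedge[of I 4 3 P] I by simp
qed

text \<open>Naturality of \<open>B0\<close> gives \<open>v g = - det P (P^T P)\<close> for the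
  volume component \<open>v\<close>. Taking determinants and using \<open>v^2 = det g\<close> yields
  \<open>v^9 = (- det P)^9\<close>; odd powers are injective over the reals, so
  \<open>v = - det P\<close>, which settles metric and orientation together.\<close>

lemma gmat_eq_of_G2:
  assumes P: "invertible P" and \<phi>: "\<And>I. length I = 3 \<Longrightarrow> \<phi> I = pullback 3 P phi0 I"
    and pos: "\<And>u :: real^7. u \<noteq> 0 \<Longrightarrow> u \<bullet> (gmat g *v u) > 0"
    and vol: "alternating 7 vol" and det: "(vol indices)\<^sup>2 = det (gmat g)"
    and B: "\<And>u w. B0 \<phi> u w indices = - 6 * (u \<bullet> (gmat g *v w)) * vol indices"
  shows "gmat g = transpose P ** P"
    and "\<exists>vol0. alternating 7 vol0 \<and> vol0 indices = -1 \<and> (\<forall>L. length L = 7 \<longrightarrow> vol L = pullback 7 P vol0 L)"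
proof -
  define v where "v = vol indices"
  have "det (gmat g) \<noteq> 0"
  proof -
    have "inj ((*v) (gmat g))"
    proof (rule injI)
      fix x y assume "gmat g *v x = gmat g *v y"
      then have "gmat g *v (x - y) = 0" by (simp add: matrix_vector_mult_diff_distrib)
      then show "x = y" using pos[of "x - y"] by force
    qed
    then show ?thesis using det_nz_iff_inj[of "(*v) (gmat g)"] by (simp add: matrix_vector_mul_linear)
  qed
  then have v: "v \<noteq> 0" using det by (auto simp: v_def)
  have dP: "det P \<noteq> 0" using P by (simp add: invertible_det_nz)
  define vol1 where "vol1 = (\<lambda>L. (- 1 / v) * vol L)"
  have vol1: "alternating 7 vol1" "vol1 indices = -1"
    unfolding vol1_def using v alternating_scale[OF vol, of "- 1 / v"] by (simp_all add: v_def)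
  have B7: "alternating 7 (B0 phi0 u w)" for u w unfolding B0_def using alternating_wedge[of 4 3] by simp
  have eq: "v * (u \<bullet> (gmat g *v w)) = - det P * ((P *v u) \<bullet> (P *v w))" for u w
    using B[of u w] B0_pullback[OF \<phi>, where I = indices] pullback_7_det[OF B7] B0_phi0[OF vol1] by (simp add: v_def)
  have m: "v *\<^sub>R gmat g = (- det P) *\<^sub>R (transpose P ** P)"
  proof -
    have "(v *\<^sub>R gmat g) $ i $ j = ((- det P) *\<^sub>R (transpose P ** P)) $ i $ j" for i j
    proof -
      have "axis i 1 \<bullet> (gmat g *v axis j 1) = gmat g $ i $ j"
        by (simp add: matrix_vector_mul_component inner_axis' inner_axis row_def)
      moreover have "(P *v axis i 1) \<bullet> (P *v axis j 1) = (transpose P ** P) $ i $ j"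
        by (simp add: matrix_vector_mult_basis column_def inner_vec_def matrix_matrix_mult_def transpose_def)
      ultimately show ?thesis using eq[of "axis i 1" "axis j 1"] by simp
    qed
    then show ?thesis by (simp add: vec_eq_iff)
  qed
  have dets: "det (c *\<^sub>R A) = c ^ 7 * det A" for c and A :: "real^7^7"
  proof -
    have "c *\<^sub>R A = (\<chi> i. c *s A $ i)" by (simp add: vec_eq_iff)
    then show ?thesis using det_rows_mul[of "\<lambda>_. c" "\<lambda>i. A $ i"] by simp
  qed
  have "v ^ 9 = (- det P) ^ 9"
    using arg_cong[OF m, of det] det unfolding dets det_mul by (simp add: v_def[symmetric] power2_eq_square eval_nat_numeral mult_ac)
  then have vP: "v = - det P" 
    using odd_real_root_power_cancel[of 9 v] odd_real_root_power_cancel[of 9 "- det P"] by simp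
  show g: "gmat g = transpose P ** P" using m v unfolding vP by simp
  have "alternating 7 (pullback 7 P vol1)" by (rule alternating_pullback[OF vol1(1)])
  moreover have "pullback 7 P vol1 indices = vol indices"
    using pullback_7_det[OF vol1(1), of P] vol1(2) vP by (simp add: v_def)
  ultimately have "vol L = pullback 7 P vol1 L" if "length L = 7" for L
    using alternating_7_proportional[OF vol _ that, of "pullback 7 P vol1"] v by (simp add: v_def)
  then show "\<exists>vol0. alternating 7 vol0 \<and> vol0 indices = -1 \<and> (\<forall>L. length L = 7 \<longrightarrow> vol L = pullback 7 P vol0 L)"
    using vol1 by blast
qed

lemma pull1: "(\<Sum>c\<in>C. (\<Sum>r\<in>R. M r * P r c) * Q c) = (\<Sum>r\<in>R. M r * (\<Sum>c\<in>C. P r c * (Q c :: real)))"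
  by (simp only: sum_distrib_left sum_distrib_right mult.assoc) (rule sum.swap)

lemma pull2: "(\<Sum>b\<in>B. \<Sum>c\<in>C. (\<Sum>r\<in>R. M r * P r b c) * Q b c) = (\<Sum>r\<in>R. M r * (\<Sum>b\<in>B. \<Sum>c\<in>C. P r b c * (Q b c :: real)))"
  by (simp only: pull1) (simp only: sum_distrib_left, rule sum.swap)

lemma pull3: "(\<Sum>a\<in>A. \<Sum>b\<in>B. \<Sum>c\<in>C. (\<Sum>r\<in>R. M r * P r a b c) * Q a b c)
   = (\<Sum>r\<in>R. M r * (\<Sum>a\<in>A. \<Sum>b\<in>B. \<Sum>c\<in>C. P r a b c * (Q a b c :: real)))"
  by (simp only: pull2) (simp only: sum_distrib_left, rule sum.swap)

lemma kdelta_mult_if: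
  "x * (kdelta i j * y) = (if i = j then x * y else 0)" "x * kdelta i j = (if i = j then x else 0)"
  "kdelta i j * y = (if i = j then y else 0)"
  "x * (if P then y else 0) = (if P then x * y else (0::real))" "(if P then y else 0) * x = (if P then y * x else (0::real))"
  "(\<Sum>r\<in>A. if P then f r else 0) = (if P then sum f A else (0::real))"
  by (simp_all add: of_bool_def)

section \<open>Contractions of the standard forms\<close>

text \<open>Arrays of three frame components replace list tensors here to keep the algebra readable.
  As in \<open>contr\<close> there is no normalisation.\<close>

definition ctr :: "(7 \<Rightarrow> 7 \<Rightarrow> 7 \<Rightarrow> real) \<Rightarrow> (7 \<Rightarrow> 7 \<Rightarrow> 7 \<Rightarrow> real) \<Rightarrow> real" where
  "ctr u w = (\<Sum>a\<in>UNIV. \<Sum>b\<in>UNIV. \<Sum>c\<in>UNIV. u a b c * w a b c)"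

definition alt3 :: "(7 \<Rightarrow> 7 \<Rightarrow> 7 \<Rightarrow> real) \<Rightarrow> bool" where
  "alt3 w \<longleftrightarrow> (\<forall>a b c. w b a c = - w a b c \<and> w a c b = - w a b c)"

lemma alt3_psi [simp]: "alt3 (psi i)" and alt3_phi [simp]: "alt3 phi"
  unfolding alt3_def by (intro allI conjI psi_swap phi_swap)+

lemma alt3D: "alt3 w \<Longrightarrow> w b a c = - w a b c" "alt3 w \<Longrightarrow> w a c b = - w a b c"
  unfolding alt3_def by blast+

lemma ctr_add: "ctr (\<lambda>a b c. u a b c + v a b c) w = ctr u w + ctr v w"
  by (simp add: ctr_def distrib_right sum.distrib)

lemma ctr_diff: "ctr (\<lambda>a b c. u a b c - v a b c) w = ctr u w - ctr v w"
  by (simp add: ctr_def left_diff_distrib sum_subtractf)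

lemma ctr_minus: "ctr (\<lambda>a b c. - u a b c) w = - ctr u w"
  by (simp add: ctr_def sum_negf)

lemma ctr_scale: "ctr (\<lambda>a b c. k * u a b c) w = k * ctr u w"
  by (simp add: ctr_def sum_distrib_left mult.assoc)

lemma ctr_sum: "ctr (\<lambda>a b c. \<Sum>r\<in>UNIV. k r * u r a b c) w = (\<Sum>r\<in>UNIV. k r * ctr (u r) w)"
  unfolding ctr_def by (rule pull3)

lemma ctr_commute: "ctr u w = ctr w u"
  by (simp add: ctr_def mult.commute)

text \<open>Against an alternating \<open>w\<close>, permuting the slots of \<open>u\<close> costs
  only a sign. With \<open>ctr_23\<close> and \<open>ctr_rot\<close> this collapses an
  antisymmetrised sum of three terms to three times its first term, the main simplification of this
  section.\<close>

lemma ctr_12: "alt3 w \<Longrightarrow> ctr (\<lambda>a b c. u b a c) w = - ctr u w"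
proof -
  assume w: "alt3 w"
  have *: "u a b c * w b a c = - (u a b c * w a b c)" for a b c using alt3D(1)[OF w, of b a c] by simp
  show ?thesis unfolding ctr_def by (subst sum.swap) (simp only: * sum_negf)
qed

lemma ctr_23: "alt3 w \<Longrightarrow> ctr (\<lambda>a b c. u a c b) w = - ctr u w"
proof -
  assume w: "alt3 w"
  have *: "u a b c * w a c b = - (u a b c * w a b c)" for a b c using alt3D(2)[OF w, of a c b] by simp
  have "ctr (\<lambda>a b c. u a c b) w = (\<Sum>a\<in>UNIV. \<Sum>c\<in>UNIV. \<Sum>b\<in>UNIV. u a c b * w a b c)"
    unfolding ctr_def by (intro sum.cong refl sum.swap)
  then show ?thesis unfolding ctr_def by (simp only: * sum_negf)
qed

lemma ctr_rot: "alt3 w \<Longrightarrow> ctr (\<lambda>a b c. u c a b) w = ctr u w"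
  using ctr_12[of w "\<lambda>a b c. u c b a"] ctr_23[of w "\<lambda>a b c. u b c a"] ctr_12[of w "\<lambda>a b c. u a c b"] ctr_23[of w u]
    ctr_23[of w "\<lambda>a b c. u c b a"] ctr_12[of w u] by simp

section \<open>Single and quadratic contractions with psi\<close>

lemma psi_pair: "psi k l i j = psi i j k l"
  using psi_swap(2)[of k l i j] psi_swap(1)[of k i l j] psi_swap(3)[of i k l j] psi_swap(2)[of i k j l] by linarith

lemma phi_rot: "phi k l m = phi m k l"
  using phi_swap(2)[of k m l] phi_swap(1)[of k m l] by linarith

lemma psi_phi_1: "(\<Sum>k\<in>UNIV. psi a b c k * phi i j k) = kdelta i a * phi j b c + kdelta i b * phi a j c + kdelta i c * phi a b j
     - kdelta j a * phi i b c - kdelta j b * phi a i c - kdelta j c * phi a b i"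
  by (simp add: phi_psi mult.commute[of "psi _ _ _ _"])

text \<open>Replacing one \<open>psi\<close> by its definition leaves a product of two copies of
  \<open>phi\<close> and one \<open>psi\<close>, which \<open>phi_psi_2\<close> and then
  \<open>phi_phi\<close> reduce.\<close>

lemma psi_psi_2:
  "(\<Sum>k\<in>UNIV. \<Sum>l\<in>UNIV. psi i j k l * psi a b k l) = 4 * (kdelta i a * kdelta j b) - 4 * (kdelta i b * kdelta j a) - 2 * psi i j a b"
proof -
  have 1: "psi i j k l * psi a b k l = kdelta i k * (kdelta j l * psi a b k l) - kdelta i l * (kdelta j k * psi a b k l)
     - (\<Sum>m\<in>UNIV. phi i j m * phi k l m) * psi a b k l" for k l
    by (simp only: psi_def[of i j] left_diff_distrib mult.assoc)
  have "(\<Sum>k\<in>UNIV. \<Sum>l\<in>UNIV. (\<Sum>m\<in>UNIV. phi i j m * phi k l m) * psi a b k l)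
     = (\<Sum>m\<in>UNIV. phi i j m * (\<Sum>k\<in>UNIV. \<Sum>l\<in>UNIV. phi k l m * psi a b k l))"
    by (rule pull2)
  also have "\<dots> = (\<Sum>m\<in>UNIV. phi i j m * (- 4 * phi a b m))"
  proof (intro sum.cong refl arg_cong2[of _ _ _ _ "(*)"])
    fix m
    have "(\<Sum>k\<in>UNIV. \<Sum>l\<in>UNIV. phi k l m * psi a b k l) = (\<Sum>k\<in>UNIV. \<Sum>l\<in>UNIV. phi m k l * psi a b k l)"
      by (simp only: phi_rot[of _ _ m])
    then show "(\<Sum>k\<in>UNIV. \<Sum>l\<in>UNIV. phi k l m * psi a b k l) = - 4 * phi a b m"
      by (simp add: phi_psi_2 phi_rot[of a b m])
  qed
  also have "\<dots> = - 4 * (\<Sum>m\<in>UNIV. phi i j m * phi a b m)" by (simp only: sum_distrib_left mult_ac)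
  finally have 2: "(\<Sum>k\<in>UNIV. \<Sum>l\<in>UNIV. (\<Sum>m\<in>UNIV. phi i j m * phi k l m) * psi a b k l)
     = - 4 * (kdelta i a * kdelta j b - kdelta i b * kdelta j a - psi i j a b)" by (simp only: phi_phi)
  show ?thesis unfolding 1 sum_subtractf 2
    using psi_pair[of i j a b] psi_swap(3)[of a b i j] by (simp add: sum_distrib_left[symmetric])
qed

lemma ctr_psi_psi: "ctr (psi i) (psi j) = 24 * kdelta i j"
  unfolding ctr_def by (simp add: psi_psi_2 psi_repeat sum_subtractf sum_distrib_left[symmetric] sum_distrib_right[symmetric])

lemma ctr_phi_psi: "ctr phi (psi j) = 0"
proof -
  have "ctr phi (psi j) = (\<Sum>a\<in>UNIV. - 4 * phi a j a)"
    unfolding ctr_def phi_psi_2 ..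
  then show ?thesis by (simp add: phi_repeat)
qed

lemma ctr_phi_pair: "ctr (\<lambda>a b c. \<Sum>l\<in>UNIV. u a l * phi l b c) (psi q) = - 4 * (\<Sum>a\<in>UNIV. \<Sum>l\<in>UNIV. u a l * phi l q a)"
  unfolding ctr_def pull2 phi_psi_2 by (simp add: sum_distrib_left mult_ac)

lemma ctr_psi_pair: "ctr (\<lambda>a b c. \<Sum>r\<in>UNIV. M a r * psi i r b c) (psi j)
   = 4 * kdelta i j * (\<Sum>a\<in>UNIV. M a a) - 4 * M i j - 2 * (\<Sum>a\<in>UNIV. \<Sum>r\<in>UNIV. M a r * psi i r j a)"
  unfolding ctr_def pull2 psi_psi_2
  by (simp add: right_diff_distrib sum_subtractf kdelta_mult_if sum_distrib_left mult.left_commute[of _ 2] mult.left_commute[of _ 4] mult.commute[of _ 4])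

text \<open>Counterpart of \<open>ctr_phi_pair\<close> for the case in which \<open>phi\<close>
  shares a single index with \<open>psi\<close>; every term of an antisymmetrised derivative falls
  under one of the two.\<close>

lemma ctr_phi_single:
  "ctr (\<lambda>a b c. \<Sum>l\<in>UNIV. w a b l * phi p l c) (psi q)
    = kdelta p q * (\<Sum>a\<in>UNIV. \<Sum>b\<in>UNIV. \<Sum>l\<in>UNIV. w a b l * phi l a b) + (\<Sum>b\<in>UNIV. \<Sum>l\<in>UNIV. w p b l * phi q l b)
      + (\<Sum>a\<in>UNIV. \<Sum>l\<in>UNIV. w a p l * phi q a l) - (\<Sum>a\<in>UNIV. \<Sum>b\<in>UNIV. w a b q * phi p a b)
      - (\<Sum>a\<in>UNIV. \<Sum>b\<in>UNIV. w a b a * phi q p b) - (\<Sum>a\<in>UNIV. \<Sum>b\<in>UNIV. w a b b * phi q a p)"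
  unfolding ctr_def pull1 phi_psi
  by (simp add: right_diff_distrib distrib_left sum_subtractf sum.distrib kdelta_mult_if)

text \<open>The action of the matrix \<open>M\<close> on \<open>psi\<close> as a derivation.\<close>

definition dia :: "(7 \<Rightarrow> 7 \<Rightarrow> real) \<Rightarrow> 7 \<Rightarrow> 7 \<Rightarrow> 7 \<Rightarrow> 7 \<Rightarrow> real" where
  "dia M i a b c = (\<Sum>r\<in>UNIV. M i r * psi r a b c) + (\<Sum>r\<in>UNIV. M a r * psi i r b c)
     + (\<Sum>r\<in>UNIV. M b r * psi i a r c) + (\<Sum>r\<in>UNIV. M c r * psi i a b r)"

text \<open>The pattern of an exterior derivative: antisymmetrises the derivative index
  \<open>p\<close> over an array that is already alternating in the other three.\<close>

definition alt4 :: "(7 \<Rightarrow> 7 \<Rightarrow> 7 \<Rightarrow> 7 \<Rightarrow> real) \<Rightarrow> 7 \<Rightarrow> 7 \<Rightarrow> 7 \<Rightarrow> 7 \<Rightarrow> real" where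
  "alt4 V p i j k = V p i j k - V i p j k + V j p i k - V k p i j"

text \<open>The variation of \<open>psi\<close> when \<open>phi\<close> varies by the contraction of \<open>psi\<close> with \<open>Y\<close>.\<close>

definition cpsi :: "(7 \<Rightarrow> real) \<Rightarrow> 7 \<Rightarrow> 7 \<Rightarrow> 7 \<Rightarrow> 7 \<Rightarrow> real" where
  "cpsi Y i j k l = - (Y i * phi j k l) + Y j * phi i k l - Y k * phi i j l + Y l * phi i j k"

section \<open>Contractions of antisymmetrised derivatives\<close>

lemma sum_antisym_eq_0:
  assumes "\<And>a l. F l a = - F a l"
  shows "(\<Sum>a\<in>A. \<Sum>l\<in>A. F a l :: real) = 0"
proof -
  have "(\<Sum>a\<in>A. \<Sum>l\<in>A. F a l) = (\<Sum>a\<in>A. \<Sum>l\<in>A. - F a l)"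
    by (subst sum.swap, intro sum.cong refl assms)
  then show ?thesis by (simp add: sum_negf)
qed

lemma psi_moves: "psi r p j k = - psi p r j k" "psi r p i k = psi p i r k" "psi r p i j = - psi p i j r"
  using psi_swap(1)[of p r j k] psi_swap(1)[of p r i k] psi_swap(2)[of p r i k] psi_swap(1)[of p r i j]
    psi_swap(2)[of p r i j] psi_swap(3)[of p i r j] by linarith+

text \<open>Moving the contracted index of each term into the slot it replaces turns
  antisymmetrisation into a derivation. Consequently d\<phi> is the action of the torsion tensor on
  \<open>psi\<close>.\<close>

lemma dia_alt4: "dia T = alt4 (\<lambda>p i j k. \<Sum>q\<in>UNIV. T p q * psi q i j k)"
proof (intro ext)
  fix p i j k
  have "(\<Sum>r\<in>UNIV. T i r * psi r p j k) = - (\<Sum>r\<in>UNIV. T i r * psi p r j k)"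
    unfolding psi_moves(1)[of _ p j k] by (simp add: sum_negf)
  moreover have "(\<Sum>r\<in>UNIV. T j r * psi r p i k) = (\<Sum>r\<in>UNIV. T j r * psi p i r k)"
    unfolding psi_moves(2)[of _ p i k] ..
  moreover have "(\<Sum>r\<in>UNIV. T k r * psi r p i j) = - (\<Sum>r\<in>UNIV. T k r * psi p i j r)"
    unfolding psi_moves(3)[of _ p i j] by (simp add: sum_negf)
  ultimately show "dia T p i j k = alt4 (\<lambda>p i j k. \<Sum>q\<in>UNIV. T p q * psi q i j k) p i j k"
    unfolding dia_def alt4_def by simp
qed

lemma ctr_alt4:
  assumes "alt3 w"
  shows "ctr (alt4 V p) w = ctr (V p) w - 3 * ctr (\<lambda>a b c. V a p b c) w"
  using ctr_12[OF assms, of "\<lambda>a b c. V a p b c"] ctr_rot[OF assms, of "\<lambda>a b c. V a p b c"]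
  unfolding alt4_def[abs_def] ctr_diff ctr_add by simp

lemma alt3_dia: "alt3 (dia M p)"
  unfolding alt3_def
proof (intro allI conjI)
  fix a b c
  show "dia M p b a c = - dia M p a b c"
    unfolding dia_def psi_swap(2)[of _ b a c] psi_swap(2)[of p b _ c] psi_swap(2)[of p _ a c] psi_swap(2)[of p b a _]
    by (simp add: sum_negf)
  show "dia M p a c b = - dia M p a b c"
    unfolding dia_def psi_swap(3)[of _ a c b] psi_swap(3)[of p _ c b] psi_swap(3)[of p a _ b] psi_swap(3)[of p a c _]
    by (simp add: sum_negf)
qed

text \<open>The terms in which \<open>M\<close> acts on one of the last three slots differ by a
  permutation of the contracted indices, hence the factor 3.\<close>

lemma ctr_dia_gen:
  assumes w: "alt3 w"
  shows "ctr (dia M p) w = (\<Sum>r\<in>UNIV. M p r * ctr (psi r) w) + 3 * ctr (\<lambda>a b c. \<Sum>r\<in>UNIV. M a r * psi p r b c) w"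
proof -
  let ?u = "\<lambda>a b c. \<Sum>r\<in>UNIV. M a r * psi p r b c"
  have 1: "(\<lambda>a b c. \<Sum>r\<in>UNIV. M b r * psi p a r c) = (\<lambda>a b c. - ?u b a c)"
  proof (intro ext)
    fix a b c
    have "psi p a r c = - psi p r a c" for r by (rule psi_swap)
    then show "(\<Sum>r\<in>UNIV. M b r * psi p a r c) = - ?u b a c" by (simp add: sum_negf)
  qed
  have 2: "(\<lambda>a b c. \<Sum>r\<in>UNIV. M c r * psi p a b r) = (\<lambda>a b c. ?u c a b)"
  proof (intro ext)
    fix a b c
    have "psi p a b r = psi p r a b" for r
      using psi_swap(3)[of p a r b] psi_swap(2)[of p r a b] by simp
    then show "(\<Sum>r\<in>UNIV. M c r * psi p a b r) = ?u c a b" by simp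
  qed
  show ?thesis
    unfolding dia_def[abs_def] ctr_add ctr_sum 1 2 ctr_minus ctr_12[OF w, of ?u] ctr_rot[OF w, of ?u] by simp
qed

lemma ctr_dia:
  "ctr (dia M i) (psi j) = 12 * M i j + 12 * kdelta i j * (\<Sum>a\<in>UNIV. M a a) - 6 * (\<Sum>a\<in>UNIV. \<Sum>r\<in>UNIV. M a r * psi i r j a)"
  unfolding ctr_dia_gen[OF alt3_psi] ctr_psi_pair ctr_psi_psi by (simp add: kdelta_mult_if algebra_simps)

text \<open>The term of \<open>ctr_dia\<close> still containing \<open>psi\<close> is skew in
  \<open>i\<close> and \<open>j\<close>, so symmetrising leaves the symmetric part and the trace of
  \<open>M\<close>.\<close>

lemma ctr_dia_sym:
  "ctr (dia M i) (psi j) + ctr (dia M j) (psi i) = 12 * (M i j + M j i) + 24 * kdelta i j * (\<Sum>a\<in>UNIV. M a a)"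
proof -
  have "psi j r i a = - psi i r j a" for r a
    using psi_swap(1)[of r j i a] psi_swap(2)[of r j i a] psi_swap(1)[of r i j a] by linarith
  then show ?thesis unfolding ctr_dia by (simp add: sum_negf algebra_simps)
qed

text \<open>With \<open>H\<close> standing for \<nabla>h, \<open>V\<close> is the part of the
  derivative of the velocity that involves \<nabla>h. After symmetrisation only the curl
  \<open>cu\<close> is left; it is the source of the two curl terms of the evolution
  equation.\<close>

lemma ctr_alt4_sym2:
  fixes H :: "7 \<Rightarrow> 7 \<Rightarrow> 7 \<Rightarrow> real"
  assumes H: "\<And>p i l. H p i l = H p l i"
  defines "V \<equiv> \<lambda>p i j k. (\<Sum>l\<in>UNIV. H p i l * phi l j k) + (\<Sum>l\<in>UNIV. H p j l * phi i l k) + (\<Sum>l\<in>UNIV. H p k l * phi i j l)"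
    and "cu \<equiv> \<lambda>p q. \<Sum>k\<in>UNIV. \<Sum>l\<in>UNIV. H k l p * phi k l q"
  shows "ctr (alt4 V p) (psi q) + ctr (alt4 V q) (psi p) = 12 * (cu p q + cu q p)"
proof -
  \<comment> \<open>Each term pairs \<open>H\<close>, symmetric in its last two indices, with a skew
    component of \<open>phi\<close>.\<close>
  have *: "ctr (V p) (psi q) = 0" for p q
  proof -
    let ?u = "\<lambda>a b c. \<Sum>l\<in>UNIV. H p a l * phi l b c"
    have 1: "(\<lambda>a b c. \<Sum>l\<in>UNIV. H p b l * phi a l c) = (\<lambda>a b c. - ?u b a c)"
    proof (intro ext)
      fix a b c
      have "phi a l c = - phi l a c" for l by (rule phi_swap)
      then show "(\<Sum>l\<in>UNIV. H p b l * phi a l c) = - ?u b a c" by (simp add: sum_negf)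
    qed
    have 2: "(\<lambda>a b c. \<Sum>l\<in>UNIV. H p c l * phi a b l) = (\<lambda>a b c. ?u c a b)"
      by (intro ext sum.cong refl arg_cong2[of _ _ _ _ "(*)"] phi_rot)
    have "H p l a * phi a q l = - (H p a l * phi l q a)" for a l
      using H[of p a l] phi_rot[of a q l] phi_swap(2)[of l a q] by simp
    then have "ctr ?u (psi q) = 0" unfolding ctr_phi_pair
      by (subst sum_antisym_eq_0) (assumption, simp)
    then show ?thesis unfolding V_def ctr_add 1 2 ctr_minus ctr_12[OF alt3_psi, of ?u] ctr_rot[OF alt3_psi, of ?u] by simp
  qed
  have K: "ctr (alt4 V p) (psi q) = 6 * cu p q + 6 * cu q p + 6 * (\<Sum>a\<in>UNIV. \<Sum>b\<in>UNIV. H a b a * phi q p b)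
      + 6 * (\<Sum>a\<in>UNIV. \<Sum>b\<in>UNIV. H a b b * phi q a p)" for p q
  proof -
    let ?u = "\<lambda>a b c. \<Sum>l\<in>UNIV. H a b l * phi p l c"
    have 1: "(\<lambda>a b c. \<Sum>l\<in>UNIV. H a c l * phi p b l) = (\<lambda>a b c. - ?u a c b)"
    proof (intro ext)
      fix a b c
      have "phi p b l = - phi p l b" for l by (rule phi_swap)
      then show "(\<Sum>l\<in>UNIV. H a c l * phi p b l) = - ?u a c b" by (simp add: sum_negf)
    qed
    have e1: "(\<Sum>a\<in>UNIV. \<Sum>l\<in>UNIV. H a p l * phi l q a) = cu p q"
    proof -
      have "H a p l * phi l q a = H a l p * phi a l q" for a l using H[of a p l] phi_rot[of l q a] by simp
      then show ?thesis unfolding cu_def by simp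
    qed
    have e2: "(\<Sum>a\<in>UNIV. \<Sum>b\<in>UNIV. \<Sum>l\<in>UNIV. H a b l * phi l a b) = 0"
    proof -
      have "H a l b * phi b a l = - (H a b l * phi l a b)" for a b l
        using H[of a l b] phi_rot[of b a l] phi_swap(2)[of l b a] by simp
      then have "(\<Sum>b\<in>UNIV. \<Sum>l\<in>UNIV. H a b l * phi l a b) = 0" for a
        by (rule sum_antisym_eq_0)
      then show ?thesis by simp
    qed
    have e3: "(\<Sum>b\<in>UNIV. \<Sum>l\<in>UNIV. H p b l * phi q l b) = 0"
    proof (rule sum_antisym_eq_0)
      fix b l show "H p l b * phi q b l = - (H p b l * phi q l b)"
        using H[of p l b] phi_swap(2)[of q b l] by simp
    qed
    have e4: "(\<Sum>a\<in>UNIV. \<Sum>l\<in>UNIV. H a p l * phi q a l) = cu p q"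
    proof -
      have "H a p l * phi q a l = H a l p * phi a l q" for a l using H[of a p l] phi_rot[of a l q] by simp
      then show ?thesis unfolding cu_def by simp
    qed
    have e5: "(\<Sum>a\<in>UNIV. \<Sum>b\<in>UNIV. H a b q * phi p a b) = cu q p"
      unfolding cu_def phi_rot[of _ _ p] ..
    show ?thesis
      unfolding ctr_alt4[OF alt3_psi] * unfolding V_def ctr_add 1 ctr_minus ctr_23[OF alt3_psi, of ?u] ctr_phi_pair ctr_phi_single e1 e2 e3 e4 e5
      by simp
  qed
  have "phi q p b = - phi p q b" "phi q a p = - phi p a q" for a b
    using phi_swap(1)[of p q b] phi_rot[of q a p] phi_rot[of p a q] phi_swap(1)[of q p a] phi_swap(2)[of p q a]
      phi_swap(2)[of q p a] phi_swap(1)[of p q a] by linarith+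
  \<comment> \<open>The divergence and trace terms of \<open>H\<close> are skew in \<open>p\<close>
    and \<open>q\<close> and disappear from the symmetrisation.\<close>
  then have "(\<Sum>a\<in>UNIV. \<Sum>b\<in>UNIV. H a b a * phi q p b) = - (\<Sum>a\<in>UNIV. \<Sum>b\<in>UNIV. H a b a * phi p q b)"
    "(\<Sum>a\<in>UNIV. \<Sum>b\<in>UNIV. H a b b * phi q a p) = - (\<Sum>a\<in>UNIV. \<Sum>b\<in>UNIV. H a b b * phi p a q)"
    by (simp_all add: sum_negf)
  then show ?thesis unfolding K by simp
qed

lemma sum_XX:
  "(\<Sum>a\<in>UNIV. X a * phi q a r) = - (\<Sum>l\<in>UNIV. X l * phi l q r)"
  "(\<Sum>a\<in>UNIV. X a * phi q r a) = (\<Sum>l\<in>UNIV. X l * phi l q r)"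
  unfolding phi_rot[of q r] unfolding phi_swap(1)[of q _ r] by (simp_all add: sum_negf)

lemma ctr_XX_pair:
  "ctr (\<lambda>a b c. t a * (\<Sum>l\<in>UNIV. X l * phi l b c)) (psi q) = - 4 * (\<Sum>a\<in>UNIV. t a * (\<Sum>l\<in>UNIV. X l * phi l q a))"
  using ctr_phi_pair[of "\<lambda>a l. t a * X l" q] by (simp only: sum_distrib_left mult.assoc)

lemma ctr_XX_single:
  defines "XX \<equiv> \<lambda>X j k. \<Sum>l\<in>UNIV. X l * phi l j k"
  shows "ctr (\<lambda>a b c. t a b * XX X p c) (psi q)
    = - kdelta p q * (\<Sum>a\<in>UNIV. \<Sum>b\<in>UNIV. t a b * XX X a b) + (\<Sum>b\<in>UNIV. t p b * XX X q b)
      - (\<Sum>a\<in>UNIV. t a p * XX X q a) + X q * (\<Sum>a\<in>UNIV. \<Sum>b\<in>UNIV. t a b * phi p a b)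
      + (\<Sum>a\<in>UNIV. \<Sum>b\<in>UNIV. t a b * X a * phi q p b) + (\<Sum>a\<in>UNIV. \<Sum>b\<in>UNIV. t a b * X b * phi q a p)"
proof -
  have XX: "XX X p c = - (\<Sum>l\<in>UNIV. X l * phi p l c)" for p c unfolding XX_def sum_XX(1) by simp
  have "(\<lambda>a b c. t a b * XX X p c) = (\<lambda>a b c. - (\<Sum>l\<in>UNIV. (t a b * X l) * phi p l c))"
    unfolding XX by (simp add: sum_distrib_left mult.assoc)
  moreover have "(\<Sum>l\<in>UNIV. t a b * X l * phi l a b) = t a b * XX X a b" for a b
    unfolding XX_def by (simp add: sum_distrib_left mult.assoc)
  moreover have "(\<Sum>l\<in>UNIV. t p b * X l * phi q l b) = - (t p b * XX X q b)" for b
    unfolding XX by (simp add: sum_distrib_left mult.assoc)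
  moreover have "(\<Sum>l\<in>UNIV. t a p * X l * phi q a l) = t a p * XX X q a" for a
    unfolding XX_def sum_XX(2)[symmetric] by (simp add: sum_distrib_left mult.assoc)
  moreover have "(\<Sum>a\<in>UNIV. \<Sum>b\<in>UNIV. t a b * X q * phi p a b) = X q * (\<Sum>a\<in>UNIV. \<Sum>b\<in>UNIV. t a b * phi p a b)"
    by (simp add: sum_distrib_left mult_ac)
  ultimately show ?thesis
    by (simp add: ctr_minus ctr_phi_single sum_negf)
qed

text \<open>Collects what is linear in both \<open>X\<close> and the torsion: from differentiating
  \<open>psi\<close> in the velocity, and from the motion of \<open>psi\<close> in time. The terms
  in \<open>X q * tau p\<close> cancel between the two sources, and those in \<xi>,
  \<open>N\<close>, \<open>N'\<close> and \<open>B\<close> come out skew in \<open>p\<close> and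
  \<open>q\<close>. What survives is the symmetrised product \<open>A\<close> and the full
  contraction \<open>tt\<close>.\<close>

lemma ctr_torsion_sym:
  fixes X :: "7 \<Rightarrow> real" and T :: "7 \<Rightarrow> 7 \<Rightarrow> real"
  defines "V \<equiv> \<lambda>p i j k. \<Sum>l\<in>UNIV. X l * cpsi (T p) l i j k"
    and "XX \<equiv> \<lambda>j k. \<Sum>l\<in>UNIV. X l * phi l j k"
  shows "(ctr (alt4 V p) (psi q) + ctr (dia T p) (cpsi X q)) + (ctr (alt4 V q) (psi p) + ctr (dia T q) (cpsi X p))
     = - 12 * ((\<Sum>a\<in>UNIV. T p a * XX q a) + (\<Sum>a\<in>UNIV. T q a * XX p a))
       - 24 * kdelta p q * (\<Sum>a\<in>UNIV. \<Sum>b\<in>UNIV. T a b * XX a b)"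
proof -
  define \<xi> where "\<xi> p = (\<Sum>l\<in>UNIV. X l * T p l)" for p
  define A where "A p q = (\<Sum>a\<in>UNIV. T p a * XX q a)" for p q
  define B where "B p q = (\<Sum>a\<in>UNIV. T a p * XX q a)" for p q
  define tau where "tau p = (\<Sum>a\<in>UNIV. \<Sum>b\<in>UNIV. T a b * phi p a b)" for p
  define tt where "tt = (\<Sum>a\<in>UNIV. \<Sum>b\<in>UNIV. T a b * XX a b)"
  have V: "V p i j k = - (\<xi> p * phi i j k) + T p i * XX j k - T p j * XX i k + T p k * XX i j" for p i j k
  proof -
    have "V p i j k = (\<Sum>l\<in>UNIV. - (X l * T p l * phi i j k) + T p i * (X l * phi l j k) - T p j * (X l * phi l i k) + T p k * (X l * phi l i j))"
      unfolding V_def cpsi_def by (intro sum.cong refl) (simp add: algebra_simps)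
    then show ?thesis unfolding \<xi>_def XX_def
      by (simp add: sum.distrib sum_subtractf sum_negf sum_distrib_left sum_distrib_right)
  qed
  have XX_anti: "XX k j = - XX j k" for j k
  proof -
    have "phi l k j = - phi l j k" for l by (rule phi_swap)
    then show ?thesis unfolding XX_def by (simp add: sum_negf)
  qed
  have K1: "ctr (V p) (psi q) = - 12 * A p q" for p q
  proof -
    let ?u = "\<lambda>a b c. T p a * XX b c"
    have e: "V p = (\<lambda>a b c. - (\<xi> p * phi a b c) + ?u a b c - ?u b a c + ?u c a b)" by (intro ext) (simp add: V)
    have "ctr ?u (psi q) = - 4 * A p q" unfolding XX_def A_def by (rule ctr_XX_pair)
    then show ?thesis
      unfolding e ctr_add ctr_diff ctr_minus ctr_scale ctr_phi_psi ctr_12[OF alt3_psi, of ?u] ctr_rot[OF alt3_psi, of ?u] by simp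
  qed
  have K2: "ctr (\<lambda>a b c. V a p b c) (psi q) = 4 * (\<Sum>a\<in>UNIV. \<xi> a * phi p q a) - 4 * B p q
     - 2 * (- kdelta p q * tt + A p q - B p q + X q * tau p
      + (\<Sum>a\<in>UNIV. \<Sum>b\<in>UNIV. T a b * X a * phi q p b) + (\<Sum>a\<in>UNIV. \<Sum>b\<in>UNIV. T a b * X b * phi q a p))" for p q
  proof -
    let ?u = "\<lambda>a b c. T a b * XX p c"
    have e: "(\<lambda>a b c. V a p b c) = (\<lambda>a b c. - (\<xi> a * phi p b c) + T a p * XX b c - ?u a b c + ?u a c b)"
      by (intro ext) (simp add: V)
    have 1: "ctr (\<lambda>a b c. \<xi> a * phi p b c) (psi q) = - 4 * (\<Sum>a\<in>UNIV. \<xi> a * phi p q a)"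
    proof -
      have "ctr (\<lambda>a b c. \<xi> a * phi p b c) (psi q) = (\<Sum>a\<in>UNIV. \<xi> a * (\<Sum>b\<in>UNIV. \<Sum>c\<in>UNIV. phi p b c * psi q a b c))"
        unfolding ctr_def by (simp add: sum_distrib_left mult.assoc)
      then show ?thesis by (simp add: phi_psi_2 sum_distrib_left mult_ac)
    qed
    have 2: "ctr (\<lambda>a b c. T a p * XX b c) (psi q) = - 4 * B p q"
      unfolding XX_def B_def by (rule ctr_XX_pair)
    have 3: "ctr ?u (psi q) = - kdelta p q * tt + A p q - B p q + X q * tau p
      + (\<Sum>a\<in>UNIV. \<Sum>b\<in>UNIV. T a b * X a * phi q p b) + (\<Sum>a\<in>UNIV. \<Sum>b\<in>UNIV. T a b * X b * phi q a p)"
      unfolding XX_def A_def B_def tau_def tt_def by (rule ctr_XX_single)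
    show ?thesis
      unfolding e ctr_add ctr_diff ctr_minus ctr_23[OF alt3_psi, of ?u] 1 2 3 by simp
  qed
  have K3: "ctr phi (dia T p) = 12 * tau p" for p
  proof -
    have "ctr (dia T p) phi = (\<Sum>r\<in>UNIV. T p r * ctr phi (psi r)) + 3 * (\<Sum>a\<in>UNIV. \<Sum>r\<in>UNIV. T a r * (\<Sum>b\<in>UNIV. \<Sum>c\<in>UNIV. psi p r b c * phi a b c))"
      unfolding ctr_dia_gen[OF alt3_phi] ctr_commute[of phi] unfolding ctr_def pull2 ..
    also have "\<dots> = 3 * (\<Sum>a\<in>UNIV. \<Sum>r\<in>UNIV. T a r * (4 * phi p a r))"
    proof -
      have "(\<Sum>b\<in>UNIV. \<Sum>c\<in>UNIV. psi p r b c * phi a b c) = 4 * phi p a r" for a r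
        using phi_psi_2[of a p r] phi_swap(1)[of a p r] by (simp add: mult.commute)
      then show ?thesis by (simp add: ctr_phi_psi)
    qed
    finally show ?thesis unfolding tau_def by (simp add: ctr_commute[of phi] mult.left_commute[of _ 4] sum_distrib_left[symmetric])
  qed
  define N where "N p q = (\<Sum>a\<in>UNIV. \<Sum>r\<in>UNIV. T a r * X a * phi q p r)" for p q
  define N' where "N' p q = (\<Sum>a\<in>UNIV. \<Sum>r\<in>UNIV. T r r * X a * phi p a q)" for p q
  have K4: "ctr (\<lambda>a b c. X a * phi q b c) (dia T p) = - 4 * A p q - 4 * N p q
     + 2 * (- kdelta p q * tt + X q * tau p - B q p + A p q + N p q - N' p q)" for p q
  proof -
    let ?W = "\<lambda>a b c. X a * phi q b c"
    have t1: "(\<Sum>r\<in>UNIV. T p r * ctr (psi r) ?W) = - 4 * A p q"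
    proof -
      have "ctr (psi r) ?W = (\<Sum>a\<in>UNIV. X a * (\<Sum>b\<in>UNIV. \<Sum>c\<in>UNIV. phi q b c * psi r a b c))" for r
        unfolding ctr_def by (simp add: sum_distrib_left mult_ac)
      also have "\<dots> r = - 4 * XX q r" for r
        unfolding phi_psi_2 XX_def sum_XX(2)[symmetric] by (simp add: sum_distrib_left mult_ac)
      finally show ?thesis unfolding A_def by (simp add: sum_distrib_left mult_ac)
    qed
    have t2: "ctr (\<lambda>a b c. \<Sum>r\<in>UNIV. T a r * psi p r b c) ?W = - 4 * N p q"
    proof -
      have "ctr (\<lambda>a b c. \<Sum>r\<in>UNIV. T a r * psi p r b c) ?W
        = (\<Sum>a\<in>UNIV. \<Sum>r\<in>UNIV. T a r * X a * (\<Sum>b\<in>UNIV. \<Sum>c\<in>UNIV. phi q b c * psi p r b c))"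
        unfolding ctr_def pull2 by (simp add: sum_distrib_left mult_ac)
      then show ?thesis unfolding phi_psi_2 N_def by (simp add: sum_distrib_left mult_ac)
    qed
    have t3: "ctr (\<lambda>a b c. \<Sum>r\<in>UNIV. T b r * psi p a r c) ?W = - kdelta p q * tt + X q * tau p - B q p + A p q + N p q - N' p q"
    proof -
      have "ctr (\<lambda>a b c. \<Sum>r\<in>UNIV. T b r * psi p a r c) ?W
        = (\<Sum>a\<in>UNIV. \<Sum>b\<in>UNIV. \<Sum>r\<in>UNIV. (T b r * X a) * (\<Sum>c\<in>UNIV. psi p a r c * phi q b c))"
        unfolding ctr_def pull1 by (simp add: sum_distrib_left mult_ac)
      also have "\<dots> = kdelta p q * (\<Sum>a\<in>UNIV. \<Sum>b\<in>UNIV. \<Sum>r\<in>UNIV. T b r * X a * phi b a r)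
         + (\<Sum>b\<in>UNIV. \<Sum>r\<in>UNIV. T b r * X q * phi p b r) + (\<Sum>a\<in>UNIV. \<Sum>b\<in>UNIV. T b q * X a * phi p a b)
         - (\<Sum>a\<in>UNIV. \<Sum>r\<in>UNIV. T p r * X a * phi q a r) - (\<Sum>a\<in>UNIV. \<Sum>r\<in>UNIV. T a r * X a * phi p q r) - N' p q"
        unfolding psi_phi_1 N'_def
        by (simp add: right_diff_distrib distrib_left sum_subtractf sum.distrib kdelta_mult_if)
      also have "(\<Sum>a\<in>UNIV. \<Sum>b\<in>UNIV. \<Sum>r\<in>UNIV. T b r * X a * phi b a r) = - tt"
      proof -
        have "(\<Sum>a\<in>UNIV. \<Sum>b\<in>UNIV. \<Sum>r\<in>UNIV. T b r * X a * phi b a r) = (\<Sum>b\<in>UNIV. \<Sum>r\<in>UNIV. \<Sum>a\<in>UNIV. T b r * (X a * phi b a r))"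
        proof -
          have "(\<Sum>a\<in>UNIV. \<Sum>b\<in>UNIV. \<Sum>r\<in>UNIV. T b r * X a * phi b a r) = (\<Sum>b\<in>UNIV. \<Sum>a\<in>UNIV. \<Sum>r\<in>UNIV. T b r * X a * phi b a r)"
            by (rule sum.swap)
          also have "\<dots> = (\<Sum>b\<in>UNIV. \<Sum>r\<in>UNIV. \<Sum>a\<in>UNIV. T b r * X a * phi b a r)"
            by (intro sum.cong refl sum.swap)
          finally show ?thesis by (simp only: mult.assoc)
        qed
        also have "\<dots> = (\<Sum>b\<in>UNIV. \<Sum>r\<in>UNIV. T b r * - XX b r)"
          unfolding sum_distrib_left[symmetric] sum_XX(1) XX_def ..
        finally show ?thesis unfolding tt_def by (simp add: sum_negf)
      qed
      also have "(\<Sum>b\<in>UNIV. \<Sum>r\<in>UNIV. T b r * X q * phi p b r) = X q * tau p"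
        unfolding tau_def by (simp add: sum_distrib_left mult_ac)
      also have "(\<Sum>a\<in>UNIV. \<Sum>b\<in>UNIV. T b q * X a * phi p a b) = - B q p"
      proof -
        have "(\<Sum>a\<in>UNIV. \<Sum>b\<in>UNIV. T b q * X a * phi p a b) = (\<Sum>b\<in>UNIV. \<Sum>a\<in>UNIV. T b q * (X a * phi p a b))"
          by (subst sum.swap) (simp add: mult.assoc)
        also have "\<dots> = (\<Sum>b\<in>UNIV. T b q * - XX p b)"
          unfolding sum_distrib_left[symmetric] sum_XX(1) XX_def ..
        finally show ?thesis unfolding B_def by (simp add: sum_negf)
      qed
      also have "(\<Sum>a\<in>UNIV. \<Sum>r\<in>UNIV. T p r * X a * phi q a r) = - A p q"
      proof -
        have "(\<Sum>a\<in>UNIV. \<Sum>b\<in>UNIV. T p b * X a * phi q a b) = (\<Sum>b\<in>UNIV. \<Sum>a\<in>UNIV. T p b * (X a * phi q a b))"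
          by (subst sum.swap) (simp add: mult.assoc)
        also have "\<dots> = (\<Sum>b\<in>UNIV. T p b * - XX q b)"
          unfolding sum_distrib_left[symmetric] sum_XX(1) XX_def ..
        finally show ?thesis unfolding A_def by (simp add: sum_negf)
      qed
      also have "(\<Sum>a\<in>UNIV. \<Sum>r\<in>UNIV. T a r * X a * phi p q r) = - N p q"
      proof -
        have "phi p q r = - phi q p r" for r by (rule phi_swap)
        then show ?thesis unfolding N_def by (simp add: sum_negf)
      qed
      finally show ?thesis by simp
    qed
    have t4: "ctr (\<lambda>a b c. \<Sum>r\<in>UNIV. T c r * psi p a b r) ?W = ctr (\<lambda>a b c. \<Sum>r\<in>UNIV. T b r * psi p a r c) ?W"
    proof -
      have 1: "(\<Sum>b\<in>UNIV. \<Sum>c\<in>UNIV. (\<Sum>r\<in>UNIV. T c r * psi p a b r) * (X a * phi q b c))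
          = (\<Sum>b\<in>UNIV. \<Sum>c\<in>UNIV. (\<Sum>r\<in>UNIV. T b r * psi p a c r) * (X a * phi q c b))" for a
        by (rule sum.swap)
      have 2: "(\<Sum>r\<in>UNIV. T b r * psi p a c r) * (X a * phi q c b) = (\<Sum>r\<in>UNIV. T b r * psi p a r c) * (X a * phi q b c)" for a b c
      proof -
        have "psi p a c r = - psi p a r c" for r by (rule psi_swap)
        then show ?thesis using phi_swap(2)[of q c b] by (simp add: sum_negf)
      qed
      show ?thesis unfolding ctr_def by (rule sum.cong[OF refl], subst 1, intro sum.cong refl 2)
    qed
    show ?thesis
      unfolding ctr_commute[of ?W] unfolding dia_def[abs_def] ctr_add ctr_sum t1 t2 t4 t3 by simp
  qed
  have K5: "ctr (dia T p) (cpsi X q) = - 12 * X q * tau p + 3 * ctr (\<lambda>a b c. X a * phi q b c) (dia T p)" for p q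
  proof -
    let ?u = "\<lambda>a b c. X a * phi q b c"
    have e: "cpsi X q = (\<lambda>a b c. - (X q * phi a b c) + ?u a b c - ?u b a c + ?u c a b)"
      by (intro ext) (simp add: cpsi_def)
    show ?thesis
      unfolding ctr_commute[of "dia T p"] e ctr_add ctr_diff ctr_minus ctr_scale K3 ctr_12[OF alt3_dia, of ?u] ctr_rot[OF alt3_dia, of ?u]
      by simp
  qed
  have anti: "phi q p b = - phi p q b" "phi q a p = - phi p a q" "phi p q a = - phi q p a" for a b
    using phi_swap(1)[of p q b] phi_rot[of q a p] phi_rot[of p a q] phi_swap(1)[of q p a] phi_swap(2)[of p q a]
      phi_swap(2)[of q p a] phi_swap(1)[of p q a] by linarith+
  have a1: "(\<Sum>a\<in>UNIV. \<xi> a * phi q p a) = - (\<Sum>a\<in>UNIV. \<xi> a * phi p q a)"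
    by (simp only: anti(1)) (simp add: sum_negf)
  have a2: "(\<Sum>a\<in>UNIV. \<Sum>b\<in>UNIV. T a b * X a * phi q p b) = - (\<Sum>a\<in>UNIV. \<Sum>b\<in>UNIV. T a b * X a * phi p q b)"
    by (simp only: anti(1)) (simp add: sum_negf)
  have a3: "(\<Sum>a\<in>UNIV. \<Sum>b\<in>UNIV. T a b * X b * phi q a p) = - (\<Sum>a\<in>UNIV. \<Sum>b\<in>UNIV. T a b * X b * phi p a q)"
    by (simp only: anti(2)) (simp add: sum_negf)
  have a4: "N q p = - N p q" unfolding N_def a2 by simp
  have a5: "N' q p = - N' p q" unfolding N'_def by (simp only: anti(2)) (simp add: sum_negf)
  have kd: "kdelta q p = kdelta p q" by auto
  show ?thesis
    unfolding tt_def[symmetric] unfolding ctr_alt4[OF alt3_psi] K1 K2 K5 K4 A_def[symmetric] a1 a2 a3 a4 a5 kd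
    by (simp add: algebra_simps)
qed

section \<open>Variations of phi and the Lie algebra of G2\<close>

lemma phi_perm: "phi j k i = phi i j k" "phi k i j = phi i j k" "phi j i k = - phi i j k" "phi i k j = - phi i j k" "phi k j i = - phi i j k"
  using phi_rot[of j k i] phi_rot[of i j k] phi_swap(1)[of i j k] phi_swap(2)[of i j k] phi_swap(1)[of k j i] by linarith+

text \<open>This is the product rule for the defining formula of \<open>psi\<close> with the metric
  held fixed. The terms carrying a \<open>kdelta\<close> cancel between the two factors.\<close>

lemma cpsi_variation:
  assumes \<eta>: "\<And>i j k. \<eta> i j k = (\<Sum>q\<in>UNIV. Y q * psi q i j k)"
  shows "- (\<Sum>m\<in>UNIV. \<eta> i j m * phi k l m) - (\<Sum>m\<in>UNIV. phi i j m * \<eta> k l m) = cpsi Y i j k l"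
proof -
  have 1: "(\<Sum>m\<in>UNIV. \<eta> i j m * phi k l m) = Y k * phi l i j + kdelta k i * (\<Sum>q\<in>UNIV. Y q * phi q l j)
     + kdelta k j * (\<Sum>q\<in>UNIV. Y q * phi q i l) - Y l * phi k i j - kdelta l i * (\<Sum>q\<in>UNIV. Y q * phi q k j)
     - kdelta l j * (\<Sum>q\<in>UNIV. Y q * phi q i k)" for i j k l
  proof -
    have "(\<Sum>m\<in>UNIV. \<eta> i j m * phi k l m) = (\<Sum>q\<in>UNIV. Y q * (\<Sum>m\<in>UNIV. psi q i j m * phi k l m))"
      unfolding \<eta> by (rule pull1)
    then show ?thesis unfolding psi_phi_1
      by (simp add: right_diff_distrib distrib_left sum_subtractf sum.distrib kdelta_mult_if)
  qed
  have Yanti: "(\<Sum>q\<in>UNIV. Y q * phi q b a) = - (\<Sum>q\<in>UNIV. Y q * phi q a b)" for a b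
  proof -
    have "phi q b a = - phi q a b" for q by (rule phi_swap)
    then show ?thesis by (simp add: sum_negf)
  qed
  have comm: "(\<Sum>m\<in>UNIV. phi i j m * \<eta> k l m) = (\<Sum>m\<in>UNIV. \<eta> k l m * phi i j m)" by (simp add: mult.commute)
  have kd: "kdelta k i = kdelta i k" "kdelta k j = kdelta j k" "kdelta l i = kdelta i l" "kdelta l j = kdelta j l" by auto
  show ?thesis
    unfolding comm 1 kd cpsi_def
    using Yanti[of l j] Yanti[of i l] Yanti[of k j] Yanti[of i k] phi_perm[of i j k] phi_perm[of i j l] phi_perm[of i k l] phi_perm[of j k l]
    by (simp add: algebra_simps)
qed

text \<open>A skew matrix in the kernel of contraction with \<open>phi\<close> lies in the Lie algebra of $G_2$.\<close>
lemma g2_derivation: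
  assumes skew: "\<And>a b. \<beta> b a = - \<beta> a b" and ker: "\<And>k. (\<Sum>a\<in>UNIV. \<Sum>b\<in>UNIV. \<beta> a b * phi a b k) = 0"
  shows "(\<Sum>m\<in>UNIV. \<Sum>n\<in>UNIV. \<beta> m n * psi m n i a) = 2 * \<beta> i a"
    and "(\<Sum>a\<in>UNIV. \<beta> i a * phi a j k) + (\<Sum>a\<in>UNIV. \<beta> j a * phi a k i) + (\<Sum>a\<in>UNIV. \<beta> k a * phi a i j) = 0"
proof -
  show 2: "(\<Sum>m\<in>UNIV. \<Sum>n\<in>UNIV. \<beta> m n * psi m n i a) = 2 * \<beta> i a" for i a
  proof -
    \<comment> \<open>Contracting the kernel condition once more with \<open>phi\<close> and
      expanding by \<open>phi_phi\<close> exposes the eigenvalue 2.\<close>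
    have "0 = (\<Sum>k\<in>UNIV. (\<Sum>m\<in>UNIV. \<Sum>n\<in>UNIV. \<beta> m n * phi m n k) * phi i a k)" by (simp add: ker)
    also have "\<dots> = (\<Sum>m\<in>UNIV. \<Sum>n\<in>UNIV. \<beta> m n * (\<Sum>k\<in>UNIV. phi m n k * phi i a k))"
      unfolding sum_distrib_left sum_distrib_right mult.assoc
      by (subst sum.swap, rule sum.cong[OF refl], subst sum.swap) (rule refl)
    also have "\<dots> = \<beta> i a - \<beta> a i - (\<Sum>m\<in>UNIV. \<Sum>n\<in>UNIV. \<beta> m n * psi m n i a)"
      unfolding phi_phi by (simp add: right_diff_distrib sum_subtractf kdelta_mult_if)
    finally show ?thesis using skew[of i a] by simp
  qed
  have ker': "(\<Sum>m\<in>UNIV. \<Sum>n\<in>UNIV. \<beta> m n * phi m n k) = 0" for k by (rule ker)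
  have 3: "2 * (\<Sum>a\<in>UNIV. \<beta> i a * phi a j k) = - 2 * (\<Sum>a\<in>UNIV. \<beta> j a * phi a k i) - 2 * (\<Sum>a\<in>UNIV. \<beta> k a * phi a i j)"
  proof -
    have "2 * (\<Sum>a\<in>UNIV. \<beta> i a * phi a j k) = (\<Sum>a\<in>UNIV. (\<Sum>m\<in>UNIV. \<Sum>n\<in>UNIV. \<beta> m n * psi m n i a) * phi j k a)"
      unfolding 2 phi_rot[of j k] by (simp add: sum_distrib_left mult.assoc)
    also have "\<dots> = (\<Sum>m\<in>UNIV. \<Sum>n\<in>UNIV. \<beta> m n * (\<Sum>a\<in>UNIV. psi m n i a * phi j k a))"
      unfolding sum_distrib_left sum_distrib_right mult.assoc
      by (subst sum.swap, rule sum.cong[OF refl], subst sum.swap) (rule refl)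
    also have "\<dots> = (\<Sum>n\<in>UNIV. \<beta> j n * phi k n i) + (\<Sum>m\<in>UNIV. \<beta> m j * phi m k i) - (\<Sum>n\<in>UNIV. \<beta> k n * phi j n i)
        - (\<Sum>m\<in>UNIV. \<beta> m k * phi m j i)"
      unfolding psi_phi_1
      using ker'[of k] ker'[of j] by (simp add: right_diff_distrib distrib_left sum_subtractf sum.distrib kdelta_mult_if)
    also have "(\<Sum>n\<in>UNIV. \<beta> j n * phi k n i) = - (\<Sum>a\<in>UNIV. \<beta> j a * phi a k i)"
    proof -
      have "phi k n i = - phi n k i" for n by (rule phi_swap)
      then show ?thesis by (simp add: sum_negf)
    qed
    also have "(\<Sum>m\<in>UNIV. \<beta> m j * phi m k i) = - (\<Sum>a\<in>UNIV. \<beta> j a * phi a k i)"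
      unfolding skew[of j] by (simp add: sum_negf)
    also have "(\<Sum>n\<in>UNIV. \<beta> k n * phi j n i) = (\<Sum>a\<in>UNIV. \<beta> k a * phi a i j)"
    proof -
      have "phi j n i = phi n i j" for n using phi_rot[of n i j] by simp
      then show ?thesis by simp
    qed
    also have "(\<Sum>m\<in>UNIV. \<beta> m k * phi m j i) = (\<Sum>a\<in>UNIV. \<beta> k a * phi a i j)"
    proof -
      have "phi m j i = - phi m i j" for m by (rule phi_swap)
      then show ?thesis unfolding skew[of k] by (simp add: sum_negf)
    qed
    finally show ?thesis by simp
  qed
  show "(\<Sum>a\<in>UNIV. \<beta> i a * phi a j k) + (\<Sum>a\<in>UNIV. \<beta> j a * phi a k i) + (\<Sum>a\<in>UNIV. \<beta> k a * phi a i j) = 0"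
    using 3 by simp
qed

text \<open>For each \<open>p\<close> the skew matrix \<open>\<rho> p\<close> lies in the Lie
  algebra of G2, so \<open>U\<close> is skew in its first and in its last pair and satisfies the
  cyclic identity. As for a curvature tensor this implies symmetry under exchange of the pairs,
  which turns \<open>U\<close> into a contraction of \<open>phi\<close> with \<rho>. Contracting
  \<open>U\<close> with \<open>phi\<close> then gives 6 \<rho> by definition and zero by
  hypothesis.\<close>

lemma alt3_phi_kernel:
  assumes \<rho>: "alt3 \<rho>" and ker: "\<And>i j. (\<Sum>a\<in>UNIV. \<Sum>b\<in>UNIV. \<rho> i a b * phi j a b) = 0"
  shows "\<rho> i j k = 0"
proof -
  note sw = alt3D[OF \<rho>]
  define U where "U p i j k = (\<Sum>a\<in>UNIV. \<rho> p i a * phi a j k)" for p i j k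
  have ker': "(\<Sum>a\<in>UNIV. \<Sum>b\<in>UNIV. \<rho> p a b * phi a b k) = 0" for p k
    using ker[of p k] by (simp only: phi_rot[of _ _ k])
  have cyc: "U p i j k + U p j k i + U p k i j = 0" for p i j k
    unfolding U_def by (rule g2_derivation(2)[of "\<rho> p"]) (rule sw(2), rule ker')
  have a1: "U i p j k = - U p i j k" for p i j k
    unfolding U_def sw(1)[of p i] by (simp add: sum_negf)
  have a2: "U p i k j = - U p i j k" for p i j k
  proof -
    have "phi a k j = - phi a j k" for a by (rule phi_swap)
    then show ?thesis unfolding U_def by (simp add: sum_negf)
  qed
  have pair: "U j k p i = U p i j k" for p i j k
  proof -
    have "U i j k p = - U i j p k" "U i k p j = - U k i p j" "U i p j k = - U p i j k" "U j p i k = - U j p k i"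
      "U j p k i = - U p j k i" "U j i k p = - U i j k p" "U k p i j = - U p k i j" "U k i j p = - U k i p j"
      "U k j p i = - U j k p i" by (rule a1 a2)+
    then show ?thesis using cyc[of p i j k] cyc[of i j k p] cyc[of j k p i] cyc[of k p i j] by linarith
  qed
  have "6 * \<rho> p i m = (\<Sum>j\<in>UNIV. \<Sum>k\<in>UNIV. U p i j k * phi m j k)" for p i m
  proof -
    have "(\<Sum>j\<in>UNIV. \<Sum>k\<in>UNIV. U p i j k * phi m j k) = (\<Sum>a\<in>UNIV. \<rho> p i a * (\<Sum>j\<in>UNIV. \<Sum>k\<in>UNIV. phi a j k * phi m j k))"
      unfolding U_def by (rule pull2)
    then show ?thesis unfolding phi_phi_2 by (simp add: kdelta_mult_if)
  qed
  also have "(\<Sum>j\<in>UNIV. \<Sum>k\<in>UNIV. U p i j k * phi m j k) = 0" for p i m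
  proof -
    have "U p i j k = (\<Sum>a\<in>UNIV. phi a p i * \<rho> a j k)" for j k
    proof -
      have "\<rho> j k a = \<rho> a j k" for a
      proof -
        have "\<rho> j k a = - \<rho> j a k" by (rule sw)
        moreover have "\<rho> j a k = - \<rho> a j k" by (rule sw)
        ultimately show ?thesis by simp
      qed
      then have "U j k p i = (\<Sum>a\<in>UNIV. phi a p i * \<rho> a j k)"
        unfolding U_def by (simp add: mult.commute)
      then show ?thesis using pair[of j k p i] by simp
    qed
    then have "(\<Sum>j\<in>UNIV. \<Sum>k\<in>UNIV. U p i j k * phi m j k) = (\<Sum>a\<in>UNIV. phi a p i * (\<Sum>j\<in>UNIV. \<Sum>k\<in>UNIV. \<rho> a j k * phi m j k))"
      by (simp only: pull2)
    then show ?thesis by (simp only: ker) simp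
  qed
  finally show ?thesis by simp
qed

text \<open>3-forms split under G2 into pieces of dimension 1, 7 and 27, and the symmetrised
  contraction with \<open>phi\<close> annihilates just the 7-dimensional one, the contractions of
  \<open>psi\<close> with vectors. The factor 1/24 comes from \<open>ctr_psi_psi\<close>; the
  difference of both sides satisfies \<open>alt3_phi_kernel\<close>.\<close>

lemma alt3_eq_contract_psi:
  assumes \<eta>: "alt3 \<eta>"
    and ker: "\<And>i j. (\<Sum>a\<in>UNIV. \<Sum>b\<in>UNIV. \<eta> i a b * phi j a b) + (\<Sum>a\<in>UNIV. \<Sum>b\<in>UNIV. \<eta> j a b * phi i a b) = 0"
  defines "Y \<equiv> \<lambda>l. ctr \<eta> (psi l) / 24"
  shows "\<eta> i j k = (\<Sum>l\<in>UNIV. Y l * psi l i j k)"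
proof -
  define S where "S i j = (\<Sum>a\<in>UNIV. \<Sum>b\<in>UNIV. \<eta> i a b * phi j a b)" for i j
  have skew: "S j i = - S i j" for i j using ker[of i j] unfolding S_def by simp
  have ctr_S: "ctr (\<lambda>a b c. kdelta i a * phi j b c) \<eta> = S i j" for i j
    unfolding ctr_def S_def by (simp add: kdelta_mult_if mult.commute)
  \<comment> \<open>Inserting the definition of \<open>Y\<close> and expanding the product of
    \<open>phi\<close> and \<open>psi\<close> by \<open>phi_psi\<close> expresses the vector through
    the skew matrix \<open>S\<close>.\<close>
  have S24: "24 * (\<Sum>l\<in>UNIV. Y l * phi l i j) = - 3 * (S i j - S j i)" for i j
  proof -
    have "24 * (\<Sum>l\<in>UNIV. Y l * phi l i j) = (\<Sum>l\<in>UNIV. phi l i j * ctr (psi l) \<eta>)"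
      unfolding Y_def by (simp add: sum_distrib_left ctr_commute[of \<eta>] mult_ac)
    also have "\<dots> = ctr (\<lambda>a b c. \<Sum>l\<in>UNIV. phi l i j * psi l a b c) \<eta>"
      unfolding ctr_sum ..
    also have "(\<lambda>a b c. \<Sum>l\<in>UNIV. phi l i j * psi l a b c) = (\<lambda>a b c. - (kdelta i a * phi j b c + kdelta i b * phi a j c + kdelta i c * phi a b j
     - kdelta j a * phi i b c - kdelta j b * phi a i c - kdelta j c * phi a b i))"
    proof (intro ext)
      fix a b c
      have "phi l i j * psi l a b c = - (phi i j l * psi a b c l)" for l
        using phi_rot[of i j l] psi_moves(3)[of l a b c] psi_swap(1)[of a l b c] psi_swap(2)[of a l b c] psi_swap(3)[of a b l c] by simp
      then show "(\<Sum>l\<in>UNIV. phi l i j * psi l a b c) = - (kdelta i a * phi j b c + kdelta i b * phi a j c + kdelta i c * phi a b j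
         - kdelta j a * phi i b c - kdelta j b * phi a i c - kdelta j c * phi a b i)"
        by (simp only: sum_negf phi_psi)
    qed
    also have "ctr \<dots> \<eta> = - 3 * (ctr (\<lambda>a b c. kdelta i a * phi j b c) \<eta> - ctr (\<lambda>a b c. kdelta j a * phi i b c) \<eta>)"
    proof -
      let ?u = "\<lambda>i j a b c. kdelta i a * phi j b c"
      have e: "(\<lambda>a b c. - (kdelta i a * phi j b c + kdelta i b * phi a j c + kdelta i c * phi a b j
         - kdelta j a * phi i b c - kdelta j b * phi a i c - kdelta j c * phi a b i))
        = (\<lambda>a b c. - (?u i j a b c - ?u i j b a c + ?u i j c a b - ?u j i a b c + ?u j i b a c - ?u j i c a b))"
      proof (intro ext)
        fix a b c
        show "- (kdelta i a * phi j b c + kdelta i b * phi a j c + kdelta i c * phi a b j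
         - kdelta j a * phi i b c - kdelta j b * phi a i c - kdelta j c * phi a b i)
         = - (?u i j a b c - ?u i j b a c + ?u i j c a b - ?u j i a b c + ?u j i b a c - ?u j i c a b)"
          using phi_swap(1)[of a j c] phi_rot[of a b j] phi_swap(1)[of a i c] phi_rot[of a b i] by simp
      qed
      show ?thesis unfolding e ctr_minus ctr_diff ctr_add ctr_12[OF \<eta>, of "?u i j"] ctr_rot[OF \<eta>, of "?u i j"]
        ctr_12[OF \<eta>, of "?u j i"] ctr_rot[OF \<eta>, of "?u j i"] by simp
    qed
    finally show ?thesis unfolding ctr_S .
  qed
  have S: "S i j = - 4 * (\<Sum>l\<in>UNIV. Y l * phi l i j)" for i j
  proof -
    have "24 * y = - 3 * (s - s') \<Longrightarrow> s' = - s \<Longrightarrow> s = - 4 * y" for y s s' :: real by (simp add: algebra_simps)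
    then show ?thesis using S24 skew .
  qed
  define \<rho> where "\<rho> i j k = \<eta> i j k - (\<Sum>l\<in>UNIV. Y l * psi l i j k)" for i j k
  have "\<rho> i j k = 0"
  proof (rule alt3_phi_kernel)
    show "alt3 \<rho>" unfolding alt3_def
    proof (intro allI conjI)
      fix a b c
      have "psi l b a c = - psi l a b c" "psi l a c b = - psi l a b c" for l by (rule psi_swap)+
      then show "\<rho> b a c = - \<rho> a b c" "\<rho> a c b = - \<rho> a b c"
        unfolding \<rho>_def using alt3D[OF \<eta>, of b a c] alt3D[OF \<eta>, of a c b] by (simp_all add: sum_negf)
    qed
    fix i j
    have "(\<Sum>a\<in>UNIV. \<Sum>b\<in>UNIV. (\<Sum>l\<in>UNIV. Y l * psi l i a b) * phi j a b) = - 4 * (\<Sum>l\<in>UNIV. Y l * phi l i j)"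
    proof -
      have "(\<Sum>a\<in>UNIV. \<Sum>b\<in>UNIV. psi l i a b * phi j a b) = - 4 * phi l i j" for l
        using phi_psi_2[of j l i] phi_rot[of l i j] by (simp add: mult.commute)
      then show ?thesis unfolding pull2 by (simp add: sum_distrib_left mult_ac)
    qed
    then show "(\<Sum>a\<in>UNIV. \<Sum>b\<in>UNIV. \<rho> i a b * phi j a b) = 0"
      unfolding \<rho>_def left_diff_distrib sum_subtractf using S[of i j] unfolding S_def by simp
  qed
  then show ?thesis by (simp add: \<rho>_def)
qed

definition alt5 :: "(7 \<Rightarrow> 7 \<Rightarrow> 7 \<Rightarrow> 7 \<Rightarrow> 7 \<Rightarrow> real) \<Rightarrow> 7 \<Rightarrow> 7 \<Rightarrow> 7 \<Rightarrow> 7 \<Rightarrow> 7 \<Rightarrow> real" where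
  "alt5 V a b i j k = V a b i j k - V b a i j k + V i a b j k - V j a b i k + V k a b i j"

lemma ctr_alt5:
  assumes "alt3 w"
  shows "ctr (alt5 V a b) w = ctr (V a b) w - ctr (V b a) w + 3 * ctr (\<lambda>i j k. V i a b j k) w"
  using ctr_12[OF assms, of "\<lambda>i j k. V i a b j k"] ctr_rot[OF assms, of "\<lambda>i j k. V i a b j k"]
  unfolding alt5_def[abs_def] ctr_diff ctr_add by simp

section \<open>The skew part of the torsion tensor from the derivative of psi\<close>

lemma ctr_phi_left: "ctr (\<lambda>i j k. t i * phi b j k) phi = 6 * t b"
proof -
  have "ctr (\<lambda>i j k. t i * phi b j k) phi = (\<Sum>i\<in>UNIV. t i * (\<Sum>j\<in>UNIV. \<Sum>k\<in>UNIV. phi b j k * phi i j k))"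
    unfolding ctr_def by (simp add: sum_distrib_left mult.assoc)
  then show ?thesis unfolding phi_phi_2 by (simp add: kdelta_mult_if)
qed

lemma ctr_phi_phi: "ctr phi phi = 42"
  unfolding ctr_def phi_phi_2 by simp

text \<open>Here \<open>cpsi (T p)\<close> is the covariant derivative of \<open>psi\<close>, so the
  left side is d\<psi> contracted with \<open>phi\<close>, a 2-form that sees only the skew part
  \<open>S\<close> of the torsion tensor.\<close>

lemma ctr_alt5_cpsi:
  fixes T :: "7 \<Rightarrow> 7 \<Rightarrow> real"
  defines "S \<equiv> \<lambda>a b. T a b - T b a"
  shows "ctr (alt5 (\<lambda>p. cpsi (T p)) a b) phi = - 12 * S a b + 3 * (\<Sum>i\<in>UNIV. \<Sum>j\<in>UNIV. S i j * psi i j a b)"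
proof -
  have 1: "ctr (cpsi (T a) b) phi = - 24 * T a b" for a b
  proof -
    let ?u = "\<lambda>i j k. T a i * phi b j k"
    have e: "cpsi (T a) b = (\<lambda>i j k. - (T a b * phi i j k) + ?u i j k - ?u j i k + ?u k i j)"
      by (intro ext) (simp add: cpsi_def)
    show ?thesis
      unfolding e ctr_add ctr_diff ctr_minus ctr_scale ctr_12[OF alt3_phi, of ?u] ctr_rot[OF alt3_phi, of ?u] ctr_phi_left ctr_phi_phi by simp
  qed
  have 2: "ctr (\<lambda>i j k. cpsi (T i) a b j k) phi = 4 * S a b + (\<Sum>i\<in>UNIV. \<Sum>j\<in>UNIV. S i j * psi i j a b)"
  proof -
    let ?u = "\<lambda>i j k. T i j * phi a b k"
    have e: "(\<lambda>i j k. cpsi (T i) a b j k) = (\<lambda>i j k. - (T i a * phi b j k) + T i b * phi a j k - ?u i j k + ?u i k j)"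
      by (intro ext) (simp add: cpsi_def)
    have "ctr ?u phi = (\<Sum>i\<in>UNIV. \<Sum>j\<in>UNIV. T i j * (\<Sum>k\<in>UNIV. phi a b k * phi i j k))"
      unfolding ctr_def by (simp add: sum_distrib_left mult.assoc)
    also have "\<dots> = S a b - (\<Sum>i\<in>UNIV. \<Sum>j\<in>UNIV. T i j * psi a b i j)"
      unfolding phi_phi S_def by (simp add: right_diff_distrib sum_subtractf kdelta_mult_if)
    finally have u: "ctr ?u phi = S a b - (\<Sum>i\<in>UNIV. \<Sum>j\<in>UNIV. T i j * psi i j a b)"
      unfolding psi_pair[of a b] .
    have "(\<Sum>i\<in>UNIV. \<Sum>j\<in>UNIV. T j i * psi i j a b) = (\<Sum>i\<in>UNIV. \<Sum>j\<in>UNIV. T i j * psi j i a b)"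
      by (rule sum.swap)
    also have "\<dots> = - (\<Sum>i\<in>UNIV. \<Sum>j\<in>UNIV. T i j * psi i j a b)"
    proof -
      have "T i j * psi j i a b = - (T i j * psi i j a b)" for i j using psi_swap(1)[of j i a b] by simp
      then have "(\<Sum>i\<in>UNIV. \<Sum>j\<in>UNIV. T i j * psi j i a b) = (\<Sum>i\<in>UNIV. \<Sum>j\<in>UNIV. - (T i j * psi i j a b))"
        by (intro sum.cong refl)
      then show ?thesis by (simp add: sum_negf)
    qed
    finally have t: "(\<Sum>i\<in>UNIV. \<Sum>j\<in>UNIV. S i j * psi i j a b) = 2 * (\<Sum>i\<in>UNIV. \<Sum>j\<in>UNIV. T i j * psi i j a b)"
      unfolding S_def left_diff_distrib sum_subtractf by simp
    show ?thesis
      unfolding e ctr_add ctr_diff ctr_minus ctr_23[OF alt3_phi, of ?u] ctr_phi_left u t by (simp add: S_def)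
  qed
  show ?thesis unfolding ctr_alt5[OF alt3_phi] 1 2 by (simp add: S_def algebra_simps)
qed

text \<open>Let \<open>L\<close> denote contraction of a 2-form with \<open>psi\<close>. It acts as
  -4 on contractions of \<open>phi\<close> with a vector and as 2 on the kernel of contraction with
  \<open>phi\<close>. The difference \<open>R\<close> of the two sides would be an eigenvector for
  4, which is excluded by the quadratic equation \<open>(L + 4) (L - 2) = 0\<close>.\<close>

lemma psi_skew_eigen:
  fixes S t2 :: "7 \<Rightarrow> 7 \<Rightarrow> real" and t1 :: "7 \<Rightarrow> real"
  assumes S: "\<And>a b. S b a = - S a b" and t2: "\<And>a b. t2 b a = - t2 a b"
    and ker: "\<And>k. (\<Sum>a\<in>UNIV. \<Sum>b\<in>UNIV. t2 a b * phi a b k) = 0"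
    and eq: "\<And>a b. - 12 * S a b + 3 * (\<Sum>i\<in>UNIV. \<Sum>j\<in>UNIV. S i j * psi i j a b) = - 48 * (\<Sum>l\<in>UNIV. t1 l * phi l a b) + 6 * t2 a b"
  shows "S a b = 2 * (\<Sum>l\<in>UNIV. t1 l * phi l a b) - t2 a b"
proof -
  define t where "t a b = (\<Sum>l\<in>UNIV. t1 l * phi l a b)" for a b
  define R where "R a b = S a b - 2 * t a b + t2 a b" for a b
  define L where "L B a b = (\<Sum>i\<in>UNIV. \<Sum>j\<in>UNIV. B i j * psi i j a b)" for B a b
  have Lt: "L t a b = - 4 * t a b" for a b
  proof -
    have "L t a b = (\<Sum>l\<in>UNIV. t1 l * (\<Sum>i\<in>UNIV. \<Sum>j\<in>UNIV. phi l i j * psi i j a b))"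
      unfolding L_def t_def by (rule pull2)
    moreover have "psi i j a b = psi a b i j" for i j by (rule psi_pair)
    ultimately have "L t a b = (\<Sum>l\<in>UNIV. t1 l * (\<Sum>i\<in>UNIV. \<Sum>j\<in>UNIV. phi l i j * psi a b i j))" by simp
    then show ?thesis unfolding phi_psi_2 t_def by (simp add: sum_distrib_left mult_ac)
  qed
  have Lt2: "L t2 a b = 2 * t2 a b" for a b
    unfolding L_def by (rule g2_derivation(1)[OF t2 ker])
  have LR: "L R a b = 4 * R a b" for a b
  proof -
    have "L R a b = L S a b - 2 * L t a b + L t2 a b"
      unfolding L_def R_def by (simp add: left_diff_distrib distrib_right sum.distrib sum_subtractf sum_distrib_left mult.assoc)
    moreover have "- 12 * S a b + 3 * L S a b = - 48 * t a b + 6 * t2 a b"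
      using eq[of a b] unfolding L_def t_def .
    ultimately show ?thesis unfolding Lt Lt2 R_def by simp
  qed
  have tskew: "t b a = - t a b" for a b
  proof -
    have "phi l b a = - phi l a b" for l by (rule phi_swap)
    then show ?thesis unfolding t_def by (simp add: sum_negf)
  qed
  have Rskew: "R b a = - R a b" for a b
    unfolding R_def S[of b a] t2[of b a] tskew[of b a] by simp
  \<comment> \<open>Applies \<open>L\<close> twice; by \<open>psi_psi_2\<close> its square is
    \<open>8 - 2 L\<close> on skew matrices.\<close>
  have "4 * L R a b = 8 * R a b - 2 * L R a b" for a b
  proof -
    have "4 * L R a b = (\<Sum>m\<in>UNIV. \<Sum>n\<in>UNIV. L R m n * psi m n a b)"
    proof -
      have "(\<Sum>m\<in>UNIV. \<Sum>n\<in>UNIV. (4 * R m n) * psi m n a b) = 4 * L R a b"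
        unfolding L_def by (simp only: sum_distrib_left mult.assoc)
      then show ?thesis by (simp only: LR)
    qed
    also have "\<dots> = (\<Sum>m\<in>UNIV. \<Sum>n\<in>UNIV. \<Sum>i\<in>UNIV. \<Sum>j\<in>UNIV. R i j * (psi i j m n * psi a b m n))"
    proof -
      have "psi m n a b = psi a b m n" for m n by (rule psi_pair)
      then show ?thesis unfolding L_def by (simp only: sum_distrib_right mult.assoc)
    qed
    also have "\<dots> = (\<Sum>i\<in>UNIV. \<Sum>j\<in>UNIV. \<Sum>m\<in>UNIV. \<Sum>n\<in>UNIV. R i j * (psi i j m n * psi a b m n))"
      by (rule sum_swap22)
    also have "\<dots> = (\<Sum>i\<in>UNIV. \<Sum>j\<in>UNIV. R i j * (4 * (kdelta i a * kdelta j b) - 4 * (kdelta i b * kdelta j a) - 2 * psi i j a b))"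
      unfolding sum_distrib_left[symmetric] psi_psi_2 ..
    also have "\<dots> = 4 * R a b - 4 * R b a - 2 * L R a b"
      unfolding L_def by (simp add: right_diff_distrib sum_subtractf kdelta_mult_if sum_distrib_left mult.left_commute[of _ 2])
    finally show ?thesis using Rskew[of a b] by simp
  qed
  then have "R a b = 0" using LR[of a b] by (smt (verit))
  then show ?thesis by (simp add: R_def t_def)
qed

section \<open>The evolution equations in an adapted frame\<close>

lemma alt4_add: "alt4 (\<lambda>p i j k. V p i j k + W p i j k) = (\<lambda>p i j k. alt4 V p i j k + alt4 W p i j k)"
  by (intro ext) (simp add: alt4_def)

text \<open>Letting \<open>h\<close> act on the three form slots before antisymmetrising differs
  from letting it act on all four slots of d\<phi> precisely by its action on the derivative index,
  which replaces the torsion by the product \<open>h T\<close>.\<close>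

lemma alt4_h_action:
  fixes h T :: "7 \<Rightarrow> 7 \<Rightarrow> real"
  defines "TP \<equiv> \<lambda>p i j k. \<Sum>q\<in>UNIV. T p q * psi q i j k"
  shows "alt4 (\<lambda>p i j k. (\<Sum>l\<in>UNIV. h i l * TP p l j k) + (\<Sum>l\<in>UNIV. h j l * TP p i l k) + (\<Sum>l\<in>UNIV. h k l * TP p i j l)) p i j k
     - ((\<Sum>l\<in>UNIV. h p l * dia T l i j k) + (\<Sum>l\<in>UNIV. h i l * dia T p l j k) + (\<Sum>l\<in>UNIV. h j l * dia T p i l k)
        + (\<Sum>l\<in>UNIV. h k l * dia T p i j l))
     = - dia (\<lambda>p q. \<Sum>l\<in>UNIV. h p l * T l q) p i j k"
proof -
  have hT: "(\<Sum>q\<in>UNIV. (\<Sum>l\<in>UNIV. h p l * T l q) * psi q i j k) = (\<Sum>l\<in>UNIV. h p l * TP l i j k)" for p i j k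
    unfolding TP_def by (rule pull1)
  show ?thesis
    unfolding dia_alt4 TP_def[symmetric] alt4_def hT
    by (simp add: right_diff_distrib distrib_left sum_subtractf sum.distrib)
qed

text \<open>The algebra behind both evolution equations. \<open>V\<close> is the covariant
  derivative of the velocity of \<phi>, \<open>D'\<close> the derivative of d\<phi> in the moved
  frame, and \<open>K\<close> the derivative of its contraction with \<psi>. The left side of the
  second claim is the derivative of \<open>2 \<tau>0 g\<close> minus the symmetrised contraction
  over 24, plus the two products that undo the motion of the frame.\<close>

lemma frame_evolution:
  fixes h t2 t3 DX :: "7 \<Rightarrow> 7 \<Rightarrow> real" and H :: "7 \<Rightarrow> 7 \<Rightarrow> 7 \<Rightarrow> real" and X \<tau>1 :: "7 \<Rightarrow> real" and \<tau>0 :: real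
  assumes h: "\<And>a b. h b a = h a b" and H: "\<And>p a b. H p b a = H p a b" and t3: "\<And>a b. t3 b a = t3 a b"
    and tr3: "(\<Sum>a\<in>UNIV. t3 a a) = 0"
    and t2: "\<And>a b. t2 b a = - t2 a b" and ker: "\<And>k. (\<Sum>a\<in>UNIV. \<Sum>b\<in>UNIV. t2 a b * phi a b k) = 0"
  defines "t1 \<equiv> \<lambda>a b. \<Sum>l\<in>UNIV. \<tau>1 l * phi l a b" and "XX \<equiv> \<lambda>a b. \<Sum>l\<in>UNIV. X l * phi l a b"
  assumes T: "\<And>a b. T a b = \<tau>0 / 4 * kdelta a b - t3 a b + t1 a b - t2 a b / 2"
  defines "TP \<equiv> \<lambda>p i j k. \<Sum>q\<in>UNIV. T p q * psi q i j k"
  assumes V: "\<And>p i j k. V p i j k =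
      ((\<Sum>l\<in>UNIV. H p i l * phi l j k) + (\<Sum>l\<in>UNIV. H p j l * phi i l k) + (\<Sum>l\<in>UNIV. H p k l * phi i j l))
      + ((\<Sum>l\<in>UNIV. h i l * TP p l j k) + (\<Sum>l\<in>UNIV. h j l * TP p i l k) + (\<Sum>l\<in>UNIV. h k l * TP p i j l))
      + ((\<Sum>l\<in>UNIV. DX p l * psi l i j k) + (\<Sum>l\<in>UNIV. X l * cpsi (T p) l i j k))"
    and D': "\<And>p i j k. D' p i j k = alt4 V p i j k
     - ((\<Sum>l\<in>UNIV. h p l * dia T l i j k) + (\<Sum>l\<in>UNIV. h i l * dia T p l j k) + (\<Sum>l\<in>UNIV. h j l * dia T p i l k)
        + (\<Sum>l\<in>UNIV. h k l * dia T p i j l))"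
    and K: "\<And>p q. K p q = ctr (D' p) (psi q) + ctr (dia T p) (cpsi X q)"
    and t0': "t0' = (\<Sum>p\<in>UNIV. K p p) / 168"
  defines "trh \<equiv> \<Sum>a\<in>UNIV. h a a" and "ht3 \<equiv> \<Sum>a\<in>UNIV. \<Sum>b\<in>UNIV. h a b * t3 a b"
    and "xt1 \<equiv> \<Sum>a\<in>UNIV. \<Sum>b\<in>UNIV. XX a b * t1 a b" and "divX \<equiv> \<Sum>a\<in>UNIV. DX a a"
    and "mul \<equiv> \<lambda>A B p q. \<Sum>l\<in>UNIV. A p l * B l q :: real"
    and "cu \<equiv> \<lambda>p q. \<Sum>k\<in>UNIV. \<Sum>l\<in>UNIV. H k l p * phi k l q"
  shows "t0' = - 1/7 * trh * \<tau>0 + 4/7 * ht3 - 4/7 * xt1 + 4/7 * divX"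
    and "2 * t0' * kdelta p q - (K p q + K q p) / 24 + mul h t3 p q + mul t3 h p q =
      (- 1/28 * trh * \<tau>0 + 1/7 * ht3 - 1/7 * xt1 + 1/7 * divX) * kdelta p q
      + 1/4 * \<tau>0 * h p q + 1/2 * (mul h t3 p q + mul t3 h p q)
      + 1/2 * (mul h t1 p q - mul t1 h p q) - 1/4 * (mul h t2 p q - mul t2 h p q)
      - 1/2 * (mul XX t3 p q - mul t3 XX p q) - 1/2 * (mul XX t1 p q + mul t1 XX p q)
      + 1/4 * (mul XX t2 p q + mul t2 XX p q) - 1/2 * cu p q - 1/2 * cu q p - 1/2 * (DX p q + DX q p)"
proof -
  \<comment> \<open>The derivative of \<open>X\<close> and the term \<open>- h T\<close> from
    \<open>alt4_h_action\<close> both act on \<open>psi\<close> as derivations, so they are handled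
    as one matrix.\<close>
  define M where "M p q = DX p q - mul h T p q" for p q
  define VH where "VH p i j k = (\<Sum>l\<in>UNIV. H p i l * phi l j k) + (\<Sum>l\<in>UNIV. H p j l * phi i l k) + (\<Sum>l\<in>UNIV. H p k l * phi i j l)" for p i j k
  define VX where "VX p i j k = (\<Sum>l\<in>UNIV. X l * cpsi (T p) l i j k)" for p i j k
  have skew1: "t1 b a = - t1 a b" "XX b a = - XX a b" for a b
  proof -
    have "phi l b a = - phi l a b" for l by (rule phi_swap)
    then show "t1 b a = - t1 a b" "XX b a = - XX a b" unfolding t1_def XX_def by (simp_all add: sum_negf)
  qed
  have D'_eq: "D' p = (\<lambda>i j k. alt4 VH p i j k + dia M p i j k + alt4 VX p i j k)" for p
  proof (intro ext)
    fix i j k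
    let ?U = "\<lambda>p i j k. (\<Sum>l\<in>UNIV. h i l * TP p l j k) + (\<Sum>l\<in>UNIV. h j l * TP p i l k) + (\<Sum>l\<in>UNIV. h k l * TP p i j l)"
    have "V = (\<lambda>p i j k. VH p i j k + ?U p i j k + ((\<Sum>l\<in>UNIV. DX p l * psi l i j k) + VX p i j k))"
      by (intro ext) (simp add: V VH_def VX_def)
    then have "alt4 V p i j k = alt4 VH p i j k + alt4 ?U p i j k + (dia DX p i j k + alt4 VX p i j k)"
      by (simp only: alt4_add dia_alt4)
    moreover have act: "alt4 ?U p i j k
     - ((\<Sum>l\<in>UNIV. h p l * dia T l i j k) + (\<Sum>l\<in>UNIV. h i l * dia T p l j k) + (\<Sum>l\<in>UNIV. h j l * dia T p i l k)
        + (\<Sum>l\<in>UNIV. h k l * dia T p i j l)) = - dia (mul h T) p i j k"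
      unfolding TP_def mul_def by (rule alt4_h_action)
    moreover have "dia M p i j k = dia DX p i j k - dia (mul h T) p i j k"
      unfolding M_def dia_def by (simp add: left_diff_distrib sum_subtractf)
    ultimately show "D' p i j k = alt4 VH p i j k + dia M p i j k + alt4 VX p i j k"
      using act unfolding D' by linarith
  qed
  define A where "A p q = (\<Sum>a\<in>UNIV. T p a * XX q a)" for p q
  define tt where "tt = (\<Sum>a\<in>UNIV. \<Sum>b\<in>UNIV. T a b * XX a b)"
  define trM where "trM = (\<Sum>a\<in>UNIV. M a a)"
  have S: "K p q + K q p = 12 * (cu p q + cu q p) + (12 * (M p q + M q p) + 24 * kdelta p q * trM)
      - 12 * (A p q + A q p) - 24 * kdelta p q * tt" for p q
  proof -
    have "K p q + K q p = (ctr (alt4 VH p) (psi q) + ctr (alt4 VH q) (psi p)) + (ctr (dia M p) (psi q) + ctr (dia M q) (psi p))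
      + ((ctr (alt4 VX p) (psi q) + ctr (dia T p) (cpsi X q)) + (ctr (alt4 VX q) (psi p) + ctr (dia T q) (cpsi X p)))"
      unfolding K D'_eq ctr_add by simp
    moreover have "ctr (alt4 VH p) (psi q) + ctr (alt4 VH q) (psi p) = 12 * (cu p q + cu q p)"
      unfolding cu_def VH_def[abs_def] by (rule ctr_alt4_sym2) (rule H)
    moreover have "ctr (dia M p) (psi q) + ctr (dia M q) (psi p) = 12 * (M p q + M q p) + 24 * kdelta p q * trM"
      unfolding trM_def by (rule ctr_dia_sym)
    moreover have "(ctr (alt4 VX p) (psi q) + ctr (dia T p) (cpsi X q)) + (ctr (alt4 VX q) (psi p) + ctr (dia T q) (cpsi X p))
      = - 12 * (A p q + A q p) - 24 * kdelta p q * tt"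
      unfolding A_def tt_def VX_def[abs_def] XX_def by (rule ctr_torsion_sym)
    ultimately show ?thesis by linarith
  qed
  have hT: "mul h T p q = \<tau>0 / 4 * h p q - mul h t3 p q + mul h t1 p q - mul h t2 p q / 2" for p q
    unfolding mul_def T by (simp add: right_diff_distrib distrib_left sum_subtractf sum.distrib kdelta_mult_if sum_divide_distrib)
  have hT': "mul h t3 q p = mul t3 h p q" "mul h t1 q p = - mul t1 h p q" "mul h t2 q p = - mul t2 h p q" for p q
  proof -
    have "h q l * t3 l p = t3 p l * h l q" "h q l * t1 l p = - (t1 p l * h l q)" "h q l * t2 l p = - (t2 p l * h l q)" for l
      using h[of l q] t3[of p l] skew1(1)[of p l] t2[of p l] by simp_all
    then show "mul h t3 q p = mul t3 h p q" "mul h t1 q p = - mul t1 h p q" "mul h t2 q p = - mul t2 h p q"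
      unfolding mul_def by (simp_all add: sum_negf)
  qed
  have Aeq: "A p q = - (\<tau>0 / 4 * XX p q - mul t3 XX p q + mul t1 XX p q - mul t2 XX p q / 2)" for p q
  proof -
    have "A p q = (\<Sum>a\<in>UNIV. - (T p a * XX a q))"
      unfolding A_def by (intro sum.cong refl) (simp add: skew1(2)[of _ q])
    then show ?thesis
      unfolding mul_def T by (simp add: left_diff_distrib distrib_right sum_subtractf sum.distrib kdelta_mult_if sum_divide_distrib sum_negf)
  qed
  have Aeq': "A q p = \<tau>0 / 4 * XX p q - mul XX t3 p q - mul XX t1 p q + mul XX t2 p q / 2" for p q
  proof -
    have "A q p = (\<Sum>a\<in>UNIV. XX p a * (\<tau>0 / 4 * kdelta a q - t3 a q - t1 a q + t2 a q / 2))"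
    proof -
      have "T q a * XX p a = XX p a * (\<tau>0 / 4 * kdelta a q - t3 a q - t1 a q + t2 a q / 2)" for a
        using t3[of q a] skew1(1)[of q a] t2[of q a] by (auto simp: T)
      then show ?thesis unfolding A_def by (intro sum.cong refl)
    qed
    then show ?thesis
      unfolding mul_def by (simp add: right_diff_distrib distrib_left sum_subtractf sum.distrib kdelta_mult_if sum_divide_distrib)
  qed
  have tt: "tt = xt1"
  proof -
    have "tt = (\<Sum>a\<in>UNIV. \<Sum>b\<in>UNIV. \<tau>0 / 4 * kdelta a b * XX a b) - (\<Sum>a\<in>UNIV. \<Sum>b\<in>UNIV. t3 a b * XX a b)
        + (\<Sum>a\<in>UNIV. \<Sum>b\<in>UNIV. t1 a b * XX a b) - (\<Sum>a\<in>UNIV. \<Sum>b\<in>UNIV. t2 a b * XX a b) / 2"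
      unfolding tt_def T by (simp add: left_diff_distrib distrib_right sum_subtractf sum.distrib sum_divide_distrib)
    also have "(\<Sum>a\<in>UNIV. \<Sum>b\<in>UNIV. \<tau>0 / 4 * kdelta a b * XX a b) = 0"
    proof -
      have "XX a a = 0" for a using skew1(2)[of a a] by simp
      then show ?thesis by (simp add: kdelta_mult_if)
    qed
    also have "(\<Sum>a\<in>UNIV. \<Sum>b\<in>UNIV. t3 a b * XX a b) = 0"
    proof (rule sum_antisym_eq_0)
      fix a b show "t3 b a * XX b a = - (t3 a b * XX a b)" using t3[of a b] skew1(2)[of a b] by simp
    qed
    also have "(\<Sum>a\<in>UNIV. \<Sum>b\<in>UNIV. t2 a b * XX a b) = 0"
    proof -
      have "(\<Sum>a\<in>UNIV. \<Sum>b\<in>UNIV. t2 a b * XX a b) = (\<Sum>a\<in>UNIV. \<Sum>b\<in>UNIV. (\<Sum>l\<in>UNIV. X l * phi l a b) * t2 a b)"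
        unfolding XX_def by (simp add: mult.commute)
      also have "\<dots> = (\<Sum>l\<in>UNIV. X l * (\<Sum>a\<in>UNIV. \<Sum>b\<in>UNIV. phi l a b * t2 a b))" by (rule pull2)
      also have "\<dots> = (\<Sum>l\<in>UNIV. X l * (\<Sum>a\<in>UNIV. \<Sum>b\<in>UNIV. t2 a b * phi a b l))"
      proof -
        have "phi l a b * t2 a b = t2 a b * phi a b l" for l a b using phi_rot[of a b l] by simp
        then show ?thesis by (simp only:)
      qed
      finally show ?thesis by (simp add: ker)
    qed
    finally show ?thesis unfolding xt1_def by (simp add: mult.commute)
  qed
  have trM: "trM = divX - \<tau>0 / 4 * trh + ht3"
  proof -
    have "(\<Sum>p\<in>UNIV. mul h t1 p p) = 0" "(\<Sum>p\<in>UNIV. mul h t2 p p) = 0"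
    proof -
      have "h l p * t1 p l = - (h p l * t1 l p)" "h l p * t2 p l = - (h p l * t2 l p)" for l p
        using h[of p l] skew1(1)[of l p] t2[of l p] by simp_all
      note * = this
      show "(\<Sum>p\<in>UNIV. mul h t1 p p) = 0" "(\<Sum>p\<in>UNIV. mul h t2 p p) = 0"
        unfolding mul_def by (rule sum_antisym_eq_0, rule *)+
    qed
    moreover have "(\<Sum>p\<in>UNIV. mul h t3 p p) = ht3"
      unfolding mul_def ht3_def by (intro sum.cong refl arg_cong2[of _ _ _ _ "(*)"] t3)
    ultimately show ?thesis
      unfolding trM_def M_def hT divX_def trh_def
      by (simp add: sum_subtractf sum.distrib sum_divide_distrib[symmetric] sum_distrib_left)
  qed
  \<comment> \<open>Doubling the trace makes the symmetrised formula \<open>S\<close> applicable, as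
    \<open>K\<close> itself is not known to be symmetric.\<close>
  have "2 * (\<Sum>p\<in>UNIV. K p p) = (\<Sum>p\<in>UNIV. K p p + K p p)" by (simp add: sum_distrib_left)
  also have "\<dots> = (\<Sum>p\<in>UNIV. 24 * cu p p + 24 * M p p + 24 * trM - 24 * A p p - 24 * tt)"
    unfolding S by (simp add: add.assoc)
  also have "\<dots> = 24 * (\<Sum>p\<in>UNIV. cu p p) + 24 * trM + 168 * trM - 24 * (\<Sum>p\<in>UNIV. A p p) - 168 * tt"
    by (simp add: sum.distrib sum_subtractf sum_distrib_left trM_def)
  also have "(\<Sum>p\<in>UNIV. cu p p) = 0"
  proof -
    have *: "(\<Sum>p\<in>UNIV. cu p p) = (\<Sum>k\<in>UNIV. \<Sum>p\<in>UNIV. \<Sum>l\<in>UNIV. H k l p * phi k l p)"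
      unfolding cu_def by (rule sum.swap)
    have "(\<Sum>p\<in>UNIV. \<Sum>l\<in>UNIV. H k l p * phi k l p) = 0" for k
    proof (rule sum_antisym_eq_0)
      fix l p show "H k p l * phi k p l = - (H k l p * phi k l p)"
        using H[of k p l] phi_swap(2)[of k p l] by simp
    qed
    then show ?thesis unfolding * by simp
  qed
  also have "(\<Sum>p\<in>UNIV. A p p) = tt" unfolding A_def tt_def ..
  \<comment> \<open>The quotient 96/168 = 4/7 is the coefficient in the evolution of \<tau>0. In the
    multiple of the metric in the evolution of \<tau>3 it enters as 2 * 4/7 - 1 = 1/7.\<close>
  finally have K168: "(\<Sum>p\<in>UNIV. K p p) = 96 * trM - 96 * tt" by simp
  show 0: "t0' = - 1/7 * trh * \<tau>0 + 4/7 * ht3 - 4/7 * xt1 + 4/7 * divX"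
    unfolding t0' K168 trM tt by simp
  show "2 * t0' * kdelta p q - (K p q + K q p) / 24 + mul h t3 p q + mul t3 h p q =
      (- 1/28 * trh * \<tau>0 + 1/7 * ht3 - 1/7 * xt1 + 1/7 * divX) * kdelta p q
      + 1/4 * \<tau>0 * h p q + 1/2 * (mul h t3 p q + mul t3 h p q)
      + 1/2 * (mul h t1 p q - mul t1 h p q) - 1/4 * (mul h t2 p q - mul t2 h p q)
      - 1/2 * (mul XX t3 p q - mul t3 XX p q) - 1/2 * (mul XX t1 p q + mul t1 XX p q)
      + 1/4 * (mul XX t2 p q + mul t2 XX p q) - 1/2 * cu p q - 1/2 * cu q p - 1/2 * (DX p q + DX q p)"
    unfolding S 0 trM tt M_def hT[of p q] hT[of q p] hT' Aeq[of p q] Aeq'[of q p] h[of p q]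
    by (simp add: field_simps)
qed

text \<open>Infinitesimal form of \<open>pullback_7_det\<close>: a derivation acts on forms of top
  degree by its trace. Replacing an entry of a rearrangement by any other index creates a
  repetition, so only the diagonal terms are left.\<close>

lemma alternating_list_update_sum:
  assumes T: "alternating 7 T" and L: "length L = 7"
  shows "(\<Sum>r<7. \<Sum>q\<in>UNIV. A q (L ! r) * T (L[r := q])) = (\<Sum>a\<in>UNIV. A a a) * T L"
proof (cases "distinct L")
  case True
  have "set L = UNIV" using L True by (intro card_subset_eq) (auto simp: distinct_card)
  then have bij: "bij_betw ((!) L) {..<7} UNIV"
    using bij_betw_nth[OF True, of "{..<7}" UNIV] L by simp
  have "(\<Sum>q\<in>UNIV. A q (L ! r) * T (L[r := q])) = A (L ! r) (L ! r) * T L" if r: "r < 7" for r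
  proof -
    have "T (L[r := q]) = 0" if "q \<noteq> L ! r" for q
    proof (rule alternating_not_distinct[OF T])
      have "q \<in> set L" using \<open>set L = UNIV\<close> by simp
      then obtain s where s: "s < 7" "L ! s = q" using L by (auto simp: in_set_conv_nth)
      then have "s \<noteq> r" using that by auto
      then have "L[r := q] ! r = L[r := q] ! s" using s r L by simp
      then show "\<not> distinct (L[r := q])" using \<open>s \<noteq> r\<close> s r L by (metis length_list_update nth_eq_iff_index_eq)
    qed (simp add: L)
    then have "(\<Sum>q\<in>UNIV. A q (L ! r) * T (L[r := q])) = (\<Sum>q\<in>{L ! r}. A q (L ! r) * T (L[r := q]))"
      by (intro sum.mono_neutral_right) auto
    then show ?thesis by simp
  qed
  then have "(\<Sum>r<7. \<Sum>q\<in>UNIV. A q (L ! r) * T (L[r := q])) = (\<Sum>r<7. A (L ! r) (L ! r)) * T L"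
    unfolding sum_distrib_right by (intro sum.cong refl) simp
  also have "(\<Sum>r<7. A (L ! r) (L ! r)) = (\<Sum>a\<in>UNIV. A a a)"
    by (rule sum.reindex_bij_betw[OF bij, of "\<lambda>a. A a a"])
  finally show ?thesis .
next
  case False
  then obtain a b where ab: "a < 7" "b < 7" "a \<noteq> b" "L ! a = L ! b"
    using L by (auto simp: distinct_conv_nth)
  have "T (L[r := q]) = 0" if "r < 7" "r \<noteq> a" "r \<noteq> b" for r q
  proof (rule alternating_not_distinct[OF T])
    have "L[r := q] ! a = L[r := q] ! b" using ab that L by simp
    then show "\<not> distinct (L[r := q])" using ab L by (metis length_list_update nth_eq_iff_index_eq)
  qed (simp add: L)
  then have "(\<Sum>r<7. \<Sum>q\<in>UNIV. A q (L ! r) * T (L[r := q])) = (\<Sum>r\<in>{a, b}. \<Sum>q\<in>UNIV. A q (L ! r) * T (L[r := q]))"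
    using ab by (intro sum.mono_neutral_right) auto
  also have "\<dots> = 0"
  proof -
    have "T (L[b := q]) = - T (L[a := q])" for q
    proof -
      have "permute_list (Transposition.transpose a b) (L[a := q]) = L[b := q]"
        using ab L by (intro nth_equalityI) (auto simp: permute_list_def Transposition.transpose_def nth_list_update simp del: upt_Suc)
      then show ?thesis using alternating_swap[OF T, of "L[a := q]" a b] ab L by simp
    qed
    then show ?thesis using ab by (simp add: sum_negf)
  qed
  finally show ?thesis using alternating_not_distinct[OF T L False] by simp
qed

text \<open>A traceless symmetric matrix annihilates the volume form as a derivation, and symmetry
  lets it move from the slots of \<open>phi\<close> to those of \<open>vol\<close>. Hence the Hodge
  star turns its action on \<open>phi\<close> into minus its action on \<open>psi\<close>; the
  factor 6 is the missing normalisation of the star.\<close>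

lemma star_sym_phi:
  assumes vol: "alternating 7 vol" "vol indices = -1"
    and t3: "\<And>a b. t3 b a = t3 a b" and tr: "(\<Sum>a\<in>UNIV. t3 a a) = 0"
  shows "ctr (\<lambda>a b c. vol [a, b, c, i, j, k, l])
     (\<lambda>a b c. (\<Sum>l\<in>UNIV. t3 a l * phi l b c) + (\<Sum>l\<in>UNIV. t3 b l * phi a l c) + (\<Sum>l\<in>UNIV. t3 c l * phi a b l)) = - 6 * dia t3 i j k l"
proof -
  note s = swap_7[OF vol(1)]
  define v where "v i j k l a b c = vol [a, b, c, i, j, k, l]" for i j k l a b c
  have alt: "alt3 (v i j k l)" for i j k l
    unfolding alt3_def v_def using s(1,2) by blast
  have psi: "ctr phi (v i j k l) = 6 * psi i j k l" for i j k l
    using star_phi0[OF vol, of i j k l]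
    unfolding contr_kdelta sum_lists_3 ctr_def v_def phi_def by (simp add: mult.commute)
  let ?u = "\<lambda>a b c. \<Sum>l\<in>UNIV. t3 a l * phi l b c"
  have 1: "(\<lambda>a b c. ?u a b c + (\<Sum>l\<in>UNIV. t3 b l * phi a l c) + (\<Sum>l\<in>UNIV. t3 c l * phi a b l)) = (\<lambda>a b c. ?u a b c - ?u b a c + ?u c a b)"
  proof (intro ext)
    fix a b c
    have "phi a l c = - phi l a c" "phi a b l = phi l a b" for l
      using phi_swap(1)[of l a c] phi_rot[of a b l] by simp_all
    then show "?u a b c + (\<Sum>l\<in>UNIV. t3 b l * phi a l c) + (\<Sum>l\<in>UNIV. t3 c l * phi a b l) = ?u a b c - ?u b a c + ?u c a b"
      by (simp add: sum_negf)
  qed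
  let ?w = "\<lambda>r b c. \<Sum>a\<in>UNIV. t3 a r * v i j k l a b c"
  have E: "ctr ?u (v i j k l) = ctr ?w phi"
  proof -
    have "ctr ?u (v i j k l) = (\<Sum>a\<in>UNIV. \<Sum>r\<in>UNIV. t3 a r * (\<Sum>b\<in>UNIV. \<Sum>c\<in>UNIV. phi r b c * v i j k l a b c))"
      unfolding ctr_def pull2 ..
    also have "\<dots> = (\<Sum>r\<in>UNIV. \<Sum>a\<in>UNIV. t3 a r * (\<Sum>b\<in>UNIV. \<Sum>c\<in>UNIV. v i j k l a b c * phi r b c))"
      by (subst sum.swap) (simp only: mult.commute[of "phi _ _ _"])
    finally show ?thesis unfolding ctr_def pull2 .
  qed
  \<comment> \<open>By tracelessness the action on all seven slots vanishes, so the first three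
    slots can be exchanged for the last four.\<close>
  have lie: "?w a b c - ?w b a c + ?w c a b = - ((\<Sum>q\<in>UNIV. t3 i q * v q j k l a b c) + (\<Sum>q\<in>UNIV. t3 j q * v i q k l a b c)
     + (\<Sum>q\<in>UNIV. t3 k q * v i j q l a b c) + (\<Sum>q\<in>UNIV. t3 l q * v i j k q a b c))" for a b c
  proof -
    have "(\<Sum>r<7. \<Sum>q\<in>UNIV. t3 q ([a, b, c, i, j, k, l] ! r) * vol ([a, b, c, i, j, k, l][r := q])) = 0"
      using alternating_list_update_sum[OF vol(1), of "[a, b, c, i, j, k, l]" t3] tr by simp
    then have "(\<Sum>q\<in>UNIV. t3 q a * v i j k l q b c) + (\<Sum>q\<in>UNIV. t3 q b * v i j k l a q c) + (\<Sum>q\<in>UNIV. t3 q c * v i j k l a b q)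
      + (\<Sum>q\<in>UNIV. t3 q i * v q j k l a b c) + (\<Sum>q\<in>UNIV. t3 q j * v i q k l a b c)
      + (\<Sum>q\<in>UNIV. t3 q k * v i j q l a b c) + (\<Sum>q\<in>UNIV. t3 q l * v i j k q a b c) = 0"
      by (simp add: v_def numeral_eq_Suc)
    moreover have sym: "(\<Sum>q\<in>UNIV. t3 q x * F q) = (\<Sum>q\<in>UNIV. t3 x q * F q)" for x and F :: "7 \<Rightarrow> real"
      by (intro sum.cong refl arg_cong2[of _ _ _ _ "(*)"] t3)
    moreover have "v i j k l a q c = - v i j k l q a c" "v i j k l a b q = v i j k l q a b" for q
      using alt3D[OF alt[of i j k l]] by (blast, metis minus_minus)
    ultimately show ?thesis unfolding sym[of i] sym[of j] sym[of k] sym[of l] by (simp add: sum_negf)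
  qed
  have "3 * ctr ?w phi = ctr (\<lambda>a b c. ?w a b c - ?w b a c + ?w c a b) phi"
    unfolding ctr_add ctr_diff ctr_12[OF alt3_phi, of ?w] ctr_rot[OF alt3_phi, of ?w] by simp
  also have "\<dots> = - 6 * dia t3 i j k l"
    unfolding lie ctr_minus ctr_add ctr_sum
    unfolding ctr_commute[of _ phi] psi dia_def by (simp add: sum_distrib_left distrib_left mult.left_commute sum_negf)
  finally show ?thesis
    unfolding 1 v_def[symmetric] unfolding ctr_commute[of "v i j k l"] ctr_add ctr_diff ctr_12[OF alt, of ?u] ctr_rot[OF alt, of ?u]
    using E by simp
qed

text \<open>Contracting the star of a 2-form with \<open>phi\<close> amounts to contracting the
  2-form with \<open>psi\<close>; on the 14-dimensional piece the eigenvalue 2 makes this 3 *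
  2.\<close>

lemma star_two_form_phi:
  assumes vol: "alternating 7 vol" "vol indices = -1" and t2: "\<And>a b. t2 b a = - t2 a b"
    and ker: "\<And>k. (\<Sum>a\<in>UNIV. \<Sum>b\<in>UNIV. t2 a b * phi a b k) = 0"
  shows "ctr (\<lambda>i j k. 1 / 2 * (\<Sum>c\<in>UNIV. \<Sum>d\<in>UNIV. vol [c, d, a, b, i, j, k] * t2 c d)) phi = 6 * t2 a b"
proof -
  have psi: "ctr (\<lambda>i j k. vol [c, d, a, b, i, j, k]) phi = 6 * psi c d a b" for c d
    using star_phi0[OF vol, of c d a b] swap_7_block[OF vol(1), of c d a b]
    unfolding contr_kdelta sum_lists_3 ctr_def phi_def by simp
  have "ctr (\<lambda>i j k. 1 / 2 * (\<Sum>c\<in>UNIV. \<Sum>d\<in>UNIV. vol [c, d, a, b, i, j, k] * t2 c d)) phi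
     = 1 / 2 * (\<Sum>c\<in>UNIV. \<Sum>d\<in>UNIV. t2 c d * ctr (\<lambda>i j k. vol [c, d, a, b, i, j, k]) phi)"
    unfolding ctr_scale mult.commute[of "vol _"]
    using ctr_sum[of "\<lambda>_. 1" "\<lambda>c i j k. \<Sum>d\<in>UNIV. t2 c d * vol [c, d, a, b, i, j, k]" phi] by (simp add: ctr_sum)
  also have "\<dots> = 3 * (\<Sum>c\<in>UNIV. \<Sum>d\<in>UNIV. t2 c d * psi c d a b)"
    unfolding psi by (simp add: sum_distrib_left)
  finally show ?thesis using g2_derivation(1)[OF t2 ker, of a b] by simp
qed

section \<open>Adapted frames\<close>

lemma matrix_inv_eqI:
  fixes A B :: "real^'n^'n"
  assumes "A ** B = mat 1" "B ** A = mat 1"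
  shows "matrix_inv A = B"
  unfolding matrix_inv_def
proof (rule some_equality)
  fix C assume "A ** C = mat 1 \<and> C ** A = mat 1"
  then show "C = B" by (metis assms matrix_mul_assoc matrix_mul_lid matrix_mul_rid)
qed (use assms in simp)

lemma length_2E: "length L = 2 \<Longrightarrow> (\<And>a b. L = [a, b] \<Longrightarrow> P) \<Longrightarrow> P"
  by (auto simp: numeral_eq_Suc length_Suc_conv)

lemma length_3E: "length L = 3 \<Longrightarrow> (\<And>a b c. L = [a, b, c] \<Longrightarrow> P) \<Longrightarrow> P"
  by (auto simp: numeral_eq_Suc length_Suc_conv)

lemma length_4E: "length L = 4 \<Longrightarrow> (\<And>a b c d. L = [a, b, c, d] \<Longrightarrow> P) \<Longrightarrow> P"
  by (auto simp: numeral_eq_Suc length_Suc_conv)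

lemma nat_sums: "2 + 2 = (4::nat)" "1 + 2 = (3::nat)" "1 + 1 = (2::nat)" "0 + 3 = (3::nat)"
  by simp_all

text \<open>The rows of \<open>N\<close> are an orthonormal coframe, in which the inverse metric is
  the identity.\<close>

lemma ginv_frame:
  assumes N: "invertible N" and g: "gmat g = transpose N ** N"
  shows "(\<Sum>i\<in>UNIV. \<Sum>j\<in>UNIV. N $ a $ i * N $ b $ j * ginv g i j) = kdelta a b"
proof -
  obtain M where M: "N ** M = mat 1" "M ** N = mat 1" using N by (auto simp: invertible_def)
  have MT: "transpose N ** transpose M = mat 1" "transpose M ** transpose N = mat 1"
    using M by (simp_all add: matrix_transpose_mul[symmetric] transpose_mat)
  have "matrix_inv (gmat g) = M ** transpose M"
  proof (rule matrix_inv_eqI)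
    show "gmat g ** (M ** transpose M) = mat 1"
      unfolding g by (metis M(1) MT(1) matrix_mul_assoc matrix_mul_rid)
    show "M ** transpose M ** gmat g = mat 1"
      unfolding g by (metis M(2) MT(2) matrix_mul_assoc matrix_mul_rid)
  qed
  then have "N ** matrix_inv (gmat g) ** transpose N = mat 1"
    by (metis M(1) MT(2) matrix_mul_assoc matrix_mul_lid)
  then have "(N ** matrix_inv (gmat g) ** transpose N) $ a $ b = kdelta a b"
    by (simp add: mat_def)
  moreover have "(N ** matrix_inv (gmat g) ** transpose N) $ a $ b = (\<Sum>j\<in>UNIV. \<Sum>i\<in>UNIV. N $ a $ i * N $ b $ j * ginv g i j)"
    unfolding ginv_def matrix_matrix_mult_def transpose_def by (simp add: sum_distrib_left sum_distrib_right mult_ac)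
  ultimately show ?thesis by (subst sum.swap) simp
qed

lemma contr_cong:
  "(\<And>K. length K = k \<Longrightarrow> u K = u' K) \<Longrightarrow> (\<And>K. length K = k \<Longrightarrow> w K = w' K) \<Longrightarrow> contr k \<gamma> u w = contr k \<gamma> u' w'"
  unfolding contr_def by (intro sum.cong refl) simp

lemma contr_swap: "contr k \<gamma> u w = contr k (\<lambda>i j. \<gamma> j i) w u"
  unfolding contr_def by (subst sum.swap) (simp add: mult_ac)

lemma pullback_contr_right:
  "pullback l N (\<lambda>J. contr k \<gamma> \<alpha> (\<lambda>I. T I J)) J = contr k \<gamma> \<alpha> (\<lambda>I. pullback l N (T I) J)"
  unfolding contr_swap[of k \<gamma> \<alpha>] by (rule pullback_contr_left)

lemma contr_frame:
  assumes "invertible N" "gmat g = transpose N ** N"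
  shows "contr k (ginv g) (pullback k N u) (pullback k N w) = contr k kdelta u w"
  by (rule contr_pullback) (use ginv_frame[OF assms] in simp)

text \<open>Contracts the trailing \<open>k\<close> slots of both tensors. Joining the free slots
  \<open>I\<close> and \<open>J\<close> into one list makes the outcome again a pullback of its
  frame components.\<close>

lemma contr_append:
  assumes N: "invertible N" "gmat g = transpose N ** N" and I: "length I = m" "length J = n"
    and u: "\<And>K. length K = m + k \<Longrightarrow> u K = pullback (m + k) N u0 K"
    and w: "\<And>K. length K = n + k \<Longrightarrow> w K = pullback (n + k) N w0 K"
  shows "contr k (ginv g) (\<lambda>K. u (I @ K)) (\<lambda>K. w (J @ K))
    = pullback (m + n) N (\<lambda>L. contr k kdelta (\<lambda>K. u0 (take m L @ K)) (\<lambda>K. w0 (drop m L @ K))) (I @ J)"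
proof -
  have "contr k (ginv g) (\<lambda>K. u (I @ K)) (\<lambda>K. w (J @ K))
     = contr k (ginv g) (\<lambda>K. pullback m N (\<lambda>I'. pullback k N (\<lambda>K'. u0 (I' @ K')) K) I)
         (\<lambda>K. pullback n N (\<lambda>J'. pullback k N (\<lambda>K'. w0 (J' @ K')) K) J)"
    using I by (intro contr_cong) (simp_all add: u w pullback_append)
  also have "\<dots> = pullback m N (\<lambda>I'. pullback n N (\<lambda>J'. contr k (ginv g) (pullback k N (\<lambda>K'. u0 (I' @ K'))) (pullback k N (\<lambda>K'. w0 (J' @ K')))) J) I"
    unfolding pullback_contr_right pullback_contr_left ..
  also have "\<dots> = pullback m N (\<lambda>I'. pullback n N (\<lambda>J'. contr k kdelta (\<lambda>K. u0 (I' @ K)) (\<lambda>K. w0 (J' @ K))) J) I"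
    unfolding contr_frame[OF N] ..
  also have "\<dots> = pullback m N (\<lambda>I'. pullback n N (\<lambda>J'. contr k kdelta (\<lambda>K. u0 (take m (I' @ J') @ K)) (\<lambda>K. w0 (drop m (I' @ J') @ K))) J) I"
    by (intro pullback_cong) simp
  also have "\<dots> = pullback (m + n) N (\<lambda>L. contr k kdelta (\<lambda>K. u0 (take m L @ K)) (\<lambda>K. w0 (drop m L @ K))) (I @ J)"
    using I by (simp only: pullback_append)
  finally show ?thesis .
qed

definition psiL :: tensor where "psiL L = psi (L ! 0) (L ! 1) (L ! 2) (L ! 3)"

lemma psiL [simp]: "psiL [i, j, k, l] = psi i j k l"
  by (simp add: psiL_def)

lemma pullback_2_gmat:
  assumes "gmat g = transpose N ** N"
  shows "pullback 2 N (\<lambda>L. kdelta (L ! 0) (L ! 1)) [i, j] = g [i, j]"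
proof -
  have "g [i, j] = gmat g $ i $ j" by (simp add: gmat_def)
  then show ?thesis unfolding assms
    by (simp add: numeral_2_eq_2 pullback_Suc matrix_matrix_mult_def transpose_def kdelta_mult_if sum_distrib_left)
qed

text \<open>Simultaneous adaptation of 3-form, metric and 4-form at a single point. Nothing relates
  the matrices at different points.\<close>

definition frame_data :: "real^7^7 \<Rightarrow> tensor \<Rightarrow> tensor \<Rightarrow> tensor \<Rightarrow> bool" where
  "frame_data N f g p \<longleftrightarrow> invertible N \<and> gmat g = transpose N ** N \<and>
     (\<forall>K. length K = 3 \<longrightarrow> f K = pullback 3 N phi0 K) \<and> (\<forall>K. length K = 4 \<longrightarrow> p K = pullback 4 N psiL K)"

text \<open>The identity \<open>phi_phi_2\<close> freed from the frame. In this form it can be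
  differentiated although the frames vary arbitrarily.\<close>

lemma frame_data_metric:
  assumes "frame_data N f g p"
  shows "contr 2 (ginv g) (\<lambda>K. f (i # K)) (\<lambda>K. f (j # K)) = 6 * g [i, j]"
proof -
  have N: "invertible N" "gmat g = transpose N ** N" and f: "\<And>K. length K = 3 \<Longrightarrow> f K = pullback 3 N phi0 K"
    using assms by (auto simp: frame_data_def)
  have "contr 2 (ginv g) (\<lambda>K. f ([i] @ K)) (\<lambda>K. f ([j] @ K))
     = pullback (1 + 1) N (\<lambda>L. contr 2 kdelta (\<lambda>K. phi0 (take 1 L @ K)) (\<lambda>K. phi0 (drop 1 L @ K))) ([i] @ [j])"
    by (rule contr_append[OF N]) (simp_all add: f numeral_2_eq_2 numeral_3_eq_3)
  also have "\<dots> = pullback (1 + 1) N (\<lambda>L. 6 * kdelta (L ! 0) (L ! 1)) [i, j]"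
    by (simp only: append.simps, rule pullback_cong)
       (auto simp: length_Suc_conv contr_kdelta sum_lists_2 phi_phi_2 phi_def[symmetric])
  also have "\<dots> = 6 * g [i, j]"
    using pullback_2_gmat[OF N(2)] by (simp add: pullback_scale numeral_2_eq_2)
  finally show ?thesis by simp
qed

text \<open>Expresses the 4-form through the metric and the 3-form without reference to a frame; its
  derivatives and its differentiability are read off from this formula.\<close>

lemma frame_data_psi:
  assumes "frame_data N f g p"
  shows "p [i, j, k, l] = g [i, k] * g [j, l] - g [i, l] * g [j, k]
     - contr 1 (ginv g) (\<lambda>K. f ([i, j] @ K)) (\<lambda>K. f ([k, l] @ K))"
proof -
  have N: "invertible N" "gmat g = transpose N ** N" and f: "\<And>K. length K = 3 \<Longrightarrow> f K = pullback 3 N phi0 K"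
    and p: "p [i, j, k, l] = pullback 4 N psiL [i, j, k, l]"
    using assms by (auto simp: frame_data_def)
  have "contr 1 (ginv g) (\<lambda>K. f ([i, j] @ K)) (\<lambda>K. f ([k, l] @ K))
     = pullback (2 + 2) N (\<lambda>L. contr 1 kdelta (\<lambda>K. phi0 (take 2 L @ K)) (\<lambda>K. phi0 (drop 2 L @ K))) ([i, j] @ [k, l])"
    by (rule contr_append[OF N]) (simp_all add: f numeral_2_eq_2 numeral_3_eq_3)
  also have "\<dots> = pullback 4 N (\<lambda>L. kdelta (L ! 0) (L ! 2) * kdelta (L ! 1) (L ! 3) - kdelta (L ! 0) (L ! 3) * kdelta (L ! 1) (L ! 2) - psiL L) [i, j, k, l]"
  proof -
    have *: "contr 1 kdelta (\<lambda>K. phi0 (take 2 L @ K)) (\<lambda>K. phi0 (drop 2 L @ K))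
      = kdelta (L ! 0) (L ! 2) * kdelta (L ! 1) (L ! 3) - kdelta (L ! 0) (L ! 3) * kdelta (L ! 1) (L ! 2) - psiL L"
      if "length L = 4" for L
    proof -
      from that obtain a b c d where L: "L = [a, b, c, d]" by (rule length_4E)
      have *: "contr 1 kdelta (\<lambda>K. phi0 (take 2 L @ K)) (\<lambda>K. phi0 (drop 2 L @ K)) = (\<Sum>m\<in>UNIV. phi a b m * phi c d m)"
        by (simp add: L contr_kdelta_Suc phi_def)
      then show ?thesis by (simp add: L phi_phi)
    qed
    show ?thesis unfolding nat_sums append.simps by (rule pullback_cong) (rule *)
  qed
  also have "\<dots> = g [i, k] * g [j, l] - g [i, l] * g [j, k] - pullback 4 N psiL [i, j, k, l]"
  proof -
    have *: "(\<Sum>a\<in>UNIV. N $ a $ i * N $ a $ j) = g [i, j]" for i j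
      using pullback_2_gmat[OF N(2), of i j]
      by (simp add: numeral_2_eq_2 pullback_Suc kdelta_mult_if sum_distrib_left)
    have "pullback 4 N (\<lambda>L. kdelta (L ! 0) (L ! 2) * kdelta (L ! 1) (L ! 3)) [i, j, k, l] = g [i, k] * g [j, l]"
      unfolding *[symmetric] sum_product
      by (simp add: numeral_eq_Suc pullback_Suc kdelta_mult_if sum_distrib_left mult_ac)
    moreover have "pullback 4 N (\<lambda>L. kdelta (L ! 0) (L ! 3) * kdelta (L ! 1) (L ! 2)) [i, j, k, l] = g [i, l] * g [j, k]"
      unfolding *[symmetric] sum_product
      by (simp add: numeral_eq_Suc pullback_Suc kdelta_mult_if sum_distrib_left mult_ac)
    ultimately show ?thesis by (simp only: pullback_diff)
  qed
  finally show ?thesis using p by simp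
qed

text \<open>One of the three terms of \<open>h\<close> acting on the 3-form. The contracted slot is
  kept last to suit \<open>contr_append\<close>, which for a 3-form is an even rotation.\<close>

definition hphi :: "tensor \<Rightarrow> tensor \<Rightarrow> tensor \<Rightarrow> 7 \<Rightarrow> 7 \<Rightarrow> 7 \<Rightarrow> real" where
  "hphi g h f i j k = contr 1 (ginv g) (\<lambda>K. h ([i] @ K)) (\<lambda>K. f ([j, k] @ K))"

lemma hphi_frame:
  assumes "frame_data N f g p" and h: "\<And>K. length K = 2 \<Longrightarrow> h K = pullback 2 N h0 K"
  shows "hphi g h f i j k = pullback 3 N (\<lambda>L. \<Sum>l\<in>UNIV. h0 [L ! 0, l] * phi l (L ! 1) (L ! 2)) [i, j, k]"
proof -
  have N: "invertible N" "gmat g = transpose N ** N" and f: "\<And>K. length K = 3 \<Longrightarrow> f K = pullback 3 N phi0 K"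
    using assms by (auto simp: frame_data_def)
  have "hphi g h f i j k = pullback (1 + 2) N (\<lambda>L. contr 1 kdelta (\<lambda>K. h0 (take 1 L @ K)) (\<lambda>K. phi0 (drop 1 L @ K))) ([i] @ [j, k])"
    unfolding hphi_def by (rule contr_append[OF N]) (simp_all add: f h numeral_2_eq_2 numeral_3_eq_3)
  also have "\<dots> = pullback 3 N (\<lambda>L. \<Sum>l\<in>UNIV. h0 [L ! 0, l] * phi l (L ! 1) (L ! 2)) [i, j, k]"
  proof -
    have *: "contr 1 kdelta (\<lambda>K. h0 (take 1 L @ K)) (\<lambda>K. phi0 (drop 1 L @ K)) = (\<Sum>l\<in>UNIV. h0 [L ! 0, l] * phi l (L ! 1) (L ! 2))"
      if "length L = 3" for L
    proof -
      from that obtain a b c where L: "L = [a, b, c]" by (rule length_3E)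
      show ?thesis by (simp add: L contr_kdelta_Suc phi_def[symmetric] phi_rot[of b c])
    qed
    show ?thesis unfolding nat_sums append.simps by (rule pullback_cong) (rule *)
  qed
  finally show ?thesis .
qed

text \<open>The minus sign comes from moving the contracted slot of the 4-form from the last to the
  first position.\<close>

lemma contr_psi_frame:
  assumes "frame_data N f g p" and x: "\<And>K. length K = 1 \<Longrightarrow> x K = pullback 1 N x0 K"
  shows "contr 1 (ginv g) x (\<lambda>K. p ([i, j, k] @ K)) = - pullback 3 N (\<lambda>L. \<Sum>l\<in>UNIV. x0 [l] * psi l (L ! 0) (L ! 1) (L ! 2)) [i, j, k]"
proof -
  have N: "invertible N" "gmat g = transpose N ** N" and p: "\<And>K. length K = 4 \<Longrightarrow> p K = pullback 4 N psiL K"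
    using assms by (auto simp: frame_data_def)
  have "contr 1 (ginv g) (\<lambda>K. x ([] @ K)) (\<lambda>K. p ([i, j, k] @ K))
     = pullback (0 + 3) N (\<lambda>L. contr 1 kdelta (\<lambda>K. x0 (take 0 L @ K)) (\<lambda>K. psiL (drop 0 L @ K))) ([] @ [i, j, k])"
    by (rule contr_append[OF N]) (simp_all add: p x)
  also have "\<dots> = pullback 3 N (\<lambda>L. (-1) * (\<Sum>l\<in>UNIV. x0 [l] * psi l (L ! 0) (L ! 1) (L ! 2))) [i, j, k]"
  proof -
    have *: "contr 1 kdelta (\<lambda>K. x0 (take 0 L @ K)) (\<lambda>K. psiL (drop 0 L @ K)) = (-1) * (\<Sum>l\<in>UNIV. x0 [l] * psi l (L ! 0) (L ! 1) (L ! 2))"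
      if "length L = 3" for L
    proof -
      from that obtain a b c where L: "L = [a, b, c]" by (rule length_3E)
      have "psi a b c l = - psi l a b c" for l using psi_moves(3)[of l a b c] by simp
      then show ?thesis by (simp add: L contr_kdelta_Suc sum_negf)
    qed
    show ?thesis unfolding nat_sums append.simps by (rule pullback_cong) (rule *)
  qed
  finally have "contr 1 (ginv g) (\<lambda>K. x K) (\<lambda>K. p ([i, j, k] @ K)) = (- 1) * pullback 3 N (\<lambda>L. \<Sum>l\<in>UNIV. x0 [l] * psi l (L ! 0) (L ! 1) (L ! 2)) [i, j, k]"
    unfolding pullback_scale append.simps .
  then show ?thesis by simp
qed

lemma contr_3_frame:
  assumes "frame_data N f g p" and D: "\<And>K. length K = 4 \<Longrightarrow> D K = pullback 4 N D0 K"
  shows "contr 3 (ginv g) (\<lambda>K. D (i # K)) (\<lambda>K. p (j # K))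
    = pullback 2 N (\<lambda>L. ctr (\<lambda>a b c. D0 [L ! 0, a, b, c]) (psi (L ! 1))) [i, j]"
proof -
  have N: "invertible N" "gmat g = transpose N ** N" and p: "\<And>K. length K = 4 \<Longrightarrow> p K = pullback 4 N psiL K"
    using assms by (auto simp: frame_data_def)
  have "contr 3 (ginv g) (\<lambda>K. D ([i] @ K)) (\<lambda>K. p ([j] @ K))
     = pullback (1 + 1) N (\<lambda>L. contr 3 kdelta (\<lambda>K. D0 (take 1 L @ K)) (\<lambda>K. psiL (drop 1 L @ K))) ([i] @ [j])"
    by (rule contr_append[OF N]) (simp_all add: p D)
  also have "\<dots> = pullback 2 N (\<lambda>L. ctr (\<lambda>a b c. D0 [L ! 0, a, b, c]) (psi (L ! 1))) [i, j]"
  proof -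
    have *: "contr 3 kdelta (\<lambda>K. D0 (take 1 L @ K)) (\<lambda>K. psiL (drop 1 L @ K)) = ctr (\<lambda>a b c. D0 [L ! 0, a, b, c]) (psi (L ! 1))"
      if "length L = 2" for L
    proof -
      from that obtain a b where L: "L = [a, b]" by (rule length_2E)
      show ?thesis by (simp add: L contr_kdelta sum_lists_3 ctr_def)
    qed
    show ?thesis unfolding nat_sums append.simps by (rule pullback_cong) (rule *)
  qed
  finally show ?thesis by simp
qed

text \<open>List version of \<open>alt3\<close>-type antisymmetrisation as in \<open>alt4\<close>
  and \<open>alt5\<close>, available in every rank and commuting with pullbacks.\<close>

definition altL :: "nat \<Rightarrow> tensor \<Rightarrow> tensor" where
  "altL k T L = (\<Sum>r<k. (- 1) ^ r * T (L ! r # take r L @ drop (Suc r) L))"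

lemma altL_3: "altL 3 T [a, b, c] = T [a, b, c] - T [b, a, c] + T [c, a, b]"
  and altL_4: "altL 4 T [a, b, c, d] = T [a, b, c, d] - T [b, a, c, d] + T [c, a, b, d] - T [d, a, b, c]"
  and altL_5: "altL 5 T [a, b, c, d, e] = T [a, b, c, d, e] - T [b, a, c, d, e] + T [c, a, b, d, e] - T [d, a, b, c, e] + T [e, a, b, c, d]"
  by (simp_all add: altL_def numeral_eq_Suc)

lemma pullback_move:
  assumes r: "r < k" and I: "length I = k"
  shows "pullback k N (\<lambda>L. T (L ! r # take r L @ drop (Suc r) L)) I = pullback k N T (I ! r # take r I @ drop (Suc r) I)"
proof -
  define \<sigma> where "\<sigma> i = (if i = 0 then r else if i \<le> r then i - 1 else i)" for i :: nat
  have inj: "inj_on \<sigma> {..<k}" unfolding inj_on_def \<sigma>_def by auto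
  have im: "\<sigma> ` {..<k} \<subseteq> {..<k}" unfolding \<sigma>_def using r by auto
  have "\<sigma> ` {..<k} = {..<k}" by (rule endo_inj_surj[OF _ im inj]) simp
  then have "bij_betw \<sigma> {..<k} {..<k}" using inj by (simp add: bij_betw_def)
  then have \<sigma>: "\<sigma> permutes {..<k}" by (rule bij_imp_permutes) (use r in \<open>auto simp: \<sigma>_def\<close>)
  have *: "permute_list \<sigma> L = L ! r # take r L @ drop (Suc r) L" if "length L = k" for L :: "7 list"
  proof (rule nth_equalityI)
    show "length (permute_list \<sigma> L) = length (L ! r # take r L @ drop (Suc r) L)" using that r by simp
    fix i assume i: "i < length (permute_list \<sigma> L)"
    then have "permute_list \<sigma> L ! i = L ! \<sigma> i" by (simp add: permute_list_def)
    also have "\<dots> = (L ! r # take r L @ drop (Suc r) L) ! i"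
      using that r i by (cases i) (auto simp: \<sigma>_def nth_append)
    finally show "permute_list \<sigma> L ! i = (L ! r # take r L @ drop (Suc r) L) ! i" .
  qed
  have "pullback k N (\<lambda>L. T (L ! r # take r L @ drop (Suc r) L)) I = pullback k N (\<lambda>L. T (permute_list \<sigma> L)) I"
    by (rule pullback_cong) (simp add: *)
  also have "\<dots> = pullback k N T (I ! r # take r I @ drop (Suc r) I)"
    unfolding pullback_permute[OF \<sigma> I] *[OF I] ..
  finally show ?thesis .
qed

lemma pullback_altL: "length I = k \<Longrightarrow> pullback k N (altL k T) I = altL k (pullback k N T) I"
  unfolding altL_def[abs_def] pullback_sum by (intro sum.cong refl) (simp add: pullback_move)

lemma pullback_inverse:
  assumes "Q ** N = mat 1" "length I = k"
  shows "pullback k N (pullback k Q T) I = T I"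
  using pullback_pullback[OF assms(2), of N Q T] pullback_one[OF assms(2)] assms(1) by simp

text \<open>Carries an equation between coordinate components over to frame components.\<close>

lemma pullback_inject:
  assumes N: "invertible N" and eq: "\<And>I. length I = k \<Longrightarrow> pullback k N S I = pullback k N T I" and L: "length L = k"
  shows "S L = T L"
proof -
  obtain Q where Q: "N ** Q = mat 1" using N by (auto simp: invertible_def)
  have "pullback k Q (pullback k N S) L = pullback k Q (pullback k N T) L"
    by (rule pullback_cong) (rule eq)
  then show ?thesis using pullback_inverse[OF Q L] by simp
qed

lemma hodge_star_frame:
  assumes N: "invertible N" "gmat g = transpose N ** N"
    and vol: "\<And>L. length L = k + n \<Longrightarrow> vol L = pullback (k + n) N vol0 L"
    and \<alpha>: "\<And>K. length K = k \<Longrightarrow> \<alpha> K = pullback k N \<alpha>0 K" and I: "length I = n"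
  shows "hodge_star g vol k \<alpha> I = pullback n N (\<lambda>J. 1 / fact k * contr k kdelta (\<lambda>K. vol0 (K @ J)) \<alpha>0) I"
proof -
  have "contr k (ginv g) (\<lambda>K. vol (K @ I)) \<alpha>
     = contr k (ginv g) (pullback k N (\<lambda>K. pullback n N (\<lambda>J. vol0 (K @ J)) I)) (pullback k N \<alpha>0)"
    using I by (intro contr_cong) (simp_all add: vol \<alpha> pullback_append)
  also have "\<dots> = contr k kdelta (\<lambda>K. pullback n N (\<lambda>J. vol0 (K @ J)) I) \<alpha>0"
    by (rule contr_frame[OF N])
  also have "\<dots> = pullback n N (\<lambda>J. contr k kdelta (\<lambda>K. vol0 (K @ J)) \<alpha>0) I"
    by (rule pullback_contr_left[symmetric])
  finally show ?thesis unfolding hodge_star_contr pullback_scale by simp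
qed

text \<open>Of the six terms of \<open>e3\<close>, those exchanging the last two slots agree in
  pairs, which absorbs the factor 1/2.\<close>

lemma form3_of_sym2_hphi:
  assumes f: "alternating 3 f"
  shows "form3_of_sym2 f g s [i, j, k] = hphi g s f i j k - hphi g s f j i k + hphi g s f k i j"
proof -
  have A: "(\<Sum>m\<in>UNIV. \<Sum>l\<in>UNIV. s [i, m] * ginv g m l * f [l, j, k]) = hphi g s f i j k" for i j k
  proof -
    have "f [l, j, k] = f [j, k, l]" for l
      using swap_3(1)[OF f, of l j k] swap_3(2)[OF f, of j l k] by simp
    then show ?thesis unfolding hphi_def by (simp add: contr_Suc mult_ac)
  qed
  have sw: "hphi g s f i k j = - hphi g s f i j k" for i j k
  proof -
    have "f [l, k, j] = - f [l, j, k]" for l by (rule swap_3(2)[OF f])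
    then show ?thesis unfolding A[symmetric] by (simp add: sum_negf)
  qed
  have "form3_of_sym2 f g s [i, j, k] = 1 / 2 * (\<Sum>a\<in>UNIV. \<Sum>b\<in>UNIV. \<Sum>c\<in>UNIV. hphi g s f a b c * e3 a b c [i, j, k])"
    unfolding form3_of_sym2_def A[symmetric] sum_distrib_right ..
  also have "(\<Sum>a\<in>UNIV. \<Sum>b\<in>UNIV. \<Sum>c\<in>UNIV. hphi g s f a b c * e3 a b c [i, j, k])
     = hphi g s f i j k - hphi g s f i k j - hphi g s f j i k + hphi g s f j k i - (hphi g s f k j i - hphi g s f k i j)"
    unfolding e3_eq' by (simp add: right_diff_distrib distrib_left sum_subtractf sum.distrib kdelta_mult_if)
  finally show ?thesis using sw[of i j k] sw[of j i k] sw[of k i j] by simp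
qed

lemma frame_data_alternating:
  assumes "frame_data N f g p"
  shows "alternating 3 f"
proof -
  have "alternating 3 (pullback 3 N phi0)" by (intro alternating_pullback alternating_phi0)
  then show ?thesis using assms unfolding frame_data_def alternating_def by simp
qed

text \<open>The wedge of a 1-form with \<open>phi\<close> is, up to sign, a \<open>cpsi\<close>, and
  its contraction with \<open>psi\<close> is skew. The symmetrised contraction is therefore blind to
  \<tau>1.\<close>

lemma ctr_cpsi_sym: "ctr (cpsi Y p) (psi q) + ctr (cpsi Y q) (psi p) = 0"
proof -
  have 1: "ctr (cpsi Y p) (psi q) = 3 * (\<Sum>i\<in>UNIV. Y i * (\<Sum>j\<in>UNIV. \<Sum>k\<in>UNIV. phi p j k * psi q i j k))" for p q
  proof -
    let ?u = "\<lambda>i j k. Y i * phi p j k"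
    have e: "cpsi Y p = (\<lambda>i j k. - (Y p * phi i j k) + ?u i j k - ?u j i k + ?u k i j)"
      by (intro ext) (simp add: cpsi_def)
    have m: "ctr (\<lambda>i j k. - (Y p * phi i j k)) (psi q) = 0"
      unfolding ctr_minus ctr_scale ctr_phi_psi by simp
    have "ctr (cpsi Y p) (psi q) = 3 * ctr ?u (psi q)"
      unfolding e ctr_add ctr_diff m ctr_12[OF alt3_psi, of ?u] ctr_rot[OF alt3_psi, of ?u] by simp
    then show ?thesis unfolding ctr_def by (simp add: sum_distrib_left mult.assoc)
  qed
  have "(\<Sum>j\<in>UNIV. \<Sum>k\<in>UNIV. phi p j k * psi q i j k) = - (\<Sum>j\<in>UNIV. \<Sum>k\<in>UNIV. phi q j k * psi p i j k)" for i
    unfolding phi_psi_2 using phi_swap(2)[of p q i] phi_swap(1)[of p q i] phi_rot[of p q i] phi_rot[of q p i] by simp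
  then show ?thesis unfolding 1 by (simp add: sum_negf)
qed

text \<open>The structure equation of d\<phi> with each term rewritten by the standard forms: the
  wedge with \<tau>1 becomes \<open>- cpsi\<close>, and the star of the 3-form of \<tau>3 becomes
  \<open>- dia\<close> by \<open>star_sym_phi\<close>.\<close>

lemma torsion_phi_frame:
  assumes fr: "frame_data N f g p" and vol0: "alternating 7 vol0" "vol0 indices = -1"
    and vol: "\<And>L. length L = 7 \<Longrightarrow> vol L = pullback 7 N vol0 L"
    and \<tau>1: "\<And>K. length K = 1 \<Longrightarrow> \<tau>1 K = pullback 1 N t1 K"
    and \<tau>3: "\<And>K. length K = 2 \<Longrightarrow> \<tau>3 K = pullback 2 N t3 K"
    and sym: "\<And>a b. t3 [b, a] = t3 [a, b]" and tr: "(\<Sum>a\<in>UNIV. t3 [a, a]) = 0"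
    and D: "\<And>K. length K = 4 \<Longrightarrow> D K = pullback 4 N D0 K"
    and eq: "\<And>I. length I = 4 \<Longrightarrow> D I = \<tau>0 * p I + 3 * wedge 1 3 \<tau>1 f I + hodge_star g vol 3 (form3_of_sym2 f g \<tau>3) I"
  shows "D0 [i, j, k, l] = \<tau>0 * psi i j k l - 3 * cpsi (\<lambda>a. t1 [a]) i j k l - dia (\<lambda>a b. t3 [a, b]) i j k l"
proof -
  have N: "invertible N" "gmat g = transpose N ** N" and f: "\<And>K. length K = 3 \<Longrightarrow> f K = pullback 3 N phi0 K"
    and p: "\<And>K. length K = 4 \<Longrightarrow> p K = pullback 4 N psiL K"
    using fr by (auto simp: frame_data_def)
  let ?U = "\<lambda>L. \<Sum>l\<in>UNIV. t3 [L ! 0, l] * phi l (L ! 1) (L ! 2)"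
  have form: "form3_of_sym2 f g \<tau>3 K = pullback 3 N (altL 3 ?U) K" if "length K = 3" for K
  proof -
    from that obtain a b c where K: "K = [a, b, c]" by (rule length_3E)
    have "hphi g \<tau>3 f a b c = pullback 3 N ?U [a, b, c]" for a b c
      by (rule hphi_frame[OF fr]) (rule \<tau>3)
    then show ?thesis unfolding K form3_of_sym2_hphi[OF frame_data_alternating[OF fr]]
      by (simp add: pullback_altL altL_3 del: One_nat_def)
  qed
  have star: "hodge_star g vol 3 (form3_of_sym2 f g \<tau>3) I
    = pullback 4 N (\<lambda>J. 1 / fact 3 * contr 3 kdelta (\<lambda>K. vol0 (K @ J)) (altL 3 ?U)) I" if "length I = 4" for I
    by (rule hodge_star_frame[OF N _ form that]) (simp_all add: vol)
  have w: "wedge 1 3 \<tau>1 f I = pullback 4 N (wedge 1 3 t1 phi0) I" if "length I = 4" for I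
  proof -
    have "wedge 1 3 \<tau>1 f I = wedge 1 3 (pullback 1 N t1) (pullback 3 N phi0) I"
      by (rule wedge_cong) (use that \<tau>1 f in simp_all)
    then show ?thesis using pullback_wedge[of I 1 3 N t1 phi0] that by simp
  qed
  have "D0 L = \<tau>0 * psiL L + 3 * wedge 1 3 t1 phi0 L + 1 / fact 3 * contr 3 kdelta (\<lambda>K. vol0 (K @ L)) (altL 3 ?U)"
    if "length L = 4" for L
  proof (rule pullback_inject[OF N(1) _ that])
    fix I :: "7 list" assume I: "length I = 4"
    show "pullback 4 N D0 I = pullback 4 N (\<lambda>L. \<tau>0 * psiL L + 3 * wedge 1 3 t1 phi0 L + 1 / fact 3 * contr 3 kdelta (\<lambda>K. vol0 (K @ L)) (altL 3 ?U)) I"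
      unfolding pullback_add pullback_scale[of 4 N \<tau>0] pullback_scale[of 4 N 3]
      unfolding D[OF I, symmetric] p[OF I, symmetric] w[OF I, symmetric] star[OF I, symmetric] by (rule eq[OF I])
  qed
  from this[of "[i, j, k, l]"]
  have "D0 [i, j, k, l] = \<tau>0 * psi i j k l + 3 * wedge 1 3 t1 phi0 [i, j, k, l]
     + 1 / 6 * contr 3 kdelta (\<lambda>K. vol0 (K @ [i, j, k, l])) (altL 3 ?U)" by (simp add: fact_numeral)
  moreover have "wedge 1 3 t1 phi0 [i, j, k, l] = - cpsi (\<lambda>a. t1 [a]) i j k l"
    unfolding wedge_1_3[OF alternating_phi0] phi_def[symmetric] cpsi_def
    using phi_swap(1)[of j i l] phi_rot[of j k i] by simp
  moreover have "contr 3 kdelta (\<lambda>K. vol0 (K @ [i, j, k, l])) (altL 3 ?U) = - 6 * dia (\<lambda>a b. t3 [a, b]) i j k l"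
  proof -
    have e: "altL 3 ?U [a, b, c] = (\<Sum>l\<in>UNIV. t3 [a, l] * phi l b c) + (\<Sum>l\<in>UNIV. t3 [b, l] * phi a l c) + (\<Sum>l\<in>UNIV. t3 [c, l] * phi a b l)" for a b c
    proof -
      have "phi a l c = - phi l a c" "phi a b l = phi l a b" for l
        using phi_swap(1)[of l a c] phi_rot[of a b l] by simp_all
      then show ?thesis by (simp add: altL_3 sum_negf)
    qed
    show ?thesis
      using star_sym_phi[OF vol0, of "\<lambda>a b. t3 [a, b]" i j k l] sym tr
      unfolding contr_kdelta sum_lists_3 ctr_def e by simp
  qed
  ultimately show ?thesis by simp
qed

text \<open>The constants are 48 = 2 * 24 from \<open>ctr_psi_psi\<close>, 24 = 12 * 2 from
  \<open>ctr_dia_sym\<close>, and 168 = 24 * 7 for the trace.\<close>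

lemma torsion_phi_sym:
  fixes t1 t3
  assumes D: "\<And>i j k l. D i j k l = \<tau>0 * psi i j k l - 3 * cpsi t1 i j k l - dia t3 i j k l"
    and sym: "\<And>a b. t3 b a = t3 a b" and tr: "(\<Sum>a\<in>UNIV. t3 a a) = 0"
  shows "ctr (D p) (psi q) + ctr (D q) (psi p) = 48 * \<tau>0 * kdelta p q - 24 * t3 p q"
    and "(\<Sum>p\<in>UNIV. ctr (D p) (psi p)) = 168 * \<tau>0"
proof -
  have D': "D p = (\<lambda>j k l. \<tau>0 * psi p j k l - 3 * cpsi t1 p j k l - dia t3 p j k l)" for p
    by (intro ext) (rule D)
  show S: "ctr (D p) (psi q) + ctr (D q) (psi p) = 48 * \<tau>0 * kdelta p q - 24 * t3 p q" for p q
    using ctr_cpsi_sym[of t1 p q] ctr_dia_sym[of t3 p q] sym[of p q] tr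
    unfolding D' ctr_diff ctr_scale ctr_psi_psi by (auto simp: algebra_simps)
  have "2 * (\<Sum>p\<in>UNIV. ctr (D p) (psi p)) = (\<Sum>p\<in>UNIV. 48 * \<tau>0 * kdelta p p - 24 * t3 p p)"
    unfolding S[symmetric] by (simp add: sum.distrib sum_distrib_left)
  also have "\<dots> = 336 * \<tau>0" using tr by (simp add: sum_subtractf sum_distrib_left[symmetric])
  finally show "(\<Sum>p\<in>UNIV. ctr (D p) (psi p)) = 168 * \<tau>0" by simp
qed

text \<open>In the wedge of \<tau>1 with \<open>psi\<close>, two terms vanish because
  \<open>psi\<close> with one free index is orthogonal to \<open>phi\<close>. The other three are
  equal and give 4 * 3 * (-4) = -48. The term in \<tau>2 is
  \<open>star_two_form_phi\<close>.\<close>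

lemma torsion_psi_frame:
  assumes fr: "frame_data N f g p" and vol0: "alternating 7 vol0" "vol0 indices = -1"
    and vol: "\<And>L. length L = 7 \<Longrightarrow> vol L = pullback 7 N vol0 L"
    and \<tau>1: "\<And>K. length K = 1 \<Longrightarrow> \<tau>1 K = pullback 1 N t1 K"
    and \<tau>2: "\<And>K. length K = 2 \<Longrightarrow> \<tau>2 K = pullback 2 N t2 K"
    and t2: "\<And>a b. t2 [b, a] = - t2 [a, b]" and ker: "\<And>k. (\<Sum>a\<in>UNIV. \<Sum>b\<in>UNIV. t2 [a, b] * phi a b k) = 0"
    and D: "\<And>K. length K = 5 \<Longrightarrow> D K = pullback 5 N D0 K"
    and eq: "\<And>I. length I = 5 \<Longrightarrow> D I = 4 * wedge 1 4 \<tau>1 p I + hodge_star g vol 2 \<tau>2 I"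
  shows "ctr (\<lambda>i j k. D0 [a, b, i, j, k]) phi = - 48 * (\<Sum>l\<in>UNIV. t1 [l] * phi l a b) + 6 * t2 [a, b]"
proof -
  have N: "invertible N" "gmat g = transpose N ** N" and p: "\<And>K. length K = 4 \<Longrightarrow> p K = pullback 4 N psiL K"
    using fr by (auto simp: frame_data_def)
  define \<Psi> where "\<Psi> J = 1 / 6 * contr 3 kdelta (\<lambda>I. vol0 (I @ J)) phi0" for J
  note \<Psi> = alternating_psi[OF vol0, folded \<Psi>_def]
  have p': "p K = pullback 4 N \<Psi> K" if "length K = 4" for K
    unfolding p[OF that] by (rule pullback_cong) (auto elim!: length_4E simp: \<Psi>(2))
  have star: "hodge_star g vol 2 \<tau>2 I = pullback 5 N (\<lambda>J. 1 / fact 2 * contr 2 kdelta (\<lambda>K. vol0 (K @ J)) t2) I" if "length I = 5" for I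
    by (rule hodge_star_frame[OF N _ \<tau>2 that]) (simp_all add: vol)
  have w: "wedge 1 4 \<tau>1 p I = pullback 5 N (wedge 1 4 t1 \<Psi>) I" if "length I = 5" for I
  proof -
    have "wedge 1 4 \<tau>1 p I = wedge 1 4 (pullback 1 N t1) (pullback 4 N \<Psi>) I"
      by (rule wedge_cong) (use that \<tau>1 p' in simp_all)
    then show ?thesis using pullback_wedge[of I 1 4 N t1 \<Psi>] that by simp
  qed
  have "D0 L = 4 * wedge 1 4 t1 \<Psi> L + 1 / fact 2 * contr 2 kdelta (\<lambda>K. vol0 (K @ L)) t2" if "length L = 5" for L
  proof (rule pullback_inject[OF N(1) _ that])
    fix I :: "7 list" assume I: "length I = 5"
    show "pullback 5 N D0 I = pullback 5 N (\<lambda>L. 4 * wedge 1 4 t1 \<Psi> L + 1 / fact 2 * contr 2 kdelta (\<lambda>K. vol0 (K @ L)) t2) I"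
      unfolding pullback_add pullback_scale[of 5 N 4]
      unfolding D[OF I, symmetric] w[OF I, symmetric] star[OF I, symmetric] by (rule eq[OF I])
  qed
  note D0' = this
  have D0: "(\<lambda>i j k. D0 [a, b, i, j, k]) = (\<lambda>i j k. 4 * (t1 [a] * psi b i j k - t1 [b] * psi a i j k
      - t1 [i] * psi b a j k - t1 [j] * psi b i a k - t1 [k] * psi b i j a)
      + 1 / 2 * (\<Sum>c\<in>UNIV. \<Sum>d\<in>UNIV. vol0 [c, d, a, b, i, j, k] * t2 [c, d]))"
  proof (intro ext)
    fix i j k
    show "D0 [a, b, i, j, k] = 4 * (t1 [a] * psi b i j k - t1 [b] * psi a i j k
      - t1 [i] * psi b a j k - t1 [j] * psi b i a k - t1 [k] * psi b i j a)
      + 1 / 2 * (\<Sum>c\<in>UNIV. \<Sum>d\<in>UNIV. vol0 [c, d, a, b, i, j, k] * t2 [c, d])"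
      using D0'[of "[a, b, i, j, k]"] unfolding wedge_1_4[OF \<Psi>(1)] \<Psi>(2)
      by (simp add: contr_kdelta sum_lists_2)
  qed
  let ?u = "\<lambda>i j k. t1 [i] * psi a b j k"
  have e: "t1 [a] * psi b i j k - t1 [b] * psi a i j k - t1 [i] * psi b a j k - t1 [j] * psi b i a k - t1 [k] * psi b i j a
    = t1 [a] * psi b i j k - t1 [b] * psi a i j k + (?u i j k - ?u j i k + ?u k i j)" for i j k
    using psi_swap(1)[of b a j k] psi_swap(1)[of a b i k] psi_swap(2)[of b a i k] psi_swap(1)[of a b i j] psi_swap(2)[of b a i j] psi_swap(3)[of b i a j]
    by (simp add: algebra_simps)
  have z: "ctr (psi x) phi = 0" for x
  proof -
    have "ctr (psi x) phi = ctr phi (psi x)" by (rule ctr_commute)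
    also have "\<dots> = (\<Sum>i\<in>UNIV. \<Sum>j\<in>UNIV. \<Sum>k\<in>UNIV. phi i j k * psi x i j k)" unfolding ctr_def ..
    also have "\<dots> = 0" unfolding phi_psi_2 by (simp add: phi_repeat)
    finally show ?thesis .
  qed
  have u: "ctr ?u phi = - 4 * (\<Sum>l\<in>UNIV. t1 [l] * phi l a b)"
  proof -
    have "ctr ?u phi = (\<Sum>i\<in>UNIV. t1 [i] * (\<Sum>j\<in>UNIV. \<Sum>k\<in>UNIV. phi i j k * psi a b j k))"
      unfolding ctr_def by (simp add: sum_distrib_left mult.assoc mult.commute[of "phi _ _ _"])
    then show ?thesis unfolding phi_psi_2 by (simp add: sum_distrib_left mult.left_commute sum_negf)
  qed
  have c: "ctr (\<lambda>i j k. t1 [a] * psi b i j k) phi = 0" "ctr (\<lambda>i j k. t1 [b] * psi a i j k) phi = 0"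
    unfolding ctr_scale z by simp_all
  show ?thesis
    unfolding D0 e ctr_add ctr_scale[of 4] ctr_diff c ctr_12[OF alt3_phi, of ?u] ctr_rot[OF alt3_phi, of ?u] u
      star_two_form_phi[OF vol0, of "\<lambda>a b. t2 [a, b]", OF t2 ker]
    by simp
qed

text \<open>The equation of d\<phi> determines the symmetric part of \<open>T\<close> and its trace
  \<open>7 / 4 * \<tau>0\<close> (from 192 = 24 + 168 and 336), that of d\<psi> the skew part
  through \<open>psi_skew_eigen\<close>.\<close>

lemma torsion_tensor:
  fixes T :: "7 \<Rightarrow> 7 \<Rightarrow> real"
  assumes D: "\<And>i j k l. dia T i j k l = \<tau>0 * psi i j k l - 3 * cpsi t1 i j k l - dia t3 i j k l"
    and sym: "\<And>a b. t3 b a = t3 a b" and tr: "(\<Sum>a\<in>UNIV. t3 a a) = 0"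
    and t2: "\<And>a b. t2 b a = - t2 a b" and ker: "\<And>k. (\<Sum>a\<in>UNIV. \<Sum>b\<in>UNIV. t2 a b * phi a b k) = 0"
    and E: "\<And>a b. ctr (alt5 (\<lambda>p. cpsi (T p)) a b) phi = - 48 * (\<Sum>l\<in>UNIV. t1 l * phi l a b) + 6 * t2 a b"
  shows "T a b = \<tau>0 / 4 * kdelta a b - t3 a b + (\<Sum>l\<in>UNIV. t1 l * phi l a b) - t2 a b / 2"
proof -
  have S: "12 * (T p q + T q p) + 24 * kdelta p q * (\<Sum>a\<in>UNIV. T a a) = 48 * \<tau>0 * kdelta p q - 24 * t3 p q" for p q
    using torsion_phi_sym(1)[OF D sym tr, of p q] ctr_dia_sym[of T p q] by simp
  have "(\<Sum>p\<in>UNIV. 12 * (T p p + T p p) + 24 * kdelta p p * (\<Sum>a\<in>UNIV. T a a)) = (\<Sum>p\<in>UNIV. 48 * \<tau>0 * kdelta p p - 24 * t3 p p)"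
    by (simp only: S)
  then have "192 * (\<Sum>a\<in>UNIV. T a a) = 336 * \<tau>0"
    using tr by (simp add: sum.distrib sum_subtractf sum_distrib_left[symmetric])
  then have trT: "(\<Sum>a\<in>UNIV. T a a) = 7 / 4 * \<tau>0" by simp
  have "T a b - T b a = 2 * (\<Sum>l\<in>UNIV. t1 l * phi l a b) - t2 a b"
  proof (rule psi_skew_eigen[where S = "\<lambda>a b. T a b - T b a", OF _ t2 ker])
    show "- 12 * (T a b - T b a) + 3 * (\<Sum>i\<in>UNIV. \<Sum>j\<in>UNIV. (T i j - T j i) * psi i j a b)
      = - 48 * (\<Sum>l\<in>UNIV. t1 l * phi l a b) + 6 * t2 a b" for a b
      using E[of a b] unfolding ctr_alt5_cpsi .
  qed simp
  then show ?thesis using S[of a b] unfolding trT by (simp add: algebra_simps)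
qed

section \<open>Derivatives of tensors and second derivatives\<close>

text \<open>Leibniz' rule for a frame obeying \<open>Q' = - B Q\<close>: its motion subtracts the
  derivation action of \<open>B\<close> on every slot. With Christoffel symbols for \<open>B\<close>
  this is the covariant derivative, with the raised \<open>h\<close> the time derivative compensated
  for the flow.\<close>

lemma pullback_has_derivative:
  fixes Q :: "real \<Rightarrow> real^7^7"
  assumes Q: "\<And>i a. ((\<lambda>s. Q s $ i $ a) has_real_derivative - (\<Sum>m\<in>UNIV. B i m * Q s0 $ m $ a)) (at s0 within S)"
    and T: "\<And>K. length K = k \<Longrightarrow> ((\<lambda>s. T s K) has_real_derivative T' K) (at s0 within S)"
    and I: "length I = k"
  shows "((\<lambda>s. pullback k (Q s) (T s) I) has_real_derivative
     pullback k (Q s0) (\<lambda>K. T' K - (\<Sum>r<k. \<Sum>m\<in>UNIV. B m (K ! r) * T s0 (K[r := m]))) I) (at s0 within S)"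
  using T I
proof (induction k arbitrary: T T' I)
  case 0 then show ?case by simp
next
  case (Suc k)
  then obtain i I' where I: "I = i # I'" "length I' = k" by (cases I) auto
  let ?L = "\<lambda>a K. T' (a # K) - (\<Sum>r<k. \<Sum>m\<in>UNIV. B m (K ! r) * T s0 (a # K[r := m]))"
  have IH: "((\<lambda>s. pullback k (Q s) (\<lambda>K. T s (a # K)) I') has_real_derivative pullback k (Q s0) (?L a) I') (at s0 within S)" for a
    using Suc.IH[of "\<lambda>s K. T s (a # K)" "\<lambda>K. T' (a # K)" I'] Suc.prems I by simp
  let ?P = "\<lambda>a. pullback k (Q s0) (\<lambda>K. T s0 (a # K)) I'"
  have der: "((\<lambda>s. \<Sum>a\<in>UNIV. Q s $ a $ i * pullback k (Q s) (\<lambda>K. T s (a # K)) I') has_real_derivative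
     (\<Sum>a\<in>UNIV. - (\<Sum>m\<in>UNIV. B a m * Q s0 $ m $ i) * ?P a + pullback k (Q s0) (?L a) I' * Q s0 $ a $ i)) (at s0 within S)"
    by (rule DERIV_sum, rule DERIV_mult[OF Q IH])
  have "(\<Sum>a\<in>UNIV. - (\<Sum>m\<in>UNIV. B a m * Q s0 $ m $ i) * ?P a + pullback k (Q s0) (?L a) I' * Q s0 $ a $ i)
     = (\<Sum>a\<in>UNIV. Q s0 $ a $ i * (pullback k (Q s0) (?L a) I' - (\<Sum>m\<in>UNIV. B m a * ?P m)))"
  proof -
    have "(\<Sum>a\<in>UNIV. (\<Sum>m\<in>UNIV. B a m * Q s0 $ m $ i) * ?P a) = (\<Sum>a\<in>UNIV. \<Sum>m\<in>UNIV. Q s0 $ a $ i * (B m a * ?P m))"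
      unfolding sum_distrib_right by (subst sum.swap) (simp only: mult_ac)
    then show ?thesis
      by (simp add: sum.distrib sum_negf right_diff_distrib sum_subtractf sum_distrib_left mult.commute)
  qed
  also have "\<dots> = (\<Sum>a\<in>UNIV. Q s0 $ a $ i * pullback k (Q s0) (\<lambda>K. ?L a K - (\<Sum>m\<in>UNIV. B m a * T s0 (m # K))) I')"
    unfolding pullback_diff pullback_sum ..
  also have "\<dots> = pullback (Suc k) (Q s0) (\<lambda>K. T' K - (\<Sum>r<Suc k. \<Sum>m\<in>UNIV. B m (K ! r) * T s0 (K[r := m]))) I"
  proof -
    have "?L a K - (\<Sum>m\<in>UNIV. B m a * T s0 (m # K)) = T' (a # K) - ((\<Sum>m\<in>UNIV. B m ((a # K) ! 0) * T s0 ((a # K)[0 := m]))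
        + (\<Sum>r<k. \<Sum>m\<in>UNIV. B m ((a # K) ! Suc r) * T s0 ((a # K)[Suc r := m])))" for a K
      by simp
    then show ?thesis unfolding I pullback_Suc sum.lessThan_Suc_shift by presburger
  qed
  finally have "((\<lambda>s. \<Sum>a\<in>UNIV. Q s $ a $ i * pullback k (Q s) (\<lambda>K. T s (a # K)) I') has_real_derivative
     pullback (Suc k) (Q s0) (\<lambda>K. T' K - (\<Sum>r<Suc k. \<Sum>m\<in>UNIV. B m (K ! r) * T s0 (K[r := m]))) I) (at s0 within S)"
    by (rule DERIV_cong[OF der])
  moreover have "pullback (Suc k) (Q s) (T s) I = (\<Sum>a\<in>UNIV. Q s $ a $ i * pullback k (Q s) (\<lambda>K. T s (a # K)) I')" for s
    unfolding I(1) by (rule pullback_Suc)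
  ultimately show ?case by simp
qed

section \<open>Directional and mixed second derivatives\<close>

lemma smooth_on_open_differentiable:
  assumes "smooth_on S f" "open S" "x \<in> S"
  shows "f differentiable (at x)"
proof -
  have "\<exists>U F. open U \<and> x \<in> U \<and> (\<forall>n. Ck_on n U F) \<and> (\<forall>y\<in>S \<inter> U. f y = F y)"
    by (rule bspec[OF assms(1)[unfolded smooth_on_def] assms(3)])
  then obtain U F where U: "open U" "x \<in> U" "\<And>n. Ck_on n U F" "\<And>y. y \<in> S \<inter> U \<Longrightarrow> f y = F y"
    by (elim exE conjE) metis
  have "F differentiable (at x)" using U(3)[of 1] U(2) by simp
  then obtain D where "(F has_derivative D) (at x)" by (auto simp: differentiable_def)
  then have "(f has_derivative D) (at x)"
    by (rule has_derivative_transform_within_open[of _ _ _ _ "S \<inter> U"]) (use assms U in auto)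
  then show ?thesis by (auto simp: differentiable_def)
qed

lemma has_derivative_line:
  fixes f :: "real^7 \<Rightarrow> real"
  assumes f: "f differentiable (at x)"
  shows "((\<lambda>s. f (x + s *\<^sub>R v)) has_real_derivative (\<Sum>i\<in>UNIV. v $ i * pd i f x)) (at 0)"
proof -
  let ?D = "frechet_derivative f (at x)"
  have D: "(f has_derivative ?D) (at x)" using f by (simp add: frechet_derivative_works)
  then have lin: "linear ?D" by (rule has_derivative_linear)
  have "?D v = ?D (\<Sum>i\<in>UNIV. v $ i *\<^sub>R axis i 1)"
    using basis_expansion[of v] by (simp add: scalar_mult_eq_scaleR)
  then have v: "?D v = (\<Sum>i\<in>UNIV. v $ i * pd i f x)"
    by (simp add: linear_sum[OF lin] linear_cmul[OF lin] pd_def)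
  have "((\<lambda>s. x + s *\<^sub>R v) has_derivative (\<lambda>s. s *\<^sub>R v)) (at 0)"
    by (auto intro!: derivative_eq_intros)
  moreover have "(f has_derivative ?D) (at (x + 0 *\<^sub>R v))" using D by simp
  ultimately have "((\<lambda>s. f (x + s *\<^sub>R v)) has_derivative (\<lambda>s. ?D (s *\<^sub>R v))) (at 0)"
    by (rule has_derivative_compose[of "\<lambda>s. x + s *\<^sub>R v" _ 0 UNIV f ?D, unfolded o_def])
  then show ?thesis
    unfolding has_field_derivative_def linear_cmul[OF lin] v by (simp add: mult_commute_abs)
qed

text \<open>The second difference quotient is symmetric in \<open>a\<close> and \<open>b\<close>.
  The mean value theorem, applied once in each direction, writes it as either mixed derivative at a
  nearby point, and continuity passes to the limit.\<close>

lemma second_derivative_symmetric: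
  fixes F :: "'b::real_normed_vector \<Rightarrow> real"
  assumes U: "open U" "z \<in> U" and C: "\<And>n. Ck_on n U F"
  shows "frechet_derivative (\<lambda>y. frechet_derivative F (at y) a) (at z) b
    = frechet_derivative (\<lambda>y. frechet_derivative F (at y) b) (at z) a"
proof -
  define A where "A = (\<lambda>a y. frechet_derivative F (at y) a)"
  define A2 where "A2 = (\<lambda>a b y. frechet_derivative (A a) (at y) b)"
  have dF: "(F has_derivative (\<lambda>v. A v y)) (at y)" if "y \<in> U" for y
    using C[of 1] that by (simp add: frechet_derivative_works[symmetric] A_def)
  have dA: "(A a has_derivative (\<lambda>v. A2 a v y)) (at y)" if "y \<in> U" for y a
    using C[of 2] that by (simp add: frechet_derivative_works[symmetric] A_def A2_def numeral_2_eq_2)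
  have cont: "continuous_on U (A2 a b)" for a b
    using C[of 2] by (simp add: A_def A2_def numeral_2_eq_2)
  obtain e where e: "e > 0" "ball z e \<subseteq> U" using U openE by blast
  have line: "((\<lambda>s. f (y + s *\<^sub>R v)) has_real_derivative f' v) (at s)"
    if "(f has_derivative f') (at (y + s *\<^sub>R v))" for f :: "'b \<Rightarrow> real" and f' y v s
  proof -
    have lin: "linear f'" using that by (rule has_derivative_linear)
    have "((\<lambda>s. y + s *\<^sub>R v) has_derivative (\<lambda>s. s *\<^sub>R v)) (at s)"
      by (auto intro!: derivative_eq_intros)
    then have "((\<lambda>s. f (y + s *\<^sub>R v)) has_derivative (\<lambda>s. f' (s *\<^sub>R v))) (at s)"
      using that by (rule has_derivative_compose[of "\<lambda>s. y + s *\<^sub>R v" _ s UNIV f f', unfolded o_def])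
    then show ?thesis
      unfolding has_field_derivative_def linear_cmul[OF lin] by (simp add: mult_commute_abs)
  qed
  have key: "\<exists>x y. 0 < x \<and> x < h \<and> 0 < y \<and> y < h \<and>
     F (z + h *\<^sub>R a + h *\<^sub>R b) - F (z + h *\<^sub>R a) - F (z + h *\<^sub>R b) + F z = h * h * A2 a b (z + x *\<^sub>R a + y *\<^sub>R b)"
    if h: "0 < h" "h * (norm a + norm b) < e" for h a b
  proof -
    have inU: "z + x *\<^sub>R a + y *\<^sub>R b \<in> U" if "0 \<le> x" "x \<le> h" "0 \<le> y" "y \<le> h" for x y
    proof -
      have "norm (x *\<^sub>R a + y *\<^sub>R b) \<le> x * norm a + y * norm b"
        using norm_triangle_ineq[of "x *\<^sub>R a" "y *\<^sub>R b"] that by simp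
      also have "\<dots> \<le> h * norm a + h * norm b"
        using that by (intro add_mono mult_right_mono) auto
      finally have "norm (x *\<^sub>R a + y *\<^sub>R b) < e" using h(2) by (simp add: distrib_left)
      moreover have "dist (z + (x *\<^sub>R a + y *\<^sub>R b)) z = norm (x *\<^sub>R a + y *\<^sub>R b)" by (simp add: dist_norm)
      ultimately have "z + x *\<^sub>R a + y *\<^sub>R b \<in> ball z e" by (simp only: mem_ball dist_commute[of z] add.assoc)
      then show ?thesis using e by auto
    qed
    let ?g = "\<lambda>s. F (z + s *\<^sub>R a + h *\<^sub>R b) - F (z + s *\<^sub>R a)"
    have "\<exists>x. 0 < x \<and> x < h \<and> ?g h - ?g 0 = (h - 0) * (A a (z + x *\<^sub>R a + h *\<^sub>R b) - A a (z + x *\<^sub>R a))"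
    proof (rule MVT2)
      fix x assume x: "0 \<le> x" "x \<le> h"
      have 1: "((\<lambda>s. F ((z + h *\<^sub>R b) + s *\<^sub>R a)) has_real_derivative A a ((z + h *\<^sub>R b) + x *\<^sub>R a)) (at x)"
        using inU[of x h] x h by (intro line dF) (simp add: algebra_simps)
      have 2: "((\<lambda>s. F (z + s *\<^sub>R a)) has_real_derivative A a (z + x *\<^sub>R a)) (at x)"
        using inU[of x 0] x h by (intro line dF) simp
      show "(?g has_real_derivative (A a (z + x *\<^sub>R a + h *\<^sub>R b) - A a (z + x *\<^sub>R a))) (at x)"
        using DERIV_diff[OF 1 2] by (simp add: algebra_simps)
    qed (use h in simp)
    then obtain x where x: "0 < x" "x < h" "?g h - ?g 0 = h * (A a (z + x *\<^sub>R a + h *\<^sub>R b) - A a (z + x *\<^sub>R a))" by auto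
    have "\<exists>y. 0 < y \<and> y < h \<and> A a (z + x *\<^sub>R a + h *\<^sub>R b) - A a (z + x *\<^sub>R a + 0 *\<^sub>R b) = (h - 0) * A2 a b (z + x *\<^sub>R a + y *\<^sub>R b)"
    proof (rule MVT2)
      fix t assume t: "0 \<le> t" "t \<le> h"
      show "((\<lambda>t. A a (z + x *\<^sub>R a + t *\<^sub>R b)) has_real_derivative A2 a b (z + x *\<^sub>R a + t *\<^sub>R b)) (at t)"
        by (rule line[OF dA]) (use inU[of x t] x t in simp)
    qed (rule h)
    then obtain y where y: "0 < y" "y < h" "A a (z + x *\<^sub>R a + h *\<^sub>R b) - A a (z + x *\<^sub>R a) = h * A2 a b (z + x *\<^sub>R a + y *\<^sub>R b)" by auto
    show ?thesis using x y by (intro exI[of _ x] exI[of _ y]) (simp add: algebra_simps)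
  qed
  have lim: "(\<lambda>n. A2 a b (z + x n *\<^sub>R a + y n *\<^sub>R b)) \<longlonglongrightarrow> A2 a b z"
    if "x \<longlonglongrightarrow> 0" "y \<longlonglongrightarrow> 0" for x y :: "nat \<Rightarrow> real" and a b
  proof -
    have "(\<lambda>n. z + x n *\<^sub>R a + y n *\<^sub>R b) \<longlonglongrightarrow> z + 0 *\<^sub>R a + 0 *\<^sub>R b"
      by (intro tendsto_intros that)
    moreover have "isCont (A2 a b) z" using cont U by (simp add: continuous_on_eq_continuous_at)
    ultimately show ?thesis using isCont_tendsto_compose[of z "A2 a b"] by simp
  qed
  \<comment> \<open>Keeps all parallelograms spanned by multiples of \<open>a\<close> and
    \<open>b\<close> inside the ball; the added 1 covers the case that both vectors vanish.\<close>
  define d where "d = e / (norm a + norm b + 1)"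
  have d: "d > 0" using e by (simp add: d_def add_nonneg_pos)
  define h where "h n = d / real (Suc n)" for n
  have h0: "0 < h n" for n using d by (simp add: h_def)
  have hd: "h n \<le> d" for n using d by (simp add: h_def field_simps)
  have he: "h n * (norm a + norm b) < e" "h n * (norm b + norm a) < e" for n
  proof -
    have "h n * (norm a + norm b) \<le> d * (norm a + norm b)" by (intro mult_right_mono hd) simp
    also have "\<dots> < d * (norm a + norm b + 1)" using d by simp
    also have "\<dots> = e" unfolding d_def by (simp add: add_nonneg_eq_0_iff add_nonneg_pos less_imp_neq[symmetric])
    finally show "h n * (norm a + norm b) < e" .
    then show "h n * (norm b + norm a) < e" by (simp add: add.commute)
  qed
  have hlim: "h \<longlonglongrightarrow> 0" unfolding h_def using LIMSEQ_inverse_real_of_nat tendsto_mult_right_zero[of "\<lambda>n. inverse (real (Suc n))" sequentially d]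
    by (simp add: divide_inverse)
  obtain x y where xy: "\<And>n. 0 < x n \<and> x n < h n \<and> 0 < y n \<and> y n < h n \<and>
     F (z + h n *\<^sub>R a + h n *\<^sub>R b) - F (z + h n *\<^sub>R a) - F (z + h n *\<^sub>R b) + F z = h n * h n * A2 a b (z + x n *\<^sub>R a + y n *\<^sub>R b)"
    using key[OF h0 he(1)] by metis
  obtain x' y' where xy': "\<And>n. 0 < x' n \<and> x' n < h n \<and> 0 < y' n \<and> y' n < h n \<and>
     F (z + h n *\<^sub>R b + h n *\<^sub>R a) - F (z + h n *\<^sub>R b) - F (z + h n *\<^sub>R a) + F z = h n * h n * A2 b a (z + x' n *\<^sub>R b + y' n *\<^sub>R a)"
    using key[OF h0 he(2)] by metis
  have sq: "u \<longlonglongrightarrow> 0" if "\<And>n. 0 < u n \<and> u n < h n" for u :: "nat \<Rightarrow> real"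
    by (rule real_tendsto_sandwich[OF _ _ tendsto_const hlim]) (use that in \<open>auto intro!: always_eventually less_imp_le\<close>)
  have eq: "A2 a b (z + x n *\<^sub>R a + y n *\<^sub>R b) = A2 b a (z + x' n *\<^sub>R b + y' n *\<^sub>R a)" for n
  proof -
    have "h n * h n * A2 a b (z + x n *\<^sub>R a + y n *\<^sub>R b) = h n * h n * A2 b a (z + x' n *\<^sub>R b + y' n *\<^sub>R a)"
      using xy[of n] xy'[of n] by (simp add: algebra_simps)
    then show ?thesis using h0[of n] by simp
  qed
  have "(\<lambda>n. A2 a b (z + x n *\<^sub>R a + y n *\<^sub>R b)) \<longlonglongrightarrow> A2 a b z"
    by (rule lim; rule sq) (use xy in blast)+
  moreover have "(\<lambda>n. A2 a b (z + x n *\<^sub>R a + y n *\<^sub>R b)) \<longlonglongrightarrow> A2 b a z"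
    unfolding eq by (rule lim; rule sq) (use xy' in blast)+
  ultimately have "A2 a b z = A2 b a z" by (rule LIMSEQ_unique)
  then show ?thesis by (simp add: A2_def A_def)
qed

lemma deriv_unique_within:
  fixes f :: "real \<Rightarrow> real"
  assumes "(f has_real_derivative D) (at x within S)" "(f has_real_derivative E) (at x within S)"
    and "at x within S \<noteq> bot"
  shows "D = E"
  using assms tendsto_unique[of "at x within S"] unfolding has_field_derivative_iff by blast

section \<open>Derivatives of determinants and of inverse matrices\<close>

lemma differentiable_prod:
  fixes f :: "'i \<Rightarrow> 'a::real_normed_vector \<Rightarrow> real"
  assumes "finite X" "\<And>i. i \<in> X \<Longrightarrow> f i differentiable (at s within S)"
  shows "(\<lambda>s. \<Prod>i\<in>X. f i s) differentiable (at s within S)"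
  using assms by (induction rule: finite_induct) auto

lemma differentiable_det:
  fixes A :: "'a::real_normed_vector \<Rightarrow> real^'n^'n"
  assumes "\<And>i j. (\<lambda>s. A s $ i $ j) differentiable (at s within S)"
  shows "(\<lambda>s. det (A s)) differentiable (at s within S)"
  unfolding det_def
  by (intro differentiable_sum ballI differentiable_mult differentiable_const differentiable_prod assms) simp_all

lemma matrix_inv_cramer:
  fixes A :: "real^'n^'n"
  assumes A: "det A \<noteq> 0"
  shows "matrix_inv A $ i $ j = det (\<chi> k l. if l = i then (axis j 1 :: real^'n) $ k else A $ k $ l) / det A"
proof -
  obtain B where B: "A ** B = mat 1" "B ** A = mat 1" using A by (auto simp: invertible_det_nz[symmetric] invertible_def)
  have "A *v (B *v axis j 1) = axis j 1" by (simp add: matrix_vector_mul_assoc B)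
  then have "B *v axis j 1 = (\<chi> k. det (\<chi> i l. if l = k then (axis j 1 :: real^'n) $ i else A $ i $ l) / det A)"
    using cramer[OF A] by blast
  moreover have "B $ i $ j = (B *v axis j 1) $ i"
    by (simp add: matrix_vector_mult_def axis_def if_distrib cong: if_cong)
  ultimately show ?thesis using matrix_inv_eqI[OF B] by simp
qed

lemma matrix_inv_mult:
  fixes A :: "real^'n^'n"
  assumes "invertible A"
  shows "A ** matrix_inv A = mat 1" "matrix_inv A ** A = mat 1"
proof -
  obtain B where B: "A ** B = mat 1" "B ** A = mat 1" using assms by (auto simp: invertible_def)
  show "A ** matrix_inv A = mat 1" "matrix_inv A ** A = mat 1"
    using B unfolding matrix_inv_eqI[OF B] by simp_all
qed

text \<open>Cramer's rule shows that the entries of the inverse are differentiable; the value then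
  follows by differentiating the product of the matrix with its inverse.\<close>

lemma matrix_inv_has_derivative:
  fixes A :: "real \<Rightarrow> real^'n^'n"
  assumes A': "\<And>i j. ((\<lambda>s. A s $ i $ j) has_real_derivative A' $ i $ j) (at s0 within S)"
    and inv: "\<And>s. s \<in> S \<Longrightarrow> invertible (A s)" and s0: "s0 \<in> S" "at s0 within S \<noteq> bot"
  shows "((\<lambda>s. matrix_inv (A s) $ i $ j) has_real_derivative
     (- (matrix_inv (A s0) ** (A' ** matrix_inv (A s0)))) $ i $ j) (at s0 within S)"
proof -
  have dA: "(\<lambda>s. A s $ i $ j) differentiable (at s0 within S)" for i j
    using A' by (auto simp: real_differentiable_def)
  have "\<exists>D. ((\<lambda>s. matrix_inv (A s) $ i $ j) has_real_derivative D) (at s0 within S)" for i j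
  proof -
    let ?F = "\<lambda>s. det (\<chi> k l. if l = i then (axis j 1 :: real^'n) $ k else A s $ k $ l) / det (A s)"
    have c: "(\<lambda>s. if l = i then (axis j 1 :: real^'n) $ k else A s $ k $ l) differentiable (at s0 within S)" for k l
      by (cases "l = i") (simp_all add: dA)
    have "?F differentiable (at s0 within S)"
      using inv[OF s0(1)] dA c by (intro differentiable_divide differentiable_det) (simp_all add: invertible_det_nz)
    then obtain D where D: "(?F has_real_derivative D) (at s0 within S)" by (auto simp: real_differentiable_def)
    have "((\<lambda>s. matrix_inv (A s) $ i $ j) has_real_derivative D) (at s0 within S)"
      by (rule has_field_derivative_transform_within[OF D zero_less_one s0(1)])
         (use inv in \<open>simp add: matrix_inv_cramer invertible_det_nz\<close>)
    then show ?thesis ..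
  qed
  then obtain D where D: "\<And>i j. ((\<lambda>s. matrix_inv (A s) $ i $ j) has_real_derivative D i j) (at s0 within S)"
    by metis
  define M where "M = (\<chi> i j. D i j)"
  have M: "((\<lambda>s. matrix_inv (A s) $ i $ j) has_real_derivative M $ i $ j) (at s0 within S)" for i j
    unfolding M_def using D by simp
  have "(A' ** matrix_inv (A s0) + A s0 ** M) $ i $ j = 0" for i j
  proof (rule deriv_unique_within[OF _ _ s0(2)])
    have "((\<lambda>s. \<Sum>k\<in>UNIV. A s $ i $ k * matrix_inv (A s) $ k $ j) has_real_derivative
       (\<Sum>k\<in>UNIV. A' $ i $ k * matrix_inv (A s0) $ k $ j + M $ k $ j * A s0 $ i $ k)) (at s0 within S)"
      by (intro DERIV_sum DERIV_mult A' M)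
    then show "((\<lambda>s. \<Sum>k\<in>UNIV. A s $ i $ k * matrix_inv (A s) $ k $ j) has_real_derivative
       (A' ** matrix_inv (A s0) + A s0 ** M) $ i $ j) (at s0 within S)"
      by (simp add: matrix_matrix_mult_def sum.distrib mult.commute[of "M $ _ $ _"])
    have *: "(\<Sum>k\<in>UNIV. A s $ i $ k * matrix_inv (A s) $ k $ j) = (mat 1 :: real^'n^'n) $ i $ j" if "s \<in> S" for s
    proof -
      have "(\<Sum>k\<in>UNIV. A s $ i $ k * matrix_inv (A s) $ k $ j) = (A s ** matrix_inv (A s)) $ i $ j"
        by (simp add: matrix_matrix_mult_def)
      then show ?thesis using matrix_inv_mult(1)[OF inv[OF that]] by simp
    qed
    show "((\<lambda>s. \<Sum>k\<in>UNIV. A s $ i $ k * matrix_inv (A s) $ k $ j) has_real_derivative 0) (at s0 within S)"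
      by (rule has_field_derivative_transform_within[OF DERIV_const zero_less_one s0(1)]) (rule *[symmetric])
  qed
  then have "A s0 ** M = - (A' ** matrix_inv (A s0))"
    by (simp add: vec_eq_iff eq_neg_iff_add_eq_0 add.commute)
  then have "matrix_inv (A s0) ** (A s0 ** M) = matrix_inv (A s0) ** (- (A' ** matrix_inv (A s0)))" by simp
  moreover have "matrix_inv (A s0) ** (A s0 ** M) = M"
    unfolding matrix_mul_assoc matrix_inv_mult(2)[OF inv[OF s0(1)]] by simp
  moreover have "matrix_inv (A s0) ** (- Y) = - (matrix_inv (A s0) ** Y)" for Y :: "real^'n^'n"
    by (simp add: vec_eq_iff matrix_matrix_mult_def sum_negf)
  ultimately have "M = - (matrix_inv (A s0) ** (A' ** matrix_inv (A s0)))" by simp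
  then show ?thesis using M[of i j] by simp
qed

section \<open>Change of frame\<close>

lemma gmat_pullback: "gmat (pullback 2 Q g) = transpose Q ** gmat g ** Q"
proof -
  have "pullback 2 Q g [i, j] = (transpose Q ** gmat g ** Q) $ i $ j" for i j
    by (simp add: numeral_2_eq_2 pullback_Suc gmat_def matrix_matrix_mult_def transpose_def sum_distrib_left sum_distrib_right mult_ac)
       (subst sum.swap, simp add: mult_ac)
  then show ?thesis by (simp add: gmat_def vec_eq_iff)
qed

lemma invertible_transpose_iff: "invertible (A :: real^'n^'n) \<Longrightarrow> invertible (transpose A)"
  by (simp add: invertible_det_nz)

lemma ginv_pullback:
  assumes Q: "invertible Q" and g: "invertible (gmat g)"
  shows "ginv g a b = (\<Sum>i\<in>UNIV. \<Sum>j\<in>UNIV. Q $ a $ i * Q $ b $ j * ginv (pullback 2 Q g) i j)"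
proof -
  let ?R = "matrix_inv (transpose Q ** gmat g ** Q)"
  have inv: "invertible (transpose Q ** gmat g ** Q)"
    using Q g by (intro invertible_mult invertible_transpose_iff)
  obtain W where W: "Q ** W = mat 1" "W ** Q = mat 1" using Q by (auto simp: invertible_def)
  have WT: "transpose Q ** transpose W = mat 1" "transpose W ** transpose Q = mat 1"
    using W by (simp_all add: matrix_transpose_mul[symmetric])
  have "matrix_inv (gmat g) = Q ** ?R ** transpose Q"
  proof (rule matrix_inv_eqI)
    have "gmat g ** (Q ** ?R ** transpose Q) = (transpose W ** transpose Q) ** gmat g ** Q ** ?R ** transpose Q"
      by (simp add: WT matrix_mul_assoc)
    also have "\<dots> = transpose W ** ((transpose Q ** gmat g ** Q) ** ?R) ** transpose Q"
      by (simp only: matrix_mul_assoc)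
    finally show "gmat g ** (Q ** ?R ** transpose Q) = mat 1"
      by (simp add: matrix_inv_mult(1)[OF inv] WT)
    have "Q ** ?R ** transpose Q ** gmat g = Q ** ?R ** transpose Q ** gmat g ** (Q ** W)"
      by (simp add: W)
    also have "\<dots> = Q ** (?R ** (transpose Q ** gmat g ** Q)) ** W"
      by (simp only: matrix_mul_assoc)
    finally show "Q ** ?R ** transpose Q ** gmat g = mat 1"
      by (simp add: matrix_inv_mult(2)[OF inv] W)
  qed
  then have "ginv g a b = (Q ** ?R ** transpose Q) $ a $ b" by (simp add: ginv_def)
  also have "\<dots> = (\<Sum>j\<in>UNIV. \<Sum>i\<in>UNIV. Q $ a $ i * Q $ b $ j * ginv (pullback 2 Q g) i j)"
    unfolding ginv_def gmat_pullback
    by (simp add: matrix_matrix_mult_def transpose_def sum_distrib_left sum_distrib_right mult_ac)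
  finally show ?thesis by (subst sum.swap) simp
qed

text \<open>The analogue of \<open>contr_append\<close> for an arbitrary invertible matrix, as
  required for moved frames that are no longer adapted.\<close>

lemma contr_append_pullback:
  assumes Q: "invertible Q" and g: "invertible (gmat g)" and I: "length I = m" "length J = n"
  shows "pullback (m + n) Q (\<lambda>L. contr k (ginv g) (\<lambda>K. u (take m L @ K)) (\<lambda>K. w (drop m L @ K))) (I @ J)
    = contr k (ginv (pullback 2 Q g)) (\<lambda>K. pullback (m + k) Q u (I @ K)) (\<lambda>K. pullback (n + k) Q w (J @ K))"
proof -
  have "contr k (ginv (pullback 2 Q g)) (\<lambda>K. pullback (m + k) Q u (I @ K)) (\<lambda>K. pullback (n + k) Q w (J @ K))
     = contr k (ginv (pullback 2 Q g)) (\<lambda>K. pullback m Q (\<lambda>I'. pullback k Q (\<lambda>K'. u (I' @ K')) K) I)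
         (\<lambda>K. pullback n Q (\<lambda>J'. pullback k Q (\<lambda>K'. w (J' @ K')) K) J)"
    using I by (intro contr_cong) (simp_all add: pullback_append)
  also have "\<dots> = pullback m Q (\<lambda>I'. pullback n Q (\<lambda>J'. contr k (ginv (pullback 2 Q g)) (pullback k Q (\<lambda>K'. u (I' @ K'))) (pullback k Q (\<lambda>K'. w (J' @ K')))) J) I"
    unfolding pullback_contr_right pullback_contr_left ..
  also have "\<dots> = pullback m Q (\<lambda>I'. pullback n Q (\<lambda>J'. contr k (ginv g) (\<lambda>K. u (I' @ K)) (\<lambda>K. w (J' @ K))) J) I"
    unfolding contr_pullback[where \<gamma>' = "ginv g", OF ginv_pullback[OF Q g]] ..
  also have "\<dots> = pullback m Q (\<lambda>I'. pullback n Q (\<lambda>J'. contr k (ginv g) (\<lambda>K. u (take m (I' @ J') @ K)) (\<lambda>K. w (drop m (I' @ J') @ K))) J) I"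
    by (intro pullback_cong) simp
  also have "\<dots> = pullback (m + n) Q (\<lambda>L. contr k (ginv g) (\<lambda>K. u (take m L @ K)) (\<lambda>K. w (drop m L @ K))) (I @ J)"
    using I by (simp only: pullback_append)
  finally show ?thesis by simp
qed

lemma frame_data_pullback:
  assumes "frame_data N f g p" and Q: "invertible Q"
  shows "frame_data (N ** Q) (pullback 3 Q f) (pullback 2 Q g) (pullback 4 Q p)"
proof -
  have N: "invertible N" "gmat g = transpose N ** N" and f: "\<And>K. length K = 3 \<Longrightarrow> f K = pullback 3 N phi0 K"
    and p: "\<And>K. length K = 4 \<Longrightarrow> p K = pullback 4 N psiL K"
    using assms by (auto simp: frame_data_def)
  have "pullback 3 Q f K = pullback 3 (N ** Q) phi0 K" if "length K = 3" for K
    unfolding pullback_pullback[OF that, symmetric] by (rule pullback_cong) (rule f)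
  moreover have "pullback 4 Q p K = pullback 4 (N ** Q) psiL K" if "length K = 4" for K
    unfolding pullback_pullback[OF that, symmetric] by (rule pullback_cong) (rule p)
  moreover have "gmat (pullback 2 Q g) = transpose (N ** Q) ** (N ** Q)"
    unfolding gmat_pullback N(2) matrix_transpose_mul by (simp only: matrix_mul_assoc)
  ultimately show ?thesis unfolding frame_data_def using N(1) Q by (auto intro: invertible_mult)
qed

text \<open>If \<open>Q\<close> intertwines \<open>B\<close> with \<open>C\<close>, the derivation
  action of \<open>B\<close> before the pullback is that of \<open>C\<close> after it.\<close>

lemma pullback_action:
  assumes B: "\<And>m i. (\<Sum>a\<in>UNIV. B m a * Q $ a $ i) = (\<Sum>b\<in>UNIV. Q $ m $ b * C b i)"
  shows "length I = k \<Longrightarrow> pullback k Q (\<lambda>K. \<Sum>r<k. \<Sum>m\<in>UNIV. B m (K ! r) * T (K[r := m])) I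
    = (\<Sum>r<k. \<Sum>m\<in>UNIV. C m (I ! r) * pullback k Q T (I[r := m]))"
proof (induction k arbitrary: I T)
  case 0 then show ?case by simp
next
  case (Suc k)
  then obtain i I' where I: "I = i # I'" "length I' = k" by (cases I) auto
  have "(\<Sum>r<Suc k. \<Sum>m\<in>UNIV. B m ((a # K) ! r) * T ((a # K)[r := m]))
     = (\<Sum>m\<in>UNIV. B m a * T (m # K)) + (\<Sum>r<k. \<Sum>m\<in>UNIV. B m (K ! r) * T (a # K[r := m]))" for a K
    unfolding sum.lessThan_Suc_shift by simp
  moreover have "pullback k Q (\<lambda>K. \<Sum>r<k. \<Sum>m\<in>UNIV. B m (K ! r) * T (a # K[r := m])) I'
     = (\<Sum>r<k. \<Sum>m\<in>UNIV. C m (I' ! r) * pullback k Q (\<lambda>K. T (a # K)) (I'[r := m]))" for a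
    by (rule Suc.IH[OF I(2), of "\<lambda>K. T (a # K)"])
  ultimately have "pullback (Suc k) Q (\<lambda>K. \<Sum>r<Suc k. \<Sum>m\<in>UNIV. B m (K ! r) * T (K[r := m])) I
     = (\<Sum>a\<in>UNIV. Q $ a $ i * ((\<Sum>m\<in>UNIV. B m a * pullback k Q (\<lambda>K. T (m # K)) I')
         + (\<Sum>r<k. \<Sum>m\<in>UNIV. C m (I' ! r) * pullback k Q (\<lambda>K. T (a # K)) (I'[r := m]))))"
    unfolding I(1) pullback_Suc by (simp only: pullback_add pullback_sum)
  also have "\<dots> = (\<Sum>a\<in>UNIV. Q $ a $ i * (\<Sum>m\<in>UNIV. B m a * pullback k Q (\<lambda>K. T (m # K)) I'))
     + (\<Sum>r<k. \<Sum>m\<in>UNIV. C m (I' ! r) * (\<Sum>a\<in>UNIV. Q $ a $ i * pullback k Q (\<lambda>K. T (a # K)) (I'[r := m])))"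
  proof -
    have "(\<Sum>a\<in>UNIV. Q $ a $ i * (\<Sum>r<k. \<Sum>m\<in>UNIV. C m (I' ! r) * pullback k Q (\<lambda>K. T (a # K)) (I'[r := m])))
       = (\<Sum>r<k. \<Sum>m\<in>UNIV. C m (I' ! r) * (\<Sum>a\<in>UNIV. Q $ a $ i * pullback k Q (\<lambda>K. T (a # K)) (I'[r := m])))"
      unfolding sum_distrib_left
      by (subst sum.swap, rule sum.cong[OF refl], subst sum.swap) (simp add: mult.left_commute)
    then show ?thesis by (simp add: distrib_left sum.distrib)
  qed
  also have "(\<Sum>a\<in>UNIV. Q $ a $ i * (\<Sum>m\<in>UNIV. B m a * pullback k Q (\<lambda>K. T (m # K)) I'))
     = (\<Sum>m\<in>UNIV. C m i * (\<Sum>b\<in>UNIV. Q $ b $ m * pullback k Q (\<lambda>K. T (b # K)) I'))"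
  proof -
    have "(\<Sum>a\<in>UNIV. Q $ a $ i * (\<Sum>m\<in>UNIV. B m a * pullback k Q (\<lambda>K. T (m # K)) I'))
       = (\<Sum>m\<in>UNIV. (\<Sum>a\<in>UNIV. B m a * Q $ a $ i) * pullback k Q (\<lambda>K. T (m # K)) I')"
      unfolding sum_distrib_left sum_distrib_right by (subst sum.swap) (simp add: mult_ac)
    also have "\<dots> = (\<Sum>m\<in>UNIV. \<Sum>b\<in>UNIV. C b i * (Q $ m $ b * pullback k Q (\<lambda>K. T (m # K)) I'))"
      unfolding B sum_distrib_right by (simp add: mult_ac)
    finally show ?thesis unfolding sum_distrib_left by (subst (2) sum.swap)
  qed
  finally show ?case
    unfolding I(1) sum.lessThan_Suc_shift by (simp add: pullback_Suc)
qed

text \<open>An interval with interior points is not a single point, so each of its points is a limit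
  point. One-sided derivatives at an end point are then unique.\<close>

lemma interval_at_within_ne_bot:
  fixes J :: "real set"
  assumes "is_interval J" "interior J \<noteq> {}" "t \<in> J"
  shows "at t within J \<noteq> bot"
proof -
  have "J \<noteq> {x}" for x using assms(2) by auto
  then have "t islimpt J" using assms by (intro connected_imp_perfect) (auto simp: is_interval_connected)
  then show ?thesis by (simp add: trivial_limit_within)
qed

text \<open>Near the point the family agrees with a smooth function on an open set of space-time,
  whose second derivatives commute. This also covers end points of the time interval, where only
  one-sided derivatives exist.\<close>

lemma mixed_partials:
  fixes u :: "real \<Rightarrow> real^7 \<Rightarrow> real"
  assumes ne: "at t0 within J \<noteq> bot" and t0: "t0 \<in> J" and V: "open V" "x0 \<in> V"
    and sm: "smooth_on (J \<times> V) (\<lambda>(t, x). u t x)"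
    and w: "\<And>x. x \<in> V \<Longrightarrow> ((\<lambda>s. u s x) has_real_derivative w x) (at t0 within J)"
  shows "((\<lambda>s. pd i (u s) x0) has_real_derivative pd i w x0) (at t0 within J)" "w differentiable (at x0)"
proof -
  have "\<exists>U F. open U \<and> (t0, x0) \<in> U \<and> (\<forall>n. Ck_on n U F) \<and> (\<forall>y\<in>(J \<times> V) \<inter> U. (case y of (t, x) \<Rightarrow> u t x) = F y)"
    by (rule bspec[OF sm[unfolded smooth_on_def]]) (use t0 V in simp)
  then obtain U F where U: "open U" "(t0, x0) \<in> U" and UF: "\<forall>n. Ck_on n U F"
    "\<forall>y\<in>(J \<times> V) \<inter> U. (case y of (t, x) \<Rightarrow> u t x) = F y"
    by (elim exE conjE) metis
  have C: "Ck_on n U F" for n using UF(1) by blast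
  have uF: "u t x = F (t, x)" if "t \<in> J" "x \<in> V" "(t, x) \<in> U" for t x
    using bspec[OF UF(2), of "(t, x)"] that by simp
  obtain A B where "open A" "open B" "(t0, x0) \<in> A \<times> B" "A \<times> B \<subseteq> U"
    using open_prod_elim[OF U] by metis
  then have AB: "open A" "open B" "t0 \<in> A" "x0 \<in> B" "A \<times> B \<subseteq> U" by auto
  define a b where "a = (1 :: real, 0 :: real^7)" and "b = (0 :: real, axis i 1 :: real^7)"
  define F1 where "F1 v y = frechet_derivative F (at y) v" for v y
  have dF: "(F has_derivative (\<lambda>v. F1 v y)) (at y)" if "y \<in> U" for y
    using C[of 1] that by (simp add: frechet_derivative_works[symmetric] F1_def)
  have dF1: "(F1 v has_derivative frechet_derivative (F1 v) (at y)) (at y)" if "y \<in> U" for v y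
  proof -
    have "Ck_on (Suc (Suc 0)) U F" by (rule C)
    then have "Ck_on (Suc 0) U (F1 v)" unfolding Ck_on.simps(2)[of "Suc 0"] F1_def by blast
    then have "F1 v differentiable (at y)" using that unfolding Ck_on.simps(2) by blast
    then show ?thesis by (simp only: frechet_derivative_works)
  qed
  have time: "((\<lambda>s. G (s, x)) has_real_derivative G' a) (at t within J)"
    if "(G has_derivative G') (at (t, x))" for G :: "real \<times> (real^7) \<Rightarrow> real" and G' t x
  proof -
    have lin: "linear G'" using that by (rule has_derivative_linear)
    have "((\<lambda>s. (s, x)) has_derivative (\<lambda>s. (s, 0))) (at t within J)" by (auto intro!: derivative_eq_intros)
    then have "((\<lambda>s. G (s, x)) has_derivative (\<lambda>s. G' (s, 0))) (at t within J)"
      using that by (rule has_derivative_compose[of "\<lambda>s. (s, x)" _ t J G G', unfolded o_def])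
    moreover have "G' (s, 0) = G' a * s" for s
      using linear_cmul[OF lin, of s a] by (simp add: a_def mult.commute)
    ultimately show ?thesis unfolding has_field_derivative_def by simp
  qed
  have space: "((\<lambda>x. G (t, x)) has_derivative (\<lambda>v. G' (0, v))) (at x)"
    if "(G has_derivative G') (at (t, x))" for G :: "real \<times> (real^7) \<Rightarrow> real" and G' t x
  proof -
    have "((\<lambda>x. (t, x)) has_derivative (\<lambda>v. (0, v))) (at x)" by (auto intro!: derivative_eq_intros)
    then show ?thesis
      using that by (rule has_derivative_compose[of "\<lambda>x. (t, x)" _ x UNIV G G', unfolded o_def])
  qed
  have sp: "pd i (u s) x0 = F1 b (s, x0)" if s: "s \<in> J" "s \<in> A" for s
  proof -
    have "(s, x0) \<in> U" using AB s by auto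
    then have "((\<lambda>x. F (s, x)) has_derivative (\<lambda>v. F1 (0, v) (s, x0))) (at x0)" by (intro space dF)
    then have "(u s has_derivative (\<lambda>v. F1 (0, v) (s, x0))) (at x0)"
      by (rule has_derivative_transform_within_open[of _ _ _ _ "B \<inter> V"]) (use AB V s uF in auto)
    then show ?thesis using frechet_derivative_at[of "u s"] by (metis pd_def b_def)
  qed
  have wF: "w x = F1 a (t0, x)" if x: "x \<in> B" "x \<in> V" for x
  proof (rule deriv_unique_within[OF w[OF x(2)] _ ne])
    have tx: "(t0, x) \<in> U" using AB x by auto
    obtain d where d: "d > 0" "ball t0 d \<subseteq> A" using AB openE by blast
    show "((\<lambda>s. u s x) has_real_derivative F1 a (t0, x)) (at t0 within J)"
    proof (rule has_field_derivative_transform_within[OF time[OF dF[OF tx]] d(1) t0])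
      fix s assume s: "s \<in> J" "dist s t0 < d"
      then have "s \<in> A" using d by (auto simp: dist_commute)
      then have "(s, x) \<in> U" using AB x by auto
      then show "F (s, x) = u s x" using uF[of s x] s x by simp
    qed
  qed
  have z: "(t0, x0) \<in> U" by (rule U(2))
  have dw: "(w has_derivative (\<lambda>v. frechet_derivative (F1 a) (at (t0, x0)) (0, v))) (at x0)"
    by (rule has_derivative_transform_within_open[of _ _ _ _ "B \<inter> V", OF space[OF dF1[OF z, of a]]]) (use AB V wF in auto)
  then show "w differentiable (at x0)" by (auto simp: differentiable_def)
  have pw: "pd i w x0 = frechet_derivative (F1 a) (at (t0, x0)) b"
    using frechet_derivative_at[OF dw] by (metis pd_def b_def)
  have sym: "frechet_derivative (F1 b) (at (t0, x0)) a = frechet_derivative (F1 a) (at (t0, x0)) b"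
    unfolding F1_def[abs_def] by (rule second_derivative_symmetric[OF U C])
  obtain d where d: "d > 0" "ball t0 d \<subseteq> A" using AB openE by blast
  show "((\<lambda>s. pd i (u s) x0) has_real_derivative pd i w x0) (at t0 within J)"
    unfolding pw sym[symmetric]
  proof (rule has_field_derivative_transform_within[OF time[OF dF1[OF z, of b]] d(1) t0])
    fix s assume s: "s \<in> J" "dist s t0 < d"
    then have "s \<in> A" using d by (auto simp: dist_commute)
    then show "F1 b (s, x0) = pd i (u s) x0" using sp[of s] s by simp
  qed
qed

section \<open>Curves of adapted frames\<close>

text \<open>Peels off one contracted pair and keeps the variation of \<gamma> visible, as
  \<open>metric_variation\<close> requires; \<open>contr_derivative\<close> treats the stationary
  case for all pairs.\<close>

lemma contr_Suc_derivative:
  assumes \<gamma>': "\<And>i j. ((\<lambda>s. \<gamma> s i j) has_real_derivative \<gamma>' i j) (at s0 within S)"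
    and \<gamma>0: "\<And>i j. \<gamma> s0 i j = kdelta i j"
    and C: "\<And>i j. ((\<lambda>s. contr k (\<gamma> s) (\<lambda>I. u s (i # I)) (\<lambda>K. w s (j # K))) has_real_derivative C i j) (at s0 within S)"
  shows "((\<lambda>s. contr (Suc k) (\<gamma> s) (u s) (w s)) has_real_derivative
     (\<Sum>i\<in>UNIV. \<Sum>j\<in>UNIV. \<gamma>' i j * contr k kdelta (\<lambda>I. u s0 (i # I)) (\<lambda>K. w s0 (j # K))) + (\<Sum>i\<in>UNIV. C i i))
     (at s0 within S)"
proof -
  have e: "\<gamma> s0 = kdelta" by (intro ext) (rule \<gamma>0)
  have "((\<lambda>s. \<Sum>i\<in>UNIV. \<Sum>j\<in>UNIV. \<gamma> s i j * contr k (\<gamma> s) (\<lambda>I. u s (i # I)) (\<lambda>K. w s (j # K))) has_real_derivative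
     (\<Sum>i\<in>UNIV. \<Sum>j\<in>UNIV. \<gamma>' i j * contr k (\<gamma> s0) (\<lambda>I. u s0 (i # I)) (\<lambda>K. w s0 (j # K)) + C i j * \<gamma> s0 i j)) (at s0 within S)"
    by (intro DERIV_sum DERIV_mult \<gamma>' C)
  then have D: "((\<lambda>s. contr (Suc k) (\<gamma> s) (u s) (w s)) has_real_derivative
     (\<Sum>i\<in>UNIV. \<Sum>j\<in>UNIV. \<gamma>' i j * contr k (\<gamma> s0) (\<lambda>I. u s0 (i # I)) (\<lambda>K. w s0 (j # K)) + C i j * \<gamma> s0 i j)) (at s0 within S)"
    unfolding contr_Suc .
  show ?thesis
    by (rule DERIV_cong[OF D]) (simp add: e sum.distrib kdelta_mult_if)
qed

lemma contr_derivative: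
  assumes \<gamma>': "\<And>i j. ((\<lambda>s. \<gamma> s i j) has_real_derivative 0) (at s0 within S)"
    and \<gamma>0: "\<And>i j. \<gamma> s0 i j = kdelta i j"
    and u: "\<And>K. length K = k \<Longrightarrow> ((\<lambda>s. u s K) has_real_derivative u' K) (at s0 within S)"
    and w: "\<And>K. length K = k \<Longrightarrow> ((\<lambda>s. w s K) has_real_derivative w' K) (at s0 within S)"
  shows "((\<lambda>s. contr k (\<gamma> s) (u s) (w s)) has_real_derivative
     contr k kdelta u' (w s0) + contr k kdelta (u s0) w') (at s0 within S)"
  using u w
proof (induction k arbitrary: u w u' w')
  case 0
  have "((\<lambda>s. u s [] * w s []) has_real_derivative u' [] * w s0 [] + w' [] * u s0 []) (at s0 within S)"
    by (rule DERIV_mult) (use 0 in simp_all)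
  then show ?case by (simp add: mult.commute)
next
  case (Suc k)
  have "((\<lambda>s. contr k (\<gamma> s) (\<lambda>I. u s (i # I)) (\<lambda>K. w s (j # K))) has_real_derivative
     contr k kdelta (\<lambda>I. u' (i # I)) (\<lambda>K. w s0 (j # K)) + contr k kdelta (\<lambda>I. u s0 (i # I)) (\<lambda>K. w' (j # K))) (at s0 within S)" for i j
    by (rule Suc.IH) (use Suc.prems in simp_all)
  from contr_Suc_derivative[OF \<gamma>' \<gamma>0 this] show ?case
    by (rule DERIV_cong) (simp add: contr_kdelta_Suc sum.distrib)
qed

lemma frame_data_sym:
  assumes "frame_data N f g p"
  shows "g [j, i] = g [i, j]" "invertible (gmat g)"
proof -
  have N: "invertible N" "gmat g = transpose N ** N" using assms by (auto simp: frame_data_def)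
  have "gmat g $ j $ i = gmat g $ i $ j" unfolding N(2) by (simp add: matrix_matrix_mult_def transpose_def mult.commute)
  then show "g [j, i] = g [i, j]" by (simp add: gmat_def)
  show "invertible (gmat g)" unfolding N(2) using N(1) by (intro invertible_mult invertible_transpose_iff)
qed

text \<open>The curve is normalised so that the adapted frame at \<open>s0\<close> is the standard one.\<close>

locale frame_curve =
  fixes f g p :: "real \<Rightarrow> tensor" and s0 :: real and S :: "real set"
    and F' :: "7 \<Rightarrow> 7 \<Rightarrow> 7 \<Rightarrow> real" and G' :: "7 \<Rightarrow> 7 \<Rightarrow> real"
  assumes s0: "s0 \<in> S" "at s0 within S \<noteq> bot"
    and frame: "\<And>s. s \<in> S \<Longrightarrow> \<exists>N. frame_data N (f s) (g s) (p s)"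
    and g0: "\<And>i j. g s0 [i, j] = kdelta i j" and f0: "\<And>i j k. f s0 [i, j, k] = phi i j k"
    and f': "\<And>i j k. ((\<lambda>s. f s [i, j, k]) has_real_derivative F' i j k) (at s0 within S)"
    and g': "\<And>i j. ((\<lambda>s. g s [i, j]) has_real_derivative G' i j) (at s0 within S)"
begin

lemma unique: "(u has_real_derivative D) (at s0 within S) \<Longrightarrow> (w has_real_derivative E) (at s0 within S) \<Longrightarrow>
    (\<And>s. s \<in> S \<Longrightarrow> u s = w s) \<Longrightarrow> D = E"
  by (rule deriv_unique_within[OF _ _ s0(2)], assumption)
     (rule has_field_derivative_transform_within[OF _ zero_less_one s0(1)], auto)

lemma G'_sym: "G' j i = G' i j"
  by (rule unique[OF g' g']) (use frame frame_data_sym(1) in blast)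

lemma alt3_F': "alt3 F'"
  unfolding alt3_def
proof (intro allI conjI)
  fix a b c
  have alt: "f s [b, a, c] = - f s [a, b, c]" "f s [a, c, b] = - f s [a, b, c]" if "s \<in> S" for s
    using frame[OF that] frame_data_alternating swap_3 by blast+
  show "F' b a c = - F' a b c" by (rule unique[OF f' DERIV_minus[OF f']]) (rule alt)
  show "F' a c b = - F' a b c" by (rule unique[OF f' DERIV_minus[OF f']]) (rule alt)
qed

lemma ginv_0: "ginv (g s0) i j = kdelta i j"
proof -
  have 1: "gmat (g s0) = mat 1" by (simp add: gmat_def mat_def vec_eq_iff g0)
  have 2: "matrix_inv (mat 1 :: real^7^7) = mat 1" by (rule matrix_inv_eqI) simp_all
  show ?thesis unfolding ginv_def 1 2 by (simp add: mat_def)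
qed

lemma ginv': "((\<lambda>s. ginv (g s) i j) has_real_derivative - G' i j) (at s0 within S)"
proof -
  have 1: "matrix_inv (gmat (g s0)) = mat 1"
    by (simp add: vec_eq_iff ginv_0[unfolded ginv_def] mat_def)
  have "((\<lambda>s. matrix_inv (gmat (g s)) $ i $ j) has_real_derivative
     (- (matrix_inv (gmat (g s0)) ** ((\<chi> i j. G' i j) ** matrix_inv (gmat (g s0))))) $ i $ j) (at s0 within S)"
  proof (rule matrix_inv_has_derivative[OF _ _ s0])
    show "((\<lambda>s. gmat (g s) $ i $ j) has_real_derivative (\<chi> i j. G' i j) $ i $ j) (at s0 within S)" for i j
      using g' by (simp add: gmat_def)
  qed (use frame frame_data_sym(2) in blast)
  then show ?thesis unfolding 1 ginv_def by simp
qed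

text \<open>The identity of \<open>frame_data_metric\<close> is differentiated. Each of the two
  inverse metrics contributes \<open>G' i j\<close> minus \<open>kdelta i j\<close> times the trace
  of \<open>G'\<close>, because the \<open>psi\<close> term of \<open>phi_phi\<close> is skew in the
  pair contracted with the symmetric \<open>G'\<close>. Hence 4 = 6 - 2 and the factor 2 of the
  trace.\<close>

lemma metric_variation:
  "(\<Sum>a\<in>UNIV. \<Sum>b\<in>UNIV. F' i a b * phi j a b) + (\<Sum>a\<in>UNIV. \<Sum>b\<in>UNIV. phi i a b * F' j a b)
    = 4 * G' i j + 2 * kdelta i j * (\<Sum>a\<in>UNIV. G' a a)"
proof -
  have C0: "((\<lambda>s. contr 0 (ginv (g s)) (\<lambda>I. f s (i # a # c # I)) (\<lambda>K. f s (j # b # d # K))) has_real_derivative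
      F' i a c * phi j b d + F' j b d * phi i a c) (at s0 within S)" for a b c d
    using DERIV_mult[OF f'[of i a c] f'[of j b d]] by (simp add: f0)
  have C1: "((\<lambda>s. contr (Suc 0) (ginv (g s)) (\<lambda>I. f s (i # a # I)) (\<lambda>K. f s (j # b # K))) has_real_derivative
      (\<Sum>c\<in>UNIV. \<Sum>d\<in>UNIV. - G' c d * (phi i a c * phi j b d)) + (\<Sum>c\<in>UNIV. F' i a c * phi j b c + F' j b c * phi i a c)) (at s0 within S)" for a b
    using contr_Suc_derivative[OF ginv' ginv_0 C0, of a b] by (simp add: f0)
  have C2: "((\<lambda>s. contr 2 (ginv (g s)) (\<lambda>I. f s (i # I)) (\<lambda>K. f s (j # K))) has_real_derivative
      (\<Sum>a\<in>UNIV. \<Sum>b\<in>UNIV. - G' a b * (\<Sum>c\<in>UNIV. phi i a c * phi j b c))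
      + (\<Sum>a\<in>UNIV. (\<Sum>c\<in>UNIV. \<Sum>d\<in>UNIV. - G' c d * (phi i a c * phi j a d)) + (\<Sum>c\<in>UNIV. F' i a c * phi j a c + F' j a c * phi i a c))) (at s0 within S)"
    using contr_Suc_derivative[OF ginv' ginv_0 C1] by (simp add: f0 contr_kdelta_Suc numeral_2_eq_2)
  have "(\<Sum>a\<in>UNIV. \<Sum>b\<in>UNIV. - G' a b * (\<Sum>c\<in>UNIV. phi i a c * phi j b c))
      + (\<Sum>a\<in>UNIV. (\<Sum>c\<in>UNIV. \<Sum>d\<in>UNIV. - G' c d * (phi i a c * phi j a d)) + (\<Sum>c\<in>UNIV. F' i a c * phi j a c + F' j a c * phi i a c))
      = 6 * G' i j"
    by (rule unique[OF C2 DERIV_cmult[OF g']]) (use frame frame_data_metric in blast)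
  moreover have A: "(\<Sum>a\<in>UNIV. \<Sum>b\<in>UNIV. - G' a b * (\<Sum>c\<in>UNIV. phi i a c * phi j b c)) = G' i j - kdelta i j * (\<Sum>a\<in>UNIV. G' a a)"
  proof -
    have "(\<Sum>a\<in>UNIV. \<Sum>b\<in>UNIV. G' a b * psi i a j b) = 0"
    proof (rule sum_antisym_eq_0)
      fix a b
      have "psi i b j a = - psi i a j b" using psi_swap(2)[of i j b a] psi_swap(3)[of i j a b] psi_swap(2)[of i a j b] by linarith
      then show "G' b a * psi i b j a = - (G' a b * psi i a j b)" using G'_sym[of a b] by simp
    qed
    moreover have "- G' a b * (\<Sum>c\<in>UNIV. phi i a c * phi j b c)
       = kdelta i b * (kdelta a j * G' a b) - kdelta i j * (kdelta a b * G' a b) + G' a b * psi i a j b" for a b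
      unfolding phi_phi by (simp add: algebra_simps)
    moreover have "(\<Sum>a\<in>UNIV. \<Sum>b\<in>UNIV. kdelta i b * (kdelta a j * G' a b)) = G' i j"
      using G'_sym[of j i] by (simp add: kdelta_mult_if)
    moreover have "(\<Sum>a\<in>UNIV. \<Sum>b\<in>UNIV. kdelta i j * (kdelta a b * G' a b)) = kdelta i j * (\<Sum>a\<in>UNIV. G' a a)"
      by (simp add: kdelta_mult_if)
    ultimately show ?thesis by (simp only: sum.distrib sum_subtractf)
  qed
  moreover have "(\<Sum>a\<in>UNIV. \<Sum>c\<in>UNIV. \<Sum>d\<in>UNIV. - G' c d * (phi i a c * phi j a d)) = G' i j - kdelta i j * (\<Sum>a\<in>UNIV. G' a a)"
  proof -
    have "(\<Sum>a\<in>UNIV. \<Sum>c\<in>UNIV. \<Sum>d\<in>UNIV. - G' c d * (phi i a c * phi j a d)) = (\<Sum>c\<in>UNIV. \<Sum>d\<in>UNIV. - G' c d * (\<Sum>a\<in>UNIV. phi i a c * phi j a d))"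
      unfolding sum_distrib_left by (subst sum.swap, rule sum.cong[OF refl], subst sum.swap) (rule refl)
    also have "\<dots> = (\<Sum>c\<in>UNIV. \<Sum>d\<in>UNIV. - G' c d * (\<Sum>a\<in>UNIV. phi i c a * phi j d a))"
    proof -
      have "phi i a c * phi j a d = phi i c a * phi j d a" for a c d
        using phi_swap(2)[of i a c] phi_swap(2)[of j a d] by simp
      then show ?thesis by simp
    qed
    finally show ?thesis using A by simp
  qed
  ultimately show ?thesis by (simp add: sum.distrib mult.commute[of "F' j _ _"])
qed

lemma psi_variation:
  assumes G': "\<And>i j. G' i j = 0"
  shows "((\<lambda>s. p s [i, j, k, l]) has_real_derivative
     - (\<Sum>m\<in>UNIV. F' i j m * phi k l m) - (\<Sum>m\<in>UNIV. phi i j m * F' k l m)) (at s0 within S)"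
proof -
  have C: "((\<lambda>s. contr 1 (ginv (g s)) (\<lambda>K. f s ([i, j] @ K)) (\<lambda>K. f s ([k, l] @ K))) has_real_derivative
     contr 1 kdelta (\<lambda>K. F' i j (hd K)) (\<lambda>K. f s0 ([k, l] @ K)) + contr 1 kdelta (\<lambda>K. f s0 ([i, j] @ K)) (\<lambda>K. F' k l (hd K))) (at s0 within S)"
  proof (rule contr_derivative)
    show "((\<lambda>s. ginv (g s) a b) has_real_derivative 0) (at s0 within S)" for a b
      using ginv'[of a b] by (simp add: G')
  qed (use f' ginv_0 in \<open>auto simp: length_Suc_conv\<close>)
  have g0': "((\<lambda>s. g s [a, b]) has_real_derivative 0) (at s0 within S)" for a b using g'[of a b] by (simp add: G')
  have "((\<lambda>s. g s [i, k] * g s [j, l] - g s [i, l] * g s [j, k]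
     - contr 1 (ginv (g s)) (\<lambda>K. f s ([i, j] @ K)) (\<lambda>K. f s ([k, l] @ K))) has_real_derivative
     (0 * g s0 [j, l] + 0 * g s0 [i, k]) - (0 * g s0 [j, k] + 0 * g s0 [i, l])
      - (contr 1 kdelta (\<lambda>K. F' i j (hd K)) (\<lambda>K. f s0 ([k, l] @ K)) + contr 1 kdelta (\<lambda>K. f s0 ([i, j] @ K)) (\<lambda>K. F' k l (hd K)))) (at s0 within S)"
    by (intro DERIV_diff DERIV_mult g0' C)
  then have "((\<lambda>s. g s [i, k] * g s [j, l] - g s [i, l] * g s [j, k]
     - contr 1 (ginv (g s)) (\<lambda>K. f s ([i, j] @ K)) (\<lambda>K. f s ([k, l] @ K))) has_real_derivative
      - (\<Sum>m\<in>UNIV. F' i j m * phi k l m) - (\<Sum>m\<in>UNIV. phi i j m * F' k l m)) (at s0 within S)"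
    by (rule DERIV_cong) (simp add: contr_kdelta_Suc f0)
  then show ?thesis
    by (rule has_field_derivative_transform_within[OF _ zero_less_one s0(1)]) (use frame frame_data_psi in \<open>metis\<close>)
qed

text \<open>Converse of \<open>isometric_variation\<close>: such a velocity has skew contraction
  with \<open>phi\<close>, so the left side of \<open>metric_variation\<close> vanishes. The trace
  of the right side is 4 + 2 * 7 = 18 times the trace of \<open>G'\<close>, hence
  \<open>G' = 0\<close>.\<close>

lemma contract_psi_variation:
  assumes F': "\<And>i j k. F' i j k = (\<Sum>l\<in>UNIV. Y l * psi l i j k)"
  shows "G' i j = 0" "((\<lambda>s. p s [i, j, k, l]) has_real_derivative cpsi Y i j k l) (at s0 within S)"
proof -
  have 1: "(\<Sum>a\<in>UNIV. \<Sum>b\<in>UNIV. phi i a b * F' j a b) = - 4 * (\<Sum>l\<in>UNIV. Y l * phi i l j)" for i j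
  proof -
    have "(\<Sum>a\<in>UNIV. \<Sum>b\<in>UNIV. phi i a b * F' j a b) = (\<Sum>a\<in>UNIV. \<Sum>b\<in>UNIV. (\<Sum>l\<in>UNIV. Y l * psi l j a b) * phi i a b)"
      unfolding F' by (simp only: mult.commute)
    also have "\<dots> = (\<Sum>l\<in>UNIV. Y l * (\<Sum>a\<in>UNIV. \<Sum>b\<in>UNIV. psi l j a b * phi i a b))" by (rule pull2)
    also have "\<dots> = - 4 * (\<Sum>l\<in>UNIV. Y l * phi i l j)"
      unfolding mult.commute[of "psi _ _ _ _"] phi_psi_2 by (simp add: sum_distrib_left mult.left_commute sum_negf)
    finally show ?thesis .
  qed
  have eq: "4 * G' i j + 2 * kdelta i j * (\<Sum>a\<in>UNIV. G' a a) = 0" for i j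
  proof -
    have "phi j l i = - phi i l j" for l
      using phi_swap(1)[of l j i] phi_rot[of l j i] by simp
    then have "(\<Sum>l\<in>UNIV. Y l * phi j l i) = - (\<Sum>l\<in>UNIV. Y l * phi i l j)" by (simp add: sum_negf)
    then show ?thesis
      using metric_variation[of i j] 1[of i j] 1[of j i] by (simp add: mult.commute[of "F' i _ _"])
  qed
  have "(\<Sum>i\<in>UNIV. 4 * G' i i + 2 * kdelta i i * (\<Sum>a\<in>UNIV. G' a a)) = 0" by (simp only: eq sum.neutral_const)
  then have "18 * (\<Sum>a\<in>UNIV. G' a a) = 0" by (simp add: sum.distrib sum_distrib_left[symmetric])
  then show G': "G' i j = 0" for i j using eq[of i j] by simp
  show "((\<lambda>s. p s [i, j, k, l]) has_real_derivative cpsi Y i j k l) (at s0 within S)"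
    using psi_variation[OF G'] unfolding cpsi_variation[OF F'] .
qed

text \<open>With the metric stationary, \<open>metric_variation\<close> states exactly the skewness
  demanded by \<open>alt3_eq_contract_psi\<close>.\<close>

lemma isometric_variation:
  assumes G': "\<And>i j. G' i j = 0"
  obtains Y where "\<And>i j k. F' i j k = (\<Sum>l\<in>UNIV. Y l * psi l i j k)"
    and "\<And>i j k l. ((\<lambda>s. p s [i, j, k, l]) has_real_derivative cpsi Y i j k l) (at s0 within S)"
proof
  have "(\<Sum>a\<in>UNIV. \<Sum>b\<in>UNIV. F' i a b * phi j a b) + (\<Sum>a\<in>UNIV. \<Sum>b\<in>UNIV. F' j a b * phi i a b) = 0" for i j
    using metric_variation[of i j] by (simp add: G' mult.commute[of "phi i _ _"])
  then show F': "F' i j k = (\<Sum>l\<in>UNIV. ctr F' (psi l) / 24 * psi l i j k)" for i j k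
    by (rule alt3_eq_contract_psi[OF alt3_F'])
  show "((\<lambda>s. p s [i, j, k, l]) has_real_derivative cpsi (\<lambda>l. ctr F' (psi l) / 24) i j k l) (at s0 within S)" for i j k l
    by (rule contract_psi_variation(2)[OF F'])
qed

end

section \<open>The Levi-Civita connection\<close>

lemma pd_cong:
  assumes "f differentiable (at x)" "open V" "x \<in> V" "\<And>y. y \<in> V \<Longrightarrow> f y = h y"
  shows "pd i f x = pd i h x"
  unfolding pd_def using frechet_derivative_transform_within_open[OF assms] by simp

lemma differentiable_cong_open:
  assumes "f differentiable (at x)" "open V" "x \<in> V" "\<And>y. y \<in> V \<Longrightarrow> f y = h y"
  shows "h differentiable (at x)"
proof -
  obtain D where "(f has_derivative D) (at x)" using assms(1) by (auto simp: differentiable_def)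
  then have "(h has_derivative D) (at x)"
    by (rule has_derivative_transform_within_open[OF _ assms(2,3)]) (rule assms(4))
  then show ?thesis by (auto simp: differentiable_def)
qed

text \<open>Places the derivative index at the head of the list, so that a covariant derivative is
  again a tensor that can be pulled back.\<close>

definition covt :: "(real^7 \<Rightarrow> tensor) \<Rightarrow> (real^7 \<Rightarrow> tensor) \<Rightarrow> real^7 \<Rightarrow> tensor" where
  "covt g T x L = cov_deriv g T x (hd L) (tl L)"

lemma ginv_inverse:
  assumes g: "invertible (gmat g)" and sym: "\<And>i j. g [j, i] = g [i, j]"
  shows "ginv g j i = ginv g i j" "(\<Sum>m\<in>UNIV. ginv g l m * g [m, j]) = kdelta l j"
proof -
  let ?R = "matrix_inv (gmat g)"
  note R = matrix_inv_mult[OF g]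
  have tg: "transpose (gmat g) = gmat g" by (simp add: gmat_def vec_eq_iff transpose_def sym)
  have "transpose ?R ** gmat g = mat 1" "gmat g ** transpose ?R = mat 1"
    using arg_cong[OF R(1), of transpose] arg_cong[OF R(2), of transpose]
    unfolding matrix_transpose_mul tg by simp_all
  then have "?R = transpose ?R" by (intro matrix_inv_eqI)
  then have "transpose ?R $ i $ j = ?R $ i $ j" by simp
  then show "ginv g j i = ginv g i j" by (simp add: ginv_def transpose_def)
  have "(?R ** gmat g) $ l $ j = kdelta l j" by (simp add: R mat_def)
  then show "(\<Sum>m\<in>UNIV. ginv g l m * g [m, j]) = kdelta l j"
    by (simp add: matrix_matrix_mult_def ginv_def gmat_def)
qed

locale metric_patch =
  fixes g :: "real^7 \<Rightarrow> tensor" and V :: "(real^7) set"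
  assumes V: "open V"
    and diff: "\<And>x i j. x \<in> V \<Longrightarrow> (\<lambda>y. g y [i, j]) differentiable (at x)"
    and sym: "\<And>x i j. x \<in> V \<Longrightarrow> g x [j, i] = g x [i, j]"
    and inv: "\<And>x. x \<in> V \<Longrightarrow> invertible (gmat (g x))"
begin

lemma pd_sym: "x \<in> V \<Longrightarrow> pd k (\<lambda>y. g y [j, i]) x = pd k (\<lambda>y. g y [i, j]) x"
  by (rule pd_cong[OF diff V]) (use sym in auto)

lemma christoffel_sym:
  assumes x: "x \<in> V"
  shows "christoffel g x m j i = christoffel g x m i j"
  unfolding christoffel_def pd_sym[OF x, of _ j i] by (simp add: add.commute)

text \<open>Koszul's formula; metric compatibility follows from it by adding two instances.\<close>

lemma christoffel_lower:
  assumes x: "x \<in> V"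
  shows "(\<Sum>m\<in>UNIV. christoffel g x m k i * g x [m, j])
    = 1 / 2 * (pd k (\<lambda>y. g y [i, j]) x + pd i (\<lambda>y. g y [k, j]) x - pd j (\<lambda>y. g y [k, i]) x)"
proof -
  let ?D = "\<lambda>l. pd k (\<lambda>y. g y [i, l]) x + pd i (\<lambda>y. g y [k, l]) x - pd l (\<lambda>y. g y [k, i]) x"
  note gi = ginv_inverse[OF inv[OF x] sym[OF x]]
  have "(\<Sum>m\<in>UNIV. christoffel g x m k i * g x [m, j]) = (\<Sum>l\<in>UNIV. 1 / 2 * ?D l * (\<Sum>m\<in>UNIV. ginv (g x) m l * g x [m, j]))"
    unfolding christoffel_def sum_distrib_left sum_distrib_right by (subst sum.swap) (simp add: mult_ac)
  also have "\<dots> = (\<Sum>l\<in>UNIV. 1 / 2 * ?D l * kdelta l j)"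
  proof -
    have "(\<Sum>m\<in>UNIV. ginv (g x) m l * g x [m, j]) = kdelta l j" for l
      unfolding gi(2)[of l j, symmetric] by (intro sum.cong refl) (simp add: gi(1)[of l])
    then show ?thesis by simp
  qed
  also have "\<dots> = 1 / 2 * ?D j" unfolding kdelta_mult_if by simp
  finally show ?thesis .
qed

lemma cov_deriv_metric:
  assumes x: "x \<in> V"
  shows "cov_deriv g g x k [i, j] = 0"
proof -
  have "(\<Sum>m\<in>UNIV. christoffel g x m k j * g x [i, m]) = (\<Sum>m\<in>UNIV. christoffel g x m k j * g x [m, i])"
    by (intro sum.cong refl arg_cong2[of _ _ _ _ "(*)"] sym[OF x])
  then have "cov_deriv g g x k [i, j] = pd k (\<lambda>y. g y [i, j]) x
     - ((\<Sum>m\<in>UNIV. christoffel g x m k i * g x [m, j]) + (\<Sum>m\<in>UNIV. christoffel g x m k j * g x [m, i]))"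
    by (simp add: cov_deriv_def)
  moreover have "c = 0" if "c = a - (u + v)" "u = 1 / 2 * (a + b - d)" "v = 1 / 2 * (a' + d - b)" "a' = a" for a a' b c d u v :: real
    unfolding that by (simp add: field_simps)
  ultimately show ?thesis
    using christoffel_lower[OF x, of k i j] christoffel_lower[OF x, of k j i] pd_sym[OF x, of k j i] by blast
qed

text \<open>As the connection is torsion-free, the Christoffel terms of the antisymmetrised
  covariant derivative cancel in pairs and leave the partial derivatives.\<close>

lemma ext_deriv_3:
  assumes x: "x \<in> V" and alt: "alternating 3 (\<alpha> x)"
  shows "ext_deriv \<alpha> x [p, i, j, k] = altL 4 (covt g \<alpha> x) [p, i, j, k]"
proof -
  note s = swap_3[OF alt]
  define C where "C a b J = (\<Sum>m\<in>UNIV. christoffel g x m a b * \<alpha> x (m # J))" for a b J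
  have C: "C b a J = C a b J" for a b J unfolding C_def christoffel_sym[OF x, of _ b a] ..
  have 1: "christoffel g x m p j * \<alpha> x [i, m, k] = - (christoffel g x m p j * \<alpha> x [m, i, k])" for i j k m p
    using s(1)[of i m k] by simp
  have 2: "christoffel g x m p k * \<alpha> x [i, j, m] = christoffel g x m p k * \<alpha> x [m, i, j]" for i j k m p
    using s(2)[of i j m] s(1)[of i m j] by simp
  have e: "(\<Sum>m\<in>UNIV. christoffel g x m p j * \<alpha> x [i, m, k]) = - C p j [i, k]"
    "(\<Sum>m\<in>UNIV. christoffel g x m p k * \<alpha> x [i, j, m]) = C p k [i, j]" for p i j k
    unfolding C_def 1 2 sum_negf by (rule refl)+
  have c: "covt g \<alpha> x [p, i, j, k] = pd p (\<lambda>y. \<alpha> y [i, j, k]) x - (C p i [j, k] - C p j [i, k] + C p k [i, j])" for p i j k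
  proof -
    have "covt g \<alpha> x [p, i, j, k] = pd p (\<lambda>y. \<alpha> y [i, j, k]) x - ((\<Sum>m\<in>UNIV. christoffel g x m p i * \<alpha> x [m, j, k])
      + (\<Sum>m\<in>UNIV. christoffel g x m p j * \<alpha> x [i, m, k]) + (\<Sum>m\<in>UNIV. christoffel g x m p k * \<alpha> x [i, j, m]))"
      by (simp add: covt_def cov_deriv_def numeral_3_eq_3)
    then show ?thesis unfolding e by (simp add: C_def)
  qed
  have "ext_deriv \<alpha> x [p, i, j, k] = pd p (\<lambda>y. \<alpha> y [i, j, k]) x - pd i (\<lambda>y. \<alpha> y [p, j, k]) x
     + pd j (\<lambda>y. \<alpha> y [p, i, k]) x - pd k (\<lambda>y. \<alpha> y [p, i, j]) x"
    by (simp add: ext_deriv_def)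
  then show ?thesis
    unfolding altL_4 c using C[of p i] C[of p j] C[of p k] C[of i j] C[of i k] C[of j k] by simp
qed

lemma ext_deriv_4:
  assumes x: "x \<in> V" and alt: "alternating 4 (\<alpha> x)"
  shows "ext_deriv \<alpha> x [p, i, j, k, l] = altL 5 (covt g \<alpha> x) [p, i, j, k, l]"
proof -
  note s = swap_4[OF alt]
  define C where "C a b J = (\<Sum>m\<in>UNIV. christoffel g x m a b * \<alpha> x (m # J))" for a b J
  have C: "C b a J = C a b J" for a b J unfolding C_def christoffel_sym[OF x, of _ b a] ..
  have 1: "christoffel g x m p j * \<alpha> x [i, m, k, l] = - (christoffel g x m p j * \<alpha> x [m, i, k, l])" for i j k l m p
    using s(1)[of i m k l] by simp
  have 2: "christoffel g x m p k * \<alpha> x [i, j, m, l] = christoffel g x m p k * \<alpha> x [m, i, j, l]" for i j k l m p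
    using s(2)[of i j m l] s(1)[of i m j l] by simp
  have 3: "christoffel g x m p l * \<alpha> x [i, j, k, m] = - (christoffel g x m p l * \<alpha> x [m, i, j, k])" for i j k l m p
    using s(3)[of i j k m] s(2)[of i j m k] s(1)[of i m j k] by simp
  have e: "(\<Sum>m\<in>UNIV. christoffel g x m p j * \<alpha> x [i, m, k, l]) = - C p j [i, k, l]"
    "(\<Sum>m\<in>UNIV. christoffel g x m p k * \<alpha> x [i, j, m, l]) = C p k [i, j, l]"
    "(\<Sum>m\<in>UNIV. christoffel g x m p l * \<alpha> x [i, j, k, m]) = - C p l [i, j, k]" for p i j k l
    unfolding C_def 1 2 3 sum_negf by (rule refl)+
  have c: "covt g \<alpha> x [p, i, j, k, l] = pd p (\<lambda>y. \<alpha> y [i, j, k, l]) x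
     - (C p i [j, k, l] - C p j [i, k, l] + C p k [i, j, l] - C p l [i, j, k])" for p i j k l
  proof -
    have "covt g \<alpha> x [p, i, j, k, l] = pd p (\<lambda>y. \<alpha> y [i, j, k, l]) x - ((\<Sum>m\<in>UNIV. christoffel g x m p i * \<alpha> x [m, j, k, l])
      + (\<Sum>m\<in>UNIV. christoffel g x m p j * \<alpha> x [i, m, k, l]) + (\<Sum>m\<in>UNIV. christoffel g x m p k * \<alpha> x [i, j, m, l])
      + (\<Sum>m\<in>UNIV. christoffel g x m p l * \<alpha> x [i, j, k, m]))"
      by (simp add: covt_def cov_deriv_def numeral_eq_Suc)
    then show ?thesis unfolding e by (simp add: C_def)
  qed
  have "ext_deriv \<alpha> x [p, i, j, k, l] = pd p (\<lambda>y. \<alpha> y [i, j, k, l]) x - pd i (\<lambda>y. \<alpha> y [p, j, k, l]) x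
     + pd j (\<lambda>y. \<alpha> y [p, i, k, l]) x - pd k (\<lambda>y. \<alpha> y [p, i, j, l]) x + pd l (\<lambda>y. \<alpha> y [p, i, j, k]) x"
    by (simp add: ext_deriv_def)
  then show ?thesis
    unfolding altL_5 c using C[of p i] C[of p j] C[of p k] C[of p l] C[of i j] C[of i k] C[of i l] C[of j k] C[of j l] C[of k l] by simp
qed

end

text \<open>To first order, the parallel transport of the frame \<open>Q\<close> along its column \<open>p\<close>.\<close>

definition line_frame :: "(real^7 \<Rightarrow> tensor) \<Rightarrow> real^7 \<Rightarrow> real^7^7 \<Rightarrow> 7 \<Rightarrow> real \<Rightarrow> real^7^7" where
  "line_frame g x Q p s = (\<chi> m a. Q $ m $ a - s * (\<Sum>i\<in>UNIV. (\<Sum>k\<in>UNIV. Q $ k $ p * christoffel g x m k i) * Q $ i $ a))"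

lemma line_frame_0: "line_frame g x Q p 0 = Q"
  by (simp add: line_frame_def vec_eq_iff)

text \<open>Turns a covariant derivative into an ordinary derivative in one real variable, to which
  \<open>frame_curve\<close> applies.\<close>

lemma cov_deriv_line:
  assumes T: "\<And>K. length K = k \<Longrightarrow> (\<lambda>y. T y K) differentiable (at x)" and I: "length I = k"
  shows "((\<lambda>s. pullback k (line_frame g x Q p s) (T (x + s *\<^sub>R column p Q)) I) has_real_derivative
     pullback (Suc k) Q (covt g T x) (p # I)) (at 0)"
proof -
  define B where "B m i = (\<Sum>k\<in>UNIV. Q $ k $ p * christoffel g x m k i)" for m i
  have D: "((\<lambda>s. pullback k (line_frame g x Q p s) (T (x + s *\<^sub>R column p Q)) I) has_real_derivative
     pullback k (line_frame g x Q p 0) (\<lambda>K. (\<Sum>i\<in>UNIV. column p Q $ i * pd i (\<lambda>y. T y K) x)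
       - (\<Sum>r<k. \<Sum>m\<in>UNIV. B m (K ! r) * T (x + 0 *\<^sub>R column p Q) (K[r := m]))) I) (at 0)"
  proof (rule pullback_has_derivative[OF _ _ I])
    show "((\<lambda>s. line_frame g x Q p s $ i $ a) has_real_derivative - (\<Sum>m\<in>UNIV. B i m * line_frame g x Q p 0 $ m $ a)) (at 0)" for i a
      unfolding line_frame_def B_def by (auto intro!: derivative_eq_intros)
    show "((\<lambda>s. T (x + s *\<^sub>R column p Q) K) has_real_derivative (\<Sum>i\<in>UNIV. column p Q $ i * pd i (\<lambda>y. T y K) x)) (at 0)"
      if "length K = k" for K
      by (rule has_derivative_line[OF T[OF that]])
  qed
  have "pullback k Q (\<lambda>K. (\<Sum>i\<in>UNIV. column p Q $ i * pd i (\<lambda>y. T y K) x)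
       - (\<Sum>r<k. \<Sum>m\<in>UNIV. B m (K ! r) * T x (K[r := m]))) I
    = pullback k Q (\<lambda>K. \<Sum>i\<in>UNIV. Q $ i $ p * covt g T x (i # K)) I"
  proof (rule pullback_cong)
    fix K :: "7 list" assume K: "length K = k"
    have "(\<Sum>r<k. \<Sum>m\<in>UNIV. B m (K ! r) * T x (K[r := m]))
      = (\<Sum>r<k. \<Sum>i\<in>UNIV. Q $ i $ p * (\<Sum>m\<in>UNIV. christoffel g x m i (K ! r) * T x (K[r := m])))"
      unfolding B_def sum_distrib_left sum_distrib_right
      by (rule sum.cong[OF refl], subst sum.swap) (simp add: mult.assoc)
    also have "\<dots> = (\<Sum>i\<in>UNIV. Q $ i $ p * (\<Sum>r<k. \<Sum>m\<in>UNIV. christoffel g x m i (K ! r) * T x (K[r := m])))"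
      unfolding sum_distrib_left[of _ _ "{..<k}"] by (rule sum.swap)
    finally have "(\<Sum>r<k. \<Sum>m\<in>UNIV. B m (K ! r) * T x (K[r := m])) = (\<Sum>i\<in>UNIV. Q $ i $ p * (\<Sum>r<k. \<Sum>m\<in>UNIV. christoffel g x m i (K ! r) * T x (K[r := m])))" .
    then show "(\<Sum>i\<in>UNIV. column p Q $ i * pd i (\<lambda>y. T y K) x) - (\<Sum>r<k. \<Sum>m\<in>UNIV. B m (K ! r) * T x (K[r := m]))
       = (\<Sum>i\<in>UNIV. Q $ i $ p * covt g T x (i # K))"
      by (simp add: covt_def cov_deriv_def K right_diff_distrib sum_subtractf column_def)
  qed
  also have "\<dots> = pullback (Suc k) Q (covt g T x) (p # I)"
    unfolding pullback_Suc pullback_sum ..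
  finally show ?thesis using D by (simp add: line_frame_0)
qed

section \<open>Differentiability of the metric in time\<close>

lemma differentiable_matrix_inv:
  fixes A :: "'a::real_normed_vector \<Rightarrow> real^'n^'n"
  assumes A: "\<And>i j. (\<lambda>s. A s $ i $ j) differentiable (at x)" and V: "open V" "x \<in> V"
    and inv: "\<And>y. y \<in> V \<Longrightarrow> invertible (A y)"
  shows "(\<lambda>s. matrix_inv (A s) $ i $ j) differentiable (at x)"
proof -
  let ?F = "\<lambda>s. det (\<chi> k l. if l = i then (axis j 1 :: real^'n) $ k else A s $ k $ l) / det (A s)"
  have c: "(\<lambda>s. if l = i then (axis j 1 :: real^'n) $ k else A s $ k $ l) differentiable (at x)" for k l
    by (cases "l = i") (simp_all add: A)
  have "?F differentiable (at x)"
    using inv[OF V(2)] A c by (intro differentiable_divide differentiable_det) (simp_all add: invertible_det_nz)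
  then obtain D where "(?F has_derivative D) (at x)" by (auto simp: differentiable_def)
  then have "((\<lambda>s. matrix_inv (A s) $ i $ j) has_derivative D) (at x)"
    by (rule has_derivative_transform_within_open[OF _ V]) (use inv in \<open>simp add: matrix_inv_cramer invertible_det_nz\<close>)
  then show ?thesis by (auto simp: differentiable_def)
qed

lemma differentiable_wedge:
  assumes "\<And>K. length K = k \<Longrightarrow> (\<lambda>s. \<alpha> s K) differentiable (at t within J)"
    and "\<And>K. length K = l \<Longrightarrow> (\<lambda>s. \<beta> s K) differentiable (at t within J)" and I: "length I = k + l"
  shows "(\<lambda>s :: real. wedge k l (\<alpha> s) (\<beta> s) I) differentiable (at t within J)"
  unfolding wedge_def
  by (intro differentiable_mult differentiable_sum ballI differentiable_const assms) (simp_all add: I finite_permutations)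

text \<open>The polynomial \<open>B0\<close> in the components of the 3-form is \<open>-6 v g\<close> with \<open>v\<^sup>2 = det g\<close>, hence \<open>v\<^sup>9\<close> is the
  determinant of \<open>v g\<close> and \<open>g\<close> is recovered with a ninth root.\<close>

lemma metric_differentiable:
  fixes f g :: "real \<Rightarrow> tensor" and v :: "real \<Rightarrow> real"
  assumes f: "\<And>K. length K = 3 \<Longrightarrow> (\<lambda>s. f s K) differentiable (at t within J)" and t: "t \<in> J"
    and B: "\<And>s i j. s \<in> J \<Longrightarrow> B0 (f s) (axis i 1) (axis j 1) indices = - 6 * g s [i, j] * v s"
    and v: "\<And>s. s \<in> J \<Longrightarrow> (v s)\<^sup>2 = det (gmat (g s))" and g: "\<And>s. s \<in> J \<Longrightarrow> invertible (gmat (g s))"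
  shows "(\<lambda>s. g s [i, j]) differentiable (at t within J)"
proof -
  define b where "b s i j = B0 (f s) (axis i 1) (axis j 1) indices / (- 6)" for s i j
  have b: "b s i j = g s [i, j] * v s" if "s \<in> J" for s i j using B[OF that] by (simp add: b_def)
  have db: "(\<lambda>s. b s i j) differentiable (at t within J)" for i j
  proof -
    have i: "(\<lambda>s. interior_prod u (f s) K) differentiable (at t within J)" if "length K = 2" for u K
      unfolding interior_prod_def using that
      by (intro differentiable_sum ballI differentiable_mult differentiable_const f) simp_all
    have "(\<lambda>s. wedge 2 2 (interior_prod u (f s)) (interior_prod w (f s)) K) differentiable (at t within J)" if "length K = 4" for u w K
      using that i by (intro differentiable_wedge) simp_all
    then show ?thesis unfolding b_def B0_def using f i
      by (intro differentiable_divide differentiable_const differentiable_wedge) simp_all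
  qed
  have vd: "v s ^ 9 = det (\<chi> i j. b s i j)" if s: "s \<in> J" for s
  proof -
    have "(\<chi> i j. b s i j) = (\<chi> i j. if i = j then v s else 0) ** gmat (g s)"
      by (simp add: vec_eq_iff matrix_matrix_mult_def b[OF s] gmat_def if_distrib[of "\<lambda>x. x * _"] mult.commute cong: if_cong)
    moreover have "det (\<chi> i j. if i = j then v s else 0 :: real^7^7) = v s ^ 7"
      by (subst det_diagonal) simp_all
    ultimately have "det (\<chi> i j. b s i j) = v s ^ 7 * (v s)\<^sup>2" using v[OF s] by (simp add: det_mul)
    then show ?thesis by (simp add: power_add[symmetric])
  qed
  have v0: "v s \<noteq> 0" if "s \<in> J" for s using v[OF that] g[OF that] by (auto simp: invertible_det_nz)
  have vroot: "v s = root 9 (det (\<chi> i j. b s i j))" if "s \<in> J" for s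
    unfolding vd[OF that, symmetric] by (simp add: odd_real_root_power_cancel)
  have "(\<lambda>s. det (\<chi> i j. b s i j)) differentiable (at t within J)" by (rule differentiable_det) (simp add: db)
  then obtain D where D: "((\<lambda>s. det (\<chi> i j. b s i j)) has_real_derivative D) (at t within J)"
    by (auto simp: real_differentiable_def)
  \<comment> \<open>An odd root is differentiable away from zero; the radicand is
    \<open>v t ^ 9\<close>, and \<open>v t\<close> is nonzero because the metric is
    invertible.\<close>
  have "det (\<chi> i j. b t i j) \<noteq> 0" using vd[OF t] v0[OF t] by (metis power_not_zero)
  from DERIV_chain2[OF DERIV_odd_real_root[OF _ this] D, of 9]
  have r: "(\<lambda>s. root 9 (det (\<chi> i j. b s i j))) differentiable (at t within J)"
    unfolding real_differentiable_def by auto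
  have "(\<lambda>s. b s i j / root 9 (det (\<chi> i j. b s i j))) differentiable (at t within J)"
    by (rule differentiable_divide[OF db r]) (use vroot[OF t] v0[OF t] in simp)
  then obtain E where E: "((\<lambda>s. b s i j / root 9 (det (\<chi> i j. b s i j))) has_real_derivative E) (at t within J)"
    by (auto simp: real_differentiable_def)
  have "((\<lambda>s. g s [i, j]) has_real_derivative E) (at t within J)"
    by (rule has_field_derivative_transform_within[OF E zero_less_one t]) (use b v0 vroot[symmetric] in simp)
  then show ?thesis by (auto simp: real_differentiable_def)
qed

lemma contr_differentiable:
  fixes \<gamma> :: "'a::real_normed_vector \<Rightarrow> 7 \<Rightarrow> 7 \<Rightarrow> real"
  assumes "\<And>i j. (\<lambda>s. \<gamma> s i j) differentiable (at x within S)" "\<And>K. length K = k \<Longrightarrow> (\<lambda>s. u s K) differentiable (at x within S)"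
    "\<And>K. length K = k \<Longrightarrow> (\<lambda>s. w s K) differentiable (at x within S)"
  shows "(\<lambda>s. contr k (\<gamma> s) (u s) (w s)) differentiable (at x within S)"
  unfolding contr_def
  by (intro differentiable_sum ballI differentiable_mult differentiable_prod assms) (simp_all add: finite_lists_length[simplified])

section \<open>The torsion tensor at a point\<close>

lemma frame_data_1:
  assumes "frame_data (mat 1) f g p"
  shows "f [i, j, k] = phi i j k" "g [i, j] = kdelta i j" "p [i, j, k, l] = psi i j k l"
proof -
  have f: "\<And>K. length K = 3 \<Longrightarrow> f K = pullback 3 (mat 1) phi0 K" and p: "\<And>K. length K = 4 \<Longrightarrow> p K = pullback 4 (mat 1) psiL K"
    and g: "gmat g = mat 1"
    using assms by (auto simp: frame_data_def)
  show "f [i, j, k] = phi i j k" by (simp add: f pullback_one phi_def)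
  show "p [i, j, k, l] = psi i j k l" by (simp add: p pullback_one)
  have "gmat g $ i $ j = kdelta i j" unfolding g by (simp add: mat_def)
  then show "g [i, j] = kdelta i j" by (simp add: gmat_def)
qed

lemma open_det_nonzero:
  fixes A :: "real \<Rightarrow> real^'n^'n"
  assumes "\<And>i j s. (\<lambda>s. A s $ i $ j) differentiable (at s)"
  shows "open {s. det (A s) \<noteq> 0}"
proof -
  have "isCont (\<lambda>s. det (A s)) s" for s
    by (rule differentiable_imp_continuous_within) (rule differentiable_det[OF assms])
  then have "continuous_on UNIV (\<lambda>s. det (A s))" by (simp add: continuous_at_imp_continuous_on)
  then show ?thesis by (intro open_Collect_neq continuous_on_const)
qed

lemma alternating_cong: "alternating k S \<Longrightarrow> (\<And>I. length I = k \<Longrightarrow> T I = S I) \<Longrightarrow> alternating k T"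
  by (simp add: alternating_def)

lemma frame_data_alternating_psi:
  assumes frame: "frame_data N f g p" and vol0: "alternating 7 vol0" "vol0 indices = -1"
  shows "alternating 4 p"
proof -
  define \<Psi> where "\<Psi> J = 1 / 6 * contr 3 kdelta (\<lambda>I. vol0 (I @ J)) phi0" for J
  note \<Psi> = alternating_psi[OF vol0, folded \<Psi>_def]
  have "p K = pullback 4 N \<Psi> K" if "length K = 4" for K
  proof -
    have "p K = pullback 4 N psiL K" using frame that by (simp add: frame_data_def)
    also have "\<dots> = pullback 4 N \<Psi> K" by (rule pullback_cong) (auto elim!: length_4E simp: \<Psi>(2))
    finally show ?thesis .
  qed
  then show ?thesis by (rule alternating_cong[OF alternating_pullback[OF \<Psi>(1)]])
qed

text \<open>One adapted frame \<open>N\<close> is fixed at \<open>x0\<close>; at the other points a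
  frame merely exists.\<close>

locale G2_patch = metric_patch g V for g V +
  fixes \<phi> \<psi> :: "real^7 \<Rightarrow> tensor" and x0 :: "real^7" and N :: "real^7^7" and vol0 :: tensor
  assumes x0: "x0 \<in> V"
    and \<phi>_diff: "\<And>x K. x \<in> V \<Longrightarrow> length K = 3 \<Longrightarrow> (\<lambda>y. \<phi> y K) differentiable (at x)"
    and frames: "\<And>x. x \<in> V \<Longrightarrow> \<exists>N. frame_data N (\<phi> x) (g x) (\<psi> x)"
    and frame: "frame_data N (\<phi> x0) (g x0) (\<psi> x0)"
    and vol0: "alternating 7 vol0" "vol0 indices = -1"
begin

text \<open>The columns of \<open>Q\<close> are the orthonormal basis dual to the coframe formed by
  the rows of \<open>N\<close>; pulling back by \<open>Q\<close> yields frame components.\<close>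

definition Q :: "real^7^7" where "Q = matrix_inv N"

lemma N_inv: "invertible N" and NQ: "N ** Q = mat 1" and QN: "Q ** N = mat 1" and Q_inv: "invertible Q"
proof -
  show "invertible N" using frame by (simp add: frame_data_def)
  then show "N ** Q = mat 1" "Q ** N = mat 1" using matrix_inv_mult by (simp_all add: Q_def)
  then show "invertible Q" by (auto simp: invertible_def)
qed

lemma frame_1: "frame_data (mat 1) (pullback 3 Q (\<phi> x0)) (pullback 2 Q (g x0)) (pullback 4 Q (\<psi> x0))"
  using frame_data_pullback[OF frame Q_inv] by (simp add: NQ)

text \<open>Since the frames are unrelated from point to point, differentiability comes from the
  formula \<open>frame_data_psi\<close>.\<close>

lemma \<psi>_diff: "length K = 4 \<Longrightarrow> (\<lambda>y. \<psi> y K) differentiable (at x0)"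
proof -
  assume "length K = 4"
  then obtain i j k l where K: "K = [i, j, k, l]" by (rule length_4E)
  have gi: "(\<lambda>y. ginv (g y) a b) differentiable (at x0)" for a b
    unfolding ginv_def by (rule differentiable_matrix_inv[OF _ V x0 inv]) (simp_all add: gmat_def diff x0)
  have "(\<lambda>y. g y [i, k] * g y [j, l] - g y [i, l] * g y [j, k]
     - contr 1 (ginv (g y)) (\<lambda>K. \<phi> y ([i, j] @ K)) (\<lambda>K. \<phi> y ([k, l] @ K))) differentiable (at x0)"
    by (intro differentiable_diff differentiable_mult diff x0 contr_differentiable gi \<phi>_diff) simp_all
  then show ?thesis unfolding K
    by (rule differentiable_cong_open[OF _ V x0]) (use frames frame_data_psi in metis)
qed

abbreviation "LF \<equiv> line_frame g x0 Q"

definition LS :: "7 \<Rightarrow> real set" where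
  "LS p = {s. x0 + s *\<^sub>R column p Q \<in> V} \<inter> {s. det (LF p s) \<noteq> 0}"

lemma LS: "open (LS p)" "0 \<in> LS p" "at 0 within LS p = at 0"
proof -
  have "open {s. x0 + s *\<^sub>R column p Q \<in> V}"
    using continuous_open_vimage[OF V, of "\<lambda>s. x0 + s *\<^sub>R column p Q"] by (simp add: vimage_def continuous_intros)
  moreover have "open {s. det (LF p s) \<noteq> 0}"
    by (rule open_det_nonzero) (simp add: line_frame_def)
  ultimately show o: "open (LS p)" unfolding LS_def by (rule open_Int)
  show z: "0 \<in> LS p" using x0 Q_inv by (simp add: LS_def line_frame_0 invertible_det_nz)
  show "at 0 within LS p = at 0" by (rule at_within_open[OF z o])
qed

lemma LS_D: "s \<in> LS p \<Longrightarrow> invertible (LF p s)" "s \<in> LS p \<Longrightarrow> x0 + s *\<^sub>R column p Q \<in> V"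
  by (simp_all add: LS_def invertible_det_nz)

lemma along_line:
  assumes "\<And>K. length K = k \<Longrightarrow> (\<lambda>y. T y K) differentiable (at x0)" "length I = k"
  shows "((\<lambda>s. pullback k (LF p s) (T (x0 + s *\<^sub>R column p Q)) I) has_real_derivative
     pullback (Suc k) Q (covt g T x0) (p # I)) (at 0 within LS p)"
  unfolding LS(3) by (rule cov_deriv_line) (use assms in auto)

lemma covt_metric: "pullback 3 Q (covt g g x0) [p, i, j] = 0"
proof -
  have "pullback 3 Q (covt g g x0) [p, i, j] = pullback 3 Q (\<lambda>_. 0 * 0) [p, i, j]"
    by (rule pullback_cong) (auto elim!: length_3E simp: covt_def cov_deriv_metric[OF x0])
  then show ?thesis unfolding pullback_scale by simp
qed

text \<open>In the frame transported to first order the metric is stationary, as \<nabla>g = 0. So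
  \<open>isometric_variation\<close> applies along each frame direction and produces the rows of the
  torsion tensor.\<close>

sublocale line: frame_curve "\<lambda>s. pullback 3 (LF p s) (\<phi> (x0 + s *\<^sub>R column p Q))" "\<lambda>s. pullback 2 (LF p s) (g (x0 + s *\<^sub>R column p Q))"
  "\<lambda>s. pullback 4 (LF p s) (\<psi> (x0 + s *\<^sub>R column p Q))" 0 "LS p" "\<lambda>i j k. pullback 4 Q (covt g \<phi> x0) [p, i, j, k]"
  "\<lambda>i j. 0" for p
proof
  show "0 \<in> LS p" by (rule LS)
  show "at 0 within LS p \<noteq> bot" unfolding LS(3) by simp
  show "\<exists>N. frame_data N (pullback 3 (LF p s) (\<phi> (x0 + s *\<^sub>R column p Q))) (pullback 2 (LF p s) (g (x0 + s *\<^sub>R column p Q)))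
    (pullback 4 (LF p s) (\<psi> (x0 + s *\<^sub>R column p Q)))" if "s \<in> LS p" for s
    using frames[OF LS_D(2)[OF that]] frame_data_pullback[OF _ LS_D(1)[OF that]] by blast
  fix i j k
  show "pullback 2 (LF p 0) (g (x0 + 0 *\<^sub>R column p Q)) [i, j] = kdelta i j"
    using frame_data_1(2)[OF frame_1] by (simp add: line_frame_0)
  show "pullback 3 (LF p 0) (\<phi> (x0 + 0 *\<^sub>R column p Q)) [i, j, k] = phi i j k"
    using frame_data_1(1)[OF frame_1] by (simp add: line_frame_0)
  show "((\<lambda>s. pullback 3 (LF p s) (\<phi> (x0 + s *\<^sub>R column p Q)) [i, j, k]) has_real_derivative pullback 4 Q (covt g \<phi> x0) [p, i, j, k]) (at 0 within LS p)"
    using along_line[of 3 \<phi> "[i, j, k]" p] \<phi>_diff[OF x0] by (simp add: numeral_eq_Suc)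
  show "((\<lambda>s. pullback 2 (LF p s) (g (x0 + s *\<^sub>R column p Q)) [i, j]) has_real_derivative 0) (at 0 within LS p)"
  proof -
    have "((\<lambda>s. pullback 2 (LF p s) (g (x0 + s *\<^sub>R column p Q)) [i, j]) has_real_derivative pullback (Suc 2) Q (covt g g x0) [p, i, j]) (at 0 within LS p)"
      by (rule along_line) (auto elim!: length_2E simp: diff[OF x0])
    moreover have "Suc 2 = 3" by simp
    ultimately show ?thesis using covt_metric[of p i j] by simp
  qed
qed

text \<open>The torsion tensor in the frame; the two conditions determine \<open>T p\<close> and are satisfiable by \<open>isometric_variation\<close>.\<close>

definition T :: "7 \<Rightarrow> 7 \<Rightarrow> real" where
  "T p = (SOME Y. (\<forall>i j k. pullback 4 Q (covt g \<phi> x0) [p, i, j, k] = (\<Sum>l\<in>UNIV. Y l * psi l i j k))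
     \<and> (\<forall>i j k l. ((\<lambda>s. pullback 4 (LF p s) (\<psi> (x0 + s *\<^sub>R column p Q)) [i, j, k, l]) has_real_derivative cpsi Y i j k l) (at 0 within LS p)))"

lemma T: "pullback 4 Q (covt g \<phi> x0) [p, i, j, k] = (\<Sum>l\<in>UNIV. T p l * psi l i j k)"
    "((\<lambda>s. pullback 4 (LF p s) (\<psi> (x0 + s *\<^sub>R column p Q)) [i, j, k, l]) has_real_derivative cpsi (T p) i j k l) (at 0 within LS p)"
proof -
  have "\<exists>Y. (\<forall>i j k. pullback 4 Q (covt g \<phi> x0) [p, i, j, k] = (\<Sum>l\<in>UNIV. Y l * psi l i j k))
     \<and> (\<forall>i j k l. ((\<lambda>s. pullback 4 (LF p s) (\<psi> (x0 + s *\<^sub>R column p Q)) [i, j, k, l]) has_real_derivative cpsi Y i j k l) (at 0 within LS p))"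
    by (rule line.isometric_variation[of p]) blast+
  from someI_ex[OF this, folded T_def]
  show "pullback 4 Q (covt g \<phi> x0) [p, i, j, k] = (\<Sum>l\<in>UNIV. T p l * psi l i j k)"
    "((\<lambda>s. pullback 4 (LF p s) (\<psi> (x0 + s *\<^sub>R column p Q)) [i, j, k, l]) has_real_derivative cpsi (T p) i j k l) (at 0 within LS p)"
    by blast+
qed

lemma covt_\<psi>: "pullback 5 Q (covt g \<psi> x0) [p, i, j, k, l] = cpsi (T p) i j k l"
proof -
  have "((\<lambda>s. pullback 4 (LF p s) (\<psi> (x0 + s *\<^sub>R column p Q)) [i, j, k, l]) has_real_derivative pullback (Suc 4) Q (covt g \<psi> x0) [p, i, j, k, l]) (at 0 within LS p)"
    by (rule along_line[OF \<psi>_diff]) simp_all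
  then have "pullback (Suc 4) Q (covt g \<psi> x0) [p, i, j, k, l] = cpsi (T p) i j k l"
    using T(2) by (rule line.unique) simp
  then show ?thesis by simp
qed

lemma alternating_\<psi>: "alternating 4 (\<psi> x0)"
  by (rule frame_data_alternating_psi[OF frame vol0])

lemma pullback_ext_deriv_3:
  assumes "alternating 3 (\<alpha> x0)"
  shows "pullback 4 Q (ext_deriv \<alpha> x0) [p, i, j, k] = alt4 (\<lambda>p i j k. pullback 4 Q (covt g \<alpha> x0) [p, i, j, k]) p i j k"
proof -
  have "pullback 4 Q (ext_deriv \<alpha> x0) [p, i, j, k] = pullback 4 Q (altL 4 (covt g \<alpha> x0)) [p, i, j, k]"
    by (rule pullback_cong) (auto elim!: length_4E simp: ext_deriv_3[where \<alpha> = \<alpha>, OF x0 assms])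
  then show ?thesis by (simp add: pullback_altL altL_4 alt4_def)
qed

lemma ext_deriv_\<phi>: "pullback 4 Q (ext_deriv \<phi> x0) [p, i, j, k] = dia T p i j k"
  unfolding pullback_ext_deriv_3[of \<phi>, OF frame_data_alternating[OF frame]] T(1) dia_alt4 ..

lemma length_5E: "length L = 5 \<Longrightarrow> (\<And>a b c d e. L = [a, b, c, d, e] \<Longrightarrow> P) \<Longrightarrow> P"
  by (auto simp: numeral_eq_Suc length_Suc_conv)

lemma ext_deriv_\<psi>: "pullback 5 Q (ext_deriv \<psi> x0) [p, i, j, k, l] = alt5 (\<lambda>p. cpsi (T p)) p i j k l"
proof -
  have "pullback 5 Q (ext_deriv \<psi> x0) [p, i, j, k, l] = pullback 5 Q (altL 5 (covt g \<psi> x0)) [p, i, j, k, l]"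
    by (rule pullback_cong) (auto elim!: length_5E simp: ext_deriv_4[where \<alpha> = \<psi>, OF x0 alternating_\<psi>])
  then show ?thesis by (simp add: pullback_altL altL_5 alt5_def covt_\<psi>)
qed

lemma pullback_QN: "length I = k \<Longrightarrow> pullback k N (pullback k Q S) I = S I"
  by (rule pullback_inverse[OF QN])

lemma pullback_NQ: "length I = k \<Longrightarrow> pullback k Q (pullback k N S) I = S I"
  by (rule pullback_inverse[OF NQ])

text \<open>Transfers tracelessness, the condition of the 14-dimensional piece and both structure
  equations from coordinates to the frame, where \<open>torsion_tensor\<close> solves for
  \<open>T\<close>.\<close>

lemma torsion_tensor_eq:
  fixes \<tau>0 :: real and \<tau>1 \<tau>2 \<tau>3 vol :: tensor
  assumes vol: "\<And>L. length L = 7 \<Longrightarrow> vol L = pullback 7 N vol0 L"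
    and sym: "\<And>a b. \<tau>3 [b, a] = \<tau>3 [a, b]" and tr: "trace_g (g x0) \<tau>3 = 0"
    and \<tau>2: "in_Omega2_14 (\<phi> x0) (g x0) \<tau>2"
    and d\<phi>: "\<And>I. length I = 4 \<Longrightarrow> ext_deriv \<phi> x0 I = \<tau>0 * \<psi> x0 I + 3 * wedge 1 3 \<tau>1 (\<phi> x0) I
       + hodge_star (g x0) vol 3 (form3_of_sym2 (\<phi> x0) (g x0) \<tau>3) I"
    and d\<psi>: "\<And>I. length I = 5 \<Longrightarrow> ext_deriv \<psi> x0 I = 4 * wedge 1 4 \<tau>1 (\<psi> x0) I + hodge_star (g x0) vol 2 \<tau>2 I"
  defines "t3 \<equiv> \<lambda>a b. pullback 2 Q \<tau>3 [a, b]" and "t2 \<equiv> \<lambda>a b. pullback 2 Q \<tau>2 [a, b]" and "t1 \<equiv> \<lambda>a. pullback 1 Q \<tau>1 [a]"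
  shows "t3 b a = t3 a b" "(\<Sum>a\<in>UNIV. t3 a a) = 0" "t2 b a = - t2 a b" "(\<Sum>a\<in>UNIV. \<Sum>b\<in>UNIV. t2 a b * phi a b k) = 0"
    and "dia T i j k l = \<tau>0 * psi i j k l - 3 * cpsi t1 i j k l - dia t3 i j k l"
    and "T a b = \<tau>0 / 4 * kdelta a b - t3 a b + (\<Sum>l\<in>UNIV. t1 l * phi l a b) - t2 a b / 2"
proof -
  have G: "gmat (g x0) = transpose N ** N" using frame by (simp add: frame_data_def)
  show s3: "t3 b a = t3 a b" for a b
    unfolding t3_def numeral_2_eq_2 pullback_Suc pullback_0 sum_distrib_left
    by (subst sum.swap, intro sum.cong refl) (simp add: sym mult_ac)
  show tr3: "(\<Sum>a\<in>UNIV. t3 a a) = 0"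
  proof -
    have "(\<Sum>a\<in>UNIV. t3 a a) = (\<Sum>a\<in>UNIV. \<Sum>b\<in>UNIV. t3 a b * (\<Sum>i\<in>UNIV. \<Sum>j\<in>UNIV. N $ a $ i * N $ b $ j * ginv (g x0) i j))"
      unfolding ginv_frame[OF N_inv G] kdelta_mult_if by simp
    also have "\<dots> = (\<Sum>i\<in>UNIV. \<Sum>j\<in>UNIV. ginv (g x0) i j * (\<Sum>a\<in>UNIV. N $ a $ i * (\<Sum>b\<in>UNIV. N $ b $ j * t3 a b)))"
    proof -
      have "(\<Sum>a\<in>UNIV. \<Sum>b\<in>UNIV. \<Sum>i\<in>UNIV. \<Sum>j\<in>UNIV. F a b i j) = (\<Sum>i\<in>UNIV. \<Sum>j\<in>UNIV. \<Sum>a\<in>UNIV. \<Sum>b\<in>UNIV. F a b i j)"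
        for F :: "7 \<Rightarrow> 7 \<Rightarrow> 7 \<Rightarrow> 7 \<Rightarrow> real" by (rule sum_swap22)
      then show ?thesis unfolding sum_distrib_left by (simp add: mult_ac)
    qed
    also have "\<dots> = (\<Sum>i\<in>UNIV. \<Sum>j\<in>UNIV. ginv (g x0) i j * \<tau>3 [i, j])"
    proof -
      have "(\<Sum>a\<in>UNIV. N $ a $ i * (\<Sum>b\<in>UNIV. N $ b $ j * t3 a b)) = pullback 2 N (pullback 2 Q \<tau>3) [i, j]" for i j
        unfolding t3_def numeral_2_eq_2 by (simp add: pullback_Suc)
      then show ?thesis by (simp add: pullback_QN)
    qed
    finally show ?thesis using tr by (simp add: trace_g_def)
  qed
  have alt2: "alternating 2 \<tau>2" using \<tau>2 by (simp add: in_Omega2_14_def)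
  show s2: "t2 b a = - t2 a b" for a b
    unfolding t2_def by (rule swap_2[OF alternating_pullback[OF alt2]])
  show ker: "(\<Sum>a\<in>UNIV. \<Sum>b\<in>UNIV. t2 a b * phi a b k) = 0" for k
  proof -
    have z: "contr 2 (ginv (g x0)) (\<lambda>K. \<tau>2 K) (\<lambda>K. \<phi> x0 ([k] @ K)) = 0" for k
    proof -
      have rot: "\<phi> x0 [k, a, b] = \<phi> x0 [a, b, k]" for a b
        using swap_3(1)[OF frame_data_alternating[OF frame], of k a b] swap_3(2)[OF frame_data_alternating[OF frame], of a k b] by simp
      have "contr 2 (ginv (g x0)) (\<lambda>K. \<tau>2 K) (\<lambda>K. \<phi> x0 ([k] @ K))
        = (\<Sum>i\<in>UNIV. \<Sum>a\<in>UNIV. \<Sum>j\<in>UNIV. \<Sum>b\<in>UNIV. \<tau>2 [i, j] * ginv (g x0) i a * ginv (g x0) j b * \<phi> x0 [a, b, k])"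
        by (simp add: numeral_2_eq_2 contr_Suc rot sum_distrib_left mult_ac)
      also have "\<dots> = (\<Sum>i\<in>UNIV. \<Sum>j\<in>UNIV. \<Sum>a\<in>UNIV. \<Sum>b\<in>UNIV. \<tau>2 [i, j] * ginv (g x0) i a * ginv (g x0) j b * \<phi> x0 [a, b, k])"
        by (rule sum.cong[OF refl]) (rule sum.swap)
      finally show ?thesis using \<tau>2 by (simp add: in_Omega2_14_def)
    qed
    have "contr 2 (ginv (pullback 2 Q (g x0))) (\<lambda>K. pullback (0 + 2) Q \<tau>2 ([] @ K)) (\<lambda>K. pullback (1 + 2) Q (\<phi> x0) ([k] @ K))
      = pullback (0 + 1) Q (\<lambda>L. contr 2 (ginv (g x0)) (\<lambda>K. \<tau>2 (take 0 L @ K)) (\<lambda>K. \<phi> x0 (drop 0 L @ K))) ([] @ [k])"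
      by (rule contr_append_pullback[symmetric]) (simp_all add: Q_inv inv x0)
    also have "\<dots> = pullback (0 + 1) Q (\<lambda>L. 0 * 0) ([] @ [k])"
      by (rule pullback_cong) (use z in \<open>auto simp: length_Suc_conv\<close>)
    also have "\<dots> = 0" unfolding pullback_scale by simp
    finally have z': "contr 2 (ginv (pullback 2 Q (g x0))) (\<lambda>K. pullback 2 Q \<tau>2 K) (\<lambda>K. pullback 3 Q (\<phi> x0) ([k] @ K)) = 0"
      by (simp add: numeral_eq_Suc)
    have gi: "ginv (pullback 2 Q (g x0)) = kdelta"
      using line.ginv_0 by (intro ext) (simp add: line_frame_0)
    show ?thesis
      using z' unfolding gi contr_kdelta sum_lists_2 t2_def
      by (simp add: frame_data_1(1)[OF frame_1] phi_rot[of _ _ k])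
  qed
  have Gv: "gmat (g x0) = transpose N ** N" by (rule G)
  have D: "pullback 4 Q (ext_deriv \<phi> x0) [i, j, k, l] = \<tau>0 * psi i j k l - 3 * cpsi (\<lambda>a. pullback 1 Q \<tau>1 [a]) i j k l - dia (\<lambda>a b. pullback 2 Q \<tau>3 [a, b]) i j k l" for i j k l
    by (rule torsion_phi_frame[OF frame vol0, where vol = vol and ?\<tau>1.0 = \<tau>1 and ?t1.0 = "pullback 1 Q \<tau>1" and ?\<tau>3.0 = \<tau>3
          and ?t3.0 = "pullback 2 Q \<tau>3" and D = "ext_deriv \<phi> x0" and ?D0.0 = "pullback 4 Q (ext_deriv \<phi> x0)" and ?\<tau>0.0 = \<tau>0])
       (fact s3[unfolded t3_def] | fact tr3[unfolded t3_def] | erule vol | erule d\<phi> | erule pullback_QN[symmetric])+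
  then show D': "dia T i j k l = \<tau>0 * psi i j k l - 3 * cpsi t1 i j k l - dia t3 i j k l" for i j k l
    unfolding ext_deriv_\<phi> t1_def t3_def .
  have E: "ctr (\<lambda>i j k. pullback 5 Q (ext_deriv \<psi> x0) [a, b, i, j, k]) phi = - 48 * (\<Sum>l\<in>UNIV. pullback 1 Q \<tau>1 [l] * phi l a b) + 6 * pullback 2 Q \<tau>2 [a, b]" for a b
    by (rule torsion_psi_frame[OF frame vol0, where vol = vol and ?\<tau>1.0 = \<tau>1 and ?t1.0 = "pullback 1 Q \<tau>1" and ?\<tau>2.0 = \<tau>2
          and ?t2.0 = "pullback 2 Q \<tau>2" and D = "ext_deriv \<psi> x0" and ?D0.0 = "pullback 5 Q (ext_deriv \<psi> x0)"])
       (fact s2[unfolded t2_def] | fact ker[unfolded t2_def] | erule vol | erule d\<psi> | erule pullback_QN[symmetric])+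
  show "T a b = \<tau>0 / 4 * kdelta a b - t3 a b + (\<Sum>l\<in>UNIV. t1 l * phi l a b) - t2 a b / 2"
  proof (rule torsion_tensor[OF D' s3 tr3 s2 ker])
    show "ctr (alt5 (\<lambda>p. cpsi (T p)) a b) phi = - 48 * (\<Sum>l\<in>UNIV. t1 l * phi l a b) + 6 * t2 a b" for a b
      using E[of a b] unfolding ext_deriv_\<psi> t1_def t2_def .
  qed
qed

end

section \<open>Covariant derivative of the velocity\<close>

lemma cpsi_move: "cpsi Y i j k l = - cpsi Y l i j k"
  unfolding cpsi_def using phi_rot[of j k l] phi_rot[of i k l] phi_rot[of i j l] by simp

context G2_patch
begin

text \<open>In the transported frame the inverse metric is stationary at the base point. The product
  rule thus differentiates only \<open>h\<close>, the 3-form, the lowered \<open>X\<close> and the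
  4-form, the two forms through the torsion tensor.\<close>

lemma covt_flow:
  fixes h xf \<Psi> :: "real^7 \<Rightarrow> tensor"
  assumes h: "\<And>K. length K = 2 \<Longrightarrow> (\<lambda>y. h y K) differentiable (at x0)"
    and xf: "\<And>K. length K = 1 \<Longrightarrow> (\<lambda>y. xf y K) differentiable (at x0)"
    and \<Psi>_diff: "\<And>K. length K = 3 \<Longrightarrow> (\<lambda>y. \<Psi> y K) differentiable (at x0)"
    and \<Psi>: "\<And>y i j k. y \<in> V \<Longrightarrow> \<Psi> y [i, j, k] = hphi (g y) (h y) (\<phi> y) i j k - hphi (g y) (h y) (\<phi> y) j i k
      + hphi (g y) (h y) (\<phi> y) k i j - contr 1 (ginv (g y)) (xf y) (\<lambda>K. \<psi> y ([i, j, k] @ K))"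
  defines "H \<equiv> \<lambda>p a l. pullback 3 Q (covt g h x0) [p, a, l]" and "hf \<equiv> \<lambda>a l. pullback 2 Q (h x0) [a, l]"
    and "DX \<equiv> \<lambda>p l. pullback 2 Q (covt g xf x0) [p, l]" and "Xf \<equiv> \<lambda>l. pullback 1 Q (xf x0) [l]"
    and "TP \<equiv> \<lambda>p i j k. \<Sum>q\<in>UNIV. T p q * psi q i j k"
  shows "pullback 4 Q (covt g \<Psi> x0) [p, i, j, k] =
      ((\<Sum>l\<in>UNIV. H p i l * phi l j k) + (\<Sum>l\<in>UNIV. H p j l * phi i l k) + (\<Sum>l\<in>UNIV. H p k l * phi i j l))
      + ((\<Sum>l\<in>UNIV. hf i l * TP p l j k) + (\<Sum>l\<in>UNIV. hf j l * TP p i l k) + (\<Sum>l\<in>UNIV. hf k l * TP p i j l))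
      + ((\<Sum>l\<in>UNIV. DX p l * psi l i j k) + (\<Sum>l\<in>UNIV. Xf l * cpsi (T p) l i j k))"
proof -
  define y where "y s = x0 + s *\<^sub>R column p Q" for s
  define R where "R = LF p"
  have y0: "y 0 = x0" by (simp add: y_def)
  have R0: "R 0 = Q" by (simp add: R_def line_frame_0)
  define U where "U y L = hphi (g y) (h y) (\<phi> y) (L ! 0) (L ! 1) (L ! 2)" for y and L :: "7 list"
  define W where "W y L = contr 1 (ginv (g y)) (\<lambda>K. xf y (take 0 L @ K)) (\<lambda>K. \<psi> y (drop 0 L @ K))" for y and L :: "7 list"
  define A where "A s a b c = contr 1 (ginv (pullback 2 (R s) (g (y s)))) (\<lambda>K. pullback 2 (R s) (h (y s)) ([a] @ K))
     (\<lambda>K. pullback 3 (R s) (\<phi> (y s)) ([b, c] @ K))" for s a b c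
  define Z where "Z s = contr 1 (ginv (pullback 2 (R s) (g (y s)))) (\<lambda>K. pullback 1 (R s) (xf (y s)) K)
     (\<lambda>K. pullback 4 (R s) (\<psi> (y s)) ([i, j, k] @ K))" for s
  have E: "pullback 3 (R s) (\<Psi> (y s)) [i, j, k] = A s i j k - A s j i k + A s k i j - Z s" if s: "s \<in> LS p" for s
  proof -
    have inv': "invertible (R s)" "invertible (gmat (g (y s)))" and yV: "y s \<in> V"
      using LS_D[OF s] inv by (simp_all add: R_def y_def)
    have U: "pullback 3 (R s) (U (y s)) [a, b, c] = A s a b c" for a b c
    proof -
      have "pullback 3 (R s) (U (y s)) [a, b, c] = pullback (1 + 2) (R s) (\<lambda>L. contr 1 (ginv (g (y s))) (\<lambda>K. h (y s) (take 1 L @ K))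
          (\<lambda>K. \<phi> (y s) (drop 1 L @ K))) ([a] @ [b, c])"
        unfolding nat_sums append.simps by (rule pullback_cong) (auto elim!: length_3E simp: U_def hphi_def)
      also have "\<dots> = contr 1 (ginv (pullback 2 (R s) (g (y s)))) (\<lambda>K. pullback (1 + 1) (R s) (h (y s)) ([a] @ K))
          (\<lambda>K. pullback (2 + 1) (R s) (\<phi> (y s)) ([b, c] @ K))"
        by (rule contr_append_pullback[OF inv']) simp_all
      also have "\<dots> = A s a b c" unfolding A_def by (simp add: numeral_eq_Suc)
      finally show ?thesis .
    qed
    have W: "pullback 3 (R s) (W (y s)) [i, j, k] = Z s"
    proof -
      have "pullback (0 + 3) (R s) (W (y s)) ([] @ [i, j, k]) = contr 1 (ginv (pullback 2 (R s) (g (y s)))) (\<lambda>K. pullback (0 + 1) (R s) (xf (y s)) ([] @ K))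
          (\<lambda>K. pullback (3 + 1) (R s) (\<psi> (y s)) ([i, j, k] @ K))"
        unfolding W_def by (rule contr_append_pullback[OF inv']) simp_all
      then show ?thesis unfolding Z_def by (simp add: numeral_eq_Suc)
    qed
    have "pullback 3 (R s) (\<Psi> (y s)) [i, j, k] = pullback 3 (R s) (\<lambda>L. altL 3 (U (y s)) L - W (y s) L) [i, j, k]"
      by (rule pullback_cong) (auto elim!: length_3E simp: \<Psi>[OF yV] altL_3 U_def W_def)
    also have "\<dots> = altL 3 (pullback 3 (R s) (U (y s))) [i, j, k] - Z s"
      unfolding pullback_diff W by (simp add: pullback_altL)
    finally show ?thesis by (simp add: altL_3 U)
  qed
  have gi: "((\<lambda>s. ginv (pullback 2 (R s) (g (y s))) a b) has_real_derivative 0) (at 0 within LS p)"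
    "ginv (pullback 2 (R 0) (g (y 0))) a b = kdelta a b" for a b
    using line.ginv'[of p a b] line.ginv_0[of p a b] by (simp_all add: R_def y_def)
  have A': "((\<lambda>s. A s a b c) has_real_derivative (\<Sum>l\<in>UNIV. H p a l * phi l b c) + (\<Sum>l\<in>UNIV. hf a l * TP p l b c)) (at 0 within LS p)" for a b c
  proof -
    have "((\<lambda>s. A s a b c) has_real_derivative
       contr 1 kdelta (\<lambda>K. pullback 3 Q (covt g h x0) ([p, a] @ K)) (\<lambda>K. pullback 3 (R 0) (\<phi> (y 0)) ([b, c] @ K))
       + contr 1 kdelta (\<lambda>K. pullback 2 (R 0) (h (y 0)) ([a] @ K)) (\<lambda>K. pullback 4 Q (covt g \<phi> x0) ([p, b, c] @ K))) (at 0 within LS p)"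
      unfolding A_def
    proof (rule contr_derivative[OF gi])
      fix K :: "7 list" assume K: "length K = 1"
      show "((\<lambda>s. pullback 2 (R s) (h (y s)) ([a] @ K)) has_real_derivative pullback 3 Q (covt g h x0) ([p, a] @ K)) (at 0 within LS p)"
        using along_line[of 2 h "[a] @ K" p] h K by (simp add: R_def y_def numeral_eq_Suc)
      show "((\<lambda>s. pullback 3 (R s) (\<phi> (y s)) ([b, c] @ K)) has_real_derivative pullback 4 Q (covt g \<phi> x0) ([p, b, c] @ K)) (at 0 within LS p)"
        using along_line[of 3 \<phi> "[b, c] @ K" p] \<phi>_diff[OF x0] K by (simp add: R_def y_def numeral_eq_Suc)
    qed
    then show ?thesis
    proof (rule DERIV_cong)
      have TPr: "(\<Sum>q\<in>UNIV. T p q * psi q b c l) = TP p l b c" for l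
      proof -
        have "psi q b c l = psi q l b c" for q
          using psi_swap(3)[of q b c l] psi_swap(2)[of q b l c] by linarith
        then show ?thesis by (simp add: TP_def)
      qed
      show "contr 1 kdelta (\<lambda>K. pullback 3 Q (covt g h x0) ([p, a] @ K)) (\<lambda>K. pullback 3 (R 0) (\<phi> (y 0)) ([b, c] @ K))
       + contr 1 kdelta (\<lambda>K. pullback 2 (R 0) (h (y 0)) ([a] @ K)) (\<lambda>K. pullback 4 Q (covt g \<phi> x0) ([p, b, c] @ K))
       = (\<Sum>l\<in>UNIV. H p a l * phi l b c) + (\<Sum>l\<in>UNIV. hf a l * TP p l b c)"
        by (simp add: contr_kdelta_Suc R0 y0 T(1) frame_data_1(1)[OF frame_1] phi_rot[of b c] H_def hf_def TPr)
    qed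
  qed
  have Z': "(Z has_real_derivative - ((\<Sum>l\<in>UNIV. DX p l * psi l i j k) + (\<Sum>l\<in>UNIV. Xf l * cpsi (T p) l i j k))) (at 0 within LS p)"
  proof -
    have "(Z has_real_derivative
       contr 1 kdelta (\<lambda>K. pullback 2 Q (covt g xf x0) ([p] @ K)) (\<lambda>K. pullback 4 (R 0) (\<psi> (y 0)) ([i, j, k] @ K))
       + contr 1 kdelta (\<lambda>K. pullback 1 (R 0) (xf (y 0)) K) (\<lambda>K. cpsi (T p) i j k (hd K))) (at 0 within LS p)"
      unfolding Z_def
    proof (rule contr_derivative[OF gi])
      fix K :: "7 list" assume K: "length K = 1"
      show "((\<lambda>s. pullback 1 (R s) (xf (y s)) K) has_real_derivative pullback 2 Q (covt g xf x0) ([p] @ K)) (at 0 within LS p)"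
        using along_line[of 1 xf K p] xf K by (simp add: R_def y_def numeral_eq_Suc)
      show "((\<lambda>s. pullback 4 (R s) (\<psi> (y s)) ([i, j, k] @ K)) has_real_derivative cpsi (T p) i j k (hd K)) (at 0 within LS p)"
        using K T(2)[of p i j k] by (auto simp: R_def y_def length_Suc_conv)
    qed
    then show ?thesis
    proof (rule DERIV_cong)
      have "psi i j k l = - psi l i j k" "cpsi (T p) i j k l = - cpsi (T p) l i j k" for l
        using psi_moves(3)[of l i j k] cpsi_move[of "T p" i j k l] by simp_all
      then show "contr 1 kdelta (\<lambda>K. pullback 2 Q (covt g xf x0) ([p] @ K)) (\<lambda>K. pullback 4 (R 0) (\<psi> (y 0)) ([i, j, k] @ K))
       + contr 1 kdelta (\<lambda>K. pullback 1 (R 0) (xf (y 0)) K) (\<lambda>K. cpsi (T p) i j k (hd K))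
       = - ((\<Sum>l\<in>UNIV. DX p l * psi l i j k) + (\<Sum>l\<in>UNIV. Xf l * cpsi (T p) l i j k))"
        by (simp only: contr_kdelta_Suc One_nat_def contr_0 R0 y0 frame_data_1(3)[OF frame_1] DX_def Xf_def append.simps list.sel)
           (simp add: sum_negf)
    qed
  qed
  have "((\<lambda>s. pullback 3 (R s) (\<Psi> (y s)) [i, j, k]) has_real_derivative pullback 4 Q (covt g \<Psi> x0) [p, i, j, k]) (at 0 within LS p)"
    using along_line[of 3 \<Psi> "[i, j, k]" p] \<Psi>_diff by (simp add: R_def y_def numeral_eq_Suc)
  then have "pullback 4 Q (covt g \<Psi> x0) [p, i, j, k] =
      ((\<Sum>l\<in>UNIV. H p i l * phi l j k) + (\<Sum>l\<in>UNIV. hf i l * TP p l j k)) - ((\<Sum>l\<in>UNIV. H p j l * phi l i k) + (\<Sum>l\<in>UNIV. hf j l * TP p l i k))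
      + ((\<Sum>l\<in>UNIV. H p k l * phi l i j) + (\<Sum>l\<in>UNIV. hf k l * TP p l i j)) - (- ((\<Sum>l\<in>UNIV. DX p l * psi l i j k) + (\<Sum>l\<in>UNIV. Xf l * cpsi (T p) l i j k)))"
    by (rule line.unique[OF _ DERIV_diff[OF DERIV_add[OF DERIV_diff[OF A' A'] A'] Z']]) (rule E)
  moreover have "phi l i k = - phi i l k" "phi l i j = phi i j l" for l
    using phi_swap(1)[of l i k] phi_rot[of i j l] by simp_all
  moreover have "TP p l i k = - TP p i l k" "TP p l i j = TP p i j l" for l
  proof -
    have "psi q l i k = - psi q i l k" "psi q l i j = psi q i j l" for q
      using psi_swap(2)[of q l i k] psi_swap(2)[of q l i j] psi_swap(3)[of q i j l] by linarith+
    then show "TP p l i k = - TP p i l k" "TP p l i j = TP p i j l" by (simp_all add: TP_def sum_negf)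
  qed
  ultimately show ?thesis by (simp add: sum_negf)
qed

lemma covt_sym:
  assumes h: "\<And>K. length K = 2 \<Longrightarrow> (\<lambda>y. h y K) differentiable (at x0)" and sym: "\<And>y i j. y \<in> V \<Longrightarrow> h y [j, i] = h y [i, j]"
  shows "pullback 3 Q (covt g h x0) [p, b, a] = pullback 3 Q (covt g h x0) [p, a, b]"
proof -
  have d: "((\<lambda>s. pullback 2 (LF p s) (h (x0 + s *\<^sub>R column p Q)) [a, b]) has_real_derivative pullback 3 Q (covt g h x0) [p, a, b]) (at 0 within LS p)" for a b
    using along_line[of 2 h "[a, b]" p] h by (simp add: numeral_eq_Suc)
  show ?thesis
  proof (rule line.unique[OF d d])
    fix s assume "s \<in> LS p"
    then have "h (x0 + s *\<^sub>R column p Q) [j, i] = h (x0 + s *\<^sub>R column p Q) [i, j]" for i j by (intro sym LS_D)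
    then show "pullback 2 (LF p s) (h (x0 + s *\<^sub>R column p Q)) [b, a] = pullback 2 (LF p s) (h (x0 + s *\<^sub>R column p Q)) [a, b]"
      unfolding numeral_2_eq_2 pullback_Suc pullback_0 sum_distrib_left
      by (subst sum.swap, intro sum.cong refl) (simp add: mult_ac)
  qed
qed

end

section \<open>Recovering the torsion from a contraction\<close>

lemma trace_frame:
  assumes N: "invertible N" "gmat g = transpose N ** N"
  shows "trace_g g (pullback 2 N S) = (\<Sum>a\<in>UNIV. S [a, a])"
proof -
  have "trace_g g (pullback 2 N S) = (\<Sum>i\<in>UNIV. \<Sum>j\<in>UNIV. \<Sum>a\<in>UNIV. \<Sum>b\<in>UNIV. N $ a $ i * N $ b $ j * ginv g i j * S [a, b])"
    unfolding trace_g_def numeral_2_eq_2 pullback_Suc pullback_0 by (simp add: sum_distrib_left mult_ac)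
  also have "\<dots> = (\<Sum>a\<in>UNIV. \<Sum>b\<in>UNIV. \<Sum>i\<in>UNIV. \<Sum>j\<in>UNIV. N $ a $ i * N $ b $ j * ginv g i j * S [a, b])"
    by (rule sum_swap22)
  also have "\<dots> = (\<Sum>a\<in>UNIV. \<Sum>b\<in>UNIV. kdelta a b * S [a, b])"
    unfolding sum_distrib_right[symmetric] ginv_frame[OF N] ..
  finally show ?thesis unfolding kdelta_mult_if by simp
qed

text \<open>Expresses the torsion at any time through contractions of d\<phi> with \<psi>. This is
  what makes \<tau>0 and \<tau>3 differentiable in time, since their smoothness is postulated only
  in space at each fixed time.\<close>

lemma torsion_contr:
  assumes fr: "frame_data N f g p" and vol0: "alternating 7 vol0" "vol0 indices = -1"
    and vol: "\<And>L. length L = 7 \<Longrightarrow> vol L = pullback 7 N vol0 L"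
    and sym: "\<And>a b. \<tau>3 [b, a] = \<tau>3 [a, b]" and tr: "trace_g g \<tau>3 = 0"
    and eq: "\<And>I. length I = 4 \<Longrightarrow> D I = \<tau>0 * p I + 3 * wedge 1 3 \<tau>1 f I + hodge_star g vol 3 (form3_of_sym2 f g \<tau>3) I"
  defines "K \<equiv> \<lambda>L. contr 3 (ginv g) (\<lambda>K. D (take 1 L @ K)) (\<lambda>K. p (drop 1 L @ K))"
  shows "K [i, j] + K [j, i] = 48 * \<tau>0 * g [i, j] - 24 * \<tau>3 [i, j]" and "trace_g g K = 168 * \<tau>0"
proof -
  have N: "invertible N" "gmat g = transpose N ** N" using fr by (auto simp: frame_data_def)
  define Q where "Q = matrix_inv N"
  have QN: "Q ** N = mat 1" using matrix_inv_mult[OF N(1)] by (simp add: Q_def)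
  note pb = pullback_inverse[OF QN, symmetric]
  define t3 where "t3 = pullback 2 Q \<tau>3"
  define D0 where "D0 = pullback 4 Q D"
  have t3: "\<tau>3 L = pullback 2 N t3 L" if "length L = 2" for L unfolding t3_def using that by (rule pb)
  have s3: "t3 [b, a] = t3 [a, b]" for a b
    unfolding t3_def numeral_2_eq_2 pullback_Suc pullback_0 sum_distrib_left
    by (subst sum.swap, intro sum.cong refl) (simp add: sym mult_ac)
  have tr3: "(\<Sum>a\<in>UNIV. t3 [a, a]) = 0"
    using tr trace_frame[OF N, of t3] t3 by (simp add: trace_g_def)
  have D0: "D0 [i, j, k, l] = \<tau>0 * psi i j k l - 3 * cpsi (\<lambda>a. pullback 1 Q \<tau>1 [a]) i j k l - dia (\<lambda>a b. t3 [a, b]) i j k l" for i j k l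
    by (rule torsion_phi_frame[OF fr vol0, where vol = vol and ?\<tau>1.0 = \<tau>1 and ?t1.0 = "pullback 1 Q \<tau>1" and ?\<tau>3.0 = \<tau>3
          and ?t3.0 = t3 and D = D and ?D0.0 = D0 and ?\<tau>0.0 = \<tau>0])
       (fact s3 | fact tr3 | erule vol | erule eq | erule t3 | erule pb | (unfold D0_def, erule pb))+
  define S where "S L = ctr (\<lambda>a b c. D0 [L ! 0, a, b, c]) (psi (L ! 1))" for L
  have K: "K L = pullback 2 N S L" if "length L = 2" for L
  proof -
    from that obtain a b where L: "L = [a, b]" by (rule length_2E)
    show ?thesis
      using contr_3_frame[OF fr, of D D0 a b] pb[of _ 4 D] unfolding K_def L S_def D0_def by simp
  qed
  note T = torsion_phi_sym[where D = "\<lambda>i j k l. D0 [i, j, k, l]", OF D0 s3 tr3]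
  have S: "S [a, b] + S [b, a] = 48 * \<tau>0 * kdelta a b - 24 * t3 [a, b]" for a b
    using T(1)[of a b] by (simp add: S_def)
  have "K [j, i] = pullback 2 N (\<lambda>L. S [L ! 1, L ! 0]) [i, j]"
    unfolding K[of "[j, i]", simplified] numeral_2_eq_2 pullback_Suc pullback_0 sum_distrib_left
    by (subst sum.swap) (simp add: mult_ac)
  then have "K [i, j] + K [j, i] = pullback 2 N (\<lambda>L. S L + S [L ! 1, L ! 0]) [i, j]"
    unfolding pullback_add by (simp add: K)
  also have "\<dots> = pullback 2 N (\<lambda>L. (48 * \<tau>0) * kdelta (L ! 0) (L ! 1) - 24 * t3 L) [i, j]"
    by (rule pullback_cong) (auto elim!: length_2E simp: S simp del: of_bool_eq)
  also have "\<dots> = 48 * \<tau>0 * g [i, j] - 24 * \<tau>3 [i, j]"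
    unfolding pullback_diff pullback_scale[of 2 N "48 * \<tau>0"] pullback_scale[of 2 N 24] pullback_2_gmat[OF N(2)] by (simp add: t3)
  finally show "K [i, j] + K [j, i] = 48 * \<tau>0 * g [i, j] - 24 * \<tau>3 [i, j]" .
  have "trace_g g K = trace_g g (pullback 2 N S)" unfolding trace_g_def by (simp add: K)
  also have "\<dots> = 168 * \<tau>0" unfolding trace_frame[OF N] using T(2) by (simp add: S_def)
  finally show "trace_g g K = 168 * \<tau>0" .
qed

section \<open>The flow at a point\<close>

text \<open>At times other than \<open>t0\<close> the torsion enters only through the two
  contraction identities of \<open>torsion_contr\<close>, which involve no frame and can therefore
  be differentiated in time.\<close>

locale flow_point = G2_patch "g t0" V "\<phi> t0" "\<psi> t0" x0 N vol0
  for g \<phi> \<psi> :: "real \<Rightarrow> real^7 \<Rightarrow> tensor" and t0 :: real and V x0 N vol0 +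
  fixes J :: "real set" and h :: "real^7 \<Rightarrow> tensor" and X :: "real^7 \<Rightarrow> real^7"
    and \<tau>0 :: "real \<Rightarrow> real" and \<tau>3 :: "real \<Rightarrow> tensor"
  assumes t0: "t0 \<in> J" and ne: "at t0 within J \<noteq> bot"
    and smooth: "\<And>K. length K = 3 \<Longrightarrow> smooth_on (J \<times> V) (\<lambda>(t, x). \<phi> t x K)"
    and time_frames: "\<And>t. t \<in> J \<Longrightarrow> \<exists>N. frame_data N (\<phi> t x0) (g t x0) (\<psi> t x0)"
    and g_time: "\<And>i j. (\<lambda>s. g s x0 [i, j]) differentiable (at t0 within J)"
    and h_diff: "\<And>K. length K = 2 \<Longrightarrow> (\<lambda>y. h y K) differentiable (at x0)"
    and X_diff: "\<And>K. length K = 1 \<Longrightarrow> (\<lambda>y. flat (g t0 y) (X y) K) differentiable (at x0)"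
    and h_sym: "\<And>y i j. y \<in> V \<Longrightarrow> h y [j, i] = h y [i, j]"
    and flow: "\<And>x i j k. x \<in> V \<Longrightarrow> ((\<lambda>s. \<phi> s x [i, j, k]) has_real_derivative
        (\<Sum>l\<in>UNIV. raise_sym2 (g t0 x) (h x) l i * \<phi> t0 x [l, j, k] + raise_sym2 (g t0 x) (h x) l j * \<phi> t0 x [i, l, k]
           + raise_sym2 (g t0 x) (h x) l k * \<phi> t0 x [i, j, l] + X x $ l * \<psi> t0 x [l, i, j, k])) (at t0 within J)"
    and torsion_sum: "\<And>t i j. t \<in> J \<Longrightarrow>
        contr 3 (ginv (g t x0)) (\<lambda>K. ext_deriv (\<phi> t) x0 ([i] @ K)) (\<lambda>K. \<psi> t x0 ([j] @ K))
        + contr 3 (ginv (g t x0)) (\<lambda>K. ext_deriv (\<phi> t) x0 ([j] @ K)) (\<lambda>K. \<psi> t x0 ([i] @ K))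
        = 48 * \<tau>0 t * g t x0 [i, j] - 24 * \<tau>3 t [i, j]"
    and torsion_trace: "\<And>t. t \<in> J \<Longrightarrow> trace_g (g t x0)
        (\<lambda>L. contr 3 (ginv (g t x0)) (\<lambda>K. ext_deriv (\<phi> t) x0 (take 1 L @ K)) (\<lambda>K. \<psi> t x0 (drop 1 L @ K))) = 168 * \<tau>0 t"
begin

definition B :: "real^7 \<Rightarrow> 7 \<Rightarrow> 7 \<Rightarrow> real" where "B x m i = raise_sym2 (g t0 x) (h x) m i"

definition act :: "(7 \<Rightarrow> 7 \<Rightarrow> real) \<Rightarrow> nat \<Rightarrow> tensor \<Rightarrow> tensor" where
  "act C k S K = (\<Sum>r<k. \<Sum>m\<in>UNIV. C m (K ! r) * S (K[r := m]))"

definition XP :: "real^7 \<Rightarrow> tensor" where "XP x K = (\<Sum>l\<in>UNIV. X x $ l * \<psi> t0 x (l # K))"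

text \<open>The velocity of the 3-form at \<open>t0\<close>, split into the derivation action of the
  raised \<open>h\<close> and the contraction of the 4-form with \<open>X\<close>.\<close>

definition \<Psi> :: "real^7 \<Rightarrow> tensor" where "\<Psi> x K = act (B x) 3 (\<phi> t0 x) K + XP x K"

abbreviation "xf y \<equiv> flat (g t0 y) (X y)"

definition "hf = (\<lambda>a b. pullback 2 Q (h x0) [a, b])"
definition "Xf = (\<lambda>l. pullback 1 Q (xf x0) [l])"

lemma \<Psi>_derivative:
  assumes x: "x \<in> V" and K: "length K = 3"
  shows "((\<lambda>s. \<phi> s x K) has_real_derivative \<Psi> x K) (at t0 within J)"
proof -
  from K obtain i j k where "K = [i, j, k]" by (rule length_3E)
  then show ?thesis
    using flow[OF x, of i j k] by (simp add: \<Psi>_def act_def XP_def B_def numeral_3_eq_3 sum.distrib)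
qed

lemma \<psi>_alt:
  assumes "x \<in> V"
  shows "alternating 4 (\<psi> t0 x)"
proof -
  obtain M where "frame_data M (\<phi> t0 x) (g t0 x) (\<psi> t0 x)" using frames[OF assms] ..
  then show ?thesis by (rule frame_data_alternating_psi[OF _ vol0])
qed

lemma \<phi>_alt:
  assumes "x \<in> V"
  shows "alternating 3 (\<phi> t0 x)"
proof -
  obtain M where "frame_data M (\<phi> t0 x) (g t0 x) (\<psi> t0 x)" using frames[OF assms] ..
  then show ?thesis by (rule frame_data_alternating)
qed

lemma XP_contr:
  assumes x: "x \<in> V"
  shows "XP x [i, j, k] = - contr 1 (ginv (g t0 x)) (xf x) (\<lambda>K. \<psi> t0 x ([i, j, k] @ K))"
proof -
  note gi = ginv_inverse[OF inv[OF x] sym[OF x]]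
  note s = swap_4[OF \<psi>_alt[OF x]]
  have m: "\<psi> t0 x [i, j, k, l] = - \<psi> t0 x [l, i, j, k]" for l
    using s(1)[of l i j k] s(2)[of i l j k] s(3)[of i j l k] by linarith
  have X: "(\<Sum>m\<in>UNIV. ginv (g t0 x) m l * flat (g t0 x) (X x) [m]) = X x $ l" for l
  proof -
    have "(\<Sum>m\<in>UNIV. ginv (g t0 x) m l * flat (g t0 x) (X x) [m]) = (\<Sum>k\<in>UNIV. X x $ k * (\<Sum>m\<in>UNIV. ginv (g t0 x) m l * g t0 x [m, k]))"
      unfolding flat_def sum_distrib_left by (subst sum.swap) (simp add: mult_ac)
    also have "\<dots> = (\<Sum>k\<in>UNIV. X x $ k * kdelta l k)"
    proof -
      have "(\<Sum>m\<in>UNIV. ginv (g t0 x) m l * g t0 x [m, k]) = kdelta l k" for k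
        unfolding gi(2)[of l k, symmetric] by (intro sum.cong refl) (simp add: gi(1)[of l])
      then show ?thesis by simp
    qed
    finally show ?thesis unfolding kdelta_mult_if by simp
  qed
  have "contr 1 (ginv (g t0 x)) (xf x) (\<lambda>K. \<psi> t0 x ([i, j, k] @ K))
    = (\<Sum>l\<in>UNIV. (\<Sum>m\<in>UNIV. ginv (g t0 x) m l * flat (g t0 x) (X x) [m]) * \<psi> t0 x [i, j, k, l])"
    unfolding sum_distrib_right One_nat_def contr_Suc contr_0 by (subst sum.swap) (simp add: mult.assoc)
  then show ?thesis unfolding X by (simp add: XP_def m sum_negf)
qed

lemma \<Psi>_hphi:
  assumes x: "x \<in> V"
  shows "\<Psi> x [i, j, k] = hphi (g t0 x) (h x) (\<phi> t0 x) i j k - hphi (g t0 x) (h x) (\<phi> t0 x) j i k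
      + hphi (g t0 x) (h x) (\<phi> t0 x) k i j - contr 1 (ginv (g t0 x)) (xf x) (\<lambda>K. \<psi> t0 x ([i, j, k] @ K))"
proof -
  note gi = ginv_inverse(1)[OF inv[OF x] sym[OF x]]
  note s = swap_3[OF \<phi>_alt[OF x]]
  have H: "hphi (g t0 x) (h x) (\<phi> t0 x) i j k = (\<Sum>l\<in>UNIV. B x l i * \<phi> t0 x [l, j, k])" for i j k
  proof -
    have "\<phi> t0 x [j, k, l] = \<phi> t0 x [l, j, k]" for l using s(1)[of l j k] s(2)[of j l k] by simp
    then have "hphi (g t0 x) (h x) (\<phi> t0 x) i j k = (\<Sum>l\<in>UNIV. (\<Sum>m\<in>UNIV. ginv (g t0 x) m l * h x [i, m]) * \<phi> t0 x [l, j, k])"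
      unfolding hphi_def sum_distrib_right One_nat_def contr_Suc contr_0 by (subst sum.swap) (simp add: mult.assoc)
    also have "\<dots> = (\<Sum>l\<in>UNIV. B x l i * \<phi> t0 x [l, j, k])"
    proof -
      have "(\<Sum>m\<in>UNIV. ginv (g t0 x) m l * h x [i, m]) = B x l i" for l
        unfolding B_def raise_sym2_def by (intro sum.cong refl) (simp add: gi[of l])
      then show ?thesis by simp
    qed
    finally show ?thesis .
  qed
  have 2: "\<phi> t0 x [i, l, k] = - \<phi> t0 x [l, i, k]" "\<phi> t0 x [i, j, l] = \<phi> t0 x [l, i, j]" for l
    using s(1)[of i l k] s(2)[of i j l] s(1)[of i l j] by simp_all
  have a: "act (B x) 3 (\<phi> t0 x) [i, j, k] = (\<Sum>l\<in>UNIV. B x l i * \<phi> t0 x [l, j, k])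
    + (\<Sum>l\<in>UNIV. B x l j * \<phi> t0 x [i, l, k]) + (\<Sum>l\<in>UNIV. B x l k * \<phi> t0 x [i, j, l])"
    by (simp add: act_def numeral_3_eq_3)
  have "(\<Sum>l\<in>UNIV. B x l j * \<phi> t0 x [i, l, k]) = - (\<Sum>l\<in>UNIV. B x l j * \<phi> t0 x [l, i, k])"
    "(\<Sum>l\<in>UNIV. B x l k * \<phi> t0 x [i, j, l]) = (\<Sum>l\<in>UNIV. B x l k * \<phi> t0 x [l, i, j])"
    unfolding sum_negf[symmetric] by (intro sum.cong refl; simp add: 2)+
  then show ?thesis unfolding \<Psi>_def a XP_contr[OF x] H by simp
qed

lemma mixed:
  assumes K: "length K = 3"
  shows "((\<lambda>s. pd i (\<lambda>y. \<phi> s y K) x0) has_real_derivative pd i (\<lambda>y. \<Psi> y K) x0) (at t0 within J)"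
    and "(\<lambda>y. \<Psi> y K) differentiable (at x0)"
  using mixed_partials[OF ne t0 V x0 smooth[OF K] \<Psi>_derivative[OF _ K]] by auto

lemma ext_deriv_time:
  assumes I: "length I = 4"
  shows "((\<lambda>s. ext_deriv (\<phi> s) x0 I) has_real_derivative ext_deriv \<Psi> x0 I) (at t0 within J)"
  unfolding ext_deriv_def by (intro DERIV_sum DERIV_cmult mixed) (use I in auto)

text \<open>The alternation identities hold at every time and survive differentiation.\<close>

lemma \<Psi>_alternating: "alternating 3 (\<Psi> x0)"
  unfolding alternating_def
proof (intro allI impI, elim conjE)
  fix I :: "7 list" and \<sigma> assume I: "length I = 3" and \<sigma>: "\<sigma> permutes {..<3::nat}"
  show "\<Psi> x0 (permute_list \<sigma> I) = of_int (sign \<sigma>) * \<Psi> x0 I"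
  proof (rule deriv_unique_within[OF \<Psi>_derivative[OF x0] _ ne])
    show "length (permute_list \<sigma> I) = 3" using I by simp
    show "((\<lambda>s. \<phi> s x0 (permute_list \<sigma> I)) has_real_derivative of_int (sign \<sigma>) * \<Psi> x0 I) (at t0 within J)"
    proof (rule has_field_derivative_transform_within[OF DERIV_cmult[OF \<Psi>_derivative[OF x0 I]] zero_less_one t0])
      fix s assume "s \<in> J"
      then obtain M where "frame_data M (\<phi> s x0) (g s x0) (\<psi> s x0)" using time_frames by meson
      then have "alternating 3 (\<phi> s x0)" by (rule frame_data_alternating)
      then show "of_int (sign \<sigma>) * \<phi> s x0 I = \<phi> s x0 (permute_list \<sigma> I)" using I \<sigma> by (simp add: alternating_def)
    qed
  qed
qed

lemma gQ: "pullback 2 Q (g t0 x0) [i, j] = kdelta i j" "ginv (pullback 2 Q (g t0 x0)) i j = kdelta i j"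
  using frame_data_1(2)[OF frame_1] line.ginv_0 by (auto simp: line_frame_0)

lemma hf_sym: "hf b a = hf a b"
  unfolding hf_def numeral_2_eq_2 pullback_Suc pullback_0 sum_distrib_left
  by (subst sum.swap, intro sum.cong refl) (simp add: h_sym[OF x0] mult_ac)

text \<open>In the orthonormal basis \<open>Q\<close> raising an index does nothing, because the
  inverse metric is \<open>Q Q^T\<close>. So \<open>Q\<close> intertwines the raised
  \<open>h\<close> with its frame matrix, as \<open>pullback_action\<close> requires.\<close>

lemma B_frame: "(\<Sum>a\<in>UNIV. B x0 m a * Q $ a $ i) = (\<Sum>b\<in>UNIV. Q $ m $ b * hf b i)"
proof -
  have gi: "ginv (g t0 x0) m n = (\<Sum>b\<in>UNIV. Q $ m $ b * Q $ n $ b)" for n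
    unfolding ginv_pullback[OF Q_inv inv[OF x0], of m n] gQ(2) kdelta_mult_if by simp
  have "(\<Sum>a\<in>UNIV. B x0 m a * Q $ a $ i) = (\<Sum>a\<in>UNIV. \<Sum>n\<in>UNIV. \<Sum>b\<in>UNIV. Q $ m $ b * (Q $ n $ b * (Q $ a $ i * h x0 [a, n])))"
    unfolding B_def raise_sym2_def gi sum_distrib_left sum_distrib_right by (simp add: mult_ac)
  also have "\<dots> = (\<Sum>a\<in>UNIV. \<Sum>b\<in>UNIV. \<Sum>n\<in>UNIV. Q $ m $ b * (Q $ n $ b * (Q $ a $ i * h x0 [a, n])))"
    by (rule sum.cong[OF refl]) (rule sum.swap)
  also have "\<dots> = (\<Sum>b\<in>UNIV. \<Sum>a\<in>UNIV. \<Sum>n\<in>UNIV. Q $ m $ b * (Q $ n $ b * (Q $ a $ i * h x0 [a, n])))"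
    by (rule sum.swap)
  also have "\<dots> = (\<Sum>b\<in>UNIV. Q $ m $ b * hf i b)"
    unfolding hf_def numeral_2_eq_2 pullback_Suc pullback_0 sum_distrib_left by (simp add: mult_ac)
  finally show ?thesis by (simp add: hf_sym[of i])
qed

lemma pullback_act: "length I = k \<Longrightarrow> pullback k Q (act (B x0) k S) I = act hf k (pullback k Q S) I"
  unfolding act_def by (rule pullback_action[OF B_frame])

text \<open>The frame \<open>Q\<close> moved by \<open>-h\<close>, which compensates the change of the metric under the flow.\<close>

definition TF :: "real \<Rightarrow> real^7^7" where
  "TF t = (\<chi> m a. Q $ m $ a - (t - t0) * (\<Sum>i\<in>UNIV. B x0 m i * Q $ i $ a))"

definition TS :: "real set" where "TS = J \<inter> {t. det (TF t) \<noteq> 0}"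

lemma TF_0: "TF t0 = Q"
  by (simp add: TF_def vec_eq_iff)

lemma TF_derivative: "((\<lambda>s. TF s $ m $ a) has_real_derivative - (\<Sum>i\<in>UNIV. B x0 m i * Q $ i $ a)) (at t0 within S)"
  unfolding TF_def by (auto intro!: derivative_eq_intros)

lemma TS: "t0 \<in> TS" "at t0 within TS = at t0 within J" "at t0 within TS \<noteq> bot"
  and TS_D: "t \<in> TS \<Longrightarrow> t \<in> J" "t \<in> TS \<Longrightarrow> invertible (TF t)"
proof -
  have o: "open {t. det (TF t) \<noteq> 0}"
    by (rule open_det_nonzero) (simp add: TF_def)
  have z: "det (TF t0) \<noteq> 0" using Q_inv by (simp add: TF_0 invertible_det_nz)
  then show "t0 \<in> TS" using t0 by (simp add: TS_def)
  show e: "at t0 within TS = at t0 within J"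
    by (rule at_within_nhd[of _ "{t. det (TF t) \<noteq> 0}"]) (use z o in \<open>auto simp: TS_def\<close>)
  then show "at t0 within TS \<noteq> bot" using ne by simp
  show "t \<in> TS \<Longrightarrow> t \<in> J" "t \<in> TS \<Longrightarrow> invertible (TF t)" by (simp_all add: TS_def invertible_det_nz)
qed

lemma along_time:
  assumes "\<And>K. length K = k \<Longrightarrow> ((\<lambda>s. S s K) has_real_derivative S' K) (at t0 within J)" "length I = k"
  shows "((\<lambda>s. pullback k (TF s) (S s) I) has_real_derivative pullback k Q (\<lambda>K. S' K - act (B x0) k (S t0) K) I) (at t0 within TS)"
  using pullback_has_derivative[of TF "B x0" t0 TS k S S' I] TF_derivative assms
  unfolding TF_0 act_def TS(2) by simp

text \<open>Only existence of the time derivative of the metric is known beforehand. It is not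
  computed directly: \<open>contract_psi_variation\<close> forces its frame version
  \<open>GD\<close> to vanish.\<close>

definition "gd i j = (SOME D. ((\<lambda>s. g s x0 [i, j]) has_real_derivative D) (at t0 within J))"

lemma gd: "((\<lambda>s. g s x0 [i, j]) has_real_derivative gd i j) (at t0 within J)"
  unfolding gd_def by (rule someI_ex) (use g_time in \<open>simp add: real_differentiable_def\<close>)

definition "GD i j = pullback 2 Q (\<lambda>K. gd (K ! 0) (K ! 1) - act (B x0) 2 (g t0 x0) K) [i, j]"

lemma XP_frame: "pullback 3 Q (XP x0) [i, j, k] = (\<Sum>l\<in>UNIV. Xf l * psi l i j k)"
proof -
  have "XP x0 K = pullback 3 N (\<lambda>L. \<Sum>l\<in>UNIV. pullback 1 Q (xf x0) [l] * psi l (L ! 0) (L ! 1) (L ! 2)) K" if "length K = 3" for K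
  proof -
    from that obtain a b c where K: "K = [a, b, c]" by (rule length_3E)
    show ?thesis unfolding K XP_contr[OF x0]
      by (subst contr_psi_frame[OF frame, of "xf x0" "pullback 1 Q (xf x0)"]) (simp_all add: pullback_QN)
  qed
  then have "pullback 3 Q (XP x0) [i, j, k] = pullback 3 Q (pullback 3 N (\<lambda>L. \<Sum>l\<in>UNIV. pullback 1 Q (xf x0) [l] * psi l (L ! 0) (L ! 1) (L ! 2))) [i, j, k]"
    by (rule pullback_cong)
  then show ?thesis by (simp add: pullback_NQ Xf_def)
qed

text \<open>The part of the velocity due to \<open>h\<close> is exactly cancelled by the motion of
  \<open>TF\<close>, which leaves the contraction of \<open>psi\<close> with
  \<open>X\<close>.\<close>

sublocale time: frame_curve "\<lambda>s. pullback 3 (TF s) (\<phi> s x0)" "\<lambda>s. pullback 2 (TF s) (g s x0)" "\<lambda>s. pullback 4 (TF s) (\<psi> s x0)"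
  t0 TS "\<lambda>i j k. \<Sum>l\<in>UNIV. Xf l * psi l i j k" GD
proof
  show "t0 \<in> TS" "at t0 within TS \<noteq> bot" by (rule TS)+
  show "\<exists>N. frame_data N (pullback 3 (TF s) (\<phi> s x0)) (pullback 2 (TF s) (g s x0)) (pullback 4 (TF s) (\<psi> s x0))" if s: "s \<in> TS" for s
  proof -
    obtain M where "frame_data M (\<phi> s x0) (g s x0) (\<psi> s x0)" using time_frames[OF TS_D(1)[OF s]] ..
    then show ?thesis using frame_data_pullback[OF _ TS_D(2)[OF s]] by (intro exI)
  qed
  fix i j k
  show "pullback 2 (TF t0) (g t0 x0) [i, j] = kdelta i j" unfolding TF_0 by (rule gQ)
  show "pullback 3 (TF t0) (\<phi> t0 x0) [i, j, k] = phi i j k" unfolding TF_0 by (rule frame_data_1(1)[OF frame_1])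
  show "((\<lambda>s. pullback 3 (TF s) (\<phi> s x0) [i, j, k]) has_real_derivative (\<Sum>l\<in>UNIV. Xf l * psi l i j k)) (at t0 within TS)"
    using along_time[of 3 "\<lambda>s. \<phi> s x0" "\<Psi> x0" "[i, j, k]", OF \<Psi>_derivative[OF x0]]
    by (simp add: \<Psi>_def XP_frame)
  show "((\<lambda>s. pullback 2 (TF s) (g s x0) [i, j]) has_real_derivative GD i j) (at t0 within TS)"
    unfolding GD_def by (rule along_time) (auto elim!: length_2E simp: gd)
qed

lemmas GD_0 = time.contract_psi_variation(1)[OF refl] and \<psi>_time = time.contract_psi_variation(2)[OF refl]

end

section \<open>Time derivative of the contraction\<close>

lemma trace_pullback:
  assumes Q: "invertible Q" and g: "invertible (gmat g)"
  shows "trace_g (pullback 2 Q g) (pullback 2 Q S) = trace_g g S"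
proof -
  have "trace_g g S = (\<Sum>a\<in>UNIV. \<Sum>b\<in>UNIV. \<Sum>i\<in>UNIV. \<Sum>j\<in>UNIV. ginv (pullback 2 Q g) i j * (Q $ a $ i * (Q $ b $ j * S [a, b])))"
    unfolding trace_g_def ginv_pullback[OF Q g] sum_distrib_right by (simp add: mult_ac)
  also have "\<dots> = (\<Sum>i\<in>UNIV. \<Sum>j\<in>UNIV. \<Sum>a\<in>UNIV. \<Sum>b\<in>UNIV. ginv (pullback 2 Q g) i j * (Q $ a $ i * (Q $ b $ j * S [a, b])))"
    by (rule sum_swap22)
  also have "\<dots> = trace_g (pullback 2 Q g) (pullback 2 Q S)"
    unfolding trace_g_def numeral_2_eq_2 pullback_Suc pullback_0 sum_distrib_left ..
  finally show ?thesis ..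
qed

lemma pullback_2_swap: "pullback 2 N (\<lambda>L. S [L ! 1, L ! 0]) [i, j] = pullback 2 N S [j, i]"
  unfolding numeral_2_eq_2 pullback_Suc pullback_0 sum_distrib_left
  by (subst sum.swap) (simp add: mult_ac)

context flow_point
begin

definition "H p a l = pullback 3 Q (covt (g t0) h x0) [p, a, l]"
definition "DX p l = pullback 2 Q (covt (g t0) (\<lambda>y. xf y) x0) [p, l]"
definition "V4 p i j k = pullback 4 Q (covt (g t0) \<Psi> x0) [p, i, j, k]"
text \<open>The exterior derivative commutes with the time derivative, and the moving frame
  subtracts the action of \<open>h\<close>.\<close>

definition "D1 p i j k = pullback 4 Q (\<lambda>K. ext_deriv \<Psi> x0 K - act (B x0) 4 (ext_deriv (\<phi> t0) x0) K) [p, i, j, k]"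
definition "K1 p q = ctr (D1 p) (psi q) + ctr (dia T p) (cpsi Xf q)"
definition "Kt s L = contr 3 (ginv (g s x0)) (\<lambda>K. ext_deriv (\<phi> s) x0 (take 1 L @ K)) (\<lambda>K. \<psi> s x0 (drop 1 L @ K))"

lemma V4: "V4 p i j k =
      ((\<Sum>l\<in>UNIV. H p i l * phi l j k) + (\<Sum>l\<in>UNIV. H p j l * phi i l k) + (\<Sum>l\<in>UNIV. H p k l * phi i j l))
      + ((\<Sum>l\<in>UNIV. hf i l * (\<Sum>q\<in>UNIV. T p q * psi q l j k)) + (\<Sum>l\<in>UNIV. hf j l * (\<Sum>q\<in>UNIV. T p q * psi q i l k))
        + (\<Sum>l\<in>UNIV. hf k l * (\<Sum>q\<in>UNIV. T p q * psi q i j l)))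
      + ((\<Sum>l\<in>UNIV. DX p l * psi l i j k) + (\<Sum>l\<in>UNIV. Xf l * cpsi (T p) l i j k))"
  unfolding V4_def H_def DX_def hf_def Xf_def
  by (rule covt_flow[OF h_diff X_diff mixed(2) \<Psi>_hphi])

lemma D1: "D1 p i j k = alt4 V4 p i j k
     - ((\<Sum>l\<in>UNIV. hf p l * dia T l i j k) + (\<Sum>l\<in>UNIV. hf i l * dia T p l j k) + (\<Sum>l\<in>UNIV. hf j l * dia T p i l k)
        + (\<Sum>l\<in>UNIV. hf k l * dia T p i j l))"
proof -
  have s: "(\<Sum>m\<in>UNIV. hf m a * F m) = (\<Sum>m\<in>UNIV. hf a m * F m)" for a F
    by (intro sum.cong refl arg_cong2[of _ _ _ _ "(*)"] hf_sym)
  have "act hf 4 S [p, i, j, k] = (\<Sum>l\<in>UNIV. hf p l * S [l, i, j, k]) + (\<Sum>l\<in>UNIV. hf i l * S [p, l, j, k])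
     + (\<Sum>l\<in>UNIV. hf j l * S [p, i, l, k]) + (\<Sum>l\<in>UNIV. hf k l * S [p, i, j, l])" for S
    by (simp add: act_def numeral_eq_Suc s)
  then show ?thesis
    unfolding D1_def pullback_diff pullback_ext_deriv_3[where \<alpha> = \<Psi>, OF \<Psi>_alternating]
    by (simp add: pullback_act ext_deriv_\<phi> V4_def[abs_def])
qed

lemma g_inv:
  assumes "s \<in> J"
  shows "invertible (gmat (g s x0))"
proof -
  obtain M where "frame_data M (\<phi> s x0) (g s x0) (\<psi> s x0)" using time_frames[OF assms] ..
  then show ?thesis by (rule frame_data_sym(2))
qed

lemma Kt_pullback:
  assumes s: "s \<in> TS"
  shows "pullback 2 (TF s) (Kt s) [p, q] = contr 3 (ginv (pullback 2 (TF s) (g s x0)))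
    (\<lambda>K. pullback 4 (TF s) (ext_deriv (\<phi> s) x0) ([p] @ K)) (\<lambda>K. pullback 4 (TF s) (\<psi> s x0) ([q] @ K))"
proof -
  have "pullback (1 + 1) (TF s) (Kt s) ([p] @ [q]) = contr 3 (ginv (pullback 2 (TF s) (g s x0)))
    (\<lambda>K. pullback (1 + 3) (TF s) (ext_deriv (\<phi> s) x0) ([p] @ K)) (\<lambda>K. pullback (1 + 3) (TF s) (\<psi> s x0) ([q] @ K))"
    unfolding Kt_def by (rule contr_append_pullback) (use TS_D[OF s] g_inv in auto)
  then show ?thesis by (simp add: numeral_eq_Suc)
qed

lemma ginv_time: "((\<lambda>s. ginv (pullback 2 (TF s) (g s x0)) i j) has_real_derivative 0) (at t0 within TS)"
  using time.ginv'[of i j] by (simp add: GD_0)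

text \<open>With the inverse metric stationary in the moved frame only two factors vary: d\<phi> by
  \<open>D1\<close>, and the 4-form by \<open>cpsi Xf\<close>.\<close>

lemma Kt_derivative: "((\<lambda>s. pullback 2 (TF s) (Kt s) [p, q]) has_real_derivative K1 p q) (at t0 within TS)"
proof -
  have "((\<lambda>s. contr 3 (ginv (pullback 2 (TF s) (g s x0)))
    (\<lambda>K. pullback 4 (TF s) (ext_deriv (\<phi> s) x0) ([p] @ K)) (\<lambda>K. pullback 4 (TF s) (\<psi> s x0) ([q] @ K))) has_real_derivative
     contr 3 kdelta (\<lambda>K. pullback 4 Q (\<lambda>K. ext_deriv \<Psi> x0 K - act (B x0) 4 (ext_deriv (\<phi> t0) x0) K) ([p] @ K))
        (\<lambda>K. pullback 4 (TF t0) (\<psi> t0 x0) ([q] @ K))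
     + contr 3 kdelta (\<lambda>K. pullback 4 (TF t0) (ext_deriv (\<phi> t0) x0) ([p] @ K)) (\<lambda>K. cpsi Xf q (K ! 0) (K ! 1) (K ! 2))) (at t0 within TS)"
  proof (rule contr_derivative[OF ginv_time time.ginv_0])
    fix K :: "7 list" assume K: "length K = 3"
    show "((\<lambda>s. pullback 4 (TF s) (ext_deriv (\<phi> s) x0) ([p] @ K)) has_real_derivative
       pullback 4 Q (\<lambda>K. ext_deriv \<Psi> x0 K - act (B x0) 4 (ext_deriv (\<phi> t0) x0) K) ([p] @ K)) (at t0 within TS)"
      by (rule along_time[OF ext_deriv_time]) (use K in simp_all)
    show "((\<lambda>s. pullback 4 (TF s) (\<psi> s x0) ([q] @ K)) has_real_derivative cpsi Xf q (K ! 0) (K ! 1) (K ! 2)) (at t0 within TS)"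
      using K \<psi>_time[of q] by (auto elim!: length_3E)
  qed
  then have "((\<lambda>s. contr 3 (ginv (pullback 2 (TF s) (g s x0)))
    (\<lambda>K. pullback 4 (TF s) (ext_deriv (\<phi> s) x0) ([p] @ K)) (\<lambda>K. pullback 4 (TF s) (\<psi> s x0) ([q] @ K))) has_real_derivative K1 p q) (at t0 within TS)"
  proof (rule DERIV_cong)
    show "contr 3 kdelta (\<lambda>K. pullback 4 Q (\<lambda>K. ext_deriv \<Psi> x0 K - act (B x0) 4 (ext_deriv (\<phi> t0) x0) K) ([p] @ K))
        (\<lambda>K. pullback 4 (TF t0) (\<psi> t0 x0) ([q] @ K))
     + contr 3 kdelta (\<lambda>K. pullback 4 (TF t0) (ext_deriv (\<phi> t0) x0) ([p] @ K)) (\<lambda>K. cpsi Xf q (K ! 0) (K ! 1) (K ! 2)) = K1 p q"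
      by (simp add: contr_kdelta sum_lists_3 TF_0 D1_def[symmetric] ext_deriv_\<phi> frame_data_1(3)[OF frame_1] K1_def ctr_def)
  qed
  then show ?thesis
    by (rule has_field_derivative_transform_within[OF _ zero_less_one TS(1)]) (simp add: Kt_pullback)
qed

definition "t0' = (\<Sum>p\<in>UNIV. K1 p p) / 168"

lemma \<tau>0_derivative: "(\<tau>0 has_real_derivative t0') (at t0 within TS)"
proof -
  have "((\<lambda>s. (\<Sum>i\<in>UNIV. \<Sum>j\<in>UNIV. ginv (pullback 2 (TF s) (g s x0)) i j * pullback 2 (TF s) (Kt s) [i, j]) / 168) has_real_derivative
     (\<Sum>i\<in>UNIV. \<Sum>j\<in>UNIV. 0 * pullback 2 (TF t0) (Kt t0) [i, j] + K1 i j * ginv (pullback 2 (TF t0) (g t0 x0)) i j) / 168) (at t0 within TS)"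
    by (intro DERIV_cdivide DERIV_sum DERIV_mult ginv_time Kt_derivative)
  then have "((\<lambda>s. (\<Sum>i\<in>UNIV. \<Sum>j\<in>UNIV. ginv (pullback 2 (TF s) (g s x0)) i j * pullback 2 (TF s) (Kt s) [i, j]) / 168) has_real_derivative t0') (at t0 within TS)"
    by (rule DERIV_cong) (simp only: time.ginv_0 t0'_def kdelta_mult_if, simp)
  then show ?thesis
  proof (rule has_field_derivative_transform_within[OF _ zero_less_one TS(1)])
    fix s assume s: "s \<in> TS"
    have "(\<Sum>i\<in>UNIV. \<Sum>j\<in>UNIV. ginv (pullback 2 (TF s) (g s x0)) i j * pullback 2 (TF s) (Kt s) [i, j]) = trace_g (g s x0) (Kt s)"
      using trace_pullback[OF TS_D(2)[OF s] g_inv[OF TS_D(1)[OF s]], of "Kt s"] by (simp add: trace_g_def)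
    then show "(\<Sum>i\<in>UNIV. \<Sum>j\<in>UNIV. ginv (pullback 2 (TF s) (g s x0)) i j * pullback 2 (TF s) (Kt s) [i, j]) / 168 = \<tau>0 s"
      using torsion_trace[OF TS_D(1)[OF s]] by (simp add: Kt_def[abs_def])
  qed
qed

text \<open>The contraction identity solved for \<tau>3 in the moved frame, written entirely in
  quantities whose time derivatives are known.\<close>

definition "S3 s L = 2 * (\<tau>0 s * pullback 2 (TF s) (g s x0) L) - (pullback 2 (TF s) (Kt s) L + pullback 2 (TF s) (Kt s) [L ! 1, L ! 0]) / 24"

lemma S3:
  assumes s: "s \<in> TS" and L: "length L = 2"
  shows "S3 s L = pullback 2 (TF s) (\<tau>3 s) L"
proof -
  from L obtain a b where ab: "L = [a, b]" by (rule length_2E)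
  have "pullback 2 (TF s) (\<tau>3 s) [a, b] = pullback 2 (TF s) (\<lambda>L. (2 * \<tau>0 s) * g s x0 L - 1 / 24 * (Kt s L + Kt s [L ! 1, L ! 0])) [a, b]"
  proof (rule pullback_cong)
    fix K :: "7 list" assume "length K = 2"
    then obtain i j where K: "K = [i, j]" by (rule length_2E)
    show "\<tau>3 s K = (2 * \<tau>0 s) * g s x0 K - 1 / 24 * (Kt s K + Kt s [K ! 1, K ! 0])"
    proof -
      have "Kt s [i, j] + Kt s [j, i] = 48 * (\<tau>0 s * g s x0 [i, j]) - 24 * \<tau>3 s [i, j]"
        using torsion_sum[OF TS_D(1)[OF s], of i j] by (simp add: Kt_def)
      moreover have "t = 2 * x - 1 / 24 * y" if "y = 48 * x - 24 * t" for t x y :: real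
        unfolding that by (simp add: field_simps)
      ultimately have "\<tau>3 s [i, j] = 2 * (\<tau>0 s * g s x0 [i, j]) - 1 / 24 * (Kt s [i, j] + Kt s [j, i])" by blast
      then show ?thesis by (simp only: K nth_Cons_0 One_nat_def nth_Cons_Suc mult.assoc)
    qed
  qed
  then show ?thesis
    unfolding pullback_diff pullback_scale[of 2 _ "2 * \<tau>0 s"] pullback_scale[of 2 _ "1 / 24"] pullback_add pullback_2_swap ab S3_def by simp
qed

lemma S3_derivative: "((\<lambda>s. S3 s [a, b]) has_real_derivative 2 * t0' * kdelta a b - (K1 a b + K1 b a) / 24) (at t0 within TS)"
proof -
  have g: "((\<lambda>s. pullback 2 (TF s) (g s x0) [a, b]) has_real_derivative 0) (at t0 within TS)"
    using time.g'[of a b] by (simp add: GD_0)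
  have "((\<lambda>s. 2 * (\<tau>0 s * pullback 2 (TF s) (g s x0) [a, b]) - (pullback 2 (TF s) (Kt s) [a, b] + pullback 2 (TF s) (Kt s) [b, a]) / 24) has_real_derivative
     2 * (t0' * pullback 2 (TF t0) (g t0 x0) [a, b] + 0 * \<tau>0 t0) - (K1 a b + K1 b a) / 24) (at t0 within TS)"
    by (intro DERIV_diff DERIV_cmult DERIV_mult DERIV_cdivide DERIV_add \<tau>0_derivative g Kt_derivative)
  then have "((\<lambda>s. 2 * (\<tau>0 s * pullback 2 (TF s) (g s x0) [a, b]) - (pullback 2 (TF s) (Kt s) [a, b] + pullback 2 (TF s) (Kt s) [b, a]) / 24) has_real_derivative
     2 * t0' * kdelta a b - (K1 a b + K1 b a) / 24) (at t0 within TS)"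
    by (rule DERIV_cong) (simp only: time.g0, simp)
  then show ?thesis by (simp add: S3_def)
qed

text \<open>From \<open>TF' = - B Q\<close> the inverse has derivative \<open>N B Q N\<close>, which
  \<open>B_frame\<close> turns into \<open>hf N\<close>.\<close>

lemma TF_inv_derivative: "((\<lambda>s. matrix_inv (TF s) $ i $ j) has_real_derivative - (\<Sum>m\<in>UNIV. - hf i m * matrix_inv (TF t0) $ m $ j)) (at t0 within TS)"
proof -
  define BM HM :: "real^7^7" where "BM = (\<chi> m a. B x0 m a)" and "HM = (\<chi> m a. hf m a)"
  have BQ: "BM ** Q = Q ** HM"
    by (simp add: vec_eq_iff matrix_matrix_mult_def BM_def HM_def B_frame)
  have MQ: "matrix_inv (TF t0) = N" unfolding TF_0 by (rule matrix_inv_eqI[OF QN NQ])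
  have m: "(- X) ** Y = - (X ** Y)" "X ** (- Y) = - (X ** Y)" for X Y :: "real^7^7"
    by (simp_all add: vec_eq_iff matrix_matrix_mult_def sum_negf)
  have D: "((\<lambda>s. matrix_inv (TF s) $ i $ j) has_real_derivative (- (matrix_inv (TF t0) ** ((- (BM ** Q)) ** matrix_inv (TF t0)))) $ i $ j) (at t0 within TS)"
    by (rule matrix_inv_has_derivative[OF _ TS_D(2) TS(1,3)])
       (use TF_derivative in \<open>simp_all add: matrix_matrix_mult_def BM_def\<close>)
  have eq: "- (matrix_inv (TF t0) ** ((- (BM ** Q)) ** matrix_inv (TF t0))) = HM ** N"
    unfolding MQ BQ m by (simp add: matrix_mul_assoc NQ)
  show ?thesis using D unfolding eq unfolding MQ by (simp add: matrix_matrix_mult_def HM_def sum_negf)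
qed

definition "t3 a b = pullback 2 Q (\<tau>3 t0) [a, b]"

text \<open>Returning to coordinates pulls \<open>S3\<close> back by the inverse of the moving
  frame; the motion of that inverse produces the two products of \<open>h\<close> with
  \<tau>3.\<close>

lemma \<tau>3_derivative: "((\<lambda>s. \<tau>3 s [i, j]) has_real_derivative
    pullback 2 N (\<lambda>L. 2 * t0' * kdelta (L ! 0) (L ! 1) - (K1 (L ! 0) (L ! 1) + K1 (L ! 1) (L ! 0)) / 24
      + (\<Sum>m\<in>UNIV. hf (L ! 0) m * t3 m (L ! 1)) + (\<Sum>m\<in>UNIV. t3 (L ! 0) m * hf m (L ! 1))) [i, j]) (at t0 within TS)"
proof -
  have MQ: "matrix_inv (TF t0) = N" unfolding TF_0 by (rule matrix_inv_eqI[OF QN NQ])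
  have "((\<lambda>s. pullback 2 (matrix_inv (TF s)) (S3 s) [i, j]) has_real_derivative
    pullback 2 (matrix_inv (TF t0)) (\<lambda>K. (2 * t0' * kdelta (K ! 0) (K ! 1) - (K1 (K ! 0) (K ! 1) + K1 (K ! 1) (K ! 0)) / 24)
       - (\<Sum>r<2. \<Sum>m\<in>UNIV. - hf m (K ! r) * S3 t0 (K[r := m]))) [i, j]) (at t0 within TS)"
  proof (rule pullback_has_derivative[OF TF_inv_derivative])
    fix K :: "7 list" assume "length K = 2"
    then obtain a b where "K = [a, b]" by (rule length_2E)
    then show "((\<lambda>s. S3 s K) has_real_derivative 2 * t0' * kdelta (K ! 0) (K ! 1) - (K1 (K ! 0) (K ! 1) + K1 (K ! 1) (K ! 0)) / 24) (at t0 within TS)"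
      using S3_derivative[of a b] by simp
  qed simp
  then have D: "((\<lambda>s. pullback 2 (matrix_inv (TF s)) (S3 s) [i, j]) has_real_derivative
    pullback 2 N (\<lambda>L. 2 * t0' * kdelta (L ! 0) (L ! 1) - (K1 (L ! 0) (L ! 1) + K1 (L ! 1) (L ! 0)) / 24
      + (\<Sum>m\<in>UNIV. hf (L ! 0) m * t3 m (L ! 1)) + (\<Sum>m\<in>UNIV. t3 (L ! 0) m * hf m (L ! 1))) [i, j]) (at t0 within TS)"
  proof (rule DERIV_cong)
    have S: "S3 t0 [a, b] = t3 a b" for a b using S3[OF TS(1), of "[a, b]"] by (simp add: TF_0 t3_def)
    have s: "(\<Sum>m\<in>UNIV. hf m a * F m) = (\<Sum>m\<in>UNIV. hf a m * F m)" for a F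
      by (intro sum.cong refl arg_cong2[of _ _ _ _ "(*)"] hf_sym)
    have c: "(\<Sum>m\<in>UNIV. hf m b * F m) = (\<Sum>m\<in>UNIV. F m * hf m b)" for b F by (simp only: mult.commute)
    have "(\<Sum>r<2. \<Sum>m\<in>UNIV. - hf m ([a, b] ! r) * S3 t0 ([a, b][r := m]))
      = - ((\<Sum>m\<in>UNIV. hf a m * t3 m b) + (\<Sum>m\<in>UNIV. t3 a m * hf m b))" for a b
    proof -
      have "(\<Sum>r<2. \<Sum>m\<in>UNIV. - hf m ([a, b] ! r) * S3 t0 ([a, b][r := m]))
        = - ((\<Sum>m\<in>UNIV. hf m a * t3 m b) + (\<Sum>m\<in>UNIV. hf m b * t3 a m))"
        by (simp add: numeral_2_eq_2 S sum_negf)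
      then show ?thesis unfolding s[of a] c[of b] .
    qed
    then show "pullback 2 (matrix_inv (TF t0)) (\<lambda>K. (2 * t0' * kdelta (K ! 0) (K ! 1) - (K1 (K ! 0) (K ! 1) + K1 (K ! 1) (K ! 0)) / 24)
       - (\<Sum>r<2. \<Sum>m\<in>UNIV. - hf m (K ! r) * S3 t0 (K[r := m]))) [i, j]
      = pullback 2 N (\<lambda>L. 2 * t0' * kdelta (L ! 0) (L ! 1) - (K1 (L ! 0) (L ! 1) + K1 (L ! 1) (L ! 0)) / 24
      + (\<Sum>m\<in>UNIV. hf (L ! 0) m * t3 m (L ! 1)) + (\<Sum>m\<in>UNIV. t3 (L ! 0) m * hf m (L ! 1))) [i, j]"
      unfolding MQ by (intro pullback_cong) (auto elim!: length_2E simp del: of_bool_eq mult_minus_left)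
  qed
  show ?thesis
  proof (rule has_field_derivative_transform_within[OF D zero_less_one TS(1)])
    fix s assume s: "s \<in> TS"
    have "pullback 2 (matrix_inv (TF s)) (S3 s) [i, j] = pullback 2 (matrix_inv (TF s)) (pullback 2 (TF s) (\<tau>3 s)) [i, j]"
      by (rule pullback_cong) (rule S3[OF s])
    also have "\<dots> = \<tau>3 s [i, j]"
      by (rule pullback_inverse) (simp_all add: matrix_inv_mult[OF TS_D(2)[OF s]])
    finally show "pullback 2 (matrix_inv (TF s)) (S3 s) [i, j] = \<tau>3 s [i, j]" .
  qed
qed

theorem evolution:
  fixes t1 :: "7 \<Rightarrow> real" and t2 :: "7 \<Rightarrow> 7 \<Rightarrow> real"
  assumes t3: "\<And>a b. t3 b a = t3 a b" "(\<Sum>a\<in>UNIV. t3 a a) = 0"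
    and t2: "\<And>a b. t2 b a = - t2 a b" "\<And>k. (\<Sum>a\<in>UNIV. \<Sum>b\<in>UNIV. t2 a b * phi a b k) = 0"
    and T: "\<And>a b. T a b = \<tau>0 t0 / 4 * kdelta a b - t3 a b + (\<Sum>l\<in>UNIV. t1 l * phi l a b) - t2 a b / 2"
  defines "t1f \<equiv> \<lambda>a b. \<Sum>l\<in>UNIV. t1 l * phi l a b" and "XX \<equiv> \<lambda>a b. \<Sum>l\<in>UNIV. Xf l * phi l a b"
  defines "trh \<equiv> \<Sum>a\<in>UNIV. hf a a" and "ht3 \<equiv> \<Sum>a\<in>UNIV. \<Sum>b\<in>UNIV. hf a b * t3 a b"
    and "xt1 \<equiv> \<Sum>a\<in>UNIV. \<Sum>b\<in>UNIV. XX a b * t1f a b" and "divX \<equiv> \<Sum>a\<in>UNIV. DX a a"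
    and "mul \<equiv> \<lambda>A B p q. \<Sum>l\<in>UNIV. A p l * B l q :: real"
    and "cu \<equiv> \<lambda>p q. \<Sum>k\<in>UNIV. \<Sum>l\<in>UNIV. H k l p * phi k l q"
  shows "(\<tau>0 has_real_derivative (- 1/7 * trh * \<tau>0 t0 + 4/7 * ht3 - 4/7 * xt1 + 4/7 * divX)) (at t0 within J)"
    and "((\<lambda>s. \<tau>3 s [i, j]) has_real_derivative pullback 2 N (\<lambda>L. let p = L ! 0; q = L ! 1 in
      (- 1/28 * trh * \<tau>0 t0 + 1/7 * ht3 - 1/7 * xt1 + 1/7 * divX) * kdelta p q
      + 1/4 * \<tau>0 t0 * hf p q + 1/2 * (mul hf t3 p q + mul t3 hf p q)
      + 1/2 * (mul hf t1f p q - mul t1f hf p q) - 1/4 * (mul hf t2 p q - mul t2 hf p q)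
      - 1/2 * (mul XX t3 p q - mul t3 XX p q) - 1/2 * (mul XX t1f p q + mul t1f XX p q)
      + 1/4 * (mul XX t2 p q + mul t2 XX p q) - 1/2 * cu p q - 1/2 * cu q p - 1/2 * (DX p q + DX q p)) [i, j]) (at t0 within J)"
proof -
  have H_sym: "H p b a = H p a b" for p a b unfolding H_def by (rule covt_sym[where h = h, OF h_diff h_sym])
  note E = frame_evolution[where h = hf and H = H and ?t3.0 = t3 and ?t2.0 = t2 and ?\<tau>1.0 = t1 and ?\<tau>0.0 = "\<tau>0 t0" and T = T
      and V = V4 and D' = D1 and K = K1 and t0' = t0' and X = Xf and DX = DX,
      OF hf_sym H_sym t3 t2 T V4 D1 K1_def t0'_def]
  show "(\<tau>0 has_real_derivative (- 1/7 * trh * \<tau>0 t0 + 4/7 * ht3 - 4/7 * xt1 + 4/7 * divX)) (at t0 within J)"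
    using \<tau>0_derivative unfolding TS(2) E(1) trh_def ht3_def xt1_def divX_def XX_def t1f_def .
  show "((\<lambda>s. \<tau>3 s [i, j]) has_real_derivative pullback 2 N (\<lambda>L. let p = L ! 0; q = L ! 1 in
      (- 1/28 * trh * \<tau>0 t0 + 1/7 * ht3 - 1/7 * xt1 + 1/7 * divX) * kdelta p q
      + 1/4 * \<tau>0 t0 * hf p q + 1/2 * (mul hf t3 p q + mul t3 hf p q)
      + 1/2 * (mul hf t1f p q - mul t1f hf p q) - 1/4 * (mul hf t2 p q - mul t2 hf p q)
      - 1/2 * (mul XX t3 p q - mul t3 XX p q) - 1/2 * (mul XX t1f p q + mul t1f XX p q)
      + 1/4 * (mul XX t2 p q + mul t2 XX p q) - 1/2 * cu p q - 1/2 * cu q p - 1/2 * (DX p q + DX q p)) [i, j]) (at t0 within J)"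
    using \<tau>3_derivative[of i j] unfolding TS(2) E(2) Let_def mul_def trh_def ht3_def xt1_def divX_def XX_def t1f_def cu_def .
qed

end

text \<open>The orientation found in \<open>gmat_eq_of_G2\<close> is the one for which
  \<open>star_phi0\<close> applies, so the dual 4-form has the standard components in the same
  frame.\<close>

lemma hodge_star_phi_frame:
  assumes P: "invertible P" "gmat g = transpose P ** P" and f: "\<And>K. length K = 3 \<Longrightarrow> f K = pullback 3 P phi0 K"
    and vol0: "alternating 7 vol0" "vol0 indices = -1" and vol: "\<And>L. length L = 7 \<Longrightarrow> vol L = pullback 7 P vol0 L"
  shows "frame_data P f g (hodge_star g vol 3 f)"
proof -
  have "hodge_star g vol 3 f K = pullback 4 P psiL K" if K: "length K = 4" for K
  proof -
    have "hodge_star g vol 3 f K = pullback 4 P (\<lambda>J. 1 / fact 3 * contr 3 kdelta (\<lambda>K. vol0 (K @ J)) phi0) K"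
      by (rule hodge_star_frame[OF P _ f K]) (simp_all add: vol)
    also have "\<dots> = pullback 4 P psiL K"
    proof (rule pullback_cong)
      fix L :: "7 list" assume "length L = 4"
      then obtain i j k l where L: "L = [i, j, k, l]" by (rule length_4E)
      show "1 / fact 3 * contr 3 kdelta (\<lambda>K. vol0 (K @ L)) phi0 = psiL L"
        using star_phi0[OF vol0, of i j k l] by (simp add: L fact_numeral)
    qed
    finally show ?thesis .
  qed
  then show ?thesis using P f by (simp add: frame_data_def)
qed

section \<open>Metric operations in frame components\<close>

lemma flat_frame:
  assumes "gmat g = transpose N ** N"
  shows "flat g X [i] = pullback 1 N (\<lambda>L. (N *v X) $ (L ! 0)) [i]"
proof -
  have "g [i, k] = (\<Sum>a\<in>UNIV. N $ a $ i * N $ a $ k)" for k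
    using pullback_2_gmat[OF assms, of i k] by (simp add: numeral_2_eq_2 pullback_Suc kdelta_mult_if sum_distrib_left)
  then have "flat g X [i] = (\<Sum>k\<in>UNIV. \<Sum>a\<in>UNIV. N $ a $ i * (N $ a $ k * X $ k))"
    by (simp add: flat_def sum_distrib_right mult.assoc)
  also have "\<dots> = (\<Sum>a\<in>UNIV. \<Sum>k\<in>UNIV. N $ a $ i * (N $ a $ k * X $ k))" by (rule sum.swap)
  finally show ?thesis by (simp add: pullback_Suc matrix_vector_mult_def sum_distrib_left)
qed

lemma sharp_frame:
  assumes N: "invertible N" "gmat g = transpose N ** N" and \<tau>: "\<And>l. \<tau> [l] = pullback 1 N t [l]"
  shows "(N *v sharp g \<tau>) $ a = t [a]"
proof -
  have "(N *v sharp g \<tau>) $ a = (\<Sum>k\<in>UNIV. \<Sum>l\<in>UNIV. \<Sum>b\<in>UNIV. N $ b $ l * N $ a $ k * ginv g l k * t [b])"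
    unfolding matrix_vector_mult_def sharp_def by (simp add: \<tau> pullback_Suc sum_distrib_left sum_distrib_right mult_ac)
  also have "\<dots> = (\<Sum>b\<in>UNIV. \<Sum>l\<in>UNIV. \<Sum>k\<in>UNIV. N $ b $ l * N $ a $ k * ginv g l k * t [b])"
    by (subst sum.swap, subst sum.swap[of _ UNIV UNIV], subst (2) sum.swap, subst sum.swap, rule sum.cong[OF refl], subst sum.swap) (rule refl)
  also have "\<dots> = (\<Sum>b\<in>UNIV. kdelta b a * t [b])"
    unfolding sum_distrib_right[symmetric] ginv_frame[OF N] ..
  finally show ?thesis unfolding kdelta_mult_if by simp
qed

lemma interior_prod_frame:
  assumes f: "\<And>K. length K = 3 \<Longrightarrow> f K = pullback 3 N phi0 K" and K: "length K = 2"
  shows "interior_prod u f K = pullback 2 N (\<lambda>L. \<Sum>l\<in>UNIV. (N *v u) $ l * phi l (L ! 0) (L ! 1)) K"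
proof -
  have "interior_prod u f K = interior_prod u (pullback (Suc 2) N phi0) K"
    using K by (simp add: interior_prod_def f numeral_3_eq_3 numeral_2_eq_2)
  also have "\<dots> = pullback 2 N (interior_prod (N *v u) phi0) K" by (rule interior_prod_pullback)
  also have "\<dots> = pullback 2 N (\<lambda>L. \<Sum>l\<in>UNIV. (N *v u) $ l * phi l (L ! 0) (L ! 1)) K"
    by (rule pullback_cong) (auto elim!: length_2E simp: interior_prod_def phi_def)
  finally show ?thesis .
qed

lemma inner_frame:
  assumes N: "invertible N" "gmat g = transpose N ** N"
    and S: "\<And>K. length K = 2 \<Longrightarrow> S K = pullback 2 N S0 K" and T: "\<And>K. length K = 2 \<Longrightarrow> T K = pullback 2 N T0 K"
  shows "inner_g g S T = (\<Sum>a\<in>UNIV. \<Sum>b\<in>UNIV. S0 [a, b] * T0 [a, b])"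
proof -
  have "inner_g g S T = (\<Sum>i\<in>UNIV. \<Sum>k\<in>UNIV. \<Sum>j\<in>UNIV. \<Sum>l\<in>UNIV. S [i, j] * T [k, l] * ginv g i k * ginv g j l)"
    unfolding inner_g_def by (rule sum.cong[OF refl]) (rule sum.swap)
  also have "\<dots> = contr 2 (ginv g) S T"
    by (simp add: numeral_2_eq_2 contr_Suc sum_distrib_left mult_ac)
  also have "\<dots> = contr 2 (ginv g) (pullback 2 N S0) (pullback 2 N T0)"
    by (rule contr_cong) (rule S T, assumption)+
  also have "\<dots> = (\<Sum>a\<in>UNIV. \<Sum>b\<in>UNIV. S0 [a, b] * T0 [a, b])"
    unfolding contr_frame[OF N] contr_kdelta sum_lists_2 ..
  finally show ?thesis .
qed

lemma product_frame:
  assumes N: "invertible N" "gmat g = transpose N ** N"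
    and S: "\<And>K. length K = 2 \<Longrightarrow> S K = pullback 2 N S0 K" and T: "\<And>K. length K = 2 \<Longrightarrow> T K = pullback 2 N T0 K"
  shows "(\<Sum>l\<in>UNIV. \<Sum>m\<in>UNIV. S [p, l] * ginv g l m * T [m, q])
    = pullback 2 N (\<lambda>L. \<Sum>k\<in>UNIV. S0 [L ! 0, k] * T0 [k, L ! 1]) [p, q]"
proof -
  \<comment> \<open>\<open>contr\<close> pairs trailing slots, so the second factor enters with its
    two slots exchanged.\<close>
  have "(\<Sum>l\<in>UNIV. \<Sum>m\<in>UNIV. S [p, l] * ginv g l m * T [m, q]) = contr 1 (ginv g) (\<lambda>K. S ([p] @ K)) (\<lambda>K. (\<lambda>L. T [L ! 1, L ! 0]) ([q] @ K))"
    by (simp add: contr_Suc mult_ac)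
  also have "\<dots> = pullback (1 + 1) N (\<lambda>L. contr 1 kdelta (\<lambda>K. S0 (take 1 L @ K)) (\<lambda>K. (\<lambda>L. T0 [L ! 1, L ! 0]) (drop 1 L @ K))) ([p] @ [q])"
  proof (rule contr_append[OF N])
    fix K :: "7 list" assume K: "length K = 1 + 1"
    then have K2: "length K = 2" by simp
    then obtain a b where ab: "K = [a, b]" by (rule length_2E)
    show "S K = pullback (1 + 1) N S0 K" using S[OF K2] by (simp add: nat_sums del: One_nat_def add_Suc)
    show "T [K ! 1, K ! 0] = pullback (1 + 1) N (\<lambda>L. T0 [L ! 1, L ! 0]) K"
      unfolding nat_sums ab pullback_2_swap using T[of "[b, a]"] by simp
  qed simp_all
  also have "\<dots> = pullback 2 N (\<lambda>L. \<Sum>k\<in>UNIV. S0 [L ! 0, k] * T0 [k, L ! 1]) [p, q]"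
    unfolding nat_sums append.simps by (rule pullback_cong) (auto elim!: length_2E simp: contr_kdelta_Suc)
  finally show ?thesis .
qed

text \<open>The free slot of the derivative is moved to the front so that the contracted slots
  trail; this rotation is undone by \<open>pullback_move\<close>.\<close>

lemma curl_frame:
  assumes fr: "frame_data N f g p" and D: "\<And>K. length K = 3 \<Longrightarrow> D K = pullback 3 N D0 K"
  shows "(\<Sum>k\<in>UNIV. \<Sum>l\<in>UNIV. \<Sum>a\<in>UNIV. \<Sum>b\<in>UNIV. D [k, l, i] * ginv g k a * ginv g l b * f [a, b, j])
    = pullback 2 N (\<lambda>L. \<Sum>k\<in>UNIV. \<Sum>l\<in>UNIV. D0 [k, l, L ! 0] * phi k l (L ! 1)) [i, j]"
proof -
  have N: "invertible N" "gmat g = transpose N ** N" and f: "\<And>K. length K = 3 \<Longrightarrow> f K = pullback 3 N phi0 K"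
    using fr by (auto simp: frame_data_def)
  have rot: "f [a, b, j] = f [j, a, b]" for a b
    using swap_3(1)[OF frame_data_alternating[OF fr], of j a b] swap_3(2)[OF frame_data_alternating[OF fr], of a j b] by simp
  have "(\<Sum>k\<in>UNIV. \<Sum>l\<in>UNIV. \<Sum>a\<in>UNIV. \<Sum>b\<in>UNIV. D [k, l, i] * ginv g k a * ginv g l b * f [a, b, j])
    = (\<Sum>k\<in>UNIV. \<Sum>a\<in>UNIV. \<Sum>l\<in>UNIV. \<Sum>b\<in>UNIV. D [k, l, i] * ginv g k a * ginv g l b * f [a, b, j])"
    by (rule sum.cong[OF refl]) (rule sum.swap)
  also have "\<dots> = contr 2 (ginv g) (\<lambda>K. (\<lambda>L. D [L ! 1, L ! 2, L ! 0]) ([i] @ K)) (\<lambda>K. f ([j] @ K))"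
    by (simp add: numeral_2_eq_2 contr_Suc sum_distrib_left rot mult_ac)
  also have "\<dots> = pullback (1 + 1) N (\<lambda>L. contr 2 kdelta (\<lambda>K. (\<lambda>L. D0 [L ! 1, L ! 2, L ! 0]) (take 1 L @ K)) (\<lambda>K. phi0 (drop 1 L @ K))) ([i] @ [j])"
  proof (rule contr_append[OF N])
    fix K :: "7 list" assume "length K = 1 + 2"
    then have K: "length K = 3" by simp
    show "f K = pullback (1 + 2) N phi0 K" unfolding nat_sums by (rule f[OF K])
    from K obtain a b c where abc: "K = [a, b, c]" by (rule length_3E)
    have "pullback 3 N (\<lambda>L. D0 [L ! 1, L ! 2, L ! 0]) [a, b, c]
       = pullback 3 N (\<lambda>L. (\<lambda>L. D0 [L ! 1, L ! 2, L ! 0]) (L ! 2 # take 2 L @ drop (Suc 2) L)) [b, c, a]"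
      using pullback_move[of 2 3 "[b, c, a]" N "\<lambda>L. D0 [L ! 1, L ! 2, L ! 0]"] by simp
    also have "\<dots> = pullback 3 N D0 [b, c, a]"
      by (rule pullback_cong) (auto elim!: length_3E)
    finally show "D [K ! 1, K ! 2, K ! 0] = pullback (1 + 2) N (\<lambda>L. D0 [L ! 1, L ! 2, L ! 0]) K"
      unfolding nat_sums using D[of "[b, c, a]"] by (simp add: abc)
  qed simp_all
  also have "\<dots> = pullback 2 N (\<lambda>L. \<Sum>k\<in>UNIV. \<Sum>l\<in>UNIV. D0 [k, l, L ! 0] * phi k l (L ! 1)) [i, j]"
    unfolding nat_sums append.simps
  proof (rule pullback_cong)
    fix L :: "7 list" assume "length L = 2"
    then obtain a b where L: "L = [a, b]" by (rule length_2E)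
    have "phi k l b = phi b k l" for k l by (rule phi_rot)
    then have "(\<Sum>k\<in>UNIV. \<Sum>l\<in>UNIV. D0 [k, l, a] * phi k l b) = (\<Sum>k\<in>UNIV. \<Sum>l\<in>UNIV. D0 [k, l, a] * phi b k l)"
      by (intro sum.cong refl) simp
    then show "contr 2 kdelta (\<lambda>K. D0 [(take 1 L @ K) ! 1, (take 1 L @ K) ! 2, (take 1 L @ K) ! 0]) (\<lambda>K. phi0 (drop 1 L @ K))
      = (\<Sum>k\<in>UNIV. \<Sum>l\<in>UNIV. D0 [k, l, L ! 0] * phi k l (L ! 1))"
      by (simp add: L contr_kdelta sum_lists_2 phi_def[symmetric])
  qed
  finally show ?thesis .
qed

context flow_point
begin

lemma tensor_frame: "length K = 2 \<Longrightarrow> S K = pullback 2 N (\<lambda>L. pullback 2 Q S [L ! 0, L ! 1]) K"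
proof -
  assume K: "length K = 2"
  have "pullback 2 N (\<lambda>L. pullback 2 Q S [L ! 0, L ! 1]) K = pullback 2 N (pullback 2 Q S) K"
    by (rule pullback_cong) (auto elim!: length_2E)
  then show ?thesis using K by (simp add: pullback_QN)
qed

text \<open>Both sides are tensors, so each commutator, trace and curl of frame matrices is matched
  with the metric expression whose pullback it is.\<close>

lemma evolution_components:
  fixes \<tau>1 \<tau>2 vol :: tensor
  assumes vol: "\<And>L. length L = 7 \<Longrightarrow> vol L = pullback 7 N vol0 L"
    and sym: "\<And>a b. \<tau>3 t0 [b, a] = \<tau>3 t0 [a, b]" and tr: "trace_g (g t0 x0) (\<tau>3 t0) = 0"
    and \<tau>2: "in_Omega2_14 (\<phi> t0 x0) (g t0 x0) \<tau>2"
    and d\<phi>: "\<And>I. length I = 4 \<Longrightarrow> ext_deriv (\<phi> t0) x0 I = \<tau>0 t0 * \<psi> t0 x0 I + 3 * wedge 1 3 \<tau>1 (\<phi> t0 x0) I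
       + hodge_star (g t0 x0) vol 3 (form3_of_sym2 (\<phi> t0 x0) (g t0 x0) (\<tau>3 t0)) I"
    and d\<psi>: "\<And>I. length I = 5 \<Longrightarrow> ext_deriv (\<psi> t0) x0 I = 4 * wedge 1 4 \<tau>1 (\<psi> t0 x0) I + hodge_star (g t0 x0) vol 2 \<tau>2 I"
  defines "G \<equiv> g t0 x0" and "P \<equiv> \<phi> t0 x0" and "HH \<equiv> h x0" and "T0 \<equiv> \<tau>0 t0" and "T3 \<equiv> \<tau>3 t0"
    and "T1 \<equiv> interior_prod (sharp (g t0 x0) \<tau>1) (\<phi> t0 x0)" and "XX \<equiv> interior_prod (X x0) (\<phi> t0 x0)"
    and "DXX \<equiv> \<lambda>i j. cov_deriv (g t0) (\<lambda>y. flat (g t0 y) (X y)) x0 i [j]"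
    and "Dh \<equiv> \<lambda>k l i. cov_deriv (g t0) h x0 k [l, i]"
  defines "divX \<equiv> \<Sum>p\<in>UNIV. \<Sum>q\<in>UNIV. ginv G p q * DXX p q"
  shows "(\<tau>0 has_real_derivative
          - 1/7 * trace_g G HH * T0 + 4/7 * inner_g G HH T3 - 4/7 * inner_g G XX T1 + 4/7 * divX)
         (at t0 within J)"
    and "((\<lambda>s. \<tau>3 s [i, j]) has_real_derivative
          (- 1/28 * trace_g G HH * T0 + 1/7 * inner_g G HH T3 - 1/7 * inner_g G XX T1 + 1/7 * divX) * G [i, j]
          + 1/4 * T0 * HH [i, j] + 1/2 * anticommutator_g G HH T3 i j
          + 1/2 * commutator_g G HH T1 i j - 1/4 * commutator_g G HH \<tau>2 i j
          - 1/2 * commutator_g G XX T3 i j - 1/2 * anticommutator_g G XX T1 i j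
          + 1/4 * anticommutator_g G XX \<tau>2 i j
          - 1/2 * (\<Sum>k\<in>UNIV. \<Sum>l\<in>UNIV. \<Sum>a\<in>UNIV. \<Sum>b\<in>UNIV.
                     Dh k l i * ginv G k a * ginv G l b * P [a, b, j])
          - 1/2 * (\<Sum>k\<in>UNIV. \<Sum>l\<in>UNIV. \<Sum>a\<in>UNIV. \<Sum>b\<in>UNIV.
                     Dh k l j * ginv G k a * ginv G l b * P [a, b, i])
          - 1/2 * (DXX i j + DXX j i))
         (at t0 within J)"
proof -
  have N: "invertible N" "gmat G = transpose N ** N" and f: "\<And>K. length K = 3 \<Longrightarrow> P K = pullback 3 N phi0 K"
    using frame by (auto simp: frame_data_def G_def P_def)
  have fr: "frame_data N P G (\<psi> t0 x0)" using frame by (simp add: P_def G_def)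
  define t1 where "t1 a = pullback 1 Q \<tau>1 [a]" for a
  define t2 where "t2 a b = pullback 2 Q \<tau>2 [a, b]" for a b
  define t1f where "t1f a b = (\<Sum>l\<in>UNIV. t1 l * phi l a b)" for a b
  define xx where "xx a b = (\<Sum>l\<in>UNIV. Xf l * phi l a b)" for a b
  note TT = torsion_tensor_eq[OF vol sym tr \<tau>2 d\<phi> d\<psi>]
  have TT: "t3 b a = t3 a b" "(\<Sum>a\<in>UNIV. t3 a a) = 0" "t2 b a = - t2 a b" "(\<Sum>a\<in>UNIV. \<Sum>b\<in>UNIV. t2 a b * phi a b k) = 0"
    "T a b = \<tau>0 t0 / 4 * kdelta a b - t3 a b + (\<Sum>l\<in>UNIV. t1 l * phi l a b) - t2 a b / 2" for a b k
    unfolding t3_def t2_def t1_def by (rule TT; assumption)+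
  note E = evolution[where ?t1.0 = t1 and ?t2.0 = t2, OF TT, folded t1f_def xx_def]
  have cH: "HH K = pullback 2 N (\<lambda>L. hf (L ! 0) (L ! 1)) K" if "length K = 2" for K
    using tensor_frame[OF that, of HH] by (simp only: hf_def HH_def)
  have c3: "T3 K = pullback 2 N (\<lambda>L. t3 (L ! 0) (L ! 1)) K" if "length K = 2" for K
    using tensor_frame[OF that, of T3] by (simp only: t3_def T3_def)
  have c2: "\<tau>2 K = pullback 2 N (\<lambda>L. t2 (L ! 0) (L ! 1)) K" if "length K = 2" for K
    using tensor_frame[OF that, of \<tau>2] by (simp only: t2_def)
  have NX: "(N *v X x0) $ l = Xf l" for l
  proof -
    have "Xf l = pullback 1 Q (pullback 1 N (\<lambda>L. (N *v X x0) $ (L ! 0))) [l]"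
      unfolding Xf_def by (rule pullback_cong) (auto simp: length_Suc_conv flat_frame[OF N(2)[unfolded G_def]])
    then show ?thesis by (simp add: pullback_NQ)
  qed
  have cX: "XX K = pullback 2 N (\<lambda>L. xx (L ! 0) (L ! 1)) K" if "length K = 2" for K
  proof -
    have "XX K = pullback 2 N (\<lambda>L. \<Sum>l\<in>UNIV. (N *v X x0) $ l * phi l (L ! 0) (L ! 1)) K"
      unfolding XX_def P_def[symmetric] by (rule interior_prod_frame[OF _ that]) (erule f)
    then show ?thesis unfolding NX xx_def .
  qed
  have Nt: "(N *v sharp G \<tau>1) $ l = t1 l" for l
    unfolding t1_def by (rule sharp_frame[OF N]) (simp add: pullback_QN)
  have c1: "T1 K = pullback 2 N (\<lambda>L. t1f (L ! 0) (L ! 1)) K" if "length K = 2" for K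
  proof -
    have "T1 K = pullback 2 N (\<lambda>L. \<Sum>l\<in>UNIV. (N *v sharp G \<tau>1) $ l * phi l (L ! 0) (L ! 1)) K"
      unfolding T1_def P_def[symmetric] G_def[symmetric] by (rule interior_prod_frame[OF _ that]) (erule f)
    then show ?thesis unfolding Nt t1f_def .
  qed
  have dX: "DXX a b = pullback 2 N (\<lambda>L. DX (L ! 0) (L ! 1)) [a, b]" for a b
    using tensor_frame[of "[a, b]" "covt (g t0) (\<lambda>y. xf y) x0"] by (simp only: DX_def DXX_def covt_def) simp
  have tr: "trace_g G S = (\<Sum>a\<in>UNIV. s a a)" if S: "\<And>K. length K = 2 \<Longrightarrow> S K = pullback 2 N (\<lambda>L. s (L ! 0) (L ! 1)) K" for S s
  proof -
    have "trace_g G S = trace_g G (pullback 2 N (\<lambda>L. s (L ! 0) (L ! 1)))" unfolding trace_g_def by (simp add: S)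
    then show ?thesis unfolding trace_frame[OF N] by simp
  qed
  have trH: "trace_g G HH = (\<Sum>a\<in>UNIV. hf a a)" by (rule tr) (rule cH)
  have div: "divX = (\<Sum>a\<in>UNIV. DX a a)"
  proof -
    have "divX = trace_g G (pullback 2 N (\<lambda>L. DX (L ! 0) (L ! 1)))" unfolding divX_def trace_g_def dX ..
    then show ?thesis unfolding trace_frame[OF N] by simp
  qed
  have in1: "inner_g G HH T3 = (\<Sum>a\<in>UNIV. \<Sum>b\<in>UNIV. hf a b * t3 a b)"
    using inner_frame[OF N, of HH "\<lambda>L. hf (L ! 0) (L ! 1)" T3 "\<lambda>L. t3 (L ! 0) (L ! 1)"] cH c3 by simp
  have in2: "inner_g G XX T1 = (\<Sum>a\<in>UNIV. \<Sum>b\<in>UNIV. xx a b * t1f a b)"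
    using inner_frame[OF N, of XX "\<lambda>L. xx (L ! 0) (L ! 1)" T1 "\<lambda>L. t1f (L ! 0) (L ! 1)"] cX c1 by simp
  \<comment> \<open>Pairs a tensor with its frame matrix, so that one argument covers all
    commutators and anticommutators.\<close>
  define rep where "rep S s \<longleftrightarrow> (\<forall>K. length K = 2 \<longrightarrow> S K = pullback 2 N (\<lambda>L. s (L ! 0) (L ! 1)) K)" for S :: tensor and s :: "7 \<Rightarrow> 7 \<Rightarrow> real"
  have rep: "rep HH hf" "rep T3 t3" "rep \<tau>2 t2" "rep XX xx" "rep T1 t1f"
    unfolding rep_def using cH c3 c2 cX c1 by auto
  define R where "R s u = pullback 2 N (\<lambda>L. \<Sum>k\<in>UNIV. s (L ! 0) k * u k (L ! 1)) [i, j]" for s u :: "7 \<Rightarrow> 7 \<Rightarrow> real"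
  have prod: "(\<Sum>l\<in>UNIV. \<Sum>m\<in>UNIV. S [i, l] * ginv G l m * U [m, j]) = R s u" if "rep S s" "rep U u" for S U s u
    using product_frame[OF N, of S "\<lambda>L. s (L ! 0) (L ! 1)" U "\<lambda>L. u (L ! 0) (L ! 1)" i j] that by (simp add: rep_def R_def)
  have comm: "commutator_g G S U i j = R s u - R u s" "anticommutator_g G S U i j = R s u + R u s"
    if "rep S s" "rep U u" for S U s u
    unfolding commutator_g_def anticommutator_g_def sum_subtractf sum.distrib prod[OF that] prod[OF that(2,1)] by (rule refl)+
  have cu: "(\<Sum>k\<in>UNIV. \<Sum>l\<in>UNIV. \<Sum>a\<in>UNIV. \<Sum>b\<in>UNIV. Dh k l i * ginv G k a * ginv G l b * P [a, b, j])
     = pullback 2 N (\<lambda>L. \<Sum>k\<in>UNIV. \<Sum>l\<in>UNIV. H k l (L ! 0) * phi k l (L ! 1)) [i, j]" for i j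
    using curl_frame[OF fr, of "covt (g t0) h x0" "pullback 3 Q (covt (g t0) h x0)" i j]
    by (simp add: pullback_QN Dh_def H_def covt_def)
  have cu': "(\<Sum>k\<in>UNIV. \<Sum>l\<in>UNIV. \<Sum>a\<in>UNIV. \<Sum>b\<in>UNIV. Dh k l j * ginv G k a * ginv G l b * P [a, b, i])
     = pullback 2 N (\<lambda>L. \<Sum>k\<in>UNIV. \<Sum>l\<in>UNIV. H k l (L ! 1) * phi k l (L ! 0)) [i, j]"
    unfolding cu using pullback_2_swap[of N "\<lambda>L. \<Sum>k\<in>UNIV. \<Sum>l\<in>UNIV. H k l (L ! 0) * phi k l (L ! 1)" i j] by simp
  have dX': "DXX j i = pullback 2 N (\<lambda>L. DX (L ! 1) (L ! 0)) [i, j]"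
    unfolding dX using pullback_2_swap[of N "\<lambda>L. DX (L ! 0) (L ! 1)" i j] by simp
  have G: "G [i, j] = pullback 2 N (\<lambda>L. kdelta (L ! 0) (L ! 1)) [i, j]"
    by (rule pullback_2_gmat[OF N(2), symmetric])
  have cH': "HH [i, j] = pullback 2 N (\<lambda>L. hf (L ! 0) (L ! 1)) [i, j]" by (rule cH) simp
  show "(\<tau>0 has_real_derivative
          - 1/7 * trace_g G HH * T0 + 4/7 * inner_g G HH T3 - 4/7 * inner_g G XX T1 + 4/7 * divX) (at t0 within J)"
    using E(1) unfolding trH div in1 in2 T0_def .
  show "((\<lambda>s. \<tau>3 s [i, j]) has_real_derivative
          (- 1/28 * trace_g G HH * T0 + 1/7 * inner_g G HH T3 - 1/7 * inner_g G XX T1 + 1/7 * divX) * G [i, j]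
          + 1/4 * T0 * HH [i, j] + 1/2 * anticommutator_g G HH T3 i j
          + 1/2 * commutator_g G HH T1 i j - 1/4 * commutator_g G HH \<tau>2 i j
          - 1/2 * commutator_g G XX T3 i j - 1/2 * anticommutator_g G XX T1 i j
          + 1/4 * anticommutator_g G XX \<tau>2 i j
          - 1/2 * (\<Sum>k\<in>UNIV. \<Sum>l\<in>UNIV. \<Sum>a\<in>UNIV. \<Sum>b\<in>UNIV.
                     Dh k l i * ginv G k a * ginv G l b * P [a, b, j])
          - 1/2 * (\<Sum>k\<in>UNIV. \<Sum>l\<in>UNIV. \<Sum>a\<in>UNIV. \<Sum>b\<in>UNIV.
                     Dh k l j * ginv G k a * ginv G l b * P [a, b, i])
          - 1/2 * (DXX i j + DXX j i)) (at t0 within J)"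
    using E(2)[of i j]
    unfolding Let_def pullback_add pullback_diff pullback_scale cu[of i j] cu' dX dX'[unfolded dX] G cH'
      comm[OF rep(1) rep(2)] comm[OF rep(1) rep(5)] comm[OF rep(1) rep(3)] comm[OF rep(4) rep(2)] comm[OF rep(4) rep(5)]
      comm[OF rep(4) rep(3)] trH div in1 in2 T0_def R_def .
qed

end

section \<open>Evolution of the torsion forms\<close>

lemma differentiable_vec_nth:
  fixes f :: "'a::real_normed_vector \<Rightarrow> real^'n"
  assumes "f differentiable (at x within S)"
  shows "(\<lambda>y. f y $ k) differentiable (at x within S)"
  using assms bounded_linear.has_derivative[OF bounded_linear_vec_nth] unfolding differentiable_def by blast

lemma G2_metric_components:
  assumes metric: "G2_metric A \<phi> g vol" and c: "c \<in> A" and x: "x \<in> chart_ran c"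
  shows "B0 (\<phi> c x) u v indices = - 6 * (u \<bullet> (gmat (g c x) *v v)) * vol c x indices"
    and "B0 (\<phi> c x) (axis i 1) (axis j 1) indices = - 6 * g c x [i, j] * vol c x indices"
    and "(vol c x indices)\<^sup>2 = det (gmat (g c x))" and "alternating 7 (vol c x)"
    and "w \<noteq> 0 \<Longrightarrow> w \<bullet> (gmat (g c x) *v w) > 0"
proof -
  have rm: "riemannian_metric A g" and vf: "volume_form A g vol" and w: "\<And>u v I. length I = 7 \<Longrightarrow>
      wedge 4 3 (wedge 2 2 (interior_prod u (\<phi> c x)) (interior_prod v (\<phi> c x))) (\<phi> c x) I
          = - 6 * (u \<bullet> (gmat (g c x) *v v)) * vol c x I"
    using metric c x unfolding G2_metric_def by fast+
  show "w \<noteq> 0 \<Longrightarrow> w \<bullet> (gmat (g c x) *v w) > 0"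
    using rm c x unfolding riemannian_metric_def by fast
  show "(vol c x indices)\<^sup>2 = det (gmat (g c x))"
    using vf c x unfolding volume_form_def by fast
  show "alternating 7 (vol c x)"
    using vf c x unfolding volume_form_def smooth_form_def by fast
  show B: "B0 (\<phi> c x) u v indices = - 6 * (u \<bullet> (gmat (g c x) *v v)) * vol c x indices" for u v
    unfolding B0_def by (rule w) simp
  have "axis i 1 \<bullet> (gmat (g c x) *v axis j 1) = g c x [i, j]"
    by (simp add: inner_vec_def matrix_vector_mult_def gmat_def axis_def if_distrib[of "\<lambda>x. _ * x"] if_distrib[of "\<lambda>x. x * _"] cong: if_cong)
  then show "B0 (\<phi> c x) (axis i 1) (axis j 1) indices = - 6 * g c x [i, j] * vol c x indices"
    unfolding B by simp
qed

text \<open>A matrix carrying \<open>phi0\<close> to the 3-form is automatically adapted to the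
  metric, the volume form and the dual 4-form.\<close>

lemma G2_frame:
  assumes G2: "G2_structure A \<phi>" and metric: "G2_metric A \<phi> g vol" and c: "c \<in> A" and x: "x \<in> chart_ran c"
  obtains N vol0 where "alternating 7 vol0" "vol0 indices = -1" "\<forall>L. length L = 7 \<longrightarrow> vol c x L = pullback 7 N vol0 L"
    "frame_data N (\<phi> c x) (g c x) (dual4 \<phi> g vol c x)"
proof -
  have "\<exists>P. invertible P \<and> (\<forall>I. length I = 3 \<longrightarrow> \<phi> c x I = pullback 3 P phi0 I)"
    using G2 c x unfolding G2_structure_def by fast
  then obtain N where N: "invertible N" "\<And>I. length I = 3 \<Longrightarrow> \<phi> c x I = pullback 3 N phi0 I" by (elim exE conjE) metis
  note m = G2_metric_components[OF metric c x]
  have M: "gmat (g c x) = transpose N ** N"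
    by (rule gmat_eq_of_G2(1)[OF N m(5,4,3,1)])
  have "\<exists>vol0. alternating 7 vol0 \<and> vol0 indices = -1 \<and> (\<forall>L. length L = 7 \<longrightarrow> vol c x L = pullback 7 N vol0 L)"
    by (rule gmat_eq_of_G2(2)[OF N m(5,4,3,1)])
  then obtain vol0 where v: "alternating 7 vol0" "vol0 indices = -1" and vol: "\<forall>L. length L = 7 \<longrightarrow> vol c x L = pullback 7 N vol0 L"
    by (elim exE conjE) metis
  have fr: "frame_data N (\<phi> c x) (g c x) (dual4 \<phi> g vol c x)"
    unfolding dual4_def by (rule hodge_star_phi_frame[OF N(1) M N(2) v]) (use vol in auto)
  show ?thesis by (rule that[OF v vol fr])
qed

theorem proposition3p9:
  fixes M :: "'a topology" and A :: "'a chart set" and J :: "real set"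
    and \<phi> g vol h \<tau>1 \<tau>2 \<tau>3 :: "real \<Rightarrow> 'a tensor_field"
    and \<tau>0 :: "real \<Rightarrow> 'a \<Rightarrow> real"
    and X :: "real \<Rightarrow> 'a vector_field"
  assumes "smooth_manifold7 M A"
    and "is_interval J" and "interior J \<noteq> {}"
    and "smooth_G2_family A J \<phi>"
    and "\<And>t. t \<in> J \<Longrightarrow> G2_metric A (\<phi> t) (g t) (vol t)"
    and "\<And>t. t \<in> J \<Longrightarrow> smooth_sym2 A (h t)"
    and "\<And>t. t \<in> J \<Longrightarrow> smooth_vector_field A (X t)"
    and "general_flow A J \<phi> g vol h X"
    and "\<And>t. t \<in> J \<Longrightarrow> torsion_forms A (\<phi> t) (g t) (vol t) (\<tau>0 t) (\<tau>1 t) (\<tau>2 t) (\<tau>3 t)"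
  shows "\<forall>t\<in>J. \<forall>c\<in>A. \<forall>x\<in>chart_ran c.
    let p = chart_pt c x; G = g t c x; P = \<phi> t c x; H = h t c x;
        T0 = \<tau>0 t p; T2 = \<tau>2 t c x; T3 = \<tau>3 t c x;
        T1 = interior_prod (sharp G (\<tau>1 t c x)) P;
        XX = interior_prod (X t c x) P;
        DX = (\<lambda>i j. cov_deriv (g t c) (\<lambda>y. flat (g t c y) (X t c y)) x i [j]);
        Dh = (\<lambda>k l i. cov_deriv (g t c) (h t c) x k [l, i]);
        divX = (\<Sum>p\<in>UNIV. \<Sum>q\<in>UNIV. ginv G p q * DX p q)
    in ((\<lambda>s. \<tau>0 s p) has_real_derivative
          - 1/7 * trace_g G H * T0 + 4/7 * inner_g G H T3 - 4/7 * inner_g G XX T1 + 4/7 * divX)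
         (at t within J)
     \<and> (\<forall>i j. ((\<lambda>s. \<tau>3 s c x [i, j]) has_real_derivative
          (- 1/28 * trace_g G H * T0 + 1/7 * inner_g G H T3 - 1/7 * inner_g G XX T1 + 1/7 * divX) * G [i, j]
          + 1/4 * T0 * H [i, j] + 1/2 * anticommutator_g G H T3 i j
          + 1/2 * commutator_g G H T1 i j - 1/4 * commutator_g G H T2 i j
          - 1/2 * commutator_g G XX T3 i j - 1/2 * anticommutator_g G XX T1 i j
          + 1/4 * anticommutator_g G XX T2 i j
          - 1/2 * (\<Sum>k\<in>UNIV. \<Sum>l\<in>UNIV. \<Sum>a\<in>UNIV. \<Sum>b\<in>UNIV.
                     Dh k l i * ginv G k a * ginv G l b * P [a, b, j])
          - 1/2 * (\<Sum>k\<in>UNIV. \<Sum>l\<in>UNIV. \<Sum>a\<in>UNIV. \<Sum>b\<in>UNIV.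
                     Dh k l j * ginv G k a * ginv G l b * P [a, b, i])
          - 1/2 * (DX i j + DX j i))
         (at t within J))"
proof (intro ballI)
  fix t0 c x0 assume t0: "t0 \<in> J" and c: "c \<in> A" and x0: "x0 \<in> chart_ran c"
  define V where "V = chart_ran c"
  have xV: "x0 \<in> V" using x0 by (simp add: V_def)
  have V: "open V" using assms(1) c unfolding smooth_manifold7_def V_def by fast
  have G2: "G2_structure A (\<phi> t)" if "t \<in> J" for t using assms(4) that unfolding smooth_G2_family_def by fast
  have sm: "smooth_on (J \<times> V) (\<lambda>(t, x). \<phi> t c x K)" if "length K = 3" for K
    using assms(4) c that unfolding smooth_G2_family_def V_def by fast
  note frames = G2_frame[OF G2 assms(5) c, folded V_def]
  have sym2_diff: "(\<lambda>y. S c y K) differentiable (at x)" if "smooth_sym2 A S" "x \<in> V" "length K = 2" for S x K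
  proof (rule smooth_on_open_differentiable[OF _ V that(2)])
    show "smooth_on V (\<lambda>y. S c y K)" using that c unfolding smooth_sym2_def smooth_tensor_field_def V_def by fast
  qed
  have sym2: "S c x [j, i] = S c x [i, j]" if "smooth_sym2 A S" "x \<in> V" for S x i j
    using that c unfolding smooth_sym2_def V_def by metis
  have g_sym2: "smooth_sym2 A (g t)" if "t \<in> J" for t
    using assms(5)[OF that] unfolding G2_metric_def riemannian_metric_def by fast
  have \<phi>_diff: "(\<lambda>y. \<phi> t c y K) differentiable (at x)" if "t \<in> J" "x \<in> V" "length K = 3" for t x K
  proof (rule smooth_on_open_differentiable[OF _ V that(2)])
    show "smooth_on V (\<lambda>y. \<phi> t c y K)"
      using G2[OF that(1)] that c unfolding G2_structure_def smooth_form_def smooth_tensor_field_def V_def by fast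
  qed
  have X_diff: "(\<lambda>y. X t0 c y $ k) differentiable (at x0)" for k
  proof (rule differentiable_vec_nth, rule smooth_on_open_differentiable[OF _ V xV])
    show "smooth_on V (X t0 c)" using assms(7)[OF t0] c unfolding smooth_vector_field_def V_def by fast
  qed
  have tor: "in_Omega2_14 (\<phi> t c x0) (g t c x0) (\<tau>2 t c x0)" "trace_g (g t c x0) (\<tau>3 t c x0) = 0" "smooth_sym2 A (\<tau>3 t)"
    "\<And>I. length I = 4 \<Longrightarrow> ext_deriv (\<phi> t c) x0 I = \<tau>0 t (chart_pt c x0) * dual4 (\<phi> t) (g t) (vol t) c x0 I
             + 3 * wedge 1 3 (\<tau>1 t c x0) (\<phi> t c x0) I
             + hodge_star (g t c x0) (vol t c x0) 3 (form3_of_sym2 (\<phi> t c x0) (g t c x0) (\<tau>3 t c x0)) I"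
    "\<And>I. length I = 5 \<Longrightarrow> ext_deriv (dual4 (\<phi> t) (g t) (vol t) c) x0 I = 4 * wedge 1 4 (\<tau>1 t c x0) (dual4 (\<phi> t) (g t) (vol t) c x0) I
             + hodge_star (g t c x0) (vol t c x0) 2 (\<tau>2 t c x0) I" if "t \<in> J" for t
    using assms(9)[OF that] c x0 unfolding torsion_forms_def by fast+
  \<comment> \<open>Makes derivatives within the interval unique, also at an end point belonging to
    it.\<close>
  have ne: "at t0 within J \<noteq> bot" by (rule interval_at_within_ne_bot[OF assms(2,3) t0])
  obtain N vol0 where v0: "alternating 7 vol0" "vol0 indices = -1" and vol': "\<forall>L. length L = 7 \<longrightarrow> vol t0 c x0 L = pullback 7 N vol0 L"
    and fr: "frame_data N (\<phi> t0 c x0) (g t0 c x0) (dual4 (\<phi> t0) (g t0) (vol t0) c x0)"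
    by (rule frames[OF t0 t0 xV])
  have vol: "vol t0 c x0 L = pullback 7 N vol0 L" if "length L = 7" for L using vol' that by blast
  have frx: "\<exists>N. frame_data N (\<phi> t c x) (g t c x) (dual4 (\<phi> t) (g t) (vol t) c x)" if t: "t \<in> J" and x: "x \<in> V" for t x
    by (rule frames[OF t t x]) (rule exI)
  have inv: "invertible (gmat (g t c x))" if t: "t \<in> J" and x: "x \<in> V" for t x
    using frx[OF t x] frame_data_sym(2) by (elim exE) metis
  have flow: "((\<lambda>s. \<phi> s c x [i, j, k]) has_real_derivative
        (\<Sum>l\<in>UNIV. raise_sym2 (g t0 c x) (h t0 c x) l i * \<phi> t0 c x [l, j, k] + raise_sym2 (g t0 c x) (h t0 c x) l j * \<phi> t0 c x [i, l, k]
           + raise_sym2 (g t0 c x) (h t0 c x) l k * \<phi> t0 c x [i, j, l] + X t0 c x $ l * dual4 (\<phi> t0) (g t0) (vol t0) c x [l, i, j, k])) (at t0 within J)"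
    if "x \<in> V" for x i j k
    using assms(8) t0 c that unfolding general_flow_def V_def by fast
  \<comment> \<open>The flow equation concerns the 3-form alone; differentiability of the metric at
    \<open>t0\<close> is deduced from it through \<open>B0\<close>.\<close>
  have g_time: "(\<lambda>s. g s c x0 [i, j]) differentiable (at t0 within J)" for i j
  proof (rule metric_differentiable[where f = "\<lambda>s. \<phi> s c x0" and v = "\<lambda>s. vol s c x0 indices"])
    show "(\<lambda>s. \<phi> s c x0 K) differentiable (at t0 within J)" if "length K = 3" for K
    proof -
      from that obtain a b d where "K = [a, b, d]" by (rule length_3E)
      then show ?thesis using flow[OF xV, of a b d] unfolding real_differentiable_def by blast
    qed
    show "t0 \<in> J" by (rule t0)
    fix s i j assume s: "s \<in> J"
    show "B0 (\<phi> s c x0) (axis i 1) (axis j 1) indices = - 6 * g s c x0 [i, j] * vol s c x0 indices"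
      by (rule G2_metric_components[OF assms(5)[OF s] c x0])
    show "(vol s c x0 indices)\<^sup>2 = det (gmat (g s c x0))" by (rule G2_metric_components[OF assms(5)[OF s] c x0])
    show "invertible (gmat (g s c x0))" by (rule inv[OF s xV])
  qed
  \<comment> \<open>An adapted frame is chosen afresh for each time, which is harmless because the
    resulting identities do not mention it.\<close>
  have tc: "contr 3 (ginv (g t c x0)) (\<lambda>K. ext_deriv (\<phi> t c) x0 ([i] @ K)) (\<lambda>K. dual4 (\<phi> t) (g t) (vol t) c x0 ([j] @ K))
        + contr 3 (ginv (g t c x0)) (\<lambda>K. ext_deriv (\<phi> t c) x0 ([j] @ K)) (\<lambda>K. dual4 (\<phi> t) (g t) (vol t) c x0 ([i] @ K))
        = 48 * \<tau>0 t (chart_pt c x0) * g t c x0 [i, j] - 24 * \<tau>3 t c x0 [i, j]"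
    "trace_g (g t c x0) (\<lambda>L. contr 3 (ginv (g t c x0)) (\<lambda>K. ext_deriv (\<phi> t c) x0 (take 1 L @ K))
        (\<lambda>K. dual4 (\<phi> t) (g t) (vol t) c x0 (drop 1 L @ K))) = 168 * \<tau>0 t (chart_pt c x0)"
    if t: "t \<in> J" for t i j
  proof -
    obtain N vol0 where v0: "alternating 7 vol0" "vol0 indices = -1" and vol': "\<forall>L. length L = 7 \<longrightarrow> vol t c x0 L = pullback 7 N vol0 L"
      and fr: "frame_data N (\<phi> t c x0) (g t c x0) (dual4 (\<phi> t) (g t) (vol t) c x0)"
      by (rule frames[OF t t xV])
    have vol: "vol t c x0 L = pullback 7 N vol0 L" if "length L = 7" for L using vol' that by blast
    note * = torsion_contr[OF fr v0 vol sym2[OF tor(3)[OF t] xV] tor(2)[OF t] tor(4)[OF t]]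
    show "contr 3 (ginv (g t c x0)) (\<lambda>K. ext_deriv (\<phi> t c) x0 ([i] @ K)) (\<lambda>K. dual4 (\<phi> t) (g t) (vol t) c x0 ([j] @ K))
        + contr 3 (ginv (g t c x0)) (\<lambda>K. ext_deriv (\<phi> t c) x0 ([j] @ K)) (\<lambda>K. dual4 (\<phi> t) (g t) (vol t) c x0 ([i] @ K))
        = 48 * \<tau>0 t (chart_pt c x0) * g t c x0 [i, j] - 24 * \<tau>3 t c x0 [i, j]"
      using *(1)[of i j] by simp
    show "trace_g (g t c x0) (\<lambda>L. contr 3 (ginv (g t c x0)) (\<lambda>K. ext_deriv (\<phi> t c) x0 (take 1 L @ K))
        (\<lambda>K. dual4 (\<phi> t) (g t) (vol t) c x0 (drop 1 L @ K))) = 168 * \<tau>0 t (chart_pt c x0)"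
      by (rule *(2))
  qed
  interpret flow_point "\<lambda>s. g s c" "\<lambda>s. \<phi> s c" "\<lambda>s. dual4 (\<phi> s) (g s) (vol s) c" t0 V x0 N vol0 J "h t0 c" "X t0 c"
    "\<lambda>s. \<tau>0 s (chart_pt c x0)" "\<lambda>s. \<tau>3 s c x0"
  proof (intro flow_point.intro G2_patch.intro metric_patch.intro G2_patch_axioms.intro flow_point_axioms.intro)
    show "(\<lambda>y. flat (g t0 c y) (X t0 c y) K) differentiable (at x0)" if "length K = 1" for K
      unfolding flat_def using sym2_diff[OF g_sym2[OF t0] xV] X_diff
      by (intro differentiable_sum ballI differentiable_mult) simp_all
    show "open V" by (rule V)
    show "(\<lambda>y. g t0 c y [i, j]) differentiable (at x)" if "x \<in> V" for x i j by (rule sym2_diff[OF g_sym2[OF t0] that]) simp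
    show "g t0 c x [j, i] = g t0 c x [i, j]" if "x \<in> V" for x i j by (rule sym2[OF g_sym2[OF t0] that])
    show "invertible (gmat (g t0 c x))" if "x \<in> V" for x by (rule inv[OF t0 that])
    show "x0 \<in> V" by (rule xV)
    show "(\<lambda>y. \<phi> t0 c y K) differentiable (at x)" if "x \<in> V" "length K = 3" for x K by (rule \<phi>_diff[OF t0 that])
    show "\<exists>N. frame_data N (\<phi> t0 c x) (g t0 c x) (dual4 (\<phi> t0) (g t0) (vol t0) c x)" if "x \<in> V" for x by (rule frx[OF t0 that])
    show "frame_data N (\<phi> t0 c x0) (g t0 c x0) (dual4 (\<phi> t0) (g t0) (vol t0) c x0)" by (rule fr)
    show "alternating 7 vol0" "vol0 indices = -1" by (rule v0)+
    show "t0 \<in> J" "at t0 within J \<noteq> bot" by (rule t0, rule ne)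
    show "smooth_on (J \<times> V) (\<lambda>(t, x). \<phi> t c x K)" if "length K = 3" for K by (rule sm[OF that])
    show "\<exists>N. frame_data N (\<phi> t c x0) (g t c x0) (dual4 (\<phi> t) (g t) (vol t) c x0)" if "t \<in> J" for t by (rule frx[OF that xV])
    show "(\<lambda>s. g s c x0 [i, j]) differentiable (at t0 within J)" for i j by (rule g_time)
    show "(\<lambda>y. h t0 c y K) differentiable (at x0)" if "length K = 2" for K by (rule sym2_diff[OF assms(6)[OF t0] xV that])
    show "h t0 c x [j, i] = h t0 c x [i, j]" if "x \<in> V" for x i j by (rule sym2[OF assms(6)[OF t0] that])
  qed (erule flow, erule tc, erule tc)
  note E = evolution_components[OF vol sym2[OF tor(3)[OF t0] xV] tor(2)[OF t0] tor(1)[OF t0] tor(4)[OF t0] tor(5)[OF t0]]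
  show "let p = chart_pt c x0; G = g t0 c x0; P = \<phi> t0 c x0; H = h t0 c x0;
        T0 = \<tau>0 t0 p; T2 = \<tau>2 t0 c x0; T3 = \<tau>3 t0 c x0;
        T1 = interior_prod (sharp G (\<tau>1 t0 c x0)) P;
        XX = interior_prod (X t0 c x0) P;
        DX = (\<lambda>i j. cov_deriv (g t0 c) (\<lambda>y. flat (g t0 c y) (X t0 c y)) x0 i [j]);
        Dh = (\<lambda>k l i. cov_deriv (g t0 c) (h t0 c) x0 k [l, i]);
        divX = (\<Sum>p\<in>UNIV. \<Sum>q\<in>UNIV. ginv G p q * DX p q)
    in ((\<lambda>s. \<tau>0 s p) has_real_derivative
          - 1/7 * trace_g G H * T0 + 4/7 * inner_g G H T3 - 4/7 * inner_g G XX T1 + 4/7 * divX)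
         (at t0 within J)
     \<and> (\<forall>i j. ((\<lambda>s. \<tau>3 s c x0 [i, j]) has_real_derivative
          (- 1/28 * trace_g G H * T0 + 1/7 * inner_g G H T3 - 1/7 * inner_g G XX T1 + 1/7 * divX) * G [i, j]
          + 1/4 * T0 * H [i, j] + 1/2 * anticommutator_g G H T3 i j
          + 1/2 * commutator_g G H T1 i j - 1/4 * commutator_g G H T2 i j
          - 1/2 * commutator_g G XX T3 i j - 1/2 * anticommutator_g G XX T1 i j
          + 1/4 * anticommutator_g G XX T2 i j
          - 1/2 * (\<Sum>k\<in>UNIV. \<Sum>l\<in>UNIV. \<Sum>a\<in>UNIV. \<Sum>b\<in>UNIV.
                     Dh k l i * ginv G k a * ginv G l b * P [a, b, j])
          - 1/2 * (\<Sum>k\<in>UNIV. \<Sum>l\<in>UNIV. \<Sum>a\<in>UNIV. \<Sum>b\<in>UNIV.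
                     Dh k l j * ginv G k a * ginv G l b * P [a, b, i])
          - 1/2 * (DX i j + DX j i))
         (at t0 within J))"
    unfolding Let_def by (intro conjI allI E)
qed

end
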